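(* Let $G$ be a homogeneous group with sub-additive homogeneous norm $\|\cdot\|$, let $p>0$, and let $\mathbf X$ be a Lévy process in $G$ with triplet $(A,B,\Pi)$. (1) One has $\|\mathbf X\|_{p\text{-var};[0,1]}<\infty$ a.s. provided that all of the following hold: (i) $p>2d_j$ for all $j\in J$; (ii) $p>d_k$ for all $k\in K$; (iii) $p/d_i>\sup\Gamma_i$ for all $i\in\{1,\dots,m\}$. (2) One has $\|\mathbf X\|_{p\text{-var};[0,1]}=\infty$ a.s. provided that one of the following holds: (iv) $p\le 2d_j$ for some $j\in J$; (v) $p<d_k$ for some $k\in K$; (vi) $p/d_i\in\Gamma_i$ for some $i\in\{1,\dots,m\}$.
   Context: Homogeneous group: $G$ is a nilpotent, connected, simply connected Lie group with Lie algebra $\mathfrak g$, endowed with a one-parameter family of dilations (group automorphisms) $(\delta_\lambda)_{\lambda>0}$ which, upon identifying $G$ with $\mathfrak g$ via $\exp$, satisfy $\delta_\lambda(u_i)=\lambda^{d_i}u_i$ for a basis $u_1,\dots,u_m$ of $\mathfrak g$ and real numbers $d_m\ge\dots\ge d_1\ge 1$. $\|\cdot\|$ is a sub-additive homogeneous norm on $G$, inducing the left-invariant metric $d(x,y)=\|x^{-1}y\|$. $p$-variation: for $\mathbf x:[s,t]\to G$, write $\mathbf x_{u,v}=\mathbf x_u^{-1}\mathbf x_v$ and $\|\mathbf x\|_{p\text{-var};[s,t]}=\|\mathbf x_s\|+\sup_{\mathcal D}\big(\sum_{t_j\in\mathcal D}\|\mathbf x_{t_j,t_{j+1}}\|^p\big)^{1/p}$,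 the supremum over partitions $\mathcal D$ of $[s,t]$. Local coordinates: $\mathfrak g$ carries the inner product making $u_1,\dots,u_m$ orthonormal (norm $|\cdot|$). $U\subset G$ is a fixed open neighbourhood of the identity $1_G$ with compact closure such that $\exp$ is a diffeomorphism from a neighbourhood of zero in $\mathfrak g$ onto $U$; $\xi_1,\dots,\xi_m\in C_c^\infty(G,\mathbb R)$ are fixed functions with $\log(x)=\sum_i\xi_i(x)u_i$ for $x\in U$; $\xi=\sum_i\xi_iu_i$. Lévy process: a càdlàg $G$-valued process $\mathbf X$ with $\mathbf X_0=1_G$ and independent, stationary right increments $\mathbf X_s^{-1}\mathbf X_t$. A triplet $(A,B,\Pi)$ consists of an $m\times m$ covariance matrix $A$, $B=\sum_iB^iu_i\in\mathfrak g$ and a Lévy measure $\Pi$ on $G$ (i.e. $\Pi(\{1_G\})=0$, $\int|\xi|^2d\Pi<\infty$, and $\Pi(G\setminus V)<\infty$ for every neighbourhood $V$ of $1_G$). $\mathbf X$ has triplet $(A,B,\Pi)$ if its generator is, for $f\in C^2_0(G)$ and $x\in G$ (with $\mathfrak g$ identified with left-invariant vector fields), $$\lim_{t\to0}t^{-1}\mathbb E[f(x\mathbf X_t)-f(x)]=\sum_iB^i(u_if)(x)+\tfrac12\sum_{i,j}A^{i,j}(u_iu_jf)(x)+\int_G\Big[f(xy)-f(x)-\sum_i\xi_i(y)(u_if)(x)\Big]\Pi(dy).$$ Index sets: $\Gamma_i=\{0\le\gamma<2:\int_G|\xi_i(x)|^\gamma\,\Pi(dx)=\infty\}$; $J=\{j: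 A^{j,j}>0\}$; $\widetilde K=\{k:1\notin\Gamma_k\}$; for $k\in\widetilde K$, $\widetilde B^k=B^k-\int_G\xi_k(x)\Pi(dx)$; $K=\{k\in\widetilde K:\widetilde B^k\ne0\}$. If $\Gamma_i=\emptyset$, condition (iii) for that $i$ holds vacuously. *)

theory Defs
  imports "HOL-Probability.Probability" "HOL-Algebra.Generated_Groups"
begin

subsection \<open>Differentiability classes\<close>

text \<open>Functions of class \<open>C\<^sup>k\<close> on a whole space, via iterated directional derivatives. In finite
  dimension this is the usual class.\<close>

primrec Ck_on_space :: "nat \<Rightarrow> ('a::real_normed_vector \<Rightarrow> 'b::real_normed_vector) \<Rightarrow> bool" where
  "Ck_on_space 0 f \<longleftrightarrow> continuous_on UNIV f"
| "Ck_on_space (Suc k) f \<longleftrightarrow>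
     (\<forall>x. f differentiable (at x)) \<and>
     (\<forall>v. Ck_on_space k (\<lambda>x. frechet_derivative f (at x) v))"

definition smooth :: "('a::real_normed_vector \<Rightarrow> 'b::real_normed_vector) \<Rightarrow> bool" where
  "smooth f \<longleftrightarrow> (\<forall>k. Ck_on_space k f)"

definition vanishing_continuous :: "('a::real_normed_vector \<Rightarrow> real) \<Rightarrow> bool" where
  "vanishing_continuous f \<longleftrightarrow> continuous_on UNIV f \<and> (f \<longlongrightarrow> 0) at_infinity"


subsection \<open>Homogeneous groups\<close>

primrec lower_central :: "('a, 'b) monoid_scheme \<Rightarrow> nat \<Rightarrow> 'a set" where
  "lower_central G 0 = carrier G"
| "lower_central G (Suc n) = generate G
     {x \<otimes>\<^bsub>G\<^esub> y \<otimes>\<^bsub>G\<^esub> inv\<^bsub>G\<^esub> x \<otimes>\<^bsub>G\<^esub> inv\<^bsub>G\<^esub> y | x y. x \<in> lower_central G n \<and> y \<in> carrier G}"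

definition nilpotent_group :: "('a, 'b) monoid_scheme \<Rightarrow> bool" where
  "nilpotent_group G \<longleftrightarrow> (\<exists>n. lower_central G n = {\<one>\<^bsub>G\<^esub>})"

definition dilation :: "('m \<Rightarrow> real) \<Rightarrow> real \<Rightarrow> real^'m \<Rightarrow> real^'m" where
  "dilation d r x = (\<chi> i. r powr d i * x $ i)"

text \<open>A connected, simply connected nilpotent Lie group is identified with its Lie algebra through
  the exponential map, and the Lie algebra with \<open>\<real>\<^sup>m\<close> through the basis \<open>u\<^sub>1, \<dots>, u\<^sub>m\<close>,
  so that \<open>u\<^sub>i\<close> is \<^term>\<open>axis i 1\<close>. The group is then a smooth nilpotent
  group law on \<open>\<real>\<^sup>m\<close>, and \<open>exponential_coordinates\<close> says that
  the straight lines through the origin are the one-parameter subgroups, that is,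
  that the exponential map \<open>T\<^sub>0 \<real>\<^sup>m = \<real>\<^sup>m \<rightarrow> G\<close> is the identity map.
  Connectedness and simple connectedness are those of \<open>\<real>\<^sup>m\<close>.\<close>

locale homogeneous_group = group G
  for G :: "((real, 'm::{finite,linorder}) vec) monoid" (structure) +
  fixes d :: "'m \<Rightarrow> real"
  assumes carrier_UNIV: "carrier G = UNIV"
    and one_eq_zero: "\<one> = 0"
    and smooth_mult: "smooth (\<lambda>(x, y). x \<otimes> y)"
    and exponential_coordinates: "\<And>s t x. (s *\<^sub>R x) \<otimes> (t *\<^sub>R x) = (s + t) *\<^sub>R x"
    and nilpotent: "nilpotent_group G"
    and weights_mono: "mono d"
    and weights_ge_1: "\<And>i. d i \<ge> 1"
    and dilation_automorphism: "\<And>r. r > 0 \<Longrightarrow> dilation d r \<in> iso G G"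

text \<open>Symmetry makes \<open>(x, y) \<mapsto> N (x\<^sup>-\<^sup>1 y)\<close> a metric.\<close>

definition subadditive_homogeneous_norm ::
    "(real^'m) monoid \<Rightarrow> ('m \<Rightarrow> real) \<Rightarrow> (real^'m \<Rightarrow> real) \<Rightarrow> bool" where
  "subadditive_homogeneous_norm G d N \<longleftrightarrow>
     continuous_on UNIV N \<and>
     (\<forall>x. N x \<ge> 0) \<and>
     (\<forall>x. N x = 0 \<longleftrightarrow> x = \<one>\<^bsub>G\<^esub>) \<and>
     (\<forall>r>0. \<forall>x. N (dilation d r x) = r * N x) \<and>
     (\<forall>x. N (inv\<^bsub>G\<^esub> x) = N x) \<and>
     (\<forall>x y. N (x \<otimes>\<^bsub>G\<^esub> y) \<le> N x + N y)"

text \<open>The left-invariant vector field \<open>u\<^sub>i\<close>.\<close>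

definition left_field :: "(real^'m) monoid \<Rightarrow> 'm \<Rightarrow> (real^'m \<Rightarrow> real) \<Rightarrow> real^'m \<Rightarrow> real" where
  "left_field G i f x = deriv (\<lambda>t. f (x \<otimes>\<^bsub>G\<^esub> (t *\<^sub>R axis i 1))) 0"

definition C2_0 :: "(real^'m) monoid \<Rightarrow> (real^'m \<Rightarrow> real) set" where
  "C2_0 G = {f. Ck_on_space 2 f \<and> vanishing_continuous f \<and>
     (\<forall>i. vanishing_continuous (left_field G i f)) \<and>
     (\<forall>i j. vanishing_continuous (left_field G i (left_field G j f)))}"

text \<open>In exponential coordinates the logarithm is the identity map, so
  \<open>log x = \<Sum>\<^sub>i \<xi>\<^sub>i(x) u\<^sub>i\<close> reads \<open>\<xi>\<^sub>i(x) = x\<^sub>i\<close>.\<close>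

definition local_coordinates ::
    "(real^'m) monoid \<Rightarrow> (real^'m) set \<Rightarrow> ('m \<Rightarrow> real^'m \<Rightarrow> real) \<Rightarrow> bool" where
  "local_coordinates G U \<xi> \<longleftrightarrow>
     open U \<and> \<one>\<^bsub>G\<^esub> \<in> U \<and> compact (closure U) \<and>
     (\<forall>i. smooth (\<xi> i) \<and> compact (closure {x. \<xi> i x \<noteq> 0})) \<and>
     (\<forall>x\<in>U. \<forall>i. \<xi> i x = x $ i)"


subsection \<open>Variation of paths\<close>

definition increment :: "(real^'m) monoid \<Rightarrow> (real \<Rightarrow> real^'m) \<Rightarrow> real \<Rightarrow> real \<Rightarrow> real^'m" where
  "increment G x u v = inv\<^bsub>G\<^esub> (x u) \<otimes>\<^bsub>G\<^esub> x v"

definition partitions :: "real \<Rightarrow> real \<Rightarrow> real list set" where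
  "partitions s t = {ts. ts \<noteq> [] \<and> sorted_wrt (<) ts \<and> hd ts = s \<and> last ts = t}"

definition p_variation :: "(real^'m) monoid \<Rightarrow> (real^'m \<Rightarrow> real) \<Rightarrow> real \<Rightarrow> real \<Rightarrow> real
    \<Rightarrow> (real \<Rightarrow> real^'m) \<Rightarrow> ennreal" where
  "p_variation G N p s t x = ennreal (N (x s)) +
     (SUP ts\<in>partitions s t.
        ennreal ((\<Sum>j<length ts - 1. N (increment G x (ts ! j) (ts ! Suc j)) powr p) powr (1 / p)))"


subsection \<open>Levy processes\<close>

definition cadlag :: "(real \<Rightarrow> 'a::topological_space) \<Rightarrow> bool" where
  "cadlag x \<longleftrightarrow> (\<forall>t\<ge>0. (x \<longlongrightarrow> x t) (at_right t)) \<and> (\<forall>t>0. \<exists>l. (x \<longlongrightarrow> l) (at_left t))"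

text \<open>Time is \<open>[0, \<infinity>)\<close>; the values \<open>X t\<close> for \<open>t < 0\<close> play no role.\<close>

definition levy_process :: "(real^'m) monoid \<Rightarrow> 'w measure \<Rightarrow> (real \<Rightarrow> 'w \<Rightarrow> real^'m) \<Rightarrow> bool" where
  "levy_process G M X \<longleftrightarrow>
     prob_space M \<and>
     (\<forall>t\<ge>0. X t \<in> borel_measurable M) \<and>
     (AE \<omega> in M. cadlag (\<lambda>t. X t \<omega>)) \<and>
     (AE \<omega> in M. X 0 \<omega> = \<one>\<^bsub>G\<^esub>) \<and>
     (\<forall>(n::nat) (t::nat \<Rightarrow> real). t 0 \<ge> 0 \<and> (\<forall>i<n. t i \<le> t (Suc i)) \<longrightarrow>
        prob_space.indep_vars M (\<lambda>_. borel)
          (\<lambda>i \<omega>. increment G (\<lambda>r. X r \<omega>) (t i) (t (Suc i))) {..<n}) \<and>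
     (\<forall>s\<ge>0. \<forall>h\<ge>0.
        distr M borel (\<lambda>\<omega>. increment G (\<lambda>r. X r \<omega>) s (s + h)) =
        distr M borel (\<lambda>\<omega>. increment G (\<lambda>r. X r \<omega>) 0 h))"

definition covariance_matrix :: "real^'m^'m \<Rightarrow> bool" where
  "covariance_matrix A \<longleftrightarrow> transpose A = A \<and> (\<forall>v. v \<bullet> (A *v v) \<ge> 0)"

definition levy_measure ::
    "(real^'m) monoid \<Rightarrow> ('m \<Rightarrow> real^'m \<Rightarrow> real) \<Rightarrow> (real^'m) measure \<Rightarrow> bool" where
  "levy_measure G \<xi> \<nu> \<longleftrightarrow>
     sets \<nu> = sets borel \<and>
     emeasure \<nu> {\<one>\<^bsub>G\<^esub>} = 0 \<and>
     (\<integral>\<^sup>+x. ennreal ((norm (\<chi> i. \<xi> i x))\<^sup>2) \<partial>\<nu>) < \<infinity> \<and>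
     (\<forall>V. open V \<and> \<one>\<^bsub>G\<^esub> \<in> V \<longrightarrow> emeasure \<nu> (UNIV - V) < \<infinity>)"

definition has_triplet :: "(real^'m) monoid \<Rightarrow> ('m \<Rightarrow> real^'m \<Rightarrow> real) \<Rightarrow> 'w measure
    \<Rightarrow> (real \<Rightarrow> 'w \<Rightarrow> real^'m) \<Rightarrow> real^'m^'m \<Rightarrow> real^'m \<Rightarrow> (real^'m) measure \<Rightarrow> bool" where
  "has_triplet G \<xi> M X A B \<nu> \<longleftrightarrow>
     covariance_matrix A \<and> levy_measure G \<xi> \<nu> \<and>
     (\<forall>f\<in>C2_0 G. \<forall>x.
        ((\<lambda>t. (\<integral>\<omega>. f (x \<otimes>\<^bsub>G\<^esub> X t \<omega>) - f x \<partial>M) / t) \<longlongrightarrow>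
          (\<Sum>i\<in>UNIV. B $ i * left_field G i f x) +
          (\<Sum>i\<in>UNIV. \<Sum>j\<in>UNIV. A $ i $ j * left_field G i (left_field G j f) x) / 2 +
          (\<integral>y. f (x \<otimes>\<^bsub>G\<^esub> y) - f x - (\<Sum>i\<in>UNIV. \<xi> i y * left_field G i f x) \<partial>\<nu>))
        (at_right 0))"


subsection \<open>Index sets\<close>

text \<open>Since \<^term>\<open>(0::real) powr 0 = 0\<close>, the integral for \<open>\<gamma> = 0\<close> is the mass of
  \<open>{\<xi>\<^sub>i \<noteq> 0}\<close>. Whether \<open>0\<close> belongs to the set is irrelevant for comparing the
  set or its supremum with a positive number.\<close>

definition Gamma_set ::
    "('m \<Rightarrow> real^'m \<Rightarrow> real) \<Rightarrow> (real^'m) measure \<Rightarrow> 'm \<Rightarrow> real set" where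
  "Gamma_set \<xi> \<nu> i = {\<gamma>. 0 \<le> \<gamma> \<and> \<gamma> < 2 \<and> (\<integral>\<^sup>+x. ennreal (\<bar>\<xi> i x\<bar> powr \<gamma>) \<partial>\<nu>) = \<infinity>}"

definition J_set :: "real^'m^'m \<Rightarrow> 'm set" where
  "J_set A = {j. A $ j $ j > 0}"

definition K_tilde :: "('m \<Rightarrow> real^'m \<Rightarrow> real) \<Rightarrow> (real^'m) measure \<Rightarrow> 'm set" where
  "K_tilde \<xi> \<nu> = {k. 1 \<notin> Gamma_set \<xi> \<nu> k}"

definition B_tilde ::
    "('m \<Rightarrow> real^'m \<Rightarrow> real) \<Rightarrow> real^'m \<Rightarrow> (real^'m) measure \<Rightarrow> 'm \<Rightarrow> real" where
  "B_tilde \<xi> B \<nu> k = B $ k - (\<integral>x. \<xi> k x \<partial>\<nu>)"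

definition K_set ::
    "('m \<Rightarrow> real^'m \<Rightarrow> real) \<Rightarrow> real^'m \<Rightarrow> (real^'m) measure \<Rightarrow> 'm set" where
  "K_set \<xi> B \<nu> = {k \<in> K_tilde \<xi> \<nu>. B_tilde \<xi> B \<nu> k \<noteq> 0}"

end

theory Submission
  imports Defs
begin

text \<open>Write \<open>\<beta>\<^sub>i = p / d\<^sub>i\<close>; by homogeneity \<open>\<bar>\<xi>\<^sub>i\<bar>\<^bsup>\<beta>\<^sub>i\<^esup>\<close> is dominated by \<open>N\<^sup>p\<close>, so for the divergence
  it suffices to study sums of functions of \<open>\<xi>\<^sub>i\<close> over the increments of a uniform grid. For a drift or for jumps,
  a saturated version of \<open>\<xi>\<^sub>i\<close>, respectively of \<open>\<bar>\<xi>\<^sub>i\<bar>\<^bsup>\<beta>\<^sub>i\<^esup>\<close>, has a sum with small variance compared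
  with its mean, and Chebyshev's inequality applies. For a Gaussian coordinate the critical exponent
  \<open>\<beta>\<^sub>i = 2\<close> needs an adaptive partition: by the central limit theorem an interval of any small length \<open>h\<close>
  satisfies \<open>\<xi>\<^sub>i\<^sup>2 \<ge> L h\<close> with a probability bounded below, and repeatedly splitting the intervals that fail
  produces a partition whose sum of squares is close to \<open>L\<close>, for any \<open>L\<close>.

  For the finiteness choose \<open>\<gamma> < p\<close> that still satisfies the strict inequalities. Rescaling by the dilation
  \<open>\<delta>\<^bsub>1/r\<^esub>\<close> shows that a bump function at scale \<open>r\<close> has drift \<open>O(r\<^bsup>-\<gamma>\<^esup>)\<close>, hence the expected number
  of consecutive exits from balls of radius \<open>r\<close> is \<open>O(r\<^bsup>-\<gamma>\<^esup>)\<close>. This number bounds the number of increments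
  longer than \<open>2 r\<close> of every partition, and summing over dyadic \<open>r\<close> bounds the variation.\<close>

subsection \<open>Calculus of functions of class \<open>C\<^sup>k\<close>\<close>

text \<open>The triplet is known only through limits of
  \<open>expectation (f (X t) - f 0) / t\<close> at 0 for single test functions, with no uniformity
  in \<open>f\<close>. This dictates the order of choices: the parameter of the test function
  (damping level, regularisation, frequency, scale) is fixed first, and the time step is taken small
  only afterwards. The central limit theorem is at odds with that order, because the frequency
  \<theta> / sqrt t grows as t shrinks. Therefore [0, t] is cut into n steps, and n tends to
  infinity while t and the frequency are held fixed. This needs one-step errors uniform in the
  starting point y, although the increment of \<open>\<xi> j\<close> from y to y \<otimes> x depends
  on y; compact support of \<open>\<xi> j\<close> bounds its left-invariant derivatives and makes
  such errors possible. Exits are counted without stopping times: on a dyadic grid the count is a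
  function of finitely many independent increments, and Fatou's lemma together with right-continuity
  carries the bound over to all partitions of a cadlag path at once.\<close>

lemma Ck_SucI:
  assumes "\<And>x. (f has_derivative f' x) (at x)" and "\<And>v. Ck_on_space k (\<lambda>x. f' x v)"
  shows "Ck_on_space (Suc k) f"
proof -
  have "frechet_derivative f (at x) = f' x" for x
    using frechet_derivative_at[OF assms(1)] by simp
  then show ?thesis using assms by (auto simp: differentiable_def)
qed

lemma Ck_Suc_has_derivative:
  assumes "Ck_on_space (Suc k) f"
  shows "(f has_derivative frechet_derivative f (at x)) (at x)"
  using assms by (auto simp: frechet_derivative_works)

lemma Ck_Suc_directional:
  "Ck_on_space (Suc k) f \<Longrightarrow> Ck_on_space k (\<lambda>x. frechet_derivative f (at x) v)"
  by simp

lemma Ck_Suc_imp: "Ck_on_space (Suc k) f \<Longrightarrow> Ck_on_space k f"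
proof (induction k arbitrary: f)
  case 0
  then have "f differentiable_on UNIV" by (simp add: differentiable_on_def)
  then show ?case by (simp add: differentiable_imp_continuous_on)
next
  case (Suc k)
  have "Ck_on_space k (\<lambda>x. frechet_derivative f (at x) v)" for v
    using Suc.prems by (intro Suc.IH) simp
  then show ?case using Suc.prems by simp
qed

lemma Ck_antimono: "Ck_on_space n f \<Longrightarrow> k \<le> n \<Longrightarrow> Ck_on_space k f"
  by (induction n) (auto simp del: Ck_on_space.simps(2) simp: le_Suc_eq dest: Ck_Suc_imp)

lemma Ck_imp_continuous: "Ck_on_space k f \<Longrightarrow> continuous_on UNIV f"
  using Ck_antimono[of k f 0] by simp

lemma smooth_Ck: "smooth f \<Longrightarrow> Ck_on_space k f"
  by (simp add: smooth_def)

lemma Ck_const [simp]: "Ck_on_space k (\<lambda>x. c)"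
proof (induction k arbitrary: c)
  case (Suc k)
  show ?case by (rule Ck_SucI[where f' = "\<lambda>_ _. 0"]) (auto intro: Suc.IH)
qed simp

lemma Ck_bounded_linear_compose:
  assumes L: "bounded_linear L"
  shows "Ck_on_space k f \<Longrightarrow> Ck_on_space k (\<lambda>x. L (f x))"
proof (induction k arbitrary: f)
  case 0
  then show ?case using bounded_linear.continuous_on[OF L] by simp
next
  case (Suc k)
  show ?case
    by (rule Ck_SucI, rule bounded_linear.has_derivative[OF L], rule Ck_Suc_has_derivative, rule Suc.prems)
       (intro Suc.IH Ck_Suc_directional Suc.prems)
qed

lemma Ck_compose_affine:
  assumes L: "bounded_linear L"
  shows "Ck_on_space k f \<Longrightarrow> Ck_on_space k (\<lambda>x. f (c + L x))"
proof (induction k arbitrary: f)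
  case 0
  have "continuous_on UNIV (\<lambda>x. c + L x)"
    by (intro continuous_intros linear_continuous_on L)
  then show ?case using 0 continuous_on_compose2[of UNIV f UNIV "\<lambda>x. c + L x"] by auto
next
  case (Suc k)
  have "((\<lambda>x. f (c + L x)) has_derivative (\<lambda>v. frechet_derivative f (at (c + L x)) (L v))) (at x)" for x
  proof -
    have "((\<lambda>x. c + L x) has_derivative L) (at x)"
      using has_derivative_add[OF has_derivative_const bounded_linear_imp_has_derivative[OF L]] by simp
    from has_derivative_compose[OF this Ck_Suc_has_derivative[OF Suc.prems]] show ?thesis .
  qed
  then show ?case
    by (rule Ck_SucI) (intro Suc.IH Ck_Suc_directional Suc.prems)
qed

lemma Ck_compose_linear:
  "bounded_linear L \<Longrightarrow> Ck_on_space k f \<Longrightarrow> Ck_on_space k (\<lambda>x. f (L x))"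
  using Ck_compose_affine[of L k f 0] by simp

lemma Ck_bounded_linear: "bounded_linear L \<Longrightarrow> Ck_on_space k L"
proof (cases k)
  case (Suc n)
  assume L: "bounded_linear L"
  show ?thesis unfolding Suc
    by (rule Ck_SucI[where f' = "\<lambda>_. L"])
       (use L bounded_linear_imp_has_derivative in auto)
qed (simp add: linear_continuous_on)

lemma Ck_add:
  "Ck_on_space k f \<Longrightarrow> Ck_on_space k g \<Longrightarrow> Ck_on_space k (\<lambda>x. f x + g x)"
proof (induction k arbitrary: f g)
  case 0
  then show ?case by (simp add: continuous_on_add)
next
  case (Suc k)
  show ?case
    by (rule Ck_SucI, rule has_derivative_add)
       (auto intro!: Suc.IH Ck_Suc_has_derivative Ck_Suc_directional Suc.prems simp del: Ck_on_space.simps)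
qed

lemma Ck_sum:
  "(\<And>i. i \<in> I \<Longrightarrow> Ck_on_space k (f i)) \<Longrightarrow> Ck_on_space k (\<lambda>x. \<Sum>i\<in>I. f i x)"
  by (induction I rule: infinite_finite_induct) (auto intro!: Ck_add)

lemma Ck_mult:
  fixes f g :: "'a::real_normed_vector \<Rightarrow> real"
  shows "Ck_on_space k f \<Longrightarrow> Ck_on_space k g \<Longrightarrow> Ck_on_space k (\<lambda>x. f x * g x)"
proof (induction k arbitrary: f g)
  case 0
  then show ?case by (simp add: continuous_on_mult)
next
  case (Suc k)
  show ?case
    by (rule Ck_SucI, rule has_derivative_mult)
       (auto intro!: Suc.IH Ck_add Ck_Suc_has_derivative Ck_Suc_directional Suc.prems
          Suc.prems[THEN Ck_Suc_imp] simp del: Ck_on_space.simps)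
qed

lemma Ck_cmult:
  fixes f :: "'a::real_normed_vector \<Rightarrow> real"
  shows "Ck_on_space k f \<Longrightarrow> Ck_on_space k (\<lambda>x. c * f x)"
  by (intro Ck_mult Ck_const)

lemma Ck_diff:
  fixes f g :: "'a::real_normed_vector \<Rightarrow> real"
  assumes "Ck_on_space k f" "Ck_on_space k g"
  shows "Ck_on_space k (\<lambda>x. f x - g x)"
  using Ck_add[OF assms(1) Ck_cmult[OF assms(2), of "-1"]] by simp

lemma Ck_power:
  fixes f :: "'a::real_normed_vector \<Rightarrow> real"
  shows "Ck_on_space k f \<Longrightarrow> Ck_on_space k (\<lambda>x. f x ^ n)"
  by (induction n) (auto intro: Ck_mult)

lemma Ck_powr:
  fixes g :: "'a::real_normed_vector \<Rightarrow> real"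
  assumes pos: "\<And>x. g x > 0"
  shows "Ck_on_space k g \<Longrightarrow> Ck_on_space k (\<lambda>x. g x powr a)"
proof (induction k arbitrary: a)
  case 0
  have "\<forall>x\<in>UNIV. g x \<noteq> 0" using pos by (metis less_irrefl)
  with 0 show ?case by (simp add: continuous_on_powr)
next
  case (Suc k)
  have "((\<lambda>x. g x powr a) has_derivative
          (\<lambda>v. a * g x powr (a - 1) * frechet_derivative g (at x) v)) (at x)" for x
  proof -
    have "((\<lambda>u. u powr a) has_derivative (\<lambda>h. a * g x powr (a - 1) * h)) (at (g x))"
      using has_real_derivative_powr[OF pos[of x], of a] by (simp add: has_field_derivative_def)
    from has_derivative_compose[OF Ck_Suc_has_derivative[OF Suc.prems] this]
    show ?thesis .
  qed
  then show ?case
    by (rule Ck_SucI)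
       (intro Ck_mult Ck_const Suc.IH Ck_Suc_directional Suc.prems Ck_Suc_imp[OF Suc.prems])
qed

lemma has_real_derivative_max_power:
  "((\<lambda>u::real. max 0 u ^ Suc (Suc n)) has_real_derivative (real (Suc (Suc n)) * max 0 u ^ Suc n)) (at u)"
proof -
  consider "u > 0" | "u < 0" | "u = 0" by linarith
  then show ?thesis
  proof cases
    case 1
    have "((\<lambda>u::real. u ^ Suc (Suc n)) has_real_derivative (real (Suc (Suc n)) * u ^ Suc n)) (at u)"
      by (rule derivative_eq_intros | simp)+
    then have "((\<lambda>u::real. u ^ Suc (Suc n)) has_real_derivative (real (Suc (Suc n)) * max 0 u ^ Suc n)) (at u)"
      using 1 by (simp only: max_absorb2 less_imp_le)
    then show ?thesis
      by (rule has_field_derivative_transform_within_open[where S = "{0<..}"]) (use 1 in auto)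
  next
    case 2
    have "((\<lambda>u::real. 0) has_real_derivative (real (Suc (Suc n)) * max 0 u ^ Suc n)) (at u)"
      using 2 by simp
    then show ?thesis
      by (rule has_field_derivative_transform_within_open[where S = "{..<0}"]) (use 2 in auto)
  next
    case 3
    \<comment> \<open>At the kink the difference quotient is a positive power of
      \<open>max 0 h\<close> times \<open>max 0 h / h\<close>, and the latter factor is 0 or
      1.\<close>
    have "(\<lambda>h::real. max 0 h * max 0 h ^ n * (max 0 h / h)) \<midarrow>0\<rightarrow> 0"
    proof (rule Lim_null_comparison[where g = "\<lambda>h::real. max 0 h * max 0 h ^ n"])
      show "\<forall>\<^sub>F h in at 0. norm (max 0 h * max 0 h ^ n * (max 0 h / h)) \<le> max 0 h * max 0 h ^ n"
        by (auto simp: eventually_at max_def intro!: exI[of _ 1])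
      show "(\<lambda>h::real. max 0 h * max 0 h ^ n) \<midarrow>0\<rightarrow> 0"
        by (rule tendsto_eq_rhs, (rule tendsto_intros)+) simp
    qed
    moreover have "max 0 h * max 0 h ^ n * (max 0 h / h) = max 0 h ^ Suc (Suc n) / h" for h :: real
      by simp
    ultimately have "(\<lambda>h::real. max 0 h ^ Suc (Suc n) / h) \<midarrow>0\<rightarrow> 0"
      by (simp only:)
    then show ?thesis using 3 by (simp add: DERIV_def)
  qed
qed

text \<open>Each derivative of a truncated power lowers the exponent by one, and the first power of
  \<open>max 0\<close> is still continuous; hence the exponent \<open>Suc k\<close> for class k.
  This yields compactly supported test functions of class 2 from polynomials.\<close>

lemma Ck_max_power:
  fixes g :: "'a::real_normed_vector \<Rightarrow> real"
  shows "Ck_on_space k g \<Longrightarrow> Ck_on_space k (\<lambda>x. max 0 (g x) ^ Suc k)"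
proof (induction k)
  case 0
  then show ?case by (simp add: continuous_on_max)
next
  case (Suc k)
  have "((\<lambda>x. max 0 (g x) ^ Suc (Suc k)) has_derivative
          (\<lambda>v. real (Suc (Suc k)) * max 0 (g x) ^ Suc k * frechet_derivative g (at x) v)) (at x)" for x
    using has_derivative_compose[OF Ck_Suc_has_derivative[OF Suc.prems]
        has_real_derivative_max_power[unfolded has_field_derivative_def]] .
  then show ?case
    by (rule Ck_SucI)
       (rule Ck_mult[OF Ck_cmult[OF Suc.IH[OF Ck_Suc_imp[OF Suc.prems]]] Ck_Suc_directional[OF Suc.prems]])
qed

text \<open>\<open>Ck_on_space\<close> controls derivatives along fixed directions only. In the
  chain rule the direction moves with the point, and expansion in a basis brings it back to finitely
  many fixed directions.\<close>

lemma frechet_derivative_expand: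
  fixes f :: "'a::euclidean_space \<Rightarrow> 'b::real_normed_vector"
  assumes "Ck_on_space (Suc k) f"
  shows "frechet_derivative f (at x) v = (\<Sum>b\<in>Basis. (v \<bullet> b) *\<^sub>R frechet_derivative f (at x) b)"
proof -
  interpret bounded_linear "frechet_derivative f (at x)"
    using Ck_Suc_has_derivative[OF assms] by (rule has_derivative_bounded_linear)
  have "frechet_derivative f (at x) v = frechet_derivative f (at x) (\<Sum>b\<in>Basis. (v \<bullet> b) *\<^sub>R b)"
    by (simp add: euclidean_representation)
  then show ?thesis by (simp add: sum scaleR)
qed

lemma Ck_compose:
  fixes f :: "'a::euclidean_space \<Rightarrow> real" and g :: "'c::real_normed_vector \<Rightarrow> 'a"
  shows "Ck_on_space k f \<Longrightarrow> Ck_on_space k g \<Longrightarrow> Ck_on_space k (\<lambda>x. f (g x))"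
proof (induction k arbitrary: f)
  case 0
  then show ?case using continuous_on_compose2[of UNIV f UNIV g] by auto
next
  case (Suc k)
  have "((\<lambda>x. f (g x)) has_derivative
      (\<lambda>v. \<Sum>b\<in>Basis. (frechet_derivative g (at x) v \<bullet> b) * frechet_derivative f (at (g x)) b)) (at x)" for x
    using has_derivative_compose[OF Ck_Suc_has_derivative[OF Suc.prems(2)] Ck_Suc_has_derivative[OF Suc.prems(1)]]
    by (subst (asm) frechet_derivative_expand[OF Suc.prems(1)]) simp
  then show ?case
  proof (rule Ck_SucI)
    fix v
    have "Ck_on_space k (\<lambda>x. frechet_derivative g (at x) v \<bullet> b)" for b
      by (rule Ck_bounded_linear_compose[OF bounded_linear_inner_left Ck_Suc_directional[OF Suc.prems(2)]])
    moreover have "Ck_on_space k (\<lambda>x. frechet_derivative f (at (g x)) b)" for b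
      by (rule Suc.IH[OF Ck_Suc_directional[OF Suc.prems(1)] Ck_Suc_imp[OF Suc.prems(2)]])
    ultimately show "Ck_on_space k (\<lambda>x. \<Sum>b\<in>Basis. (frechet_derivative g (at x) v \<bullet> b) *
                        frechet_derivative f (at (g x)) b)"
      by (intro Ck_sum Ck_mult)
  qed
qed

text \<open>One constant serves all of \<open>K\<close>, because every segment of length at most 1
  that starts in \<open>K\<close> stays in one compact set, where the finitely many second partial
  derivatives are bounded. Two applications of the mean value theorem along the segment replace a
  Taylor remainder formula; this loses only the factor 1/2.\<close>

lemma Ck2_taylor:
  fixes F :: "'a::euclidean_space \<Rightarrow> real"
  assumes F: "Ck_on_space 2 F" and K: "compact K"
  obtains C where "C \<ge> 0" and "\<And>x v. x \<in> K \<Longrightarrow> norm v \<le> 1 \<Longrightarrow>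
    \<bar>F (x + v) - F x - frechet_derivative F (at x) v\<bar> \<le> C * (norm v)\<^sup>2"
proof -
  define S where "S = (\<Union>x\<in>K. \<Union>v\<in>cball 0 1. {x + v})"
  have "compact S"
    unfolding S_def using compact_sums'[OF K compact_cball, of 0 1] by simp
  define g where "g b c x = frechet_derivative (\<lambda>y. frechet_derivative F (at y) b) (at x) c" for b c x
  have F2: "Ck_on_space (Suc (Suc 0)) F" using F by (simp add: numeral_2_eq_2)
  have F1: "Ck_on_space (Suc 0) (\<lambda>y. frechet_derivative F (at y) b)" for b
    by (rule Ck_Suc_directional[OF F2])
  have "continuous_on UNIV (g b c)" for b c
    using Ck_Suc_directional[OF F1] unfolding g_def by (rule Ck_imp_continuous)
  then have "bounded (g b c ` S)" for b c
    by (intro compact_imp_bounded compact_continuous_image \<open>compact S\<close>)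
       (auto intro: continuous_on_subset)
  then have "\<exists>M. \<forall>x\<in>S. \<bar>g b c x\<bar> \<le> M" for b c
    by (auto simp: bounded_iff)
  then obtain M where M: "\<And>b c x. x \<in> S \<Longrightarrow> \<bar>g b c x\<bar> \<le> M b c" by metis
  define C where "C = (\<Sum>b\<in>Basis. \<Sum>c\<in>Basis. \<bar>M b c\<bar>)"
  show thesis
  proof (rule that[of C])
    show "C \<ge> 0" by (simp add: C_def sum_nonneg)
    fix x v :: 'a assume x: "x \<in> K" and v: "norm v \<le> 1"
    have inS: "x + t *\<^sub>R v \<in> S" if "0 \<le> t" "t \<le> 1" for t
    proof -
      have "norm (t *\<^sub>R v) \<le> 1" using that v by (simp add: mult_le_one)
      then show ?thesis using x unfolding S_def by force
    qed
    have line: "((\<lambda>t. H (x + t *\<^sub>R v)) has_real_derivative frechet_derivative H (at (x + t *\<^sub>R v)) v) (at t)"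
      if H: "Ck_on_space (Suc 0) H" for H :: "'a \<Rightarrow> real" and t
    proof -
      have "((\<lambda>t. x + t *\<^sub>R v) has_derivative (\<lambda>h. h *\<^sub>R v)) (at t)"
        by (auto intro!: derivative_eq_intros)
      from has_derivative_compose[OF this Ck_Suc_has_derivative[OF H]]
      have *: "((\<lambda>t. H (x + t *\<^sub>R v)) has_derivative
          (\<lambda>h. frechet_derivative H (at (x + t *\<^sub>R v)) (h *\<^sub>R v))) (at t)" .
      interpret bounded_linear "frechet_derivative H (at (x + t *\<^sub>R v))"
        using Ck_Suc_has_derivative[OF H] by (rule has_derivative_bounded_linear)
      have "(*) (frechet_derivative H (at (x + t *\<^sub>R v)) v) =
          (\<lambda>h. frechet_derivative H (at (x + t *\<^sub>R v)) (h *\<^sub>R v))"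
        by (simp add: fun_eq_iff scaleR mult.commute[of "frechet_derivative H (at (x + t *\<^sub>R v)) v"])
      then show ?thesis using * by (simp add: has_field_derivative_def)
    qed
    define \<phi>1 where "\<phi>1 t = frechet_derivative F (at (x + t *\<^sub>R v)) v" for t
    define \<phi>2 where "\<phi>2 t = g v v (x + t *\<^sub>R v)" for t
    have d1: "((\<lambda>t. F (x + t *\<^sub>R v)) has_real_derivative \<phi>1 t) (at t)" for t
      unfolding \<phi>1_def by (rule line[OF Ck_Suc_imp[OF F2]])
    have d2: "(\<phi>1 has_real_derivative \<phi>2 t) (at t)" for t
      unfolding \<phi>1_def \<phi>2_def g_def by (rule line[OF F1])
    have bnd: "\<bar>\<phi>2 t\<bar> \<le> C * (norm v)\<^sup>2" if t: "0 \<le> t" "t \<le> 1" for t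
    proof -
      let ?y = "x + t *\<^sub>R v"
      have "g v v ?y = (\<Sum>c\<in>Basis. (v \<bullet> c) * g v c ?y)"
        unfolding g_def by (subst frechet_derivative_expand[OF F1]) simp
      also have "\<dots> = (\<Sum>c\<in>Basis. (v \<bullet> c) * (\<Sum>b\<in>Basis. (v \<bullet> b) * g b c ?y))"
      proof (rule sum.cong[OF refl])
        fix c :: 'a
        have "((\<lambda>y. \<Sum>b\<in>Basis. (v \<bullet> b) * frechet_derivative F (at y) b) has_derivative
            (\<lambda>h. \<Sum>b\<in>Basis. (v \<bullet> b) * frechet_derivative (\<lambda>y. frechet_derivative F (at y) b) (at ?y) h)) (at ?y)"
          by (intro has_derivative_sum has_derivative_mult_right Ck_Suc_has_derivative[OF F1])
        moreover have "(\<lambda>y. frechet_derivative F (at y) v) =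
            (\<lambda>y. \<Sum>b\<in>Basis. (v \<bullet> b) * frechet_derivative F (at y) b)"
          by (rule ext) (subst frechet_derivative_expand[OF Ck_Suc_imp[OF F2]], simp)
        ultimately have "frechet_derivative (\<lambda>y. frechet_derivative F (at y) v) (at ?y) =
            (\<lambda>h. \<Sum>b\<in>Basis. (v \<bullet> b) * frechet_derivative (\<lambda>y. frechet_derivative F (at y) b) (at ?y) h)"
          by (simp only: frechet_derivative_at[symmetric])
        then have "g v c ?y = (\<Sum>b\<in>Basis. (v \<bullet> b) * g b c ?y)"
          by (simp add: g_def)
        then show "v \<bullet> c * g v c ?y = v \<bullet> c * (\<Sum>b\<in>Basis. (v \<bullet> b) * g b c ?y)" by simp
      qed
      finally have "\<bar>\<phi>2 t\<bar> = \<bar>\<Sum>c\<in>Basis. (v \<bullet> c) * (\<Sum>b\<in>Basis. (v \<bullet> b) * g b c ?y)\<bar>"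
        by (simp add: \<phi>2_def)
      also have "\<dots> \<le> (\<Sum>c\<in>Basis. \<bar>v \<bullet> c\<bar> * (\<Sum>b\<in>Basis. \<bar>v \<bullet> b\<bar> * \<bar>g b c ?y\<bar>))"
        by (intro order_trans[OF sum_abs] sum_mono)
           (auto simp: abs_mult intro!: mult_left_mono order_trans[OF sum_abs])
      also have "\<dots> \<le> (\<Sum>c\<in>Basis. norm v * (\<Sum>b\<in>Basis. norm v * \<bar>M b c\<bar>))"
        using M[OF inS[OF t]]
        by (intro sum_mono mult_mono sum_nonneg Basis_le_norm) (auto intro: order_trans[OF _ abs_ge_self] sum_nonneg)
      also have "\<dots> = C * (norm v)\<^sup>2"
        unfolding C_def by (subst sum.swap) (simp add: sum_distrib_left power2_eq_square mult_ac)
      finally show ?thesis .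
    qed
    obtain z where z: "0 < z" "z < 1" "F (x + 1 *\<^sub>R v) - F (x + 0 *\<^sub>R v) = (1 - 0) * \<phi>1 z"
      using MVT2[of 0 1 "\<lambda>t. F (x + t *\<^sub>R v)" \<phi>1] d1 by auto
    obtain w where w: "0 < w" "w < z" "\<phi>1 z - \<phi>1 0 = (z - 0) * \<phi>2 w"
      using MVT2[of 0 z \<phi>1 \<phi>2] d2 z by auto
    have "F (x + v) - F x - frechet_derivative F (at x) v = z * \<phi>2 w"
      using z w by (simp add: \<phi>1_def)
    also have "\<bar>\<dots>\<bar> \<le> 1 * \<bar>\<phi>2 w\<bar>"
      unfolding abs_mult using z by (intro mult_right_mono) auto
    also have "\<dots> \<le> C * (norm v)\<^sup>2" using bnd[of w] w z by simp
    finally show "\<bar>F (x + v) - F x - frechet_derivative F (at x) v\<bar> \<le> C * (norm v)\<^sup>2" .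
  qed
qed

lemma vanishing_continuousI:
  fixes f :: "'a::real_normed_vector \<Rightarrow> real"
  assumes "continuous_on UNIV f" and "\<And>x. norm x > R \<Longrightarrow> f x = 0"
  shows "vanishing_continuous f"
proof -
  have "\<forall>\<^sub>F x in at_infinity. f x = 0"
    unfolding eventually_at_infinity using assms(2) by (intro exI[of _ "R + 1"]) auto
  then show ?thesis
    using assms(1) by (simp add: vanishing_continuous_def tendsto_eventually)
qed

text \<open>Comparison with the Lagrange form of the remainder shows that
  \<open>(\<phi>1 0 - a) / t\<close> has a finite limit at 0. That forces its numerator to vanish,
  after which the same limit identifies the second derivative. An expansion from the right is
  enough, since both derivatives are assumed to exist.\<close>

lemma peano_coefficients:
  fixes \<phi> \<phi>1 \<phi>2 :: "real \<Rightarrow> real"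
  assumes d1: "\<And>t. (\<phi> has_real_derivative \<phi>1 t) (at t)"
    and d2: "\<And>t. (\<phi>1 has_real_derivative \<phi>2 t) (at t)"
    and c2: "continuous_on UNIV \<phi>2"
    and peano: "((\<lambda>t. (\<phi> t - \<phi> 0 - a * t - q * t\<^sup>2) / t\<^sup>2) \<longlongrightarrow> 0) (at_right 0)"
  shows "\<phi>1 0 = a" "\<phi>2 0 = 2 * q"
proof -
  have "\<exists>z. 0 < z \<and> z < t \<and> \<phi> t = \<phi> 0 + \<phi>1 0 * t + \<phi>2 z / 2 * t\<^sup>2" if "t > 0" for t
  proof -
    define D where "D n = (if n = 0 then \<phi> else if n = 1 then \<phi>1 else \<phi>2)" for n :: nat
    have "\<exists>z>0. z < t \<and> \<phi> t = (\<Sum>m<2. D m 0 / fact m * t ^ m) + D 2 z / fact 2 * t\<^sup>2"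
      by (rule Maclaurin[OF that]) (auto simp: D_def d1 d2 less_2_cases_iff)
    then show ?thesis by (auto simp: D_def numeral_2_eq_2)
  qed
  then obtain z where z: "\<And>t. t > 0 \<Longrightarrow> 0 < z t \<and> z t < t \<and> \<phi> t = \<phi> 0 + \<phi>1 0 * t + \<phi>2 (z t) / 2 * t\<^sup>2"
    by metis
  have "\<forall>\<^sub>F t in at_right 0. 0 \<le> z t" "\<forall>\<^sub>F t in at_right 0. z t \<le> t"
    using eventually_at_right_less[of "0::real"] by (rule eventually_mono, use z less_imp_le in blast)+
  then have "(z \<longlongrightarrow> 0) (at_right 0)"
    by (rule tendsto_sandwich) (auto intro: tendsto_ident_at)
  moreover have "isCont \<phi>2 0" using c2 by (simp add: continuous_on_eq_continuous_at)
  ultimately have z2: "((\<lambda>t. \<phi>2 (z t)) \<longlongrightarrow> \<phi>2 0) (at_right 0)"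
    using isCont_tendsto_compose by blast
  have eq: "(\<phi>1 0 - a) / t = (\<phi> t - \<phi> 0 - a * t - q * t\<^sup>2) / t\<^sup>2 - \<phi>2 (z t) / 2 + q" if "t > 0" for t
    using z[OF that] that by (simp add: field_simps power2_eq_square)
  have "((\<lambda>t. (\<phi> t - \<phi> 0 - a * t - q * t\<^sup>2) / t\<^sup>2 - \<phi>2 (z t) / 2 + q) \<longlongrightarrow> 0 - \<phi>2 0 / 2 + q) (at_right 0)"
    by (intro tendsto_intros peano z2) auto
  then have lim: "((\<lambda>t. (\<phi>1 0 - a) / t) \<longlongrightarrow> q - \<phi>2 0 / 2) (at_right 0)"
    by (rule Lim_transform_eventually[THEN tendsto_eq_rhs])
       (auto simp: eventually_at_right_field eq intro: exI[of _ 1])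
  have "((\<lambda>t. t * ((\<phi>1 0 - a) / t)) \<longlongrightarrow> 0 * (q - \<phi>2 0 / 2)) (at_right 0)"
    by (intro tendsto_mult lim tendsto_ident_at)
  then have "((\<lambda>t::real. \<phi>1 0 - a) \<longlongrightarrow> 0) (at_right 0)"
    by (rule Lim_transform_eventually[THEN tendsto_eq_rhs])
       (auto simp: eventually_at_right_field intro: exI[of _ 1])
  then show a: "\<phi>1 0 = a" by (simp add: tendsto_const_iff)
  with lim show "\<phi>2 0 = 2 * q" by (simp add: tendsto_const_iff)
qed

section \<open>Left-invariant derivatives on the group\<close>

context homogeneous_group
begin

lemma in_carrier [simp]: "x \<in> carrier G"
  by (simp add: carrier_UNIV)

lemma zero_mult [simp]: "0 \<otimes> x = x" and mult_zero [simp]: "x \<otimes> 0 = x"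
  using l_one[of x] r_one[of x] by (simp_all add: one_eq_zero)

lemma inv_eq_uminus [simp]: "inv x = - x"
proof -
  have "x \<otimes> (- x) = 0" using exponential_coordinates[of 1 x "-1"] by simp
  then show ?thesis by (metis in_carrier one_eq_zero inv_equality inv_inv r_inv_ex l_inv_ex inv_solve_left r_one)
qed

lemma mult_uminus [simp]: "x \<otimes> (- x) = 0" "(- x) \<otimes> x = 0"
  using r_inv[of x] l_inv[of x] by (simp_all add: one_eq_zero)

lemma mult_cancel_left [simp]: "(- x) \<otimes> (x \<otimes> y) = y" "x \<otimes> ((- x) \<otimes> y) = y"
  using m_assoc[of "- x" x y] m_assoc[of x "- x" y] by simp_all

lemma increment_mult: "increment G x u v \<otimes> increment G x v w = increment G x u w"
  by (simp add: increment_def m_assoc)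

lemma increment_self [simp]: "increment G x u u = 0"
  by (simp add: increment_def)

lemma Ck_mult_group: "Ck_on_space k (\<lambda>p. fst p \<otimes> snd p)"
  using smooth_Ck[OF smooth_mult, of k] by (simp add: case_prod_unfold)

lemma Ck_compose_mult:
  fixes f :: "(real, 'm) vec \<Rightarrow> real"
  shows "Ck_on_space k f \<Longrightarrow> Ck_on_space k (\<lambda>p. f (fst p \<otimes> snd p))"
  by (rule Ck_compose[OF _ Ck_mult_group])

lemma continuous_on_mult_group [continuous_intros]:
  assumes "continuous_on S f" "continuous_on S g"
  shows "continuous_on S (\<lambda>x. f x \<otimes> g x)"
  using continuous_on_compose2[OF Ck_imp_continuous[OF Ck_mult_group[of 0]] continuous_on_Pair[OF assms]] by simp

lemma tendsto_mult_group [tendsto_intros]: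
  assumes "(f \<longlongrightarrow> a) F" "(g \<longlongrightarrow> b) F"
  shows "((\<lambda>x. f x \<otimes> g x) \<longlongrightarrow> a \<otimes> b) F"
proof -
  have "isCont (\<lambda>p. fst p \<otimes> snd p) (a, b)"
    using Ck_imp_continuous[OF Ck_mult_group[of 0]] by (simp add: continuous_on_eq_continuous_at)
  from isCont_tendsto_compose[OF this tendsto_Pair[OF assms]] show ?thesis by simp
qed

lemma measurable_mult_group [measurable (raw)]:
  assumes [measurable]: "f \<in> borel_measurable M" "g \<in> borel_measurable M"
  shows "(\<lambda>x. f x \<otimes> g x) \<in> borel_measurable M"
proof -
  have "(\<lambda>p. fst p \<otimes> snd p) \<in> borel_measurable borel"
    using Ck_imp_continuous[OF Ck_mult_group[of 0]] by (rule borel_measurable_continuous_onI)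
  then have [measurable]: "(\<lambda>p. fst p \<otimes> snd p) \<in> borel_measurable (borel \<Otimes>\<^sub>M borel)"
    by (simp add: borel_prod)
  have "(\<lambda>x. (\<lambda>p. fst p \<otimes> snd p) (f x, g x)) \<in> borel_measurable M" by measurable
  then show ?thesis by simp
qed

text \<open>A derivative of the map (x, y) \<mapsto> f (x \<otimes> y) in the fixed direction (0,
  w), and not along a curve as in \<open>left_field\<close>. In this form linearity in
  \<open>w\<close> and the smoothness of the result are inherited from the Frechet
  derivative.\<close>

definition lie :: "(real, 'm) vec \<Rightarrow> ((real, 'm) vec \<Rightarrow> real) \<Rightarrow> (real, 'm) vec \<Rightarrow> real" where
  "lie w f x = frechet_derivative (\<lambda>p. f (fst p \<otimes> snd p)) (at (x, 0)) (0, w)"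

lemma lie_line:
  fixes f :: "(real, 'm) vec \<Rightarrow> real"
  assumes f: "Ck_on_space (Suc k) f"
  shows "((\<lambda>t. f (x \<otimes> (t *\<^sub>R w))) has_real_derivative lie w f x) (at 0)"
proof -
  have "((\<lambda>t. (x, t *\<^sub>R w)) has_derivative (\<lambda>h. (0, h *\<^sub>R w))) (at (0::real))"
    by (auto intro!: derivative_eq_intros)
  from has_derivative_compose[OF this, of "\<lambda>p. f (fst p \<otimes> snd p)"]
    Ck_Suc_has_derivative[OF Ck_compose_mult[OF f], of "(x, 0)"]
  have *: "((\<lambda>t. f (x \<otimes> (t *\<^sub>R w))) has_derivative
     (\<lambda>h. frechet_derivative (\<lambda>p. f (fst p \<otimes> snd p)) (at (x, 0)) (0, h *\<^sub>R w))) (at 0)"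
    by simp
  interpret bounded_linear "frechet_derivative (\<lambda>p. f (fst p \<otimes> snd p)) (at (x, 0))"
    using Ck_Suc_has_derivative[OF Ck_compose_mult[OF f]] by (rule has_derivative_bounded_linear)
  have "(*) (lie w f x) = (\<lambda>h. frechet_derivative (\<lambda>p. f (fst p \<otimes> snd p)) (at (x, 0)) (0, h *\<^sub>R w))"
  proof
    fix h :: real
    show "lie w f x * h = frechet_derivative (\<lambda>p. f (fst p \<otimes> snd p)) (at (x, 0)) (0, h *\<^sub>R w)"
      using scaleR[of h "(0, w)"] by (simp add: lie_def)
  qed
  with * show ?thesis by (simp add: has_field_derivative_def)
qed

lemma lie_eqI:
  assumes "Ck_on_space (Suc k) f" "((\<lambda>t. f (x \<otimes> (t *\<^sub>R w))) has_real_derivative D) (at 0)"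
  shows "lie w f x = D"
  using DERIV_unique[OF lie_line[OF assms(1)] assms(2)] .

lemma left_field_eq_lie: "Ck_on_space (Suc k) f \<Longrightarrow> left_field G i f x = lie (axis i 1) f x"
  unfolding left_field_def by (rule DERIV_imp_deriv[OF lie_line])

lemma Ck_lie:
  assumes f: "Ck_on_space (Suc k) f"
  shows "Ck_on_space k (lie w f)"
proof -
  have "bounded_linear (\<lambda>x::(real, 'm) vec. (x, 0::(real, 'm) vec))"
    by (intro bounded_linear_Pair bounded_linear_ident bounded_linear_zero)
  from Ck_compose_linear[OF this Ck_Suc_directional[OF Ck_compose_mult[OF f]]]
  show ?thesis by (simp add: lie_def[abs_def])
qed

lemma lie_linear:
  assumes f: "Ck_on_space (Suc k) f"
  shows "linear (\<lambda>w. lie w f x)"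
proof -
  interpret bounded_linear "frechet_derivative (\<lambda>p. f (fst p \<otimes> snd p)) (at (x, 0))"
    using Ck_Suc_has_derivative[OF Ck_compose_mult[OF f]] by (rule has_derivative_bounded_linear)
  show ?thesis
    by (rule linearI) (use add[of "(0, _)" "(0, _)"] scaleR[of _ "(0, _)"] in \<open>auto simp: lie_def\<close>)
qed

lemma lie_add_direction: "Ck_on_space (Suc k) f \<Longrightarrow> lie (v + w) f x = lie v f x + lie w f x"
  using linear_add[OF lie_linear] by blast

lemma lie_expand:
  assumes f: "Ck_on_space (Suc k) f"
  shows "lie w f x = (\<Sum>i\<in>UNIV. w $ i * lie (axis i 1) f x)"
proof -
  have "lie w f x = lie (\<Sum>i\<in>UNIV. w $ i *\<^sub>R axis i 1) f x"
    using basis_expansion[of w] by (simp add: scalar_mult_eq_scaleR)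
  also have "\<dots> = (\<Sum>i\<in>UNIV. w $ i * lie (axis i 1) f x)"
    by (simp only: linear_sum[OF lie_linear[OF f]] linear_scale[OF lie_linear[OF f]] real_scaleR_def)
  finally show ?thesis .
qed

lemma lie_add:
  assumes f: "Ck_on_space (Suc k) f" and g: "Ck_on_space (Suc k) g"
  shows "lie w (\<lambda>x. f x + g x) x = lie w f x + lie w g x"
  by (rule lie_eqI[OF Ck_add[OF f g]]) (intro derivative_intros lie_line[OF f] lie_line[OF g])

lemma lie_vanishes:
  assumes f: "\<And>x. norm x > R \<Longrightarrow> f x = (0::real)" and C: "Ck_on_space (Suc k) f" and x: "norm x > R"
  shows "lie w f x = 0"
proof (rule lie_eqI[OF C])
  have "((\<lambda>t. norm (x \<otimes> (t *\<^sub>R w))) \<longlongrightarrow> norm (x \<otimes> (0 *\<^sub>R w))) (at 0)"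
    by (intro tendsto_intros)
  then have "\<forall>\<^sub>F t in at 0. norm (x \<otimes> (t *\<^sub>R w)) > R"
    using x by (auto dest: order_tendstoD)
  then have "\<forall>\<^sub>F t in nhds 0. f (x \<otimes> (t *\<^sub>R w)) = 0"
    using x f by (auto simp: eventually_nhds_conv_at elim: eventually_mono)
  then show "((\<lambda>t. f (x \<otimes> (t *\<^sub>R w))) has_real_derivative 0) (at 0)"
    by (subst DERIV_cong_ev[OF refl _ refl]) auto
qed

text \<open>All test functions inserted into the generator below have bounded support, and then
  every vanishing condition in \<open>C2_0\<close> is automatic, as left-invariant derivatives do
  not enlarge the support.\<close>

lemma C2_0I:
  assumes f: "Ck_on_space 2 f" and van: "\<And>x. norm x > R \<Longrightarrow> f x = 0"
  shows "f \<in> C2_0 G"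
proof -
  have f2: "Ck_on_space (Suc (Suc 0)) f" using f by (simp add: numeral_2_eq_2)
  have L: "left_field G i f = lie (axis i 1) f" for i
    using left_field_eq_lie[OF f2] by blast
  have L1: "Ck_on_space (Suc 0) (lie w f)" for w by (rule Ck_lie[OF f2])
  have L2: "left_field G i (lie w f) = lie (axis i 1) (lie w f)" for i w
    using left_field_eq_lie[OF L1] by blast
  have v1: "lie w f x = 0" if "norm x > R" for w x
    by (rule lie_vanishes[OF van f2 that])
  have v2: "lie v (lie w f) x = 0" if "norm x > R" for v w x
    by (rule lie_vanishes[OF v1 L1 that])
  show ?thesis unfolding C2_0_def mem_Collect_eq L L2
    by (auto intro!: f vanishing_continuousI[of _ R] van v1 v2
          Ck_imp_continuous[OF f] Ck_imp_continuous[OF L1] Ck_imp_continuous[OF Ck_lie[OF L1]])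
qed

text \<open>The line through \<open>w\<close> is a one-parameter subgroup, so moving along it is
  right multiplication by its own elements. On that line the left-invariant derivative is an
  ordinary derivative, and it can be iterated.\<close>

lemma lie_along_line:
  assumes "Ck_on_space (Suc k) f"
  shows "((\<lambda>t. f (t *\<^sub>R w)) has_real_derivative lie w f (t *\<^sub>R w)) (at t)"
  using lie_line[OF assms, of "t *\<^sub>R w" w] DERIV_shift[of "\<lambda>s. f (s *\<^sub>R w)" "lie w f (t *\<^sub>R w)" 0 t]
  by (simp add: exponential_coordinates add.commute)

text \<open>Only the symmetric part of the second-order operator is seen at the identity, and there it is the
  ordinary Hessian because straight lines are one-parameter subgroups.\<close>

lemma generator_coefficients_at_identity:
  fixes f :: "(real, 'm) vec \<Rightarrow> real" and l :: "(real, 'm) vec" and q :: "'m \<Rightarrow> 'm \<Rightarrow> real"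
  assumes f: "Ck_on_space 2 f"
    and peano: "((\<lambda>x. (f x - f 0 - (\<Sum>i\<in>UNIV. l $ i * x $ i) -
        (\<Sum>i\<in>UNIV. \<Sum>j\<in>UNIV. q i j * (x $ i * x $ j)) / 2) / (norm x)\<^sup>2) \<longlongrightarrow> 0) (at 0)"
    and q: "\<And>i j. q i j = q j i" and A: "\<And>i j. A $ i $ j = A $ j $ (i::'m)"
  shows "left_field G i f 0 = l $ i"
    and "(\<Sum>i\<in>UNIV. \<Sum>j\<in>UNIV. A $ i $ j * left_field G i (left_field G j f) 0) =
         (\<Sum>i\<in>UNIV. \<Sum>j\<in>UNIV. A $ i $ j * q i j)"
proof -
  have f2: "Ck_on_space (Suc (Suc 0)) f" using f by (simp add: numeral_2_eq_2)
  have L: "left_field G i f = lie (axis i 1) f" for i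
    using left_field_eq_lie[OF f2] by blast
  have L1: "Ck_on_space (Suc 0) (lie w f)" for w by (rule Ck_lie[OF f2])
  define Q where "Q x = (\<Sum>i\<in>UNIV. \<Sum>j\<in>UNIV. q i j * (x $ i * x $ j))" for x :: "(real, 'm) vec"
  have Qs: "Q (t *\<^sub>R w) = t\<^sup>2 * Q w" for t w
    by (simp add: Q_def sum_distrib_left power2_eq_square mult_ac)
  have coef: "lie w f 0 = (\<Sum>i\<in>UNIV. l $ i * w $ i) \<and> lie w (lie w f) 0 = Q w" if w: "w \<noteq> 0" for w
  proof -
    define \<phi> where "\<phi> t = f (t *\<^sub>R w)" for t
    define \<phi>1 where "\<phi>1 t = lie w f (t *\<^sub>R w)" for t
    define \<phi>2 where "\<phi>2 t = lie w (lie w f) (t *\<^sub>R w)" for t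
    have "(\<phi> has_real_derivative \<phi>1 t) (at t)" for t
      unfolding \<phi>_def[abs_def] \<phi>1_def by (rule lie_along_line[OF f2])
    moreover have "(\<phi>1 has_real_derivative \<phi>2 t) (at t)" for t
      unfolding \<phi>1_def[abs_def] \<phi>2_def by (rule lie_along_line[OF L1])
    moreover have "continuous_on UNIV \<phi>2"
      unfolding \<phi>2_def[abs_def]
      by (rule continuous_on_compose2[OF Ck_imp_continuous[OF Ck_lie[OF L1]]]) (auto intro!: continuous_intros)
    moreover have "((\<lambda>t. (\<phi> t - \<phi> 0 - (\<Sum>i\<in>UNIV. l $ i * w $ i) * t - (Q w / 2) * t\<^sup>2) / t\<^sup>2) \<longlongrightarrow> 0) (at_right 0)"
    proof -
      have "filterlim (\<lambda>t. t *\<^sub>R w) (at 0) (at_right 0)"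
        using w by (auto simp: filterlim_at eventually_at_right_field intro!: tendsto_eq_intros exI[of _ 1])
      from filterlim_compose[OF peano this]
      have "((\<lambda>t. (f (t *\<^sub>R w) - f 0 - (\<Sum>i\<in>UNIV. l $ i * (t *\<^sub>R w) $ i) -
          Q (t *\<^sub>R w) / 2) / (norm (t *\<^sub>R w))\<^sup>2) \<longlongrightarrow> 0) (at_right 0)"
        unfolding Q_def .
      from tendsto_mult_right[OF this, of "(norm w)\<^sup>2"]
      show ?thesis
        by (rule Lim_transform_eventually[THEN tendsto_eq_rhs])
           (use w in \<open>auto simp: \<phi>_def Qs sum_distrib_left sum_distrib_right field_simps power_mult_distrib mult_ac
             intro!: eventually_at_right_less[THEN eventually_mono]\<close>)
    qed
    ultimately have "\<phi>1 0 = (\<Sum>i\<in>UNIV. l $ i * w $ i)" "\<phi>2 0 = 2 * (Q w / 2)"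
      by (rule peano_coefficients)+
    then show ?thesis by (simp add: \<phi>1_def \<phi>2_def)
  qed
  have ax: "axis i (1::real) \<noteq> 0" for i :: 'm by (simp add: axis_eq_0_iff)
  have m: "c * (if P then a else 0) = (if P then c * a else 0)" "(if P then a else 0) * c = (if P then a * c else 0)"
    for a c :: real and P by simp_all
  show "left_field G i f 0 = l $ i"
    unfolding L using coef[OF ax[of i]] by (simp add: axis_def m)
  define S where "S i j = lie (axis i 1) (lie (axis j 1) f) 0" for i j
  have bil: "(\<Sum>k\<in>UNIV. \<Sum>h\<in>UNIV. q k h * (axis i 1 $ k * axis j 1 $ h)) = q i j" for i j
    by (simp add: axis_def m)
  have Qax: "Q (axis i 1) = q i i" for i
    unfolding Q_def by (rule bil)
  have Qax2: "Q (axis i 1 + axis j 1) = q i i + q j j + 2 * q i j" for i j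
    using q[of i j] by (simp add: Q_def distrib_left distrib_right sum.distrib bil)
  \<comment> \<open>Polarization: lines through the identity give only the diagonal values of
    \<open>S\<close>, and the direction \<open>axis i 1 + axis j 1\<close> then yields the
    symmetrised ones. The single values \<open>S i j\<close> need not be symmetric, because the
    fields need not commute.\<close>
  have pol: "S i j + S j i = 2 * q i j" for i j
  proof -
    have Sii: "S i i = q i i" for i unfolding S_def using coef[OF ax] Qax by metis
    show ?thesis
    proof (cases "i = j")
      case False
      let ?w = "axis i 1 + axis j (1::real)"
      have "?w $ i \<noteq> 0" using False by (simp add: axis_def)
      then have nz: "?w \<noteq> 0" by (metis zero_index)
      have eq: "lie ?w f = (\<lambda>x. lie (axis i 1) f x + lie (axis j 1) f x)"
        using lie_add_direction[OF f2] by blast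
      have "lie ?w (lie ?w f) 0 = S i i + S i j + S j i + S j j"
        unfolding lie_add_direction[OF L1] unfolding eq lie_add[OF L1 L1] by (simp add: S_def)
      then show ?thesis using coef[OF nz] Sii Qax2 by simp
    qed (simp add: Sii)
  qed
  have pA: "A $ i $ j * S i j + A $ i $ j * S j i = 2 * (A $ i $ j * q i j)" for i j
    unfolding distrib_left[symmetric] pol by simp
  have "2 * (\<Sum>i\<in>UNIV. \<Sum>j\<in>UNIV. A $ i $ j * S i j) =
      (\<Sum>i\<in>UNIV. \<Sum>j\<in>UNIV. A $ i $ j * S i j) + (\<Sum>i\<in>UNIV. \<Sum>j\<in>UNIV. A $ i $ j * S j i)"
    by (subst (3) sum.swap) (simp add: A[symmetric])
  also have "\<dots> = 2 * (\<Sum>i\<in>UNIV. \<Sum>j\<in>UNIV. A $ i $ j * q i j)"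
    unfolding sum.distrib[symmetric] pA sum_distrib_left ..
  finally show "(\<Sum>i\<in>UNIV. \<Sum>j\<in>UNIV. A $ i $ j * left_field G i (left_field G j f) 0) =
         (\<Sum>i\<in>UNIV. \<Sum>j\<in>UNIV. A $ i $ j * q i j)"
    unfolding L using left_field_eq_lie[OF L1] by (simp add: S_def)
qed

text \<open>The estimate holds on the whole group with one constant: \<open>K\<close> contains every
  \<open>y\<close> for which \<open>y\<close> or some \<open>y \<otimes> z\<close> with z in the
  unit ball meets the support of \<open>f\<close>, and away from \<open>K\<close> all terms on the
  left vanish.\<close>

lemma mult_taylor:
  assumes f: "Ck_on_space 2 f" and van: "\<And>x. norm x > R \<Longrightarrow> f x = (0::real)"
  obtains C where "C \<ge> 0" and "\<And>y z. norm z \<le> 1 \<Longrightarrow>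
      \<bar>f (y \<otimes> z) - f y - (\<Sum>i\<in>UNIV. z $ i * lie (axis i 1) f y)\<bar> \<le> C * (norm z)\<^sup>2"
proof -
  have f2: "Ck_on_space (Suc (Suc 0)) f" using f by (simp add: numeral_2_eq_2)
  define K where "K = (\<lambda>p. fst p \<otimes> snd p) ` (cball 0 R \<times> cball 0 1)"
  have "compact K" unfolding K_def
    by (intro compact_continuous_image compact_Times compact_cball continuous_intros)
  then have cK: "compact (K \<times> {0::(real, 'm) vec})" by (intro compact_Times) auto
  obtain C where C: "C \<ge> 0" "\<And>p v. p \<in> K \<times> {0} \<Longrightarrow> norm v \<le> 1 \<Longrightarrow>
     \<bar>f (fst (p + v) \<otimes> snd (p + v)) - f (fst p \<otimes> snd p) -
       frechet_derivative (\<lambda>p. f (fst p \<otimes> snd p)) (at p) v\<bar> \<le> C * (norm v)\<^sup>2"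
    using Ck2_taylor[OF Ck_compose_mult[OF f] cK] by blast
  have inK: "y \<in> K" if "norm z \<le> 1" "norm (y \<otimes> z) \<le> R" for y z
  proof -
    have "(y \<otimes> z, - z) \<in> cball 0 R \<times> cball 0 1" using that by simp
    then have "fst (y \<otimes> z, - z) \<otimes> snd (y \<otimes> z, - z) \<in> K" unfolding K_def by (rule imageI)
    then show ?thesis by (simp add: m_assoc)
  qed
  show thesis
  proof (rule that[OF C(1)])
    fix y z :: "(real, 'm) vec" assume z: "norm z \<le> 1"
    show "\<bar>f (y \<otimes> z) - f y - (\<Sum>i\<in>UNIV. z $ i * lie (axis i 1) f y)\<bar> \<le> C * (norm z)\<^sup>2"
    proof (cases "y \<in> K")
      case True
      then show ?thesis
        using C(2)[of "(y, 0)" "(0, z)"] z lie_expand[OF f2, of z y] by (simp add: lie_def norm_Pair)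
    next
      case False
      have "f y = 0" using van inK[of 0 y] False by force
      moreover have "f (y \<otimes> z) = 0" using van inK[of z y] False z by force
      moreover have "lie w f y = 0" for w
        using lie_vanishes[OF van f2] inK[of 0 y] False by force
      ultimately show ?thesis using C(1) by simp
    qed
  qed
qed

lemma lie_bounded:
  assumes f: "Ck_on_space 2 f" and van: "\<And>x. norm x > R \<Longrightarrow> f x = (0::real)"
  obtains C where "C \<ge> 0" and "\<And>y. \<bar>lie w f y\<bar> \<le> C"
proof -
  have f2: "Ck_on_space (Suc (Suc 0)) f" using f by (simp add: numeral_2_eq_2)
  have "compact (lie w f ` cball 0 R)"
    by (intro compact_continuous_image continuous_on_subset[OF Ck_imp_continuous[OF Ck_lie[OF f2]]]) auto
  then obtain C where C: "\<And>y. norm y \<le> R \<Longrightarrow> \<bar>lie w f y\<bar> \<le> C"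
    using compact_imp_bounded by (force simp: bounded_iff)
  show thesis
  proof (rule that[of "\<bar>C\<bar>"])
    fix y
    show "\<bar>lie w f y\<bar> \<le> \<bar>C\<bar>"
      using C[of y] lie_vanishes[OF van f2, where x = y and w = w] by (cases "norm y \<le> R") auto
  qed simp
qed

end

subsection \<open>Homogeneous norms\<close>

context homogeneous_group
begin

lemma dilation_mult: "r > 0 \<Longrightarrow> dilation d r (x \<otimes> y) = dilation d r x \<otimes> dilation d r y"
  using dilation_automorphism[of r] by (auto simp: iso_def hom_def)

lemma weight_pos: "d i > 0"
  using weights_ge_1[of i] by linarith

text \<open>\<open>N\<close> is bounded below by a positive \<open>m\<close> on the unit sphere
  \<open>S\<close> of the maximum norm, by compactness. Every other nonzero point is moved to
  \<open>S\<close> by a dilation, under which \<open>N\<close> scales linearly and the i-th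
  coordinate with the power \<open>d i\<close>.\<close>

lemma homogeneous_norm_coordinate_bound:
  assumes N: "subadditive_homogeneous_norm G d N"
  obtains C where "C > 0" and "\<And>x i. \<bar>x $ i\<bar> \<le> C * N x powr d i"
proof -
  have Nc: "continuous_on UNIV N" and N0: "\<And>x. N x \<ge> 0" and Nz: "\<And>x. N x = 0 \<longleftrightarrow> x = 0"
    and Nh: "\<And>r x. r > 0 \<Longrightarrow> N (dilation d r x) = r * N x"
    using N by (auto simp: subadditive_homogeneous_norm_def one_eq_zero)
  define S where "S = {x :: (real, 'm) vec. (\<forall>i. \<bar>x $ i\<bar> \<le> 1) \<and> (\<exists>i. \<bar>x $ i\<bar> = 1)}"
  have "closed S"
  proof -
    have "S = (\<Inter>i. {x. \<bar>x $ i\<bar> \<le> 1}) \<inter> (\<Union>i. {x. \<bar>x $ i\<bar> = 1})" by (auto simp: S_def)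
    then show ?thesis
      by (auto intro!: closed_Int closed_INT closed_UN closed_Collect_le closed_Collect_eq continuous_intros)
  qed
  moreover have "bounded S"
    unfolding bounded_iff
  proof (intro exI ballI)
    fix x assume "x \<in> S"
    then have "(\<Sum>i\<in>UNIV. \<bar>x $ i\<bar>) \<le> (\<Sum>i\<in>(UNIV::'m set). 1)" by (intro sum_mono) (auto simp: S_def)
    then show "norm x \<le> real CARD('m)" using norm_le_l1_cart[of x] by simp
  qed
  ultimately have "compact S" by (simp add: compact_eq_bounded_closed)
  moreover have "axis undefined 1 \<in> S" by (auto simp: S_def axis_def)
  ultimately obtain x0 where x0: "x0 \<in> S" "\<And>x. x \<in> S \<Longrightarrow> N x0 \<le> N x"
    using continuous_attains_inf[of S N] continuous_on_subset[OF Nc] by (metis empty_iff subset_UNIV)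
  define m where "m = N x0"
  have "x0 \<noteq> 0" using x0(1) by (auto simp: S_def)
  then have m: "m > 0" using N0[of x0] Nz[of x0] by (simp add: m_def less_le)
  define C where "C = Max (range (\<lambda>i. (1 / m) powr d i))"
  have C: "(1 / m) powr d i \<le> C" for i unfolding C_def by (intro Max_ge) auto
  show thesis
  proof (rule that[of C])
    have "0 < (1 / m) powr d undefined" using m by simp
    then show "C > 0" using C[of undefined] by linarith
    fix x :: "(real, 'm) vec" and i
    show "\<bar>x $ i\<bar> \<le> C * N x powr d i"
    proof (cases "x = 0")
      case True
      then show ?thesis using \<open>C > 0\<close> by simp
    next
      case False
      \<comment> \<open>The homogeneous maximum norm of \<open>x\<close>; dilation by
        \<open>1 / r\<close> brings all coordinates into [-1, 1] and the maximising one to the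
        boundary.\<close>
      define r where "r = Max (range (\<lambda>i. \<bar>x $ i\<bar> powr (1 / d i)))"
      have rge: "\<bar>x $ k\<bar> powr (1 / d k) \<le> r" for k unfolding r_def by (intro Max_ge) auto
      have "r \<in> range (\<lambda>i. \<bar>x $ i\<bar> powr (1 / d i))" unfolding r_def by (intro Max_in) auto
      then obtain j where j: "r = \<bar>x $ j\<bar> powr (1 / d j)" by auto
      obtain k where k: "x $ k \<noteq> 0" using False by (auto simp: vec_eq_iff)
      then have "0 < \<bar>x $ k\<bar> powr (1 / d k)" by simp
      then have r: "r > 0" using rge[of k] by linarith
      have xr: "\<bar>x $ k\<bar> \<le> r powr d k" for k
      proof -
        have "(\<bar>x $ k\<bar> powr (1 / d k)) powr d k \<le> r powr d k"
          using rge[of k] weight_pos[of k] by (intro powr_mono2) auto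
        then show ?thesis using weight_pos[of k] by (simp add: powr_powr)
      qed
      have xj: "\<bar>x $ j\<bar> = r powr d j" using weight_pos[of j] by (simp add: j powr_powr)
      have "dilation d (1 / r) x \<in> S"
        unfolding S_def dilation_def using xr xj r
        by (auto simp: abs_mult powr_divide divide_le_eq intro!: exI[of _ j])
      then have "m \<le> N (dilation d (1 / r) x)" unfolding m_def by (rule x0(2))
      then have "m * r \<le> N x" using r by (simp add: Nh field_simps)
      then have "r \<le> N x * (1 / m)" using m by (simp add: field_simps)
      then have "r powr d i \<le> (N x * (1 / m)) powr d i"
        using r weight_pos[of i] by (intro powr_mono2) auto
      also have "\<dots> = (1 / m) powr d i * N x powr d i"
        using N0 m by (subst powr_mult) auto
      also have "\<dots> \<le> C * N x powr d i" by (intro mult_right_mono C) simp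
      finally show ?thesis using xr[of i] by linarith
    qed
  qed
qed

end

text \<open>The squared norm keeps the function polynomial inside the ball, in particular smooth at
  the origin, and the exponent 3 is the one that \<open>Ck_max_power\<close> requires for class 2
  across the sphere.\<close>

definition bump :: "real \<Rightarrow> 'a::euclidean_space \<Rightarrow> real" where
  "bump \<rho> x = max 0 (1 - (norm x / \<rho>)\<^sup>2) ^ 3"

lemma Ck_bump: "Ck_on_space 2 (bump \<rho> :: 'a::euclidean_space \<Rightarrow> real)"
proof -
  have "(norm (x::'a))\<^sup>2 = (\<Sum>b\<in>Basis. (x \<bullet> b)\<^sup>2)" for x
    by (subst power2_norm_eq_inner, subst euclidean_inner) (simp add: power2_eq_square)
  then have eq: "(norm (x::'a) / \<rho>)\<^sup>2 = (\<Sum>b\<in>Basis. (x \<bullet> b)\<^sup>2) * (1 / \<rho>\<^sup>2)" for x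
    by (simp add: power_divide)
  have "Ck_on_space 2 (\<lambda>x::'a. 1 - (norm x / \<rho>)\<^sup>2)"
    unfolding eq
    by (intro Ck_diff Ck_mult Ck_const Ck_sum Ck_power Ck_bounded_linear bounded_linear_inner_left)
  from Ck_max_power[OF this] show ?thesis
    by (simp add: bump_def[abs_def] numeral_3_eq_3)
qed

lemma bump_bounds: "0 \<le> bump \<rho> x" "bump \<rho> x \<le> 1"
  by (auto simp: bump_def intro!: power_le_one)

lemma bump_zero [simp]: "bump \<rho> 0 = 1"
  by (simp add: bump_def)

lemma bump_outside: "\<rho> > 0 \<Longrightarrow> norm x \<ge> \<rho> \<Longrightarrow> bump \<rho> x = 0"
  by (simp add: bump_def max_def le_divide_eq)
     (smt (verit) one_le_power le_divide_eq_1_pos)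

subsection \<open>Infinitesimal description of a Levy process\<close>

locale homogeneous_levy = homogeneous_group G d + prob_space M
  for G :: "((real, 'm::{finite,linorder}) vec) monoid" (structure) and d :: "'m \<Rightarrow> real"
    and M :: "'w measure" +
  fixes N :: "(real, 'm) vec \<Rightarrow> real"
    and U :: "((real, 'm) vec) set"
    and \<xi> :: "'m \<Rightarrow> (real, 'm) vec \<Rightarrow> real"
    and X :: "real \<Rightarrow> 'w \<Rightarrow> (real, 'm) vec"
    and A :: "((real, 'm) vec, 'm) vec"
    and B :: "(real, 'm) vec"
    and \<nu> :: "((real, 'm) vec) measure"
  assumes norm_N: "subadditive_homogeneous_norm G d N"
    and local_xi: "local_coordinates G U \<xi>"
    and levy: "levy_process G M X"
    and triplet: "has_triplet G \<xi> M X A B \<nu>"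
begin

lemma Ck_xi: "Ck_on_space k (\<xi> i)"
  using local_xi smooth_Ck by (auto simp: local_coordinates_def)

lemma continuous_xi: "continuous_on UNIV (\<xi> i)"
  using Ck_imp_continuous[OF Ck_xi] .

lemma xi_measurable [measurable]: "\<xi> i \<in> borel_measurable borel"
  using continuous_xi by (rule borel_measurable_continuous_onI)

lemma N_measurable [measurable]: "N \<in> borel_measurable borel"
  using norm_N by (intro borel_measurable_continuous_onI) (simp add: subadditive_homogeneous_norm_def)

lemma N_nonneg: "N x \<ge> 0" and N_zero: "N 0 = 0" and N_uminus: "N (- x) = N x"
  and N_mult: "N (x \<otimes> y) \<le> N x + N y" and N_dilation: "r > 0 \<Longrightarrow> N (dilation d r x) = r * N x"
  and N_continuous: "continuous_on UNIV N"
  using norm_N by (auto simp: subadditive_homogeneous_norm_def one_eq_zero)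

lemma xi_support: obtains R where "R > 0" and "\<And>i x. norm x > R \<Longrightarrow> \<xi> i x = 0"
proof -
  have "\<exists>R>0. \<forall>x. norm x > R \<longrightarrow> \<xi> i x = 0" for i
  proof -
    have "bounded {x. \<xi> i x \<noteq> 0}"
      using local_xi by (intro bounded_subset[OF compact_imp_bounded closure_subset])
        (auto simp: local_coordinates_def)
    then obtain R where "R > 0" "\<And>x. \<xi> i x \<noteq> 0 \<Longrightarrow> norm x \<le> R"
      by (auto simp: bounded_pos)
    then show ?thesis by (intro exI[of _ R]) force
  qed
  then obtain R where R: "\<And>i. R i > 0" "\<And>i x. norm x > R i \<Longrightarrow> \<xi> i x = 0" by metis
  show thesis
  proof (rule that[of "Max (range R)"])
    show "Max (range R) > 0" using R(1)[of undefined] by (auto simp: Max_gr_iff)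
    show "\<xi> i x = 0" if "norm x > Max (range R)" for i x
      using that by (intro R(2)) auto
  qed
qed

lemma xi_bounded: obtains C where "C > 0" and "\<And>i x. \<bar>\<xi> i x\<bar> \<le> C"
proof -
  obtain R where R: "R > 0" "\<And>i x. norm x > R \<Longrightarrow> \<xi> i x = 0" using xi_support by blast
  have "\<exists>C. \<forall>x\<in>cball 0 R. \<bar>\<xi> i x\<bar> \<le> C" for i
  proof -
    have "compact (\<xi> i ` cball 0 R)"
      by (intro compact_continuous_image continuous_on_subset[OF continuous_xi]) auto
    from compact_imp_bounded[OF this] show ?thesis by (auto simp: bounded_iff)
  qed
  then obtain C where C: "\<And>i x. x \<in> cball 0 R \<Longrightarrow> \<bar>\<xi> i x\<bar> \<le> C i" by metis
  show thesis
  proof (rule that[of "1 + (\<Sum>i\<in>UNIV. \<bar>C i\<bar>)"])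
    show "1 + (\<Sum>i\<in>UNIV. \<bar>C i\<bar>) > 0" by (simp add: add_pos_nonneg sum_nonneg)
    fix i x
    have le: "\<bar>C i\<bar> \<le> (\<Sum>i\<in>UNIV. \<bar>C i\<bar>)" by (rule member_le_sum) auto
    show "\<bar>\<xi> i x\<bar> \<le> 1 + (\<Sum>i\<in>UNIV. \<bar>C i\<bar>)"
      using C[of x i] R(2)[of x i] le by (cases "norm x > R") (auto simp: sum_nonneg add_nonneg_nonneg)
  qed
qed

lemma xi_linear_near: obtains \<rho> where "\<rho> > 0" and "\<And>i x. norm x \<le> \<rho> \<Longrightarrow> \<xi> i x = x $ i"
proof -
  have "open U" "0 \<in> U" and eq: "\<And>x i. x \<in> U \<Longrightarrow> \<xi> i x = x $ i"
    using local_xi by (auto simp: local_coordinates_def one_eq_zero)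
  then obtain \<rho> where "\<rho> > 0" "cball 0 \<rho> \<subseteq> U" by (auto simp: open_contains_cball)
  with eq show thesis by (intro that[of \<rho>]) auto
qed

lemma xi_zero [simp]: "\<xi> i 0 = 0"
  using xi_linear_near by (metis less_imp_le norm_zero zero_index)

lemma X_measurable [measurable]: "t \<ge> 0 \<Longrightarrow> X t \<in> borel_measurable M"
  using levy by (simp add: levy_process_def)

lemma X_zero: "AE \<omega> in M. X 0 \<omega> = 0"
  using levy by (simp add: levy_process_def one_eq_zero)

lemma increment_measurable [measurable]:
  "s \<ge> 0 \<Longrightarrow> t \<ge> 0 \<Longrightarrow> (\<lambda>\<omega>. increment G (\<lambda>r. X r \<omega>) s t) \<in> borel_measurable M"
  unfolding increment_def inv_eq_uminus by measurable

lemma increment_distr: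
  assumes "s \<ge> 0" "h \<ge> 0"
  shows "distr M borel (\<lambda>\<omega>. increment G (\<lambda>r. X r \<omega>) s (s + h)) = distr M borel (X h)"
proof -
  have "distr M borel (\<lambda>\<omega>. increment G (\<lambda>r. X r \<omega>) s (s + h)) =
      distr M borel (\<lambda>\<omega>. increment G (\<lambda>r. X r \<omega>) 0 h)"
    using levy assms unfolding levy_process_def by blast
  also have "\<dots> = distr M borel (X h)"
  proof (rule distr_cong_AE)
    show "AE \<omega> in M. increment G (\<lambda>r. X r \<omega>) 0 h = X h \<omega>"
      using X_zero by eventually_elim (simp add: increment_def)
  qed (use assms in auto)
  finally show ?thesis .
qed

lemma increment_expectation:
  fixes f :: "(real, 'm) vec \<Rightarrow> 'b::{banach, second_countable_topology}"
  assumes "s \<ge> 0" "h \<ge> 0" and [measurable]: "f \<in> borel_measurable borel"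
  shows "expectation (\<lambda>\<omega>. f (increment G (\<lambda>r. X r \<omega>) s (s + h))) = expectation (\<lambda>\<omega>. f (X h \<omega>))"
proof -
  have "expectation (\<lambda>\<omega>. f (increment G (\<lambda>r. X r \<omega>) s (s + h))) =
      integral\<^sup>L (distr M borel (\<lambda>\<omega>. increment G (\<lambda>r. X r \<omega>) s (s + h))) f"
    using assms by (subst integral_distr) auto
  also have "\<dots> = expectation (\<lambda>\<omega>. f (X h \<omega>))"
    unfolding increment_distr[OF assms(1,2)] using assms by (subst integral_distr) auto
  finally show ?thesis .
qed

lemma integrable_bounded:
  fixes f :: "'w \<Rightarrow> 'b::{banach, second_countable_topology}"
  assumes "f \<in> borel_measurable M" "\<And>\<omega>. norm (f \<omega>) \<le> C"
  shows "integrable M f"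
  using assms by (intro integrable_const_bound[where B = C]) auto

section \<open>Moments of the Levy measure and small-time limits\<close>

lemma sets_nu [measurable_cong]: "sets \<nu> = sets borel"
  using triplet by (simp add: has_triplet_def levy_measure_def)

lemma A_sym: "A $ i $ j = A $ j $ i"
proof -
  have "transpose A = A" using triplet by (simp add: has_triplet_def covariance_matrix_def)
  then show ?thesis by (metis transpose_def vec_lambda_beta)
qed

definition xi_sq :: "(real, 'm) vec \<Rightarrow> real" where
  "xi_sq x = (\<Sum>i\<in>UNIV. (\<xi> i x)\<^sup>2)"

lemma xi_sq_nonneg: "xi_sq x \<ge> 0"
  by (simp add: xi_sq_def sum_nonneg)

lemma xi_le_xi_sq: "(\<xi> i x)\<^sup>2 \<le> xi_sq x"
  unfolding xi_sq_def by (rule member_le_sum) auto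

lemma xi_mult_le_xi_sq: "\<bar>\<xi> i x * \<xi> j x\<bar> \<le> xi_sq x"
proof -
  have "0 \<le> (\<bar>\<xi> i x\<bar> - \<bar>\<xi> j x\<bar>)\<^sup>2" by simp
  also have "\<dots> = (\<xi> i x)\<^sup>2 + (\<xi> j x)\<^sup>2 - 2 * \<bar>\<xi> i x * \<xi> j x\<bar>"
    by (simp add: power2_diff abs_mult)
  finally show ?thesis using xi_le_xi_sq[of i x] xi_le_xi_sq[of j x] by linarith
qed

lemma xi_sq_measurable [measurable]: "xi_sq \<in> borel_measurable borel"
  unfolding xi_sq_def[abs_def] by measurable

lemma integrable_xi_sq: "integrable \<nu> xi_sq"
proof -
  have "(norm (\<chi> i. \<xi> i x))\<^sup>2 = xi_sq x" for x
    by (simp add: norm_vec_def L2_set_def xi_sq_def sum_nonneg)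
  then have "(\<integral>\<^sup>+x. ennreal (xi_sq x) \<partial>\<nu>) < \<infinity>"
    using triplet by (simp add: has_triplet_def levy_measure_def)
  then show ?thesis by (intro integrableI_nonneg) (auto simp: xi_sq_nonneg)
qed

lemma integrable_nu_bound:
  fixes g :: "(real, 'm) vec \<Rightarrow> real"
  assumes [measurable]: "g \<in> borel_measurable borel" and "\<And>x. \<bar>g x\<bar> \<le> C * xi_sq x"
  shows "integrable \<nu> g"
  by (rule Bochner_Integration.integrable_bound[OF integrable_mult_right[OF integrable_xi_sq, of C]])
     (auto intro!: AE_I2 order_trans[OF assms(2) abs_ge_self])

text \<open>Allows the generator to be evaluated from a second-order expansion at the identity, so
  that left-invariant derivatives of concrete test functions need never be computed.\<close>

lemma generator_limit:
  fixes f :: "(real, 'm) vec \<Rightarrow> real" and l :: "(real, 'm) vec"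
  assumes f: "Ck_on_space 2 f" and van: "\<And>x. norm x > R \<Longrightarrow> f x = 0"
    and peano: "((\<lambda>x. (f x - f 0 - (\<Sum>i\<in>UNIV. l $ i * x $ i) -
        (\<Sum>i\<in>UNIV. \<Sum>j\<in>UNIV. q i j * (x $ i * x $ j)) / 2) / (norm x)\<^sup>2) \<longlongrightarrow> 0) (at 0)"
    and q: "\<And>i j. q i j = q j i"
  shows "((\<lambda>t. (\<integral>\<omega>. f (X t \<omega>) - f 0 \<partial>M) / t) \<longlongrightarrow>
     (\<Sum>i\<in>UNIV. B $ i * l $ i) + (\<Sum>i\<in>UNIV. \<Sum>j\<in>UNIV. A $ i $ j * q i j) / 2 +
     (\<integral>y. f y - f 0 - (\<Sum>i\<in>UNIV. \<xi> i y * l $ i) \<partial>\<nu>)) (at_right 0)"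
proof -
  note c = generator_coefficients_at_identity[OF f peano q A_sym]
  have "f \<in> C2_0 G" by (rule C2_0I[OF f van])
  then have "((\<lambda>t. (\<integral>\<omega>. f (0 \<otimes> X t \<omega>) - f 0 \<partial>M) / t) \<longlongrightarrow>
          (\<Sum>i\<in>UNIV. B $ i * left_field G i f 0) +
          (\<Sum>i\<in>UNIV. \<Sum>j\<in>UNIV. A $ i $ j * left_field G i (left_field G j f) 0) / 2 +
          (\<integral>y. f (0 \<otimes> y) - f 0 - (\<Sum>i\<in>UNIV. \<xi> i y * left_field G i f 0) \<partial>\<nu>))
        (at_right 0)"
    using triplet unfolding has_triplet_def by blast
  then show ?thesis by (simp add: c)
qed

text \<open>The support of \<open>\<xi> i\<close> makes the product a test function whatever
  \<open>k\<close> does at infinity. Since \<open>k - 1\<close> is of smaller order than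
  \<open>norm x\<close>, the product agrees with the i-th coordinate up to second order included, so
  \<open>A\<close> does not enter and \<open>k\<close> is felt only through the jumps.\<close>

lemma limit_lin:
  fixes k :: "(real, 'm) vec \<Rightarrow> real"
  assumes k: "Ck_on_space 2 k" and k1: "((\<lambda>x. (k x - 1) / norm x) \<longlongrightarrow> 0) (at 0)"
  shows "((\<lambda>t. expectation (\<lambda>\<omega>. \<xi> i (X t \<omega>) * k (X t \<omega>)) / t) \<longlongrightarrow>
     B $ i + (\<integral>y. \<xi> i y * k y - \<xi> i y \<partial>\<nu>)) (at_right 0)"
proof -
  obtain R where R: "R > 0" "\<And>i x. norm x > R \<Longrightarrow> \<xi> i x = 0" using xi_support by blast
  obtain \<rho> where \<rho>: "\<rho> > 0" "\<And>i x. norm x \<le> \<rho> \<Longrightarrow> \<xi> i x = x $ i" using xi_linear_near by blast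
  let ?f = "\<lambda>x. \<xi> i x * k x"
  have m: "c * (if P then a else 0) = (if P then c * a else 0)" "(if P then a else 0) * c = (if P then a * c else 0)"
    for a c :: real and P by simp_all
  have "((\<lambda>x. (?f x - ?f 0 - (\<Sum>j\<in>UNIV. axis i 1 $ j * x $ j) -
        (\<Sum>i\<in>UNIV. \<Sum>j\<in>UNIV. 0 * (x $ i * x $ j)) / 2) / (norm x)\<^sup>2) \<longlongrightarrow> 0) (at 0)"
  proof (rule Lim_null_comparison[where g = "\<lambda>x. \<bar>(k x - 1) / norm x\<bar>"])
    show "((\<lambda>x. \<bar>(k x - 1) / norm x\<bar>) \<longlongrightarrow> 0) (at 0)" using k1 by (rule tendsto_rabs_zero)
    have "\<forall>\<^sub>F x in at (0::(real, 'm) vec). norm x \<le> \<rho>"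
      using \<rho>(1) by (auto simp: eventually_at dist_norm intro!: exI[of _ \<rho>])
    then show "\<forall>\<^sub>F x in at 0. norm ((?f x - ?f 0 - (\<Sum>j\<in>UNIV. axis i 1 $ j * x $ j) -
        (\<Sum>i\<in>UNIV. \<Sum>j\<in>UNIV. 0 * (x $ i * x $ j)) / 2) / (norm x)\<^sup>2) \<le> \<bar>(k x - 1) / norm x\<bar>"
    proof (rule eventually_mono)
      fix x :: "(real, 'm) vec" assume x: "norm x \<le> \<rho>"
      have "?f x - ?f 0 - (\<Sum>j\<in>UNIV. axis i 1 $ j * x $ j) -
        (\<Sum>i\<in>UNIV. \<Sum>j\<in>UNIV. 0 * (x $ i * x $ j)) / 2 = x $ i * (k x - 1)"
        using \<rho>(2)[OF x] by (simp add: axis_def m algebra_simps)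
      moreover have "\<bar>x $ i * (k x - 1)\<bar> / (norm x)\<^sup>2 \<le> norm x * \<bar>k x - 1\<bar> / (norm x)\<^sup>2"
        unfolding abs_mult using component_le_norm_cart[of x i] by (intro divide_right_mono mult_right_mono) auto
      moreover have "norm x * \<bar>k x - 1\<bar> / (norm x)\<^sup>2 = \<bar>k x - 1\<bar> / norm x"
        by (simp add: power2_eq_square)
      ultimately show "norm ((?f x - ?f 0 - (\<Sum>j\<in>UNIV. axis i 1 $ j * x $ j) -
        (\<Sum>i\<in>UNIV. \<Sum>j\<in>UNIV. 0 * (x $ i * x $ j)) / 2) / (norm x)\<^sup>2) \<le> \<bar>(k x - 1) / norm x\<bar>"
        by simp
    qed
  qed
  from generator_limit[of ?f R, OF Ck_mult[OF Ck_xi k] _ this] R(2) show ?thesis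
    by (simp add: axis_def m)
qed

text \<open>The product vanishes to second order at the identity, hence neither \<open>B\<close> nor
  the compensator contributes; what remains is the Gaussian covariance, weighted by
  \<open>k 0\<close>, and a jump moment.\<close>

lemma limit_quad:
  fixes k :: "(real, 'm) vec \<Rightarrow> real"
  assumes k: "Ck_on_space 2 k"
  shows "((\<lambda>t. expectation (\<lambda>\<omega>. \<xi> i (X t \<omega>) * \<xi> j (X t \<omega>) * k (X t \<omega>)) / t) \<longlongrightarrow>
     k 0 * A $ i $ j + (\<integral>y. \<xi> i y * \<xi> j y * k y \<partial>\<nu>)) (at_right 0)"
proof -
  obtain R where R: "R > 0" "\<And>i x. norm x > R \<Longrightarrow> \<xi> i x = 0" using xi_support by blast
  obtain \<rho> where \<rho>: "\<rho> > 0" "\<And>i x. norm x \<le> \<rho> \<Longrightarrow> \<xi> i x = x $ i" using xi_linear_near by blast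
  let ?f = "\<lambda>x. \<xi> i x * \<xi> j x * k x"
  define e where "e a b = (if a = b then 1 else (0::real))" for a b :: 'm
  \<comment> \<open>The Hessian at the identity of the product, in the symmetric form that
    \<open>generator_limit\<close> asks for.\<close>
  define q where "q a b = k 0 * (e i a * e j b + e i b * e j a)" for a b
  have e: "(\<Sum>a\<in>UNIV. e b a * g a) = g b" for b g
    by (simp add: e_def if_distrib[of "\<lambda>c. c * _"] cong: if_cong)
  have e2: "(\<Sum>a\<in>UNIV. \<Sum>b\<in>UNIV. e i a * e j b * g a b) = g i j"
    "(\<Sum>a\<in>UNIV. \<Sum>b\<in>UNIV. e i b * e j a * g a b) = g j i" for g
  proof -
    have "(\<Sum>a\<in>UNIV. \<Sum>b\<in>UNIV. e i a * e j b * g a b) = (\<Sum>a\<in>UNIV. e i a * (\<Sum>b\<in>UNIV. e j b * g a b))"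
      by (simp add: sum_distrib_left mult.assoc)
    then show "(\<Sum>a\<in>UNIV. \<Sum>b\<in>UNIV. e i a * e j b * g a b) = g i j" by (simp add: e)
    have "(\<Sum>a\<in>UNIV. \<Sum>b\<in>UNIV. e i b * e j a * g a b) = (\<Sum>a\<in>UNIV. e j a * (\<Sum>b\<in>UNIV. e i b * g a b))"
      by (simp add: sum_distrib_left mult_ac)
    then show "(\<Sum>a\<in>UNIV. \<Sum>b\<in>UNIV. e i b * e j a * g a b) = g j i" by (simp add: e)
  qed
  have qs: "(\<Sum>a\<in>UNIV. \<Sum>b\<in>UNIV. q a b * g a b) = k 0 * (g i j + g j i)" for g
  proof -
    have "(\<Sum>a\<in>UNIV. \<Sum>b\<in>UNIV. q a b * g a b) =
        k 0 * ((\<Sum>a\<in>UNIV. \<Sum>b\<in>UNIV. e i a * e j b * g a b) + (\<Sum>a\<in>UNIV. \<Sum>b\<in>UNIV. e i b * e j a * g a b))"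
      by (simp add: q_def sum_distrib_left sum.distrib[symmetric] algebra_simps)
    then show ?thesis by (simp add: e2)
  qed
  have "((\<lambda>x. (?f x - ?f 0 - (\<Sum>j\<in>UNIV. 0 $ j * x $ j) -
        (\<Sum>i\<in>UNIV. \<Sum>j\<in>UNIV. q i j * (x $ i * x $ j)) / 2) / (norm x)\<^sup>2) \<longlongrightarrow> 0) (at 0)"
  proof (rule Lim_null_comparison[where g = "\<lambda>x. \<bar>k x - k 0\<bar>"])
    have "isCont k 0" using Ck_imp_continuous[OF k] by (simp add: continuous_on_eq_continuous_at)
    then have "(k \<longlongrightarrow> k 0) (at 0)" by (simp add: isCont_def)
    then show "((\<lambda>x. \<bar>k x - k 0\<bar>) \<longlongrightarrow> 0) (at 0)"
      by (intro tendsto_rabs_zero) (simp add: LIM_zero_iff)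
    have "\<forall>\<^sub>F x in at (0::(real, 'm) vec). norm x \<le> \<rho>"
      using \<rho>(1) by (auto simp: eventually_at dist_norm intro!: exI[of _ \<rho>])
    then show "\<forall>\<^sub>F x in at 0. norm ((?f x - ?f 0 - (\<Sum>j\<in>UNIV. 0 $ j * x $ j) -
        (\<Sum>i\<in>UNIV. \<Sum>j\<in>UNIV. q i j * (x $ i * x $ j)) / 2) / (norm x)\<^sup>2) \<le> \<bar>k x - k 0\<bar>"
    proof (rule eventually_mono)
      fix x :: "(real, 'm) vec" assume x: "norm x \<le> \<rho>"
      have eq: "?f x - ?f 0 - (\<Sum>j\<in>UNIV. 0 $ j * x $ j) -
        (\<Sum>i\<in>UNIV. \<Sum>j\<in>UNIV. q i j * (x $ i * x $ j)) / 2 = x $ i * x $ j * (k x - k 0)"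
        using \<rho>(2)[OF x] unfolding qs by (simp add: algebra_simps)
      have "\<bar>x $ i * x $ j\<bar> \<le> (norm x)\<^sup>2"
        unfolding abs_mult power2_eq_square by (intro mult_mono component_le_norm_cart) auto
      then have "\<bar>x $ i * x $ j * (k x - k 0)\<bar> \<le> (norm x)\<^sup>2 * \<bar>k x - k 0\<bar>"
        by (simp add: abs_mult mult_right_mono)
      then show "norm ((?f x - ?f 0 - (\<Sum>j\<in>UNIV. 0 $ j * x $ j) -
        (\<Sum>i\<in>UNIV. \<Sum>j\<in>UNIV. q i j * (x $ i * x $ j)) / 2) / (norm x)\<^sup>2) \<le> \<bar>k x - k 0\<bar>"
        unfolding eq by (cases "x = 0") (simp_all add: divide_le_eq mult.commute)
    qed
  qed
  from generator_limit[of ?f R, OF Ck_mult[OF Ck_mult[OF Ck_xi Ck_xi] k] _ this] R(2)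
  have "((\<lambda>t. expectation (\<lambda>\<omega>. \<xi> i (X t \<omega>) * \<xi> j (X t \<omega>) * k (X t \<omega>)) / t) \<longlongrightarrow>
     (\<Sum>a\<in>UNIV. \<Sum>b\<in>UNIV. A $ a $ b * q a b) / 2 + (\<integral>y. \<xi> i y * \<xi> j y * k y \<partial>\<nu>)) (at_right 0)"
    by (simp add: q_def algebra_simps)
  moreover have "(\<Sum>a\<in>UNIV. \<Sum>b\<in>UNIV. A $ a $ b * q a b) / 2 = k 0 * A $ i $ j"
    using qs[of "\<lambda>a b. A $ a $ b"] A_sym[of j i] by (simp add: mult.commute)
  ultimately show ?thesis by simp
qed

text \<open>The function \<open>1 - bump \<rho>\<close> dominates the indicator of the complement of
  the ball. Only the existence of its generator limit c is used; the constant
  \<open>\<bar>c\<bar> + 1\<close> leaves room for small but positive times.\<close>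

lemma tail_linear:
  assumes \<rho>: "\<rho> > 0"
  obtains C where "C > 0"
    and "\<forall>\<^sub>F t in at_right 0. prob {\<omega> \<in> space M. norm (X t \<omega>) \<ge> \<rho>} \<le> C * t"
    and "\<forall>\<^sub>F t in at_right 0. expectation (\<lambda>\<omega>. 1 - bump \<rho> (X t \<omega>)) \<le> C * t"
proof -
  have b: "bump \<rho> \<in> C2_0 G"
    by (rule C2_0I[OF Ck_bump, of \<rho>]) (simp add: bump_outside[OF \<rho>])
  have "\<forall>f\<in>C2_0 G. \<exists>c. ((\<lambda>t. (\<integral>\<omega>. f (0 \<otimes> X t \<omega>) - f 0 \<partial>M) / t) \<longlongrightarrow> c) (at_right 0)"
    using triplet unfolding has_triplet_def by blast
  from bspec[OF this b] obtain c
    where "((\<lambda>t. (\<integral>\<omega>. bump \<rho> (0 \<otimes> X t \<omega>) - bump \<rho> (0 :: (real, 'm) vec) \<partial>M) / t) \<longlongrightarrow> c) (at_right 0)" ..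
  then have "\<forall>\<^sub>F t in at_right 0. (\<integral>\<omega>. bump \<rho> (0 \<otimes> X t \<omega>) - bump \<rho> (0 :: (real, 'm) vec) \<partial>M) / t > c - 1"
    by (rule order_tendstoD) simp
  moreover have "\<forall>\<^sub>F t::real in at_right 0. t > 0" by (rule eventually_at_right_less)
  ultimately have ev: "\<forall>\<^sub>F t in at_right 0. expectation (\<lambda>\<omega>. 1 - bump \<rho> (X t \<omega>)) \<le> (\<bar>c\<bar> + 1) * t \<and> t > 0"
  proof eventually_elim
    case (elim t)
    have "(\<integral>\<omega>. bump \<rho> (0 \<otimes> X t \<omega>) - bump \<rho> (0 :: (real, 'm) vec) \<partial>M) = - expectation (\<lambda>\<omega>. 1 - bump \<rho> (X t \<omega>))"
      by (subst Bochner_Integration.integral_minus[symmetric]) simp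
    moreover have "(c - 1) * t < (\<integral>\<omega>. bump \<rho> (0 \<otimes> X t \<omega>) - bump \<rho> (0 :: (real, 'm) vec) \<partial>M)"
      using elim by (simp add: field_simps)
    moreover have "- (c - 1) * t \<le> (\<bar>c\<bar> + 1) * t" using elim by (intro mult_right_mono) auto
    moreover have "- (c - 1) * t = - ((c - 1) * t)" by (simp only: mult_minus_left)
    ultimately show ?case using elim by linarith
  qed
  have [measurable]: "bump \<rho> \<in> borel_measurable (borel :: (real, 'm) vec measure)"
    by (intro borel_measurable_continuous_onI Ck_imp_continuous[OF Ck_bump])
  show thesis
  proof (rule that[of "\<bar>c\<bar> + 1"])
    show "\<forall>\<^sub>F t in at_right 0. expectation (\<lambda>\<omega>. 1 - bump \<rho> (X t \<omega>)) \<le> (\<bar>c\<bar> + 1) * t"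
      using ev by (rule eventually_mono) auto
    show "\<forall>\<^sub>F t in at_right 0. prob {\<omega> \<in> space M. norm (X t \<omega>) \<ge> \<rho>} \<le> (\<bar>c\<bar> + 1) * t"
      using ev
    proof eventually_elim
      case (elim t)
      then have [measurable]: "X t \<in> borel_measurable M" by simp
      have "prob {\<omega> \<in> space M. norm (X t \<omega>) \<ge> \<rho>} =
          expectation (indicator {\<omega> \<in> space M. norm (X t \<omega>) \<ge> \<rho>})" by simp
      also have "\<dots> \<le> expectation (\<lambda>\<omega>. 1 - bump \<rho> (X t \<omega>))"
      proof (rule integral_mono)
        show "integrable M (\<lambda>\<omega>. 1 - bump \<rho> (X t \<omega>))"
          by (rule integrable_bounded[of _ 1]) (auto simp: abs_le_iff bump_bounds intro: order_trans[OF bump_bounds(2)])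
      qed (auto simp: indicator_def emeasure_eq_measure bump_bounds bump_outside[OF \<rho>]
             intro!: integrable_real_indicator)
      finally show ?case using elim by simp
    qed
  qed simp
qed

end

subsection \<open>Sums over the increments of a uniform grid\<close>

lemma abs_le_imp_power2_le: "\<bar>a\<bar> \<le> C \<Longrightarrow> a\<^sup>2 \<le> C\<^sup>2" for a C :: real
  using power_mono[of "\<bar>a\<bar>" C 2] by simp

lemma (in prob_space) indep_centered_sum_second_moment:
  fixes Y :: "'i \<Rightarrow> 'a \<Rightarrow> real"
  assumes "finite I" and ind: "indep_vars (\<lambda>_. borel) Y I"
    and bd: "\<And>i \<omega>. i \<in> I \<Longrightarrow> \<bar>Y i \<omega>\<bar> \<le> C" and cen: "\<And>i. i \<in> I \<Longrightarrow> expectation (Y i) = 0"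
  shows "expectation (\<lambda>\<omega>. (\<Sum>i\<in>I. Y i \<omega>)\<^sup>2) = (\<Sum>i\<in>I. expectation (\<lambda>\<omega>. (Y i \<omega>)\<^sup>2))"
  using assms
proof (induction I rule: finite_induct)
  case (insert i I)
  have rv: "random_variable borel (Y j)" if "j \<in> insert i I" for j
    using insert.prems(1) that unfolding indep_vars_def by blast
  have int: "integrable M (Y j)" if "j \<in> insert i I" for j
    by (rule integrable_const_bound[of _ C]) (use insert.prems(2)[OF that] rv[OF that] in auto)
  have S: "random_variable borel (\<lambda>\<omega>. \<Sum>i\<in>I. Y i \<omega>)"
    by (intro borel_measurable_sum rv) auto
  have Sb: "\<bar>\<Sum>i\<in>I. Y i \<omega>\<bar> \<le> real (card I) * C" for \<omega>
    using insert.prems(2)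
    by (intro order_trans[OF sum_abs]) (simp add: sum_bounded_above)
  have intS: "integrable M (\<lambda>\<omega>. \<Sum>i\<in>I. Y i \<omega>)"
    by (intro Bochner_Integration.integrable_sum int) auto
  have i2: "integrable M (\<lambda>\<omega>. (Y i \<omega>)\<^sup>2)"
  proof (rule integrable_const_bound[of _ "C\<^sup>2"])
    show "AE \<omega> in M. norm ((Y i \<omega>)\<^sup>2) \<le> C\<^sup>2"
      using insert.prems(2)[of i] by (auto intro!: AE_I2 abs_le_imp_power2_le)
  qed (use rv in auto)
  have S2: "integrable M (\<lambda>\<omega>. (\<Sum>i\<in>I. Y i \<omega>)\<^sup>2)"
  proof (rule integrable_const_bound[of _ "(real (card I) * C)\<^sup>2"])
    show "AE \<omega> in M. norm ((\<Sum>i\<in>I. Y i \<omega>)\<^sup>2) \<le> (real (card I) * C)\<^sup>2"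
      using Sb by (auto intro!: AE_I2 abs_le_imp_power2_le)
  qed (use S in auto)
  have iv: "indep_var borel (Y i) borel (\<lambda>\<omega>. \<Sum>i\<in>I. Y i \<omega>)"
    by (rule indep_vars_sum) (use insert in auto)
  note cov = indep_var_lebesgue_integral[OF iv int intS] indep_var_integrable[OF iv int intS]
  have "expectation (\<lambda>\<omega>. (\<Sum>i\<in>insert i I. Y i \<omega>)\<^sup>2) =
      expectation (\<lambda>\<omega>. (Y i \<omega>)\<^sup>2 + (\<Sum>i\<in>I. Y i \<omega>)\<^sup>2 + 2 * (Y i \<omega> * (\<Sum>i\<in>I. Y i \<omega>)))"
    using insert by (simp add: power2_sum mult.assoc)
  also have "\<dots> = expectation (\<lambda>\<omega>. (Y i \<omega>)\<^sup>2) + expectation (\<lambda>\<omega>. (\<Sum>i\<in>I. Y i \<omega>)\<^sup>2) +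
      2 * expectation (\<lambda>\<omega>. Y i \<omega> * (\<Sum>i\<in>I. Y i \<omega>))"
    using i2 S2 cov(2) by simp
  also have "expectation (\<lambda>\<omega>. Y i \<omega> * (\<Sum>i\<in>I. Y i \<omega>)) = 0"
    using cov(1) insert.prems(3)[of i] by simp
  also have "expectation (\<lambda>\<omega>. (\<Sum>i\<in>I. Y i \<omega>)\<^sup>2) = (\<Sum>i\<in>I. expectation (\<lambda>\<omega>. (Y i \<omega>)\<^sup>2))"
    using insert by (intro insert.IH indep_vars_subset[OF insert.prems(1)]) auto
  finally show ?case using insert by simp
qed simp

lemma (in prob_space) indep_sum_deviation:
  fixes Y :: "'i \<Rightarrow> 'a \<Rightarrow> real"
  assumes fin: "finite I" and ind: "indep_vars (\<lambda>_. borel) Y I"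
    and bd: "\<And>i \<omega>. i \<in> I \<Longrightarrow> \<bar>Y i \<omega>\<bar> \<le> C"
  shows "expectation (\<lambda>\<omega>. ((\<Sum>i\<in>I. Y i \<omega>) - (\<Sum>i\<in>I. expectation (Y i)))\<^sup>2) \<le> (\<Sum>i\<in>I. expectation (\<lambda>\<omega>. (Y i \<omega>)\<^sup>2))"
proof -
  have rv: "random_variable borel (Y j)" if "j \<in> I" for j
    using ind that unfolding indep_vars_def by blast
  have int: "integrable M (Y j)" if "j \<in> I" for j
    by (rule integrable_const_bound[of _ C]) (use bd[OF that] rv[OF that] in auto)
  have i2: "integrable M (\<lambda>\<omega>. (Y i \<omega>)\<^sup>2)" if "i \<in> I" for i
  proof (rule integrable_const_bound[of _ "C\<^sup>2"])
    show "AE \<omega> in M. norm ((Y i \<omega>)\<^sup>2) \<le> C\<^sup>2"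
      using bd[OF that] by (auto intro!: AE_I2 abs_le_imp_power2_le)
  qed (use rv that in auto)
  define Z where "Z i \<omega> = Y i \<omega> - expectation (Y i)" for i \<omega>
  have "indep_vars (\<lambda>_. borel) Z I"
    unfolding Z_def by (rule indep_vars_compose2[OF ind]) auto
  moreover have "\<bar>Z i \<omega>\<bar> \<le> C + Max ((\<lambda>i. \<bar>expectation (Y i)\<bar>) ` I)" if "i \<in> I" for i \<omega>
  proof -
    have "\<bar>expectation (Y i)\<bar> \<le> Max ((\<lambda>i. \<bar>expectation (Y i)\<bar>) ` I)" using that fin by (intro Max_ge) auto
    then show ?thesis using bd[OF that, of \<omega>] by (simp add: Z_def)
  qed
  moreover have "expectation (Z i) = 0" if "i \<in> I" for i
    using int[OF that] by (simp add: Z_def[abs_def] prob_space)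
  ultimately have "expectation (\<lambda>\<omega>. (\<Sum>i\<in>I. Z i \<omega>)\<^sup>2) = (\<Sum>i\<in>I. expectation (\<lambda>\<omega>. (Z i \<omega>)\<^sup>2))"
    by (rule indep_centered_sum_second_moment[OF fin])
  also have "\<dots> \<le> (\<Sum>i\<in>I. expectation (\<lambda>\<omega>. (Y i \<omega>)\<^sup>2))"
  proof (rule sum_mono)
    fix i assume i: "i \<in> I"
    show "expectation (\<lambda>\<omega>. (Z i \<omega>)\<^sup>2) \<le> expectation (\<lambda>\<omega>. (Y i \<omega>)\<^sup>2)"
      using variance_eq[OF int[OF i] i2[OF i]] by (simp add: Z_def)
  qed
  finally show ?thesis by (simp add: Z_def sum_subtractf)
qed

lemma (in prob_space) indep_sum_concentration:
  fixes Y :: "'i \<Rightarrow> 'a \<Rightarrow> real"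
  assumes fin: "finite I" and ind: "indep_vars (\<lambda>_. borel) Y I"
    and bd: "\<And>i \<omega>. i \<in> I \<Longrightarrow> \<bar>Y i \<omega>\<bar> \<le> C" and a: "a > 0"
  shows "prob {\<omega> \<in> space M. \<bar>(\<Sum>i\<in>I. Y i \<omega>) - (\<Sum>i\<in>I. expectation (Y i))\<bar> \<ge> a} \<le>
     (\<Sum>i\<in>I. expectation (\<lambda>\<omega>. (Y i \<omega>)\<^sup>2)) / a\<^sup>2"
proof -
  have rv: "random_variable borel (Y j)" if "j \<in> I" for j
    using ind that unfolding indep_vars_def by blast
  have int: "integrable M (Y j)" if "j \<in> I" for j
    by (rule integrable_const_bound[of _ C]) (use bd[OF that] rv[OF that] in auto)
  have S: "random_variable borel (\<lambda>\<omega>. \<Sum>i\<in>I. Y i \<omega>)"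
    by (intro borel_measurable_sum rv) auto
  have Sb: "\<bar>\<Sum>i\<in>I. Y i \<omega>\<bar> \<le> real (card I) * C" for \<omega>
    using bd by (intro order_trans[OF sum_abs]) (simp add: sum_bounded_above)
  have S2: "integrable M (\<lambda>\<omega>. (\<Sum>i\<in>I. Y i \<omega>)\<^sup>2)"
  proof (rule integrable_const_bound[of _ "(real (card I) * C)\<^sup>2"])
    show "AE \<omega> in M. norm ((\<Sum>i\<in>I. Y i \<omega>)\<^sup>2) \<le> (real (card I) * C)\<^sup>2"
      using Sb by (auto intro!: AE_I2 abs_le_imp_power2_le)
  qed (use S in auto)
  have E: "expectation (\<lambda>\<omega>. \<Sum>i\<in>I. Y i \<omega>) = (\<Sum>i\<in>I. expectation (Y i))"
    by (intro Bochner_Integration.integral_sum int)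
  show ?thesis
    using Chebyshev_inequality[OF S S2 a] indep_sum_deviation[OF fin ind bd]
    unfolding E by (meson divide_right_mono order_trans zero_le_power2)
qed

context homogeneous_levy
begin

lemma indep_grid_increments:
  assumes "a \<ge> 0" "h \<ge> 0"
  shows "indep_vars (\<lambda>_. borel)
     (\<lambda>i \<omega>. increment G (\<lambda>r. X r \<omega>) (a + real i * h) (a + real (Suc i) * h)) {..<n}"
proof -
  have "a + real 0 * h \<ge> 0 \<and> (\<forall>i<n. a + real i * h \<le> a + real (Suc i) * h)"
    using assms by (auto simp: algebra_simps)
  moreover have "\<forall>(n::nat) (t::nat \<Rightarrow> real). t 0 \<ge> 0 \<and> (\<forall>i<n. t i \<le> t (Suc i)) \<longrightarrow>
      indep_vars (\<lambda>_. borel) (\<lambda>i \<omega>. increment G (\<lambda>r. X r \<omega>) (t i) (t (Suc i))) {..<n}"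
    using levy unfolding levy_process_def by blast
  from this[THEN spec, of n, THEN spec, of "\<lambda>i. a + real i * h"]
  have "a + real 0 * h \<ge> 0 \<and> (\<forall>i<n. a + real i * h \<le> a + real (Suc i) * h) \<longrightarrow> ?thesis" .
  ultimately show ?thesis by blast
qed

lemma grid_increment_expectation:
  fixes f :: "(real, 'm) vec \<Rightarrow> 'b::{banach, second_countable_topology}"
  assumes "a \<ge> 0" "h \<ge> 0" "f \<in> borel_measurable borel"
  shows "expectation (\<lambda>\<omega>. f (increment G (\<lambda>r. X r \<omega>) (a + real i * h) (a + real (Suc i) * h))) =
     expectation (\<lambda>\<omega>. f (X h \<omega>))"
  using increment_expectation[of "a + real i * h" h f] assms by (simp add: algebra_simps)

section \<open>Variation sums and a criterion for divergence\<close>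

definition var_sum :: "real \<Rightarrow> (real \<Rightarrow> (real, 'm) vec) \<Rightarrow> real list \<Rightarrow> real" where
  "var_sum p x ts = (\<Sum>j<length ts - 1. N (increment G x (ts ! j) (ts ! Suc j)) powr p)"

lemma var_sum_nonneg: "var_sum p x ts \<ge> 0"
  by (simp add: var_sum_def sum_nonneg)

text \<open>Taking the root \<open>1 / p\<close> preserves boundedness, so the power sums themselves
  can be used. Bounds by natural numbers turn infinite variation into a countable intersection of
  conditions.\<close>

lemma finite_p_variation_iff:
  assumes "p > 0"
  shows "p_variation G N p s t x < \<infinity> \<longleftrightarrow> (\<exists>K::nat. \<forall>ts\<in>partitions s t. var_sum p x ts \<le> real K)"
proof
  let ?S = "SUP ts\<in>partitions s t. ennreal (var_sum p x ts powr (1 / p))"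
  have pv: "p_variation G N p s t x = ennreal (N (x s)) + ?S"
    by (simp add: p_variation_def var_sum_def)
  {
    assume "p_variation G N p s t x < \<infinity>"
    then have "?S < \<infinity>" unfolding pv by (simp add: less_top)
    then obtain c where c: "?S = ennreal c" "c \<ge> 0" by (cases ?S) auto
    obtain K where K: "c powr p \<le> real K" using real_arch_simple by blast
    have "var_sum p x ts \<le> real K" if "ts \<in> partitions s t" for ts
    proof -
      have "ennreal (var_sum p x ts powr (1 / p)) \<le> ennreal c"
        unfolding c(1)[symmetric] by (rule SUP_upper[OF that])
      then have "var_sum p x ts powr (1 / p) \<le> c" using c(2) by simp
      then have "(var_sum p x ts powr (1 / p)) powr p \<le> c powr p"
        using assms by (intro powr_mono2) auto
      then show ?thesis using assms K var_sum_nonneg[of p x ts] by (simp add: powr_powr)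
    qed
    then show "\<exists>K::nat. \<forall>ts\<in>partitions s t. var_sum p x ts \<le> real K" by blast
  }
  {
    assume "\<exists>K::nat. \<forall>ts\<in>partitions s t. var_sum p x ts \<le> real K"
    then obtain K :: nat where K: "\<And>ts. ts \<in> partitions s t \<Longrightarrow> var_sum p x ts \<le> real K" by blast
    have "?S \<le> ennreal (real K powr (1 / p))"
      by (rule SUP_least) (use K assms var_sum_nonneg in \<open>auto intro!: ennreal_leI powr_mono2\<close>)
    then show "p_variation G N p s t x < \<infinity>"
      unfolding pv by (metis ennreal_add_less_top ennreal_less_top infinity_ennreal_def le_less_trans)
  }
qed

text \<open>The set of paths with a large variation sum is an uncountable union over partitions, and
  its measurability is not at hand. Events \<open>E\<close> inside it suffice once their
  probabilities can be brought close to 1.\<close>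

lemma infinite_variationI:
  assumes p: "p > 0"
    and ev: "\<And>(K::nat) \<epsilon>. \<epsilon> > 0 \<Longrightarrow> \<exists>E\<in>events. prob E \<ge> 1 - \<epsilon> \<and>
      (\<forall>\<omega>\<in>E. \<exists>ts\<in>partitions 0 1. var_sum p (\<lambda>r. X r \<omega>) ts > real K)"
  shows "AE \<omega> in M. p_variation G N p 0 1 (\<lambda>t. X t \<omega>) = \<infinity>"
proof -
  have "AE \<omega> in M. \<exists>ts\<in>partitions 0 1. var_sum p (\<lambda>r. X r \<omega>) ts > real K" for K :: nat
  proof -
    have "\<exists>E. E \<in> events \<and> prob E \<ge> 1 - 1 / Suc n \<and>
      (\<forall>\<omega>\<in>E. \<exists>ts\<in>partitions 0 1. var_sum p (\<lambda>r. X r \<omega>) ts > real K)" for n :: nat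
      using ev[of "1 / Suc n" K] by auto
    then obtain E where E: "\<And>n. E n \<in> events" "\<And>n. prob (E n) \<ge> 1 - 1 / Suc n"
      "\<And>n \<omega>. \<omega> \<in> E n \<Longrightarrow> \<exists>ts\<in>partitions 0 1. var_sum p (\<lambda>r. X r \<omega>) ts > real K"
      by metis
    have U: "(\<Union>n. E n) \<in> events" using E(1) by auto
    have "prob (\<Union>n. E n) \<ge> 1 - 1 / Suc n" for n
      using E(2)[of n] finite_measure_mono[OF _ U, of "E n"] by (meson UN_upper UNIV_I order_trans)
    moreover have "(\<lambda>n. 1 - 1 / real (Suc n)) \<longlonglongrightarrow> 1 - 0"
      by (intro tendsto_diff tendsto_const LIMSEQ_Suc lim_1_over_n)
    ultimately have "prob (\<Union>n. E n) \<ge> 1"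
      by (intro LIMSEQ_le_const2[of "\<lambda>n. 1 - 1 / real (Suc n)"]) auto
    then have "prob (\<Union>n. E n) = 1" using prob_le_1[of "\<Union>n. E n"] by linarith
    then have "AE \<omega> in M. \<omega> \<in> (\<Union>n. E n)" using U by (simp add: prob_eq_1)
    then show ?thesis by eventually_elim (use E(3) in blast)
  qed
  then have "AE \<omega> in M. \<forall>K::nat. \<exists>ts\<in>partitions 0 1. var_sum p (\<lambda>r. X r \<omega>) ts > real K"
    by (simp add: AE_all_countable)
  then show ?thesis
  proof eventually_elim
    case (elim \<omega>)
    then have "\<not> p_variation G N p 0 1 (\<lambda>t. X t \<omega>) < \<infinity>"
      unfolding finite_p_variation_iff[OF p] by (auto simp: not_le)
    then show ?case by (simp add: not_less top_unique)
  qed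
qed

definition uniform_grid :: "nat \<Rightarrow> real list" where
  "uniform_grid n = map (\<lambda>j. real j / real n) [0..<Suc n]"

lemma uniform_grid_partition:
  assumes "n > 0"
  shows "uniform_grid n \<in> partitions 0 1"
proof -
  have "sorted_wrt (<) (uniform_grid n)"
    using assms by (auto simp: uniform_grid_def sorted_wrt_map divide_strict_right_mono
        intro!: sorted_wrt_mono_rel[OF _ sorted_wrt_upt] simp del: upt_Suc)
  moreover have "hd (uniform_grid n) = 0" "last (uniform_grid n) = 1"
    using assms by (simp_all add: uniform_grid_def hd_map last_map del: upt_Suc)
  moreover have "uniform_grid n \<noteq> []" by (simp add: uniform_grid_def)
  ultimately show ?thesis by (simp add: partitions_def)
qed

lemma var_sum_uniform_grid:
  "var_sum p x (uniform_grid n) = (\<Sum>j<n. N (increment G x (real j / n) (real (Suc j) / n)) powr p)"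
  by (simp add: var_sum_def uniform_grid_def nth_append del: upt_Suc of_nat_Suc)

text \<open>A functional of the increments that is dominated by the \<open>p\<close>-th power of the norm, and whose
  sum over a fine uniform grid concentrates at a large value, forces the variation to be large.\<close>

lemma divergence_criterion:
  assumes p: "p > 0"
    and crit: "\<And>(K::nat) \<epsilon>. \<epsilon> > 0 \<Longrightarrow> \<exists>(g :: (real, 'm) vec \<Rightarrow> real) n c D.
      n > 0 \<and> g \<in> borel_measurable borel \<and> (\<forall>x. \<bar>g x\<bar> \<le> D) \<and> (\<forall>x. \<bar>g x\<bar> \<le> c * N x powr p) \<and> c > 0 \<and>
      real n * expectation (\<lambda>\<omega>. g (X (1 / n) \<omega>)) \<noteq> 0 \<and>
      2 * c * real K \<le> \<bar>real n * expectation (\<lambda>\<omega>. g (X (1 / n) \<omega>))\<bar> \<and>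
      real n * expectation (\<lambda>\<omega>. (g (X (1 / n) \<omega>))\<^sup>2) \<le>
        \<epsilon> * (real n * expectation (\<lambda>\<omega>. g (X (1 / n) \<omega>)))\<^sup>2 / 4"
  shows "AE \<omega> in M. p_variation G N p 0 1 (\<lambda>t. X t \<omega>) = \<infinity>"
proof (rule infinite_variationI[OF p])
  fix K :: nat and \<epsilon> :: real assume \<epsilon>: "\<epsilon> > 0"
  obtain g :: "(real, 'm) vec \<Rightarrow> real" and n c D where n: "n > 0"
    and gm [measurable]: "g \<in> borel_measurable borel" and gD: "\<And>x. \<bar>g x\<bar> \<le> D"
    and gN: "\<And>x. \<bar>g x\<bar> \<le> c * N x powr p" and c: "c > 0"
    and nz: "real n * expectation (\<lambda>\<omega>. g (X (1 / n) \<omega>)) \<noteq> 0"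
    and big: "2 * c * real K \<le> \<bar>real n * expectation (\<lambda>\<omega>. g (X (1 / n) \<omega>))\<bar>"
    and var: "real n * expectation (\<lambda>\<omega>. (g (X (1 / n) \<omega>))\<^sup>2) \<le>
        \<epsilon> * (real n * expectation (\<lambda>\<omega>. g (X (1 / n) \<omega>)))\<^sup>2 / 4"
    using crit[OF \<epsilon>, of K] by metis
  define \<mu> where "\<mu> = real n * expectation (\<lambda>\<omega>. g (X (1 / n) \<omega>))"
  define I where "I i \<omega> = increment G (\<lambda>r. X r \<omega>) (0 + real i * (1 / n)) (0 + real (Suc i) * (1 / n))" for i \<omega>
  have ind: "indep_vars (\<lambda>_. borel) (\<lambda>i \<omega>. g (I i \<omega>)) {..<n}"
    unfolding I_def by (rule indep_vars_compose2[OF indep_grid_increments]) auto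
  have E: "expectation (\<lambda>\<omega>. g (I i \<omega>)) = expectation (\<lambda>\<omega>. g (X (1 / n) \<omega>))" for i
    unfolding I_def by (rule grid_increment_expectation) auto
  have E2: "expectation (\<lambda>\<omega>. (g (I i \<omega>))\<^sup>2) = expectation (\<lambda>\<omega>. (g (X (1 / n) \<omega>))\<^sup>2)" for i
    unfolding I_def by (rule grid_increment_expectation[of 0 "1 / n" "\<lambda>x. (g x)\<^sup>2"]) auto
  have Im [measurable]: "I i \<in> borel_measurable M" for i
    unfolding I_def[abs_def] by measurable
  \<comment> \<open>A deviation of less than half the mean leaves a sum larger than c K in absolute
    value; this is the origin of the factor 2 in the hypothesis, and of the factor 4 after squaring
    in Chebyshev's inequality.\<close>
  let ?B = "{\<omega> \<in> space M. \<bar>(\<Sum>i<n. g (I i \<omega>)) - \<mu>\<bar> \<ge> \<bar>\<mu>\<bar> / 2}"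
  have B: "?B \<in> events" by measurable
  have \<mu>: "\<bar>\<mu>\<bar> / 2 > 0" using nz by (simp add: \<mu>_def)
  have "prob {\<omega> \<in> space M. \<bar>(\<Sum>i<n. g (I i \<omega>)) - (\<Sum>i<n. expectation (\<lambda>\<omega>. g (I i \<omega>)))\<bar> \<ge> \<bar>\<mu>\<bar> / 2}
      \<le> (\<Sum>i<n. expectation (\<lambda>\<omega>. (g (I i \<omega>))\<^sup>2)) / (\<bar>\<mu>\<bar> / 2)\<^sup>2"
    by (rule indep_sum_concentration[OF finite_lessThan ind gD \<mu>])
  then have "prob ?B \<le> (real n * expectation (\<lambda>\<omega>. (g (X (1 / n) \<omega>))\<^sup>2)) / (\<bar>\<mu>\<bar> / 2)\<^sup>2"
    by (simp add: E E2 \<mu>_def)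
  also have "\<dots> \<le> (\<epsilon> * \<mu>\<^sup>2 / 4) / (\<bar>\<mu>\<bar> / 2)\<^sup>2"
    using var unfolding \<mu>_def[symmetric] by (rule divide_right_mono) simp
  also have "\<dots> = \<epsilon>" using \<mu> by (simp add: power_divide)
  finally have pB: "prob ?B \<le> \<epsilon>" .
  show "\<exists>E\<in>events. prob E \<ge> 1 - \<epsilon> \<and>
      (\<forall>\<omega>\<in>E. \<exists>ts\<in>partitions 0 1. var_sum p (\<lambda>r. X r \<omega>) ts > real K)"
  proof (intro bexI[of _ "space M - ?B"] conjI ballI)
    show "prob (space M - ?B) \<ge> 1 - \<epsilon>" using pB by (simp add: prob_compl B)
    fix \<omega> assume "\<omega> \<in> space M - ?B"
    then have "\<bar>(\<Sum>i<n. g (I i \<omega>)) - \<mu>\<bar> < \<bar>\<mu>\<bar> / 2" by auto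
    then have "c * real K < \<bar>\<Sum>i<n. g (I i \<omega>)\<bar>" using big unfolding \<mu>_def[symmetric] by linarith
    also have "\<dots> \<le> (\<Sum>i<n. \<bar>g (I i \<omega>)\<bar>)" by (rule sum_abs)
    also have "\<dots> \<le> (\<Sum>i<n. c * N (I i \<omega>) powr p)" by (intro sum_mono gN)
    also have "\<dots> = c * var_sum p (\<lambda>r. X r \<omega>) (uniform_grid n)"
      by (simp add: var_sum_uniform_grid sum_distrib_left I_def)
    finally have "var_sum p (\<lambda>r. X r \<omega>) (uniform_grid n) > real K" using c by simp
    then show "\<exists>ts\<in>partitions 0 1. var_sum p (\<lambda>r. X r \<omega>) ts > real K"
      using uniform_grid_partition[OF n] by blast
  qed (use B in auto)
qed

text \<open>Near the identity \<open>\<xi> i\<close> is a coordinate and is controlled by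
  homogeneity. Far from it \<open>\<xi> i\<close> is merely bounded, but there some coordinate is
  large, so \<open>N\<close> stays above a positive constant \<open>m\<close>.\<close>

lemma xi_norm_bound:
  obtains C where "C > 0" and "\<And>i x. \<bar>\<xi> i x\<bar> \<le> C * N x powr d i"
proof -
  obtain C where C: "C > 0" "\<And>x i. \<bar>x $ i\<bar> \<le> C * N x powr d i"
    using homogeneous_norm_coordinate_bound[OF norm_N] by blast
  obtain D where D: "D > 0" "\<And>i x. \<bar>\<xi> i x\<bar> \<le> D" using xi_bounded by blast
  obtain \<rho> where \<rho>: "\<rho> > 0" "\<And>i x. norm x \<le> \<rho> \<Longrightarrow> \<xi> i x = x $ i" using xi_linear_near by blast
  define \<sigma> where "\<sigma> = \<rho> / (real CARD('m) * C)"
  have \<sigma>: "\<sigma> > 0" using \<rho> C by (simp add: \<sigma>_def)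
  define m where "m = Min (range (\<lambda>j. \<sigma> powr (1 / d j)))"
  have m: "m > 0" using \<sigma> unfolding m_def by (subst Min_gr_iff) auto
  have far: "N x \<ge> m" if "norm x > \<rho>" for x
  proof -
    have "\<exists>j. \<bar>x $ j\<bar> \<ge> \<rho> / real CARD('m)"
    proof (rule ccontr)
      assume "\<not> ?thesis"
      then have "\<bar>x $ j\<bar> \<le> \<rho> / real CARD('m)" for j by (metis linear)
      then have "(\<Sum>j\<in>UNIV. \<bar>x $ j\<bar>) \<le> (\<Sum>j\<in>(UNIV::'m set). \<rho> / real CARD('m))" by (intro sum_mono)
      then show False using that norm_le_l1_cart[of x] by simp
    qed
    then obtain j where "\<rho> / real CARD('m) \<le> \<bar>x $ j\<bar>" by blast
    also have "\<dots> \<le> C * N x powr d j" by (rule C)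
    finally have "\<sigma> \<le> N x powr d j" using C by (simp add: \<sigma>_def field_simps)
    then have "\<sigma> powr (1 / d j) \<le> (N x powr d j) powr (1 / d j)"
      using \<sigma> weight_pos[of j] by (intro powr_mono2) auto
    also have "\<dots> = N x" using weight_pos[of j] N_nonneg[of x] by (simp add: powr_powr)
    finally show ?thesis unfolding m_def by (intro order_trans[OF Min_le]) auto
  qed
  define C' where "C' = C + (\<Sum>i\<in>UNIV. D / m powr d i)"
  show thesis
  proof (rule that[of C'])
    show "C' > 0" unfolding C'_def using C D by (intro add_pos_nonneg sum_nonneg) auto
    fix i x
    show "\<bar>\<xi> i x\<bar> \<le> C' * N x powr d i"
    proof (cases "norm x \<le> \<rho>")
      case True
      have "C * N x powr d i \<le> C' * N x powr d i"
        unfolding C'_def using D by (intro mult_right_mono) (auto intro!: sum_nonneg)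
      then show ?thesis using \<rho>(2)[OF True] C(2)[of x i] by simp
    next
      case False
      have le: "D / m powr d i \<le> C'"
      proof -
        have "D / m powr d i \<le> (\<Sum>i\<in>UNIV. D / m powr d i)" using D by (intro member_le_sum) auto
        then show ?thesis using C(1) by (simp add: C'_def)
      qed
      have "\<bar>\<xi> i x\<bar> \<le> (D / m powr d i) * m powr d i" using D(2) m by simp
      also have "\<dots> \<le> C' * N x powr d i"
        using False le D m weight_pos[of i]
        by (intro mult_mono powr_mono2 far order_trans[OF _ le]) auto
      finally show ?thesis .
    qed
  qed
qed

lemma xi_powr_norm_bound:
  assumes "p > 0"
  obtains C where "C > 0" and "\<And>x. \<bar>\<xi> i x\<bar> powr (p / d i) \<le> C * N x powr p"
proof -
  obtain C where C: "C > 0" "\<And>i x. \<bar>\<xi> i x\<bar> \<le> C * N x powr d i" using xi_norm_bound by blast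
  show thesis
  proof (rule that[of "C powr (p / d i)"])
    fix x
    have "\<bar>\<xi> i x\<bar> powr (p / d i) \<le> (C * N x powr d i) powr (p / d i)"
      using C assms weight_pos[of i] by (intro powr_mono2) auto
    also have "\<dots> = C powr (p / d i) * N x powr p"
      using C weight_pos[of i] by (simp add: powr_mult powr_powr)
    finally show "\<bar>\<xi> i x\<bar> powr (p / d i) \<le> C powr (p / d i) * N x powr p" .
  qed (use C in simp)
qed

subsection \<open>Drift and jumps\<close>

text \<open>A rational weight which is 1 up to second order at the identity, as
  \<open>limit_lin\<close> requires, and which saturates the coordinates at a prescribed size. The
  vector \<open>a\<close> covers both uses: damping through one coordinate
  (\<open>axis_damp\<close>) and through all of them (\<open>iso_damp\<close>).\<close>

definition damp :: "('m \<Rightarrow> real) \<Rightarrow> (real, 'm) vec \<Rightarrow> real" where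
  "damp a x = 1 / (1 + (\<Sum>i\<in>UNIV. a i * (\<xi> i x)\<^sup>2))"

lemma damp_zero [simp]: "damp a 0 = 1"
  by (simp add: damp_def)

lemma damp_denominator: "(\<And>i. a i \<ge> 0) \<Longrightarrow> 1 + (\<Sum>i\<in>UNIV. a i * (\<xi> i x)\<^sup>2) \<ge> 1"
  by (simp add: sum_nonneg)

lemma damp_bounds:
  assumes "\<And>i. a i \<ge> 0"
  shows "0 < damp a x" "damp a x \<le> 1"
  using damp_denominator[of a x] assms by (auto simp: damp_def)

lemma Ck_damp:
  assumes a: "\<And>i. a i \<ge> 0"
  shows "Ck_on_space 2 (damp a)"
proof -
  have "Ck_on_space 2 (\<lambda>x. (1 + (\<Sum>i\<in>UNIV. a i * (\<xi> i x)\<^sup>2)) powr (- 1))"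
    by (intro Ck_powr Ck_add Ck_const Ck_sum Ck_cmult Ck_power Ck_xi)
       (use damp_denominator[of a] a in \<open>auto intro: less_le_trans[OF zero_less_one]\<close>)
  moreover have "(1 + (\<Sum>i\<in>UNIV. a i * (\<xi> i x)\<^sup>2)) powr (- 1) = damp a x" for x
    using damp_denominator[of a x] a by (simp add: damp_def powr_minus_divide)
  ultimately show ?thesis by simp
qed

lemma damp_measurable [measurable]: "damp a \<in> borel_measurable borel"
  unfolding damp_def[abs_def] by measurable

lemma damp_limit:
  assumes a: "\<And>i. a i \<ge> 0"
  shows "((\<lambda>x. (damp a x - 1) / norm x) \<longlongrightarrow> 0) (at 0)"
proof -
  obtain \<rho> where \<rho>: "\<rho> > 0" "\<And>i x. norm x \<le> \<rho> \<Longrightarrow> \<xi> i x = x $ i" using xi_linear_near by blast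
  define s where "s = (\<Sum>i\<in>UNIV. a i)"
  have "((\<lambda>x::(real, 'm) vec. s * norm x) \<longlongrightarrow> s * norm (0::(real, 'm) vec)) (at 0)"
    by (rule tendsto_mult[OF tendsto_const tendsto_norm[OF tendsto_ident_at]])
  then have lim: "((\<lambda>x::(real, 'm) vec. s * norm x) \<longlongrightarrow> 0) (at 0)" by simp
  have "\<forall>\<^sub>F x in at (0::(real, 'm) vec). norm x \<le> \<rho>"
    using \<rho>(1) by (auto simp: eventually_at dist_norm intro!: exI[of _ \<rho>])
  then have "\<forall>\<^sub>F x in at 0. norm ((damp a x - 1) / norm x) \<le> s * norm x"
  proof (rule eventually_mono)
    fix x :: "(real, 'm) vec" assume x: "norm x \<le> \<rho>"
    let ?q = "\<Sum>i\<in>UNIV. a i * (\<xi> i x)\<^sup>2"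
    have q0: "?q \<ge> 0" using a by (simp add: sum_nonneg)
    have "\<bar>damp a x - 1\<bar> = ?q / (1 + ?q)" using q0 by (simp add: damp_def field_simps)
    also have "\<dots> \<le> ?q" using q0 by (simp add: divide_le_eq mult_nonneg_nonneg algebra_simps)
    also have "\<dots> \<le> (\<Sum>i\<in>UNIV. a i * (norm x)\<^sup>2)"
      using \<rho>(2)[OF x] a by (intro sum_mono mult_left_mono) (auto intro!: abs_le_imp_power2_le component_le_norm_cart)
    also have "\<dots> = s * (norm x)\<^sup>2" by (simp add: s_def sum_distrib_right)
    finally have "\<bar>damp a x - 1\<bar> \<le> s * norm x * norm x" by (simp add: power2_eq_square)
    then show "norm ((damp a x - 1) / norm x) \<le> s * norm x"
      by (cases "x = 0") (simp_all add: divide_le_eq)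
  qed
  then show ?thesis using lim by (rule Lim_null_comparison)
qed

lemma lim_seq_of_right:
  assumes "((\<lambda>t. f t / t) \<longlongrightarrow> c) (at_right (0::real))"
  shows "(\<lambda>n. real (Suc n) * f (1 / real (Suc n))) \<longlonglongrightarrow> c"
proof -
  have "filterlim (\<lambda>n. 1 / real (Suc n)) (at_right 0) sequentially"
    using LIMSEQ_Suc[OF lim_1_over_n]
    by (auto simp: filterlim_at intro!: always_eventually simp del: of_nat_Suc)
  from filterlim_compose[OF assms this] show ?thesis by (simp add: mult.commute)
qed

definition axis_damp :: "'m \<Rightarrow> real \<Rightarrow> (real, 'm) vec \<Rightarrow> real" where
  "axis_damp i L = damp (\<lambda>j. if j = i then L else 0)"

lemma axis_damp_eq: "axis_damp i L x = 1 / (1 + L * (\<xi> i x)\<^sup>2)"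
  by (simp add: axis_damp_def damp_def if_distrib[of "\<lambda>c. c * _"] cong: if_cong)

lemma axis_damp_bounds: "L \<ge> 0 \<Longrightarrow> 0 < axis_damp i L x" "L \<ge> 0 \<Longrightarrow> axis_damp i L x \<le> 1"
  unfolding axis_damp_def by (rule damp_bounds; simp)+

lemma axis_damp_measurable [measurable]: "axis_damp i L \<in> borel_measurable borel"
  unfolding axis_damp_def by measurable

lemma limit_axis_lin:
  assumes "L \<ge> 0"
  shows "((\<lambda>t. expectation (\<lambda>\<omega>. \<xi> i (X t \<omega>) * axis_damp i L (X t \<omega>)) / t) \<longlongrightarrow>
     B $ i + (\<integral>y. \<xi> i y * axis_damp i L y - \<xi> i y \<partial>\<nu>)) (at_right 0)"
  unfolding axis_damp_def by (rule limit_lin[OF Ck_damp damp_limit]) (use assms in auto)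

lemma limit_axis_quad:
  assumes "L \<ge> 0"
  shows "((\<lambda>t. expectation (\<lambda>\<omega>. (\<xi> i (X t \<omega>))\<^sup>2 * axis_damp i L (X t \<omega>)) / t) \<longlongrightarrow>
     A $ i $ i + (\<integral>y. (\<xi> i y)\<^sup>2 * axis_damp i L y \<partial>\<nu>)) (at_right 0)"
  using limit_quad[OF Ck_damp[of "\<lambda>j. if j = i then L else 0"], of i i] assms
  by (simp add: axis_damp_def power2_eq_square)

lemma axis_damp_vanishes: "\<xi> i y \<noteq> 0 \<Longrightarrow> (\<lambda>j. axis_damp i (real j) y) \<longlonglongrightarrow> 0"
proof -
  assume nz: "\<xi> i y \<noteq> 0"
  have "filterlim (\<lambda>j. 1 + (\<xi> i y)\<^sup>2 * real j) at_top sequentially"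
    using nz by (intro filterlim_tendsto_add_at_top[OF tendsto_const]
        filterlim_tendsto_pos_mult_at_top[OF tendsto_const] filterlim_real_sequentially) simp
  then have "(\<lambda>j. 1 / (1 + (\<xi> i y)\<^sup>2 * real j)) \<longlonglongrightarrow> 0"
    by (intro tendsto_divide_0[OF tendsto_const] filterlim_at_top_imp_at_infinity)
  then show ?thesis by (simp add: axis_damp_eq mult.commute)
qed

text \<open>Dominated convergence. The weight stays equal to 1 on the zero set of
  \<open>\<xi> i\<close> however strong the damping, which is why \<open>g\<close> has to vanish
  there.\<close>

lemma damped_integral_vanishes:
  assumes "integrable \<nu> g" and g: "\<And>y. \<xi> i y = 0 \<Longrightarrow> g y = 0"
  shows "(\<lambda>j. \<integral>y. g y * axis_damp i (real j) y \<partial>\<nu>) \<longlonglongrightarrow> (0::real)"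
proof -
  have [measurable]: "g \<in> borel_measurable borel"
    using borel_measurable_integrable[OF assms(1)] by (simp cong: measurable_cong_sets add: sets_nu)
  have "(\<lambda>j. \<integral>y. g y * axis_damp i (real j) y \<partial>\<nu>) \<longlonglongrightarrow> (\<integral>y. 0 \<partial>\<nu>)"
  proof (rule integral_dominated_convergence[where w = "\<lambda>y. \<bar>g y\<bar>"])
    show "AE y in \<nu>. (\<lambda>j. g y * axis_damp i (real j) y) \<longlonglongrightarrow> 0"
    proof (rule AE_I2)
      fix y
      show "(\<lambda>j. g y * axis_damp i (real j) y) \<longlonglongrightarrow> 0"
        using tendsto_mult_right_zero[OF axis_damp_vanishes[of i y], of "g y"] g[of y]
        by (cases "\<xi> i y = 0") auto
    qed
    show "AE y in \<nu>. norm (g y * axis_damp i (real j) y) \<le> \<bar>g y\<bar>" for j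
      using axis_damp_bounds[of "real j" i]
      by (intro AE_I2) (auto simp: abs_mult abs_of_pos intro!: mult_left_le)
  qed (use assms(1) in auto)
  then show ?thesis by simp
qed

text \<open>After scaling by \<open>sqrt L\<close> this is the boundedness of u / (1 + u^2): damping
  at level \<open>L\<close> confines the saturated coordinate to size
  \<open>1 / sqrt L\<close>.\<close>

lemma damp_linear_small:
  assumes "L > 0"
  shows "\<bar>\<xi> i x * axis_damp i L x\<bar> \<le> L powr (- 1 / 2)"
proof -
  let ?u = "sqrt L * \<bar>\<xi> i x\<bar>"
  have "0 \<le> (?u - 1)\<^sup>2" by simp
  then have "2 * ?u \<le> 1 + ?u\<^sup>2" by (simp add: power2_diff)
  moreover have "0 \<le> ?u" using assms by simp
  ultimately have "?u \<le> 1 + ?u\<^sup>2" by linarith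
  then have "?u \<le> 1 + L * (\<xi> i x)\<^sup>2" using assms by (simp add: power_mult_distrib)
  moreover have "0 < 1 + L * (\<xi> i x)\<^sup>2" using assms by (simp add: add_pos_nonneg)
  ultimately have "?u * axis_damp i L x \<le> 1" by (simp add: axis_damp_eq)
  then have "\<bar>\<xi> i x\<bar> * axis_damp i L x \<le> 1 / sqrt L"
    using assms by (simp add: field_simps)
  moreover have "L powr (- 1 / 2) = 1 / sqrt L"
    using assms by (simp add: powr_minus_divide powr_half_sqrt)
  ultimately show ?thesis
    using axis_damp_bounds(1)[of L i x] assms by (simp add: abs_mult)
qed

section \<open>Divergence caused by a drift or by jumps\<close>

lemma notin_Gamma_set_iff_integrable:
  assumes "0 \<le> \<gamma>" "\<gamma> < 2"
  shows "\<gamma> \<notin> Gamma_set \<xi> \<nu> i \<longleftrightarrow> integrable \<nu> (\<lambda>x. \<bar>\<xi> i x\<bar> powr \<gamma>)"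
  using assms by (auto simp: Gamma_set_def integrable_iff_bounded less_top)

text \<open>Strong damping removes the jumps from \<open>\<xi> k\<close>, so the mean per unit time
  approaches the uncompensated drift \<open>B_tilde \<xi> B \<nu> k\<close>, which is not 0, while
  the second moment approaches \<open>A $ k $ k = 0\<close>. As p < d k, the damped coordinate is
  also a vanishing multiple of \<open>N x powr p\<close>, and this gives sums beyond every
  \<open>K\<close>. The case of a positive \<open>A $ k $ k\<close> belongs to the Gaussian
  argument.\<close>

theorem infinite_variation_drift:
  assumes k: "k \<in> K_set \<xi> B \<nu>" and A: "A $ k $ k = 0" and p: "0 < p" "p < d k"
  shows "AE \<omega> in M. p_variation G N p 0 1 (\<lambda>t. X t \<omega>) = \<infinity>"
proof (rule divergence_criterion[OF p(1)])
  fix K :: nat and \<epsilon> :: real assume \<epsilon>: "\<epsilon> > 0"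
  define q where "q = p / d k"
  have q: "0 < q" "q < 1" using p weight_pos[of k] by (auto simp: q_def)
  obtain C where C: "C > 0" "\<And>x. \<bar>\<xi> k x\<bar> powr q \<le> C * N x powr p"
    using xi_powr_norm_bound[OF p(1), of k] unfolding q_def by blast
  have int: "integrable \<nu> (\<xi> k)"
  proof -
    have "integrable \<nu> (\<lambda>x. \<bar>\<xi> k x\<bar> powr 1)"
      using k notin_Gamma_set_iff_integrable[of 1 k] by (simp add: K_set_def K_tilde_def)
    then show ?thesis by (simp add: integrable_abs_iff)
  qed
  have int2: "integrable \<nu> (\<lambda>x. (\<xi> k x)\<^sup>2)"
    by (rule integrable_nu_bound[of _ 1]) (auto simp: xi_le_xi_sq)
  define b where "b = \<bar>B_tilde \<xi> B \<nu> k\<bar>"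
  have b: "b > 0" using k by (simp add: b_def K_set_def)
  define m where "m L = B $ k + (\<integral>y. \<xi> k y * axis_damp k L y - \<xi> k y \<partial>\<nu>)" for L
  define v where "v L = (\<integral>y. (\<xi> k y)\<^sup>2 * axis_damp k L y \<partial>\<nu>)" for L
  have intL: "integrable \<nu> (\<lambda>y. \<xi> k y * axis_damp k L y)" if "L \<ge> 0" for L
    by (rule Bochner_Integration.integrable_bound[OF int])
       (use axis_damp_bounds[OF that, of k] in \<open>auto intro!: AE_I2 simp: abs_mult abs_of_pos mult_left_le\<close>)
  have "(\<lambda>j. B_tilde \<xi> B \<nu> k + (\<integral>y. \<xi> k y * axis_damp k (real j) y \<partial>\<nu>)) \<longlonglongrightarrow> B_tilde \<xi> B \<nu> k + 0"
    by (intro tendsto_add tendsto_const damped_integral_vanishes[OF int])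
  moreover have "B_tilde \<xi> B \<nu> k + (\<integral>y. \<xi> k y * axis_damp k (real j) y \<partial>\<nu>) = m (real j)" for j
    using intL[of "real j"] int by (simp add: B_tilde_def m_def)
  ultimately have "(\<lambda>j. m (real j)) \<longlonglongrightarrow> B_tilde \<xi> B \<nu> k" by simp
  then have "(\<lambda>j. \<bar>m (real j)\<bar>) \<longlonglongrightarrow> b" unfolding b_def by (rule tendsto_rabs)
  then have e1: "\<forall>\<^sub>F j in sequentially. \<bar>m (real j)\<bar> > b / 2"
    by (rule order_tendstoD) (use b in simp)
  have "(\<lambda>j. v (real j)) \<longlonglongrightarrow> 0" unfolding v_def by (rule damped_integral_vanishes[OF int2]) simp
  then have e2: "\<forall>\<^sub>F j in sequentially. v (real j) < \<epsilon> * (b / 2)\<^sup>2 / 4"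
    using b \<epsilon> by (intro order_tendstoD) auto
  \<comment> \<open>The constant in the comparison with \<open>N x powr p\<close> found in
    \<open>gN\<close> below: the power q of the damped coordinate is compared with \<open>N\<close>,
    and the remaining power 1 - q is at most \<open>L powr (- ((1 - q) / 2))\<close> by
    \<open>damp_linear_small\<close>. It tends to 0 because q < 1.\<close>
  define c where "c L = C * L powr (- ((1 - q) / 2))" for L
  have "((\<lambda>L. L powr (- ((1 - q) / 2))) \<longlongrightarrow> 0) at_top"
    using q by (intro tendsto_neg_powr filterlim_ident) auto
  from filterlim_compose[OF this filterlim_real_sequentially]
  have "(\<lambda>j. real j powr (- ((1 - q) / 2))) \<longlonglongrightarrow> 0" .
  then have "(\<lambda>j. 2 * real K * (C * real j powr (- ((1 - q) / 2)))) \<longlonglongrightarrow> 2 * real K * (C * 0)"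
    by (intro tendsto_intros)
  then have "(\<lambda>j. 2 * c (real j) * real K) \<longlonglongrightarrow> 0" by (simp add: c_def mult_ac)
  then have e3: "\<forall>\<^sub>F j in sequentially. 2 * c (real j) * real K < b / 2"
    using b by (intro order_tendstoD) auto
  obtain j where j: "\<bar>m (real j)\<bar> > b / 2" "v (real j) < \<epsilon> * (b / 2)\<^sup>2 / 4"
    "2 * c (real j) * real K < b / 2" "j > 0"
    using eventually_conj[OF e1 eventually_conj[OF e2 eventually_conj[OF e3 eventually_gt_at_top[of 0]]]]
    by (auto simp: eventually_sequentially)
  define L where "L = real j"
  have L: "L > 0" using j by (simp add: L_def)
  let ?g = "\<lambda>x. \<xi> k x * axis_damp k L x"
  have "(\<lambda>n. real (Suc n) * expectation (\<lambda>\<omega>. ?g (X (1 / Suc n) \<omega>))) \<longlonglongrightarrow> m L"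
    unfolding m_def by (rule lim_seq_of_right[OF limit_axis_lin]) (use L in simp)
  then have "(\<lambda>n. \<bar>real (Suc n) * expectation (\<lambda>\<omega>. ?g (X (1 / Suc n) \<omega>))\<bar>) \<longlonglongrightarrow> \<bar>m L\<bar>"
    by (rule tendsto_rabs)
  then have n1: "\<forall>\<^sub>F n in sequentially. \<bar>real (Suc n) * expectation (\<lambda>\<omega>. ?g (X (1 / Suc n) \<omega>))\<bar> > b / 2"
    using j(1) unfolding L_def[symmetric] by (rule order_tendstoD)
  have "(\<lambda>n. real (Suc n) * expectation (\<lambda>\<omega>. (\<xi> k (X (1 / Suc n) \<omega>))\<^sup>2 * axis_damp k L (X (1 / Suc n) \<omega>)))
      \<longlonglongrightarrow> A $ k $ k + v L"
    unfolding v_def by (rule lim_seq_of_right[OF limit_axis_quad]) (use L in simp)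
  then have n2: "\<forall>\<^sub>F n in sequentially. real (Suc n) * expectation (\<lambda>\<omega>. (\<xi> k (X (1 / Suc n) \<omega>))\<^sup>2 *
      axis_damp k L (X (1 / Suc n) \<omega>)) < \<epsilon> * (b / 2)\<^sup>2 / 4"
    using j(2) A unfolding L_def[symmetric] by (intro order_tendstoD) auto
  from eventually_conj[OF n1 n2]
  obtain n0 where n0: "\<bar>real (Suc n0) * expectation (\<lambda>\<omega>. ?g (X (1 / Suc n0) \<omega>))\<bar> > b / 2"
    "real (Suc n0) * expectation (\<lambda>\<omega>. (\<xi> k (X (1 / Suc n0) \<omega>))\<^sup>2 *
      axis_damp k L (X (1 / Suc n0) \<omega>)) < \<epsilon> * (b / 2)\<^sup>2 / 4"
    by (auto simp: eventually_sequentially)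
  define n where "n = Suc n0"
  define \<mu> where "\<mu> = real n * expectation (\<lambda>\<omega>. ?g (X (1 / n) \<omega>))"
  have \<mu>: "\<bar>\<mu>\<bar> > b / 2" using n0(1) by (simp only: \<mu>_def n_def)
  obtain D where D: "D > 0" "\<And>i x. \<bar>\<xi> i x\<bar> \<le> D" using xi_bounded by blast
  have gD: "\<bar>?g x\<bar> \<le> \<bar>\<xi> k x\<bar>" for x
    using axis_damp_bounds[of L k x] L by (simp add: abs_mult mult_left_le)
  have gN: "\<bar>?g x\<bar> \<le> c L * N x powr p" for x
  proof -
    have "\<bar>?g x\<bar> = \<bar>?g x\<bar> powr q * \<bar>?g x\<bar> powr (1 - q)"
      by (simp add: powr_add[symmetric])
    also have "\<dots> \<le> \<bar>\<xi> k x\<bar> powr q * (L powr (- 1 / 2)) powr (1 - q)"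
      using q gD damp_linear_small[OF L, of k x] by (intro mult_mono powr_mono2) auto
    also have "\<dots> \<le> (C * N x powr p) * (L powr (- 1 / 2)) powr (1 - q)"
      by (intro mult_right_mono C) auto
    also have "(L powr (- 1 / 2)) powr (1 - q) = L powr (- ((1 - q) / 2))"
      unfolding powr_powr by (rule arg_cong) (simp add: field_simps)
    also have "C * N x powr p * L powr (- ((1 - q) / 2)) = c L * N x powr p" by (simp add: c_def)
    finally show ?thesis .
  qed
  have var: "real n * expectation (\<lambda>\<omega>. (?g (X (1 / n) \<omega>))\<^sup>2) \<le> \<epsilon> * \<mu>\<^sup>2 / 4"
  proof -
    \<comment> \<open>One of the two damping factors in the square is bounded by 1; the expression
      left over is the one treated by \<open>limit_axis_quad\<close>.\<close>
    have "expectation (\<lambda>\<omega>. (?g (X (1 / n) \<omega>))\<^sup>2) \<le>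
        expectation (\<lambda>\<omega>. (\<xi> k (X (1 / n) \<omega>))\<^sup>2 * axis_damp k L (X (1 / n) \<omega>))"
    proof (rule integral_mono)
      have pt: "(?g x)\<^sup>2 \<le> (\<xi> k x)\<^sup>2 * axis_damp k L x" "(\<xi> k x)\<^sup>2 * axis_damp k L x \<le> D\<^sup>2" for x
      proof -
        have a: "0 < axis_damp k L x" "axis_damp k L x \<le> 1" using axis_damp_bounds[of L k x] L by auto
        then have "(axis_damp k L x)\<^sup>2 \<le> axis_damp k L x" by (simp add: power2_eq_square mult_left_le)
        then show "(?g x)\<^sup>2 \<le> (\<xi> k x)\<^sup>2 * axis_damp k L x"
          by (simp add: power_mult_distrib mult_left_mono)
        have "(\<xi> k x)\<^sup>2 * axis_damp k L x \<le> (\<xi> k x)\<^sup>2" using a by (simp add: mult_left_le)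
        also have "\<dots> \<le> D\<^sup>2" by (rule abs_le_imp_power2_le[OF D(2)])
        finally show "(\<xi> k x)\<^sup>2 * axis_damp k L x \<le> D\<^sup>2" .
      qed
      have pos: "0 \<le> (\<xi> k x)\<^sup>2 * axis_damp k L x" for x
        using axis_damp_bounds(1)[of L k x] L by simp
      show "integrable M (\<lambda>\<omega>. (?g (X (1 / n) \<omega>))\<^sup>2)"
        by (rule integrable_bounded[of _ "D\<^sup>2"]) (use pt in \<open>auto intro: order_trans\<close>)
      show "integrable M (\<lambda>\<omega>. (\<xi> k (X (1 / n) \<omega>))\<^sup>2 * axis_damp k L (X (1 / n) \<omega>))"
        by (rule integrable_bounded[of _ "D\<^sup>2"]) (use pt pos in auto)
      show "(?g (X (1 / n) \<omega>))\<^sup>2 \<le> (\<xi> k (X (1 / n) \<omega>))\<^sup>2 * axis_damp k L (X (1 / n) \<omega>)" for \<omega>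
        by (rule pt)
    qed
    then have "real n * expectation (\<lambda>\<omega>. (?g (X (1 / n) \<omega>))\<^sup>2) \<le>
        real n * expectation (\<lambda>\<omega>. (\<xi> k (X (1 / n) \<omega>))\<^sup>2 * axis_damp k L (X (1 / n) \<omega>))"
      by (rule mult_left_mono) simp
    also have "\<dots> \<le> \<epsilon> * (b / 2)\<^sup>2 / 4" using n0(2) by (simp only: n_def less_imp_le)
    also have "\<dots> \<le> \<epsilon> * \<mu>\<^sup>2 / 4"
      using \<mu> b \<epsilon> by (intro divide_right_mono mult_left_mono) (auto simp: abs_le_square_iff[symmetric])
    finally show ?thesis .
  qed
  show "\<exists>(g :: (real, 'm) vec \<Rightarrow> real) n c D.
      n > 0 \<and> g \<in> borel_measurable borel \<and> (\<forall>x. \<bar>g x\<bar> \<le> D) \<and> (\<forall>x. \<bar>g x\<bar> \<le> c * N x powr p) \<and> c > 0 \<and>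
      real n * expectation (\<lambda>\<omega>. g (X (1 / n) \<omega>)) \<noteq> 0 \<and>
      2 * c * real K \<le> \<bar>real n * expectation (\<lambda>\<omega>. g (X (1 / n) \<omega>))\<bar> \<and>
      real n * expectation (\<lambda>\<omega>. (g (X (1 / n) \<omega>))\<^sup>2) \<le>
        \<epsilon> * (real n * expectation (\<lambda>\<omega>. g (X (1 / n) \<omega>)))\<^sup>2 / 4"
  proof (rule exI[of _ ?g], rule exI[of _ n], rule exI[of _ "c L"], rule exI[of _ D], intro conjI allI)
    show "n > 0" by (simp add: n_def)
    show "\<bar>?g x\<bar> \<le> D" for x using gD[of x] D(2)[of k x] by linarith
    show "\<bar>?g x\<bar> \<le> c L * N x powr p" for x by (rule gN)
    show "c L > 0" using C L by (simp add: c_def)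
    show "real n * expectation (\<lambda>\<omega>. ?g (X (1 / n) \<omega>)) \<noteq> 0" using \<mu> b unfolding \<mu>_def by linarith
    show "2 * c L * real K \<le> \<bar>real n * expectation (\<lambda>\<omega>. ?g (X (1 / n) \<omega>))\<bar>"
      using \<mu> j(3) unfolding \<mu>_def L_def[symmetric] by linarith
    show "real n * expectation (\<lambda>\<omega>. (?g (X (1 / n) \<omega>))\<^sup>2) \<le>
        \<epsilon> * (real n * expectation (\<lambda>\<omega>. ?g (X (1 / n) \<omega>)))\<^sup>2 / 4" using var unfolding \<mu>_def .
  qed measurable
qed

lemma A_diag_nonneg: "A $ i $ i \<ge> 0"
proof -
  have "axis i 1 \<bullet> (A *v axis i 1) \<ge> 0"
    using triplet unfolding has_triplet_def covariance_matrix_def by blast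
  moreover have "axis i 1 \<bullet> (A *v axis i 1) = (A *v axis i 1) $ i"
    by (simp add: inner_axis')
  moreover have "(A *v axis i 1) $ i = A $ i $ i"
    by (simp add: matrix_vector_mult_def axis_def if_distrib cong: if_cong)
  ultimately show ?thesis by simp
qed

text \<open>The divergent moment is approximated from below by integrals of test functions, so the
  means of the grid sums can be made as large as desired. Each test function is bounded by
  \<open>D powr q\<close>, hence the sum of second moments grows at most linearly in the mean, while
  Chebyshev's inequality compares it with the square of the mean.\<close>

theorem infinite_variation_jumps:
  assumes p: "p > 0" and G: "p / d i \<in> Gamma_set \<xi> \<nu> i"
  shows "AE \<omega> in M. p_variation G N p 0 1 (\<lambda>t. X t \<omega>) = \<infinity>"
proof (rule divergence_criterion[OF p])
  fix K :: nat and \<epsilon> :: real assume \<epsilon>: "\<epsilon> > 0"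
  define q where "q = p / d i"
  have q: "0 < q" "q < 2" and qinf: "(\<integral>\<^sup>+x. ennreal (\<bar>\<xi> i x\<bar> powr q) \<partial>\<nu>) = \<infinity>"
    using p weight_pos[of i] G by (auto simp: q_def Gamma_set_def)
  obtain C where C: "C > 0" "\<And>x. \<bar>\<xi> i x\<bar> powr q \<le> C * N x powr p"
    using xi_powr_norm_bound[OF p, of i] unfolding q_def by blast
  obtain D where D: "D > 0" "\<And>i x. \<bar>\<xi> i x\<bar> \<le> D" using xi_bounded by blast
  define \<delta> where "\<delta> j = 1 / real (Suc j)" for j
  have \<delta>: "\<delta> j > 0" for j by (simp add: \<delta>_def)
  \<comment> \<open>A regularisation of the power q, which in general is not of class 2 where
    \<open>\<xi> i\<close> vanishes. The exponent \<open>q / 2 - 1\<close> is negative, so adding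
    \<delta> lowers the value and \<open>g j\<close> approaches the power q from below.\<close>
  define k where "k j x = ((\<xi> i x)\<^sup>2 + \<delta> j) powr (q / 2 - 1)" for j x
  define g where "g j x = (\<xi> i x)\<^sup>2 * k j x" for j x
  have Ck: "Ck_on_space 2 (k j)" for j
    unfolding k_def by (intro Ck_powr Ck_add Ck_power Ck_xi Ck_const) (simp add: \<delta> add_nonneg_pos)
  have km [measurable]: "k j \<in> borel_measurable borel" for j
    unfolding k_def[abs_def] by measurable
  have gm [measurable]: "g j \<in> borel_measurable borel" for j
    unfolding g_def[abs_def] by measurable
  have k0: "k j x \<ge> 0" for j x by (simp add: k_def)
  have g0: "g j x \<ge> 0" for j x by (simp add: g_def k0)
  have sq: "(u\<^sup>2) powr (q / 2) = \<bar>u\<bar> powr q" for u :: real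
    using powr_powr[of "\<bar>u\<bar>" 2 "q / 2"] by simp
  have sq1: "u\<^sup>2 * (u\<^sup>2) powr (q / 2 - 1) = \<bar>u\<bar> powr q" if "u \<noteq> 0" for u :: real
    using that powr_add[of "u\<^sup>2" 1 "q / 2 - 1"] by (simp add: sq)
  have g_le: "g j x \<le> \<bar>\<xi> i x\<bar> powr q" for j x
  proof (cases "\<xi> i x = 0")
    case False
    have "k j x \<le> ((\<xi> i x)\<^sup>2) powr (q / 2 - 1)"
      unfolding k_def using q False \<delta>[of j] by (intro powr_mono2') auto
    then have "g j x \<le> (\<xi> i x)\<^sup>2 * ((\<xi> i x)\<^sup>2) powr (q / 2 - 1)"
      unfolding g_def by (rule mult_left_mono) simp
    then show ?thesis using sq1[OF False] by simp
  qed (simp add: g_def)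
  have g_lim: "(\<lambda>j. g j x) \<longlonglongrightarrow> \<bar>\<xi> i x\<bar> powr q" for x
  proof (cases "\<xi> i x = 0")
    case False
    have "\<delta> \<longlonglongrightarrow> 0" unfolding \<delta>_def by (rule LIMSEQ_Suc[OF lim_1_over_n])
    then have "(\<lambda>j. g j x) \<longlonglongrightarrow> (\<xi> i x)\<^sup>2 * ((\<xi> i x)\<^sup>2 + 0) powr (q / 2 - 1)"
      unfolding g_def k_def using False by (intro tendsto_intros) auto
    then show ?thesis using sq1[OF False] by simp
  qed (simp add: g_def)
  have g_int: "integrable \<nu> (g j)" for j
  proof (rule integrable_nu_bound)
    fix x
    have "k j x \<le> \<delta> j powr (q / 2 - 1)"
      unfolding k_def using q \<delta>[of j] by (intro powr_mono2') auto
    then have "g j x \<le> xi_sq x * \<delta> j powr (q / 2 - 1)"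
      unfolding g_def by (intro mult_mono xi_le_xi_sq) (auto simp: k0 xi_sq_nonneg)
    then show "\<bar>g j x\<bar> \<le> \<delta> j powr (q / 2 - 1) * xi_sq x" using g0[of j x] by (simp add: mult.commute)
  qed simp
  \<comment> \<open>The first summand makes the variation sum exceed \<open>K\<close>, the second
    makes the relative variance smaller than \<epsilon>, and the third keeps the mean away from
    0.\<close>
  define T where "T = 2 * C * real K + 4 * D powr q / \<epsilon> + 1"
  have T: "T > 0" unfolding T_def using C(1) D(1) \<epsilon> by (intro add_nonneg_pos add_nonneg_nonneg) auto
  have "\<exists>j. (\<integral>x. g j x \<partial>\<nu>) > T"
  proof (rule ccontr)
    assume "\<not> ?thesis"
    then have le: "(\<integral>x. g j x \<partial>\<nu>) \<le> T" for j by (simp add: not_less)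
    have "(\<integral>\<^sup>+x. ennreal (\<bar>\<xi> i x\<bar> powr q) \<partial>\<nu>) = (\<integral>\<^sup>+x. liminf (\<lambda>j. ennreal (g j x)) \<partial>\<nu>)"
      using g_lim by (intro nn_integral_cong lim_imp_Liminf[symmetric] tendsto_ennrealI) auto
    also have "\<dots> \<le> liminf (\<lambda>j. \<integral>\<^sup>+x. ennreal (g j x) \<partial>\<nu>)"
      by (rule nn_integral_liminf) measurable
    also have "(\<lambda>j. \<integral>\<^sup>+x. ennreal (g j x) \<partial>\<nu>) = (\<lambda>j. ennreal (\<integral>x. g j x \<partial>\<nu>))"
      using nn_integral_eq_integral[OF g_int] g0 by auto
    also have "liminf (\<lambda>j. ennreal (\<integral>x. g j x \<partial>\<nu>)) \<le> liminf (\<lambda>j. ennreal T)"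
      using le by (intro Liminf_mono always_eventually allI ennreal_leI)
    also have "\<dots> = ennreal T" by (simp add: Liminf_const)
    finally show False using qinf by (simp add: top_unique)
  qed
  then obtain j where j: "(\<integral>x. g j x \<partial>\<nu>) > T" by blast
  have "(\<lambda>n. real (Suc n) * expectation (\<lambda>\<omega>. g j (X (1 / Suc n) \<omega>))) \<longlonglongrightarrow> k j 0 * A $ i $ i + (\<integral>x. g j x \<partial>\<nu>)"
    using lim_seq_of_right[OF limit_quad[OF Ck, of i i j]] by (simp add: g_def power2_eq_square)
  \<comment> \<open>A Gaussian part can only raise the mean.\<close>
  moreover have "k j 0 * A $ i $ i \<ge> 0" using k0[of j 0] A_diag_nonneg[of i] by simp
  then have "k j 0 * A $ i $ i + (\<integral>x. g j x \<partial>\<nu>) > T" using j by linarith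
  ultimately have "\<forall>\<^sub>F n in sequentially. real (Suc n) * expectation (\<lambda>\<omega>. g j (X (1 / Suc n) \<omega>)) > T"
    by (rule order_tendstoD)
  then obtain n0 where n0: "real (Suc n0) * expectation (\<lambda>\<omega>. g j (X (1 / Suc n0) \<omega>)) > T"
    by (auto simp: eventually_sequentially)
  define n where "n = Suc n0"
  define \<mu> where "\<mu> = real n * expectation (\<lambda>\<omega>. g j (X (1 / n) \<omega>))"
  have \<mu>: "\<mu> > T" using n0 by (simp only: \<mu>_def n_def)
  have gD: "g j x \<le> D powr q" for x
    using g_le[of j x] D(2)[of i x] q by (meson abs_ge_zero less_imp_le order_trans powr_mono2)
  have var: "real n * expectation (\<lambda>\<omega>. (g j (X (1 / n) \<omega>))\<^sup>2) \<le> \<epsilon> * \<mu>\<^sup>2 / 4"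
  proof -
    have "expectation (\<lambda>\<omega>. (g j (X (1 / n) \<omega>))\<^sup>2) \<le> expectation (\<lambda>\<omega>. D powr q * g j (X (1 / n) \<omega>))"
    proof (rule integral_mono)
      show "integrable M (\<lambda>\<omega>. (g j (X (1 / n) \<omega>))\<^sup>2)"
        by (rule integrable_bounded[of _ "(D powr q)\<^sup>2"]) (use gD g0 in \<open>auto intro!: power_mono\<close>)
      show "integrable M (\<lambda>\<omega>. D powr q * g j (X (1 / n) \<omega>))"
        by (rule integrable_bounded[of _ "D powr q * D powr q"]) (use gD g0 in \<open>auto simp: abs_mult intro!: mult_left_mono\<close>)
      show "(g j (X (1 / n) \<omega>))\<^sup>2 \<le> D powr q * g j (X (1 / n) \<omega>)" for \<omega>
        unfolding power2_eq_square by (intro mult_right_mono gD g0)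
    qed
    then have "real n * expectation (\<lambda>\<omega>. (g j (X (1 / n) \<omega>))\<^sup>2) \<le> real n * (D powr q * expectation (\<lambda>\<omega>. g j (X (1 / n) \<omega>)))"
      by (intro mult_left_mono) auto
    also have "\<dots> = D powr q * \<mu>" by (simp add: \<mu>_def)
    also have "\<dots> \<le> (\<epsilon> * \<mu> / 4) * \<mu>"
    proof (rule mult_right_mono)
      have "4 * D powr q / \<epsilon> \<le> \<mu>" using \<mu> mult_nonneg_nonneg[of C "real K"] C(1)
        unfolding T_def by linarith
      then show "D powr q \<le> \<epsilon> * \<mu> / 4" using \<epsilon> by (simp add: field_simps)
    qed (use \<mu> T in simp)
    finally show ?thesis by (simp add: power2_eq_square mult_ac)
  qed
  show "\<exists>(g :: (real, 'm) vec \<Rightarrow> real) n c D.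
      n > 0 \<and> g \<in> borel_measurable borel \<and> (\<forall>x. \<bar>g x\<bar> \<le> D) \<and> (\<forall>x. \<bar>g x\<bar> \<le> c * N x powr p) \<and> c > 0 \<and>
      real n * expectation (\<lambda>\<omega>. g (X (1 / n) \<omega>)) \<noteq> 0 \<and>
      2 * c * real K \<le> \<bar>real n * expectation (\<lambda>\<omega>. g (X (1 / n) \<omega>))\<bar> \<and>
      real n * expectation (\<lambda>\<omega>. (g (X (1 / n) \<omega>))\<^sup>2) \<le>
        \<epsilon> * (real n * expectation (\<lambda>\<omega>. g (X (1 / n) \<omega>)))\<^sup>2 / 4"
  proof (rule exI[of _ "g j"], rule exI[of _ n], rule exI[of _ C], rule exI[of _ "D powr q"], intro conjI allI)
    show "n > 0" by (simp add: n_def)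
    show "\<bar>g j x\<bar> \<le> D powr q" for x using gD[of x] g0[of j x] by simp
    show "\<bar>g j x\<bar> \<le> C * N x powr p" for x using g_le[of j x] C(2)[of x] g0[of j x] by simp
    show "C > 0" by (rule C)
    show "real n * expectation (\<lambda>\<omega>. g j (X (1 / n) \<omega>)) \<noteq> 0" using \<mu> T unfolding \<mu>_def by linarith
    have "4 * D powr q / \<epsilon> \<ge> 0" using \<epsilon> by simp
    then show "2 * C * real K \<le> \<bar>real n * expectation (\<lambda>\<omega>. g j (X (1 / n) \<omega>))\<bar>"
      using \<mu> unfolding \<mu>_def[symmetric] T_def by linarith
    show "real n * expectation (\<lambda>\<omega>. (g j (X (1 / n) \<omega>))\<^sup>2) \<le>
        \<epsilon> * (real n * expectation (\<lambda>\<omega>. g j (X (1 / n) \<omega>)))\<^sup>2 / 4" using var unfolding \<mu>_def .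
  qed measurable
qed

end

subsection \<open>Central limit theorem\<close>

text \<open>Fubini's theorem on the product of the two laws. It replaces conditioning: with the past
  frozen in \<open>Y\<close>, the next increment is averaged separately, which is the form of the
  Markov property used in \<open>char_iterate\<close> and \<open>expected_resets\<close>.\<close>

lemma (in prob_space) indep_var_expectation_iterated:
  fixes H :: "'b \<times> 'b \<Rightarrow> 'd::{banach, second_countable_topology}"
  assumes iv: "indep_var S Y T Z" and H [measurable]: "H \<in> borel_measurable (S \<Otimes>\<^sub>M T)"
    and bd: "\<And>p. norm (H p) \<le> C"
  shows "expectation (\<lambda>\<omega>. H (Y \<omega>, Z \<omega>)) = expectation (\<lambda>\<omega>. expectation (\<lambda>\<omega>'. H (Y \<omega>, Z \<omega>')))"
proof -
  have [measurable]: "Y \<in> measurable M S" "Z \<in> measurable M T"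
    and eq: "distr M S Y \<Otimes>\<^sub>M distr M T Z = distr M (S \<Otimes>\<^sub>M T) (\<lambda>x. (Y x, Z x))"
    using iv by (auto simp: indep_var_distribution_eq)
  interpret DY: prob_space "distr M S Y" by (rule prob_space_distr) simp
  interpret DZ: prob_space "distr M T Z" by (rule prob_space_distr) simp
  interpret P: pair_prob_space "distr M S Y" "distr M T Z" ..
  have "expectation (\<lambda>\<omega>. H (Y \<omega>, Z \<omega>)) = integral\<^sup>L (distr M (S \<Otimes>\<^sub>M T) (\<lambda>x. (Y x, Z x))) H"
    by (subst integral_distr) auto
  also have "\<dots> = integral\<^sup>L (distr M S Y \<Otimes>\<^sub>M distr M T Z) H" by (simp add: eq)
  also have "\<dots> = (\<integral>y. (\<integral>z. H (y, z) \<partial>distr M T Z) \<partial>distr M S Y)"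
  proof (rule P.integral_fst'[symmetric])
    show "integrable (distr M S Y \<Otimes>\<^sub>M distr M T Z) H"
      by (rule P.integrable_const_bound[of _ C]) (use bd in auto)
  qed
  also have "\<dots> = (\<integral>y. expectation (\<lambda>\<omega>'. H (y, Z \<omega>')) \<partial>distr M S Y)"
    by (intro Bochner_Integration.integral_cong refl) (subst integral_distr; simp)
  also have "\<dots> = expectation (\<lambda>\<omega>. expectation (\<lambda>\<omega>'. H (Y \<omega>, Z \<omega>')))"
    by (subst integral_distr) auto
  finally show ?thesis .
qed

text \<open>The damping factor \<open>k\<close> keeps both polynomial terms bounded uniformly in
  \<kappa> a, since v / (1 + v^2) and v^2 / (1 + v^2) are at most 1. This serves increments too
  large for a Taylor expansion.\<close>

lemma iexp_expansion_crude:
  fixes \<kappa> P a k W u :: real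
  assumes "a \<ge> 0" "\<kappa> \<ge> 0" "W \<ge> 0" and P: "\<bar>P\<bar> \<le> W * a" and k: "k = 1 / (1 + (\<kappa> * a)\<^sup>2)"
  shows "cmod (iexp u - 1 - \<i> * complex_of_real (\<kappa> * P * k) + complex_of_real ((\<kappa> * P)\<^sup>2 * k / 2)) \<le> 2 + W + W\<^sup>2"
proof -
  define v where "v = \<kappa> * a"
  have v: "v \<ge> 0" using assms by (simp add: v_def)
  have d: "1 + v\<^sup>2 > 0" by (simp add: add_pos_nonneg)
  have k0: "k > 0" using d by (simp add: k v_def)
  have "0 \<le> (v - 1)\<^sup>2" by simp
  then have "v \<le> 1 + v\<^sup>2" using v by (simp add: power2_diff)
  then have vk: "v * k \<le> 1" using d unfolding k v_def[symmetric] by simp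
  have v2k: "v\<^sup>2 * k \<le> 1" using d unfolding k v_def[symmetric] by simp
  have lP: "\<kappa> * \<bar>P\<bar> \<le> W * v" using mult_left_mono[OF P \<open>\<kappa> \<ge> 0\<close>] by (simp add: v_def mult_ac)
  have a1: "\<bar>\<kappa> * P * k\<bar> \<le> W"
  proof -
    have "\<bar>\<kappa> * P * k\<bar> = \<kappa> * \<bar>P\<bar> * k" using k0 assms by (simp add: abs_mult)
    also have "\<dots> \<le> W * v * k" using lP k0 by (intro mult_right_mono) auto
    also have "\<dots> \<le> W * 1" using mult_left_mono[OF vk \<open>W \<ge> 0\<close>] by (simp only: mult.assoc)
    finally show ?thesis by simp
  qed
  have a2: "\<bar>(\<kappa> * P)\<^sup>2 * k / 2\<bar> \<le> W\<^sup>2"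
  proof -
    have "(\<kappa> * P)\<^sup>2 \<le> (W * v)\<^sup>2"
      using lP assms by (intro abs_le_square_iff[THEN iffD1]) (auto simp: abs_mult v)
    then have "(\<kappa> * P)\<^sup>2 * k \<le> W\<^sup>2 * (v\<^sup>2 * k)" using k0 by (simp add: power_mult_distrib mult_right_mono mult.assoc[symmetric])
    also have "\<dots> \<le> W\<^sup>2 * 1" using v2k by (intro mult_left_mono) auto
    finally have "(\<kappa> * P)\<^sup>2 * k \<le> W\<^sup>2" by simp
    moreover have "0 \<le> (\<kappa> * P)\<^sup>2 * k" using k0 by simp
    ultimately show ?thesis by simp
  qed
  have "cmod (iexp u - 1 - \<i> * complex_of_real (\<kappa> * P * k) + complex_of_real ((\<kappa> * P)\<^sup>2 * k / 2))
      \<le> cmod (iexp u) + cmod 1 + cmod (\<i> * complex_of_real (\<kappa> * P * k)) + cmod (complex_of_real ((\<kappa> * P)\<^sup>2 * k / 2))"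
    by (meson add_mono norm_triangle_le norm_triangle_ineq4 norm_triangle_ineq order_trans order_refl)
  also have "\<dots> \<le> 2 + W + W\<^sup>2" using a1 a2 unfolding norm_mult norm_of_real by simp
  finally show ?thesis .
qed

text \<open>A cubic error has no useful generator limit of its own, so it is split by Young's
  inequality into \<delta> times a square and 1 / \<delta> times a fourth power. With
  \<open>v = \<kappa> * a\<close> the damped square is \<open>v\<^sup>2 * k\<close>, and the damped
  fourth power is its square, which equals \<open>v\<^sup>2 * (k - k\<^sup>2)\<close>. The first
  comes with a small coefficient; the second has a weight that vanishes at the identity, so the
  Gaussian part does not contribute to it.\<close>

lemma iexp_expansion:
  fixes \<kappa> \<delta> \<Delta> P a k W C :: real
  assumes a: "0 \<le> a" "a \<le> 1" and \<kappa>: "\<kappa> \<ge> 1" and \<delta>: "0 < \<delta>" "\<delta> \<le> 1" and C: "C \<ge> 0" and W: "W \<ge> 0"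
    and \<Delta>: "\<bar>\<Delta> - P\<bar> \<le> C * a\<^sup>2" and P: "\<bar>P\<bar> \<le> W * a" and k: "k = 1 / (1 + (\<kappa> * a)\<^sup>2)"
  shows "cmod (iexp (\<kappa> * \<Delta>) - 1 - \<i> * complex_of_real (\<kappa> * P * k) + complex_of_real ((\<kappa> * P)\<^sup>2 * k / 2))
    \<le> 16 * (1 + W + C) ^ 3 * ((1 / \<kappa> + \<delta>) * ((\<kappa> * a)\<^sup>2 * k) + 1 / \<delta> * ((\<kappa> * a)\<^sup>2 * (k - k\<^sup>2)))"
    (is "?L \<le> 16 * ?E ^ 3 * ?R")
proof -
  define v where "v = \<kappa> * a"
  have v: "v \<ge> 0" using a \<kappa> by (simp add: v_def)
  have d: "1 + v\<^sup>2 > 0" by (simp add: add_pos_nonneg)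
  have k0: "k > 0" using d by (simp add: k v_def)
  have k1: "1 - k = v\<^sup>2 * k" using d unfolding k v_def[symmetric] by (simp add: field_simps)
  have kk: "v\<^sup>2 * (k - k\<^sup>2) = (v\<^sup>2 * k)\<^sup>2"
  proof -
    have "v\<^sup>2 * (k - k\<^sup>2) = v\<^sup>2 * (k * (1 - k))" by (simp add: power2_eq_square algebra_simps)
    then show ?thesis unfolding k1 by (simp only: power2_eq_square mult_ac)
  qed
  have "0 \<le> v\<^sup>2 * k" using k0 by simp
  then have "k \<le> 1" using k1 by linarith
  then have v2k: "v\<^sup>2 * k \<le> v\<^sup>2" by (rule mult_left_le) simp
  define E where "E = 1 + W + C"
  have E: "E \<ge> 1" using W C by (simp add: E_def)
  have E3: "E \<le> E ^ 3" "E\<^sup>2 \<le> E ^ 3" "1 \<le> E ^ 3" using E by (auto intro: self_le_power power_increasing one_le_power)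
  have R1: "0 \<le> (1 / \<kappa> + \<delta>) * (v\<^sup>2 * k)" using \<kappa> \<delta> k0 by simp
  have Req: "?R = (1 / \<kappa> + \<delta>) * (v\<^sup>2 * k) + 1 / \<delta> * (v\<^sup>2 * k)\<^sup>2"
    unfolding v_def[symmetric] kk ..
  have lP: "\<kappa> * \<bar>P\<bar> \<le> W * v" using mult_left_mono[OF P, of \<kappa>] \<kappa> by (simp add: v_def mult_ac)
  show ?thesis
  proof (cases "v \<le> 1")
    \<comment> \<open>For v > 1 the bracket on the right is at least 1/4, so the crude bound is
      enough; this case accounts for the factor 16.\<close>
    case False
    then have "v\<^sup>2 \<ge> 1" by simp
    then have "v\<^sup>2 * k \<ge> 1 / 2" using d unfolding k v_def[symmetric] by (simp add: field_simps)
    then have "(v\<^sup>2 * k)\<^sup>2 \<ge> (1 / 2)\<^sup>2" by (intro power_mono) auto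
    then have "1 / 4 \<le> 1 * (v\<^sup>2 * k)\<^sup>2" by (simp add: power2_eq_square)
    also have "\<dots> \<le> 1 / \<delta> * (v\<^sup>2 * k)\<^sup>2" using \<delta> by (intro mult_right_mono) auto
    finally have R: "1 / 4 \<le> ?R" unfolding Req using R1 by linarith
    have "?L \<le> 2 + W + W\<^sup>2" by (rule iexp_expansion_crude[OF a(1) _ W P k]) (use \<kappa> in simp)
    also have "\<dots> \<le> 4 * E ^ 3"
    proof -
      have "W \<le> E" using C by (simp add: E_def)
      moreover have "W\<^sup>2 \<le> E\<^sup>2" using W C by (intro power_mono) (auto simp: E_def)
      ultimately show ?thesis using E3 by linarith
    qed
    also have "\<dots> = 16 * E ^ 3 * (1 / 4)" by simp
    also have "\<dots> \<le> 16 * E ^ 3 * ?R" using R E by (intro mult_left_mono) auto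
    finally show ?thesis by (simp add: E_def)
  next
    case True
    have "v\<^sup>2 \<le> 1" using True v by (simp add: power_le_one)
    then have "k \<ge> 1 / 2" unfolding k v_def[symmetric] using d by (simp add: pos_le_divide_eq)
    then have v2: "v\<^sup>2 \<le> 2 * (v\<^sup>2 * k)" using mult_left_mono[of 1 "2 * k" "v\<^sup>2"] by simp
    then have "(v\<^sup>2)\<^sup>2 \<le> (2 * (v\<^sup>2 * k))\<^sup>2" by (intro power_mono) auto
    then have v4: "v ^ 4 \<le> 4 * (v\<^sup>2 * k)\<^sup>2" by (simp add: power_mult_distrib power_mult[symmetric])
    \<comment> \<open>Young's inequality, with \<delta> as the free parameter.\<close>
    have v3: "v ^ 3 \<le> \<delta> * v\<^sup>2 + v ^ 4 / \<delta>"
    proof -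
      have "0 \<le> (v - \<delta>)\<^sup>2 + v * \<delta>" using v \<delta> by simp
      then have "v * \<delta> \<le> \<delta>\<^sup>2 + v\<^sup>2" by (simp add: power2_diff algebra_simps)
      then have "v \<le> \<delta> + v\<^sup>2 / \<delta>" using \<delta> by (simp add: field_simps power2_eq_square)
      then have "v\<^sup>2 * v \<le> v\<^sup>2 * (\<delta> + v\<^sup>2 / \<delta>)" by (rule mult_left_mono) simp
      then show ?thesis by (simp add: power2_eq_square power3_eq_cube power4_eq_xxxx algebra_simps)
    qed
    have Da: "\<bar>\<Delta>\<bar> \<le> E * a"
    proof -
      have "C * a\<^sup>2 \<le> C * a" using a C by (intro mult_left_mono) (auto simp: power2_eq_square mult_left_le)
      then have "\<bar>\<Delta>\<bar> \<le> W * a + C * a" using \<Delta> P by linarith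
      also have "\<dots> \<le> E * a" using a by (simp add: E_def algebra_simps)
      finally show ?thesis .
    qed
    have lD: "\<bar>\<kappa> * \<Delta>\<bar> \<le> E * v" using mult_left_mono[OF Da, of \<kappa>] \<kappa> by (simp add: v_def abs_mult mult_ac)
    \<comment> \<open>Three sources of error: \<open>t1\<close> is the remainder of the exponential
      series, while \<open>t2\<close> and \<open>t3\<close> come from replacing \<Delta> by its
      linearisation \<open>P\<close> and inserting the damping, in the linear and in the quadratic
      term.\<close>
    have t1: "cmod (iexp (\<kappa> * \<Delta>) - (1 + \<i> * (\<kappa> * \<Delta>) - complex_of_real ((\<kappa> * \<Delta>)\<^sup>2 / 2))) \<le> E ^ 3 * v ^ 3"
    proof -
      have "(\<Sum>k\<le>2. (\<i> * complex_of_real (\<kappa> * \<Delta>)) ^ k / fact k) = 1 + \<i> * (\<kappa> * \<Delta>) - complex_of_real ((\<kappa> * \<Delta>)\<^sup>2 / 2)"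
        by (simp add: numeral_2_eq_2 power2_eq_square algebra_simps)
      then have "cmod (iexp (\<kappa> * \<Delta>) - (1 + \<i> * (\<kappa> * \<Delta>) - complex_of_real ((\<kappa> * \<Delta>)\<^sup>2 / 2))) \<le> \<bar>\<kappa> * \<Delta>\<bar> ^ 3 / 6"
        using iexp_approx1[of "\<kappa> * \<Delta>" 2] by (simp add: fact_numeral eval_nat_numeral)
      also have "\<dots> \<le> \<bar>\<kappa> * \<Delta>\<bar> ^ 3" by simp
      also have "\<dots> \<le> (E * v) ^ 3" by (rule power_mono[OF lD]) simp
      finally show ?thesis by (simp add: power_mult_distrib)
    qed
    have t2: "\<bar>\<kappa> * \<Delta> - \<kappa> * P * k\<bar> \<le> E ^ 3 * (v\<^sup>2 / \<kappa>) + E ^ 3 * v ^ 3"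
    proof -
      have "\<bar>\<kappa> * \<Delta> - \<kappa> * P\<bar> = \<kappa> * \<bar>\<Delta> - P\<bar>"
        using \<kappa> unfolding right_diff_distrib[symmetric] by (simp add: abs_mult)
      also have "\<dots> \<le> \<kappa> * (C * a\<^sup>2)" using \<Delta> \<kappa> by (intro mult_left_mono) auto
      also have "\<dots> = C * (v\<^sup>2 / \<kappa>)" using \<kappa> by (simp add: v_def power2_eq_square field_simps)
      also have "\<dots> \<le> E ^ 3 * (v\<^sup>2 / \<kappa>)"
        using W E3 \<kappa> by (intro mult_right_mono) (auto simp: E_def intro: order_trans[OF _ E3(1)[unfolded E_def]])
      finally have 1: "\<bar>\<kappa> * \<Delta> - \<kappa> * P\<bar> \<le> E ^ 3 * (v\<^sup>2 / \<kappa>)" .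
      have "\<bar>\<kappa> * P - \<kappa> * P * k\<bar> = \<kappa> * \<bar>P\<bar> * (v\<^sup>2 * k)"
      proof -
        have "\<kappa> * P - \<kappa> * P * k = (\<kappa> * P) * (v\<^sup>2 * k)" unfolding k1[symmetric] by (simp add: algebra_simps)
        then show ?thesis using \<kappa> k0 by (simp add: abs_mult)
      qed
      also have "\<dots> \<le> (W * v) * v\<^sup>2"
        by (rule mult_mono[OF lP v2k]) (use v W k0 in auto)
      also have "\<dots> \<le> E ^ 3 * v ^ 3"
      proof -
        have "W \<le> E ^ 3" using C E3 by (simp add: E_def)
        then have "W * v ^ 3 \<le> E ^ 3 * v ^ 3" using v by (intro mult_right_mono) auto
        then show ?thesis by (simp add: power2_eq_square power3_eq_cube mult_ac)
      qed
      finally show ?thesis using 1 by linarith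
    qed
    have t3: "\<bar>(\<kappa> * \<Delta>)\<^sup>2 / 2 - (\<kappa> * P)\<^sup>2 * k / 2\<bar> \<le> E ^ 3 * (v\<^sup>2 / \<kappa>) + E ^ 3 * v ^ 3"
    proof -
      have "\<bar>(\<kappa> * \<Delta>)\<^sup>2 - (\<kappa> * P)\<^sup>2\<bar> = \<kappa>\<^sup>2 * (\<bar>\<Delta> - P\<bar> * \<bar>\<Delta> + P\<bar>)"
      proof -
        have "(\<kappa> * \<Delta>)\<^sup>2 - (\<kappa> * P)\<^sup>2 = \<kappa>\<^sup>2 * ((\<Delta> - P) * (\<Delta> + P))" by (simp add: power2_eq_square algebra_simps)
        then show ?thesis by (simp add: abs_mult)
      qed
      also have "\<dots> \<le> \<kappa>\<^sup>2 * ((C * a\<^sup>2) * (2 * E * a))"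
      proof (intro mult_left_mono mult_mono \<Delta>)
        have "W * a \<le> E * a" using a C by (intro mult_right_mono) (auto simp: E_def)
        then show "\<bar>\<Delta> + P\<bar> \<le> 2 * E * a" using Da P by linarith
      qed (use C a in auto)
      also have "\<dots> = 2 * (C * E) * (v\<^sup>2 * a)" by (simp add: v_def power2_eq_square mult_ac)
      also have "\<dots> \<le> 2 * E ^ 3 * (v\<^sup>2 / \<kappa>)"
      proof (rule mult_mono)
        have "C * E \<le> E * E" using W E by (intro mult_right_mono) (auto simp: E_def)
        then show "2 * (C * E) \<le> 2 * E ^ 3" using E3(2) by (simp add: power2_eq_square)
        have "a \<le> 1 / \<kappa>" using True \<kappa> by (simp add: v_def field_simps)
        then have "v\<^sup>2 * a \<le> v\<^sup>2 * (1 / \<kappa>)" by (rule mult_left_mono) simp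
        then show "v\<^sup>2 * a \<le> v\<^sup>2 / \<kappa>" by simp
      qed (use E a in auto)
      finally have 1: "\<bar>(\<kappa> * \<Delta>)\<^sup>2 - (\<kappa> * P)\<^sup>2\<bar> \<le> 2 * E ^ 3 * (v\<^sup>2 / \<kappa>)" .
      have "(\<kappa> * P)\<^sup>2 - (\<kappa> * P)\<^sup>2 * k = (\<kappa> * P)\<^sup>2 * (v\<^sup>2 * k)" unfolding k1[symmetric] by (simp add: algebra_simps)
      then have "\<bar>(\<kappa> * P)\<^sup>2 - (\<kappa> * P)\<^sup>2 * k\<bar> = (\<kappa> * P)\<^sup>2 * (v\<^sup>2 * k)" using k0 by simp
      also have "\<dots> \<le> (W * v)\<^sup>2 * v"
      proof (rule mult_mono)
        show "(\<kappa> * P)\<^sup>2 \<le> (W * v)\<^sup>2"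
          using lP \<kappa> W v by (intro abs_le_square_iff[THEN iffD1]) (auto simp: abs_mult)
        have "v\<^sup>2 * k \<le> v\<^sup>2" by (rule v2k)
        also have "\<dots> \<le> v" using v True by (simp add: power2_eq_square mult_left_le)
        finally show "v\<^sup>2 * k \<le> v" .
      qed (use k0 in auto)
      also have "\<dots> = W\<^sup>2 * v ^ 3" by (simp add: power2_eq_square power3_eq_cube mult_ac)
      also have "\<dots> \<le> E ^ 3 * v ^ 3"
      proof (rule mult_right_mono)
        have "W\<^sup>2 \<le> E\<^sup>2" using W C by (intro power_mono) (auto simp: E_def)
        then show "W\<^sup>2 \<le> E ^ 3" using E3 by linarith
      qed (use v in simp)
      finally have 2: "\<bar>(\<kappa> * P)\<^sup>2 - (\<kappa> * P)\<^sup>2 * k\<bar> \<le> E ^ 3 * v ^ 3" .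
      have "0 \<le> E ^ 3 * v ^ 3" using E v by simp
      then show ?thesis using 1 2 by linarith
    qed
    have eq: "iexp (\<kappa> * \<Delta>) - 1 - \<i> * complex_of_real (\<kappa> * P * k) + complex_of_real ((\<kappa> * P)\<^sup>2 * k / 2) =
      (iexp (\<kappa> * \<Delta>) - (1 + \<i> * (\<kappa> * \<Delta>) - complex_of_real ((\<kappa> * \<Delta>)\<^sup>2 / 2)))
      + \<i> * complex_of_real (\<kappa> * \<Delta> - \<kappa> * P * k) - complex_of_real ((\<kappa> * \<Delta>)\<^sup>2 / 2 - (\<kappa> * P)\<^sup>2 * k / 2)"
      by (simp add: algebra_simps)
    have "?L \<le> cmod (iexp (\<kappa> * \<Delta>) - (1 + \<i> * (\<kappa> * \<Delta>) - complex_of_real ((\<kappa> * \<Delta>)\<^sup>2 / 2)))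
      + \<bar>\<kappa> * \<Delta> - \<kappa> * P * k\<bar> + \<bar>(\<kappa> * \<Delta>)\<^sup>2 / 2 - (\<kappa> * P)\<^sup>2 * k / 2\<bar>"
      unfolding eq
      by (rule order_trans[OF norm_triangle_ineq4], rule add_mono, rule order_trans[OF norm_triangle_ineq])
         (simp_all add: norm_mult del: of_real_diff of_real_divide of_real_mult of_real_power)
    also have "\<dots> \<le> E ^ 3 * (2 * (v\<^sup>2 / \<kappa>) + 3 * v ^ 3)" using t1 t2 t3 by (simp add: algebra_simps)
    also have "\<dots> \<le> E ^ 3 * (16 * ?R)"
    proof (rule mult_left_mono)
      have "v\<^sup>2 / \<kappa> \<le> 2 * (v\<^sup>2 * k) / \<kappa>" using v2 \<kappa> by (intro divide_right_mono) auto
      moreover have "\<delta> * v\<^sup>2 \<le> \<delta> * (2 * (v\<^sup>2 * k))" using v2 \<delta> by (intro mult_left_mono) auto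
      moreover have "v ^ 4 / \<delta> \<le> 4 * (v\<^sup>2 * k)\<^sup>2 / \<delta>" using v4 \<delta> by (intro divide_right_mono) auto
      ultimately have "2 * (v\<^sup>2 / \<kappa>) + 3 * v ^ 3 \<le> 4 * (v\<^sup>2 * k / \<kappa>) + 6 * (\<delta> * (v\<^sup>2 * k)) + 12 * ((v\<^sup>2 * k)\<^sup>2 / \<delta>)"
        using v3 by simp
      moreover have "16 * ?R = 16 * (v\<^sup>2 * k / \<kappa>) + 16 * (\<delta> * (v\<^sup>2 * k)) + 16 * ((v\<^sup>2 * k)\<^sup>2 / \<delta>)"
        unfolding Req by (simp add: algebra_simps)
      moreover have "v\<^sup>2 * k / \<kappa> \<ge> 0" "\<delta> * (v\<^sup>2 * k) \<ge> 0" "(v\<^sup>2 * k)\<^sup>2 / \<delta> \<ge> 0" using \<kappa> \<delta> k0 by auto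
      ultimately show "2 * (v\<^sup>2 / \<kappa>) + 3 * v ^ 3 \<le> 16 * ?R" by linarith
    qed (use E in simp)
    also have "E ^ 3 * (16 * ?R) = 16 * E ^ 3 * ?R" by (simp only: mult_ac)
    finally show ?thesis unfolding E_def .
  qed
qed

section \<open>Characteristic function of a single small step\<close>

context homogeneous_levy
begin

text \<open>Damping in all coordinates at size 1 / \<kappa>, the scale at which an exponential of
  frequency \<kappa> oscillates.\<close>

definition iso_damp :: "real \<Rightarrow> (real, 'm) vec \<Rightarrow> real" where
  "iso_damp \<kappa> = damp (\<lambda>_. \<kappa>\<^sup>2)"

lemma iso_damp_zero [simp]: "iso_damp \<kappa> 0 = 1"
  by (simp add: iso_damp_def)

lemma iso_damp_eq: "iso_damp \<kappa> x = 1 / (1 + \<kappa>\<^sup>2 * xi_sq x)"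
  by (simp add: iso_damp_def damp_def xi_sq_def sum_distrib_left)

lemma iso_damp_bounds: "0 < iso_damp \<kappa> x" "iso_damp \<kappa> x \<le> 1"
  unfolding iso_damp_def by (rule damp_bounds; simp)+

lemma Ck_iso_damp: "Ck_on_space 2 (iso_damp \<kappa>)"
  unfolding iso_damp_def by (rule Ck_damp) simp

lemma iso_damp_measurable [measurable]: "iso_damp \<kappa> \<in> borel_measurable borel"
  unfolding iso_damp_def by measurable

lemma iso_damp_complement: "1 - iso_damp \<kappa> x = \<kappa>\<^sup>2 * xi_sq x * iso_damp \<kappa> x"
proof -
  have "1 + \<kappa>\<^sup>2 * xi_sq x > 0" using xi_sq_nonneg[of x] by (simp add: add_pos_nonneg)
  then show ?thesis by (simp add: iso_damp_eq field_simps)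
qed

lemma iso_damp_vanishes:
  assumes "xi_sq y > 0"
  shows "((\<lambda>\<kappa>. iso_damp \<kappa> y) \<longlongrightarrow> 0) at_top"
proof -
  have "filterlim (\<lambda>\<kappa>::real. \<kappa> * \<kappa>) at_top at_top"
    by (intro filterlim_at_top_mult_at_top filterlim_ident)
  then have "filterlim (\<lambda>\<kappa>. 1 + xi_sq y * \<kappa>\<^sup>2) at_top at_top"
    using assms unfolding power2_eq_square
    by (intro filterlim_tendsto_add_at_top[OF tendsto_const] filterlim_tendsto_pos_mult_at_top[OF tendsto_const])
  then have "((\<lambda>\<kappa>. 1 / (1 + xi_sq y * \<kappa>\<^sup>2)) \<longlongrightarrow> 0) at_top"
    by (intro tendsto_divide_0[OF tendsto_const] filterlim_at_top_imp_at_infinity)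
  then show ?thesis by (simp add: iso_damp_eq mult.commute)
qed

text \<open>Dominated convergence with majorant \<open>xi_sq\<close>, integrable by the definition
  of a Levy measure. Where \<open>xi_sq\<close> vanishes the majorant already forces the integrand
  to be 0, so the limit has to be checked only where the damping acts.\<close>

lemma nu_dominated_vanishing:
  fixes g :: "real \<Rightarrow> (real, 'm) vec \<Rightarrow> real"
  assumes [measurable]: "\<And>\<kappa>. g \<kappa> \<in> borel_measurable borel"
    and dom: "\<And>\<kappa> y. \<kappa> \<ge> 1 \<Longrightarrow> \<bar>g \<kappa> y\<bar> \<le> xi_sq y"
    and lim: "\<And>y. xi_sq y > 0 \<Longrightarrow> ((\<lambda>\<kappa>. g \<kappa> y) \<longlongrightarrow> 0) at_top"
  shows "((\<lambda>\<kappa>. \<integral>y. g \<kappa> y \<partial>\<nu>) \<longlongrightarrow> 0) at_top"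
proof -
  have "((\<lambda>\<kappa>. \<integral>y. g \<kappa> y \<partial>\<nu>) \<longlongrightarrow> (\<integral>y. 0 \<partial>\<nu>)) at_top"
  proof (rule integral_dominated_convergence_at_top[where w = xi_sq])
    show "\<forall>\<^sub>F \<kappa> in at_top. AE y in \<nu>. norm (g \<kappa> y) \<le> xi_sq y"
      using eventually_ge_at_top[of "1::real"] by eventually_elim (use dom in auto)
    show "AE y in \<nu>. ((\<lambda>\<kappa>. g \<kappa> y) \<longlongrightarrow> 0) at_top"
    proof (rule AE_I2)
      fix y
      show "((\<lambda>\<kappa>. g \<kappa> y) \<longlongrightarrow> 0) at_top"
      proof (cases "xi_sq y > 0")
        case False
        then have "xi_sq y = 0" using xi_sq_nonneg[of y] by linarith
        then have "g \<kappa> y = 0" if "\<kappa> \<ge> 1" for \<kappa> using dom[OF that, of y] by simp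
        then show ?thesis
          by (intro tendsto_eventually eventually_mono[OF eventually_ge_at_top[of 1]])
      qed (rule lim)
    qed
  qed (auto intro: integrable_xi_sq)
  then show ?thesis by simp
qed

lemma xi_le_sqrt: "\<bar>\<xi> i x\<bar> \<le> sqrt (xi_sq x)"
  using xi_le_xi_sq[of i x] by (metis real_sqrt_abs real_sqrt_le_iff)

definition xi_lie :: "'m \<Rightarrow> 'm \<Rightarrow> (real, 'm) vec \<Rightarrow> real" where
  "xi_lie j i y = lie (axis i 1) (\<xi> j) y"

lemma xi_taylor:
  obtains C where "C \<ge> 0" and "\<And>y z. norm z \<le> 1 \<Longrightarrow>
      \<bar>\<xi> j (y \<otimes> z) - \<xi> j y - (\<Sum>i\<in>UNIV. z $ i * xi_lie j i y)\<bar> \<le> C * (norm z)\<^sup>2"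
proof -
  obtain R where R: "R > 0" "\<And>i x. norm x > R \<Longrightarrow> \<xi> i x = 0" using xi_support by blast
  show thesis using mult_taylor[OF Ck_xi[of 2 j] R(2)] that unfolding xi_lie_def by blast
qed

lemma xi_lie_bounded:
  obtains W where "W \<ge> 0" and "\<And>i y. \<bar>xi_lie j i y\<bar> \<le> W"
proof -
  obtain R where R: "R > 0" "\<And>i x. norm x > R \<Longrightarrow> \<xi> i x = 0" using xi_support by blast
  have "\<exists>W. W \<ge> 0 \<and> (\<forall>y. \<bar>xi_lie j i y\<bar> \<le> W)" for i
    using lie_bounded[OF Ck_xi[of 2 j] R(2), where w = "axis i 1"] unfolding xi_lie_def by metis
  then obtain W where W: "\<And>i. W i \<ge> 0" "\<And>i y. \<bar>xi_lie j i y\<bar> \<le> W i" by metis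
  show thesis
  proof (rule that[of "\<Sum>i\<in>UNIV. W i"])
    show "\<bar>xi_lie j i y\<bar> \<le> (\<Sum>i\<in>UNIV. W i)" for i y
      using W by (intro order_trans[OF W(2)] member_le_sum) auto
  qed (use W in \<open>simp add: sum_nonneg\<close>)
qed

lemma xi_lie_continuous: "continuous_on UNIV (xi_lie j i)"
proof -
  have "Ck_on_space (Suc 0) (\<xi> j)" by (rule Ck_xi)
  from Ck_imp_continuous[OF Ck_lie[OF this]] show ?thesis by (simp add: xi_lie_def[abs_def])
qed

lemma xi_lie_measurable [measurable]: "xi_lie j i \<in> borel_measurable borel"
  by (intro borel_measurable_continuous_onI xi_lie_continuous)

lemma xi_lie_zero: "xi_lie j i 0 = (if i = j then 1 else 0)"
proof -
  obtain \<rho> where \<rho>: "\<rho> > 0" "\<And>i x. norm x \<le> \<rho> \<Longrightarrow> \<xi> i x = x $ i" using xi_linear_near by blast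
  have "((\<lambda>t. t * axis i 1 $ j) has_real_derivative (axis i 1 $ j)) (at 0)"
    by (auto intro!: derivative_eq_intros)
  then have "((\<lambda>t. \<xi> j (0 \<otimes> (t *\<^sub>R axis i 1))) has_real_derivative (axis i 1 $ j)) (at 0)"
    by (rule has_field_derivative_transform_within_open[where S = "ball 0 \<rho>"])
       (use \<rho> in \<open>auto simp: dist_norm\<close>)
  from lie_eqI[OF Ck_xi this] show ?thesis by (simp add: xi_lie_def axis_def)
qed

text \<open>The starting point \<open>y\<close> enters the left side only through bounded
  derivatives \<open>xi_lie j i y\<close> and a uniform Taylor error, so the right side can be a
  function of the increment \<open>x\<close> alone. Increments outside the linear region are charged
  to \<open>1 - bump \<rho> x\<close>, whose expectation is of the order of the time step.\<close>

lemma iexp_remainder: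
  obtains C \<rho> where "C \<ge> 0" "\<rho> > 0"
    and "\<And>\<kappa> \<delta> x y. \<kappa> \<ge> 1 \<Longrightarrow> 0 < \<delta> \<Longrightarrow> \<delta> \<le> 1 \<Longrightarrow>
      cmod (iexp (\<kappa> * (\<xi> j (y \<otimes> x) - \<xi> j y)) - 1
        - \<i> * complex_of_real (\<kappa> * (\<Sum>i\<in>UNIV. \<xi> i x * xi_lie j i y) * iso_damp \<kappa> x)
        + complex_of_real ((\<kappa> * (\<Sum>i\<in>UNIV. \<xi> i x * xi_lie j i y))\<^sup>2 * iso_damp \<kappa> x / 2))
      \<le> C * ((1 / \<kappa> + \<delta>) * (\<kappa>\<^sup>2 * (xi_sq x * iso_damp \<kappa> x))
          + 1 / \<delta> * (\<kappa>\<^sup>2 * (xi_sq x * (iso_damp \<kappa> x - (iso_damp \<kappa> x)\<^sup>2))) + (1 - bump \<rho> x))"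
proof -
  obtain C where C: "C \<ge> 0" "\<And>y z. norm z \<le> 1 \<Longrightarrow>
      \<bar>\<xi> j (y \<otimes> z) - \<xi> j y - (\<Sum>i\<in>UNIV. z $ i * xi_lie j i y)\<bar> \<le> C * (norm z)\<^sup>2"
    using xi_taylor by blast
  obtain W0 where W0: "W0 \<ge> 0" "\<And>i y. \<bar>xi_lie j i y\<bar> \<le> W0" using xi_lie_bounded by blast
  obtain \<rho>0 where \<rho>0: "\<rho>0 > 0" "\<And>i x. norm x \<le> \<rho>0 \<Longrightarrow> \<xi> i x = x $ i" using xi_linear_near by blast
  define \<rho> where "\<rho> = min \<rho>0 1"
  have \<rho>: "\<rho> > 0" using \<rho>0 by (simp add: \<rho>_def)
  define W where "W = real CARD('m) * W0"
  have W: "W \<ge> 0" using W0 by (simp add: W_def)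
  define D where "D = 16 * (1 + W + C) ^ 3 + (2 + W + W\<^sup>2)"
  define P where "P y x = (\<Sum>i\<in>UNIV. \<xi> i x * xi_lie j i y)" for y x
  have P: "\<bar>P y x\<bar> \<le> W * sqrt (xi_sq x)" for y x
  proof -
    have "\<bar>P y x\<bar> \<le> (\<Sum>i\<in>UNIV. \<bar>\<xi> i x\<bar> * \<bar>xi_lie j i y\<bar>)"
      unfolding P_def by (rule order_trans[OF sum_abs]) (simp add: abs_mult)
    also have "\<dots> \<le> (\<Sum>i\<in>(UNIV::'m set). sqrt (xi_sq x) * W0)"
      by (intro sum_mono mult_mono xi_le_sqrt W0) (auto simp: xi_sq_nonneg)
    finally show ?thesis by (simp add: W_def mult_ac)
  qed
  show thesis
  proof (rule that[of D \<rho>])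
    show "D \<ge> 0" unfolding D_def using W C by (intro add_nonneg_nonneg mult_nonneg_nonneg zero_le_power) auto
    show "\<rho> > 0" by (rule \<rho>)
    fix \<kappa> \<delta> :: real and x y assume \<kappa>: "\<kappa> \<ge> 1" and \<delta>: "0 < \<delta>" "\<delta> \<le> 1"
    let ?h = "iso_damp \<kappa> x"
    let ?R1 = "(1 / \<kappa> + \<delta>) * (\<kappa>\<^sup>2 * (xi_sq x * ?h)) + 1 / \<delta> * (\<kappa>\<^sup>2 * (xi_sq x * (?h - ?h\<^sup>2)))"
    let ?L = "cmod (iexp (\<kappa> * (\<xi> j (y \<otimes> x) - \<xi> j y)) - 1 - \<i> * complex_of_real (\<kappa> * P y x * ?h)
        + complex_of_real ((\<kappa> * P y x)\<^sup>2 * ?h / 2))"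
    have hh: "?h - ?h\<^sup>2 \<ge> 0" using iso_damp_bounds[of \<kappa> x] by (simp add: power2_eq_square mult_left_le)
    have R1: "?R1 \<ge> 0"
      using \<kappa> \<delta> iso_damp_bounds(1)[of \<kappa> x] hh xi_sq_nonneg[of x]
      by (intro add_nonneg_nonneg mult_nonneg_nonneg) auto
    have k: "?h = 1 / (1 + (\<kappa> * sqrt (xi_sq x))\<^sup>2)"
      using xi_sq_nonneg[of x] by (simp add: iso_damp_eq power_mult_distrib)
    have b: "1 - bump \<rho> x \<ge> 0" using bump_bounds[of \<rho> x] by simp
    have "?L \<le> D * (?R1 + (1 - bump \<rho> x))"
    proof (cases "norm x \<le> \<rho>")
      case True
      then have x: "norm x \<le> 1" "\<And>i. \<xi> i x = x $ i" using \<rho>0(2) by (auto simp: \<rho>_def)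
      have "xi_sq x = (norm x)\<^sup>2"
        unfolding xi_sq_def x(2) norm_vec_def L2_set_def by (simp add: sum_nonneg)
      then have sx: "sqrt (xi_sq x) = norm x" by simp
      have sx2: "(\<kappa> * sqrt (xi_sq x))\<^sup>2 = \<kappa>\<^sup>2 * xi_sq x" using xi_sq_nonneg[of x] by (simp add: power_mult_distrib)
      have "?L \<le> 16 * (1 + W + C) ^ 3 * ((1 / \<kappa> + \<delta>) * ((\<kappa> * sqrt (xi_sq x))\<^sup>2 * ?h) + 1 / \<delta> * ((\<kappa> * sqrt (xi_sq x))\<^sup>2 * (?h - ?h\<^sup>2)))"
      proof (rule iexp_expansion[OF _ _ \<kappa> \<delta> C(1) W _ P k])
        show "\<bar>\<xi> j (y \<otimes> x) - \<xi> j y - P y x\<bar> \<le> C * (sqrt (xi_sq x))\<^sup>2"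
          using C(2)[OF x(1), of y] unfolding P_def x(2) sx .
      qed (use x sx in auto)
      also have "\<dots> = 16 * (1 + W + C) ^ 3 * ?R1" unfolding sx2 by (simp only: mult.assoc)
      also have "\<dots> \<le> D * (?R1 + (1 - bump \<rho> x))"
        unfolding D_def using R1 b W C by (intro mult_mono) auto
      finally show ?thesis .
    next
      case False
      then have "bump \<rho> x = 0" using \<rho> by (intro bump_outside) auto
      have "?L \<le> 2 + W + W\<^sup>2"
        by (rule iexp_expansion_crude[OF _ _ W P k]) (use \<kappa> xi_sq_nonneg[of x] in auto)
      also have "\<dots> \<le> D * 1" unfolding D_def using W C by simp
      also have "\<dots> \<le> D * (?R1 + (1 - bump \<rho> x))"
        using R1 \<open>bump \<rho> x = 0\<close> \<open>D \<ge> 0\<close> by (intro mult_left_mono) auto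
      finally show ?thesis .
    qed
    then show "cmod (iexp (\<kappa> * (\<xi> j (y \<otimes> x) - \<xi> j y)) - 1
        - \<i> * complex_of_real (\<kappa> * (\<Sum>i\<in>UNIV. \<xi> i x * xi_lie j i y) * iso_damp \<kappa> x)
        + complex_of_real ((\<kappa> * (\<Sum>i\<in>UNIV. \<xi> i x * xi_lie j i y))\<^sup>2 * iso_damp \<kappa> x / 2))
      \<le> D * ((1 / \<kappa> + \<delta>) * (\<kappa>\<^sup>2 * (xi_sq x * iso_damp \<kappa> x))
          + 1 / \<delta> * (\<kappa>\<^sup>2 * (xi_sq x * (iso_damp \<kappa> x - (iso_damp \<kappa> x)\<^sup>2))) + (1 - bump \<rho> x))"
      unfolding P_def .
  qed
qed

definition damped_cov :: "real \<Rightarrow> real \<Rightarrow> 'm \<Rightarrow> 'm \<Rightarrow> real" where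
  "damped_cov \<kappa> s i l = expectation (\<lambda>\<omega>. \<xi> i (X s \<omega>) * \<xi> l (X s \<omega>) * iso_damp \<kappa> (X s \<omega>))"

definition damped_mean :: "real \<Rightarrow> real \<Rightarrow> 'm \<Rightarrow> real" where
  "damped_mean \<kappa> s i = expectation (\<lambda>\<omega>. \<xi> i (X s \<omega>) * iso_damp \<kappa> (X s \<omega>))"

text \<open>In effect a damped fourth moment: the weight is \<open>iso_damp\<close> times
  \<open>1 - iso_damp\<close>, and the second factor is of second order at the identity. Hence its
  small-time rate contains jumps only.\<close>

definition damped_defect :: "real \<Rightarrow> real \<Rightarrow> real" where
  "damped_defect \<kappa> s = (\<Sum>i\<in>UNIV. expectation (\<lambda>\<omega>. \<xi> i (X s \<omega>) * \<xi> i (X s \<omega>) *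
      (iso_damp \<kappa> (X s \<omega>) - (iso_damp \<kappa> (X s \<omega>))\<^sup>2)))"

text \<open>The Gaussian variance rate of \<open>\<xi> j\<close> for the process started at
  \<open>y\<close>: the matrix \<open>A\<close>, transported by the differential of left
  translation.\<close>

definition quad_form :: "'m \<Rightarrow> (real, 'm) vec \<Rightarrow> real" where
  "quad_form j y = (\<Sum>i\<in>UNIV. \<Sum>l\<in>UNIV. A $ i $ l * (xi_lie j i y * xi_lie j l y))"

lemma iso_damp_sq_diff: "0 \<le> iso_damp \<kappa> x - (iso_damp \<kappa> x)\<^sup>2" "iso_damp \<kappa> x - (iso_damp \<kappa> x)\<^sup>2 \<le> iso_damp \<kappa> x"
  using iso_damp_bounds[of \<kappa> x] by (auto simp: power2_eq_square mult_left_le)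

lemma Ck_iso_damp_diff: "Ck_on_space 2 (\<lambda>x. iso_damp \<kappa> x - (iso_damp \<kappa> x)\<^sup>2)"
  by (intro Ck_diff Ck_power Ck_iso_damp)

lemma expectation_affine:
  fixes a :: "'w \<Rightarrow> complex" and b c :: "'w \<Rightarrow> real"
  assumes a: "integrable M a" and b: "integrable M b" and c: "integrable M c"
  shows "expectation (\<lambda>\<omega>. a \<omega> - 1 - u * complex_of_real (b \<omega>) + v * complex_of_real (c \<omega>)) =
      expectation a - 1 - u * complex_of_real (expectation b) + v * complex_of_real (expectation c)"
    and "integrable M (\<lambda>\<omega>. a \<omega> - 1 - u * complex_of_real (b \<omega>) + v * complex_of_real (c \<omega>))"
proof -
  have b': "integrable M (\<lambda>\<omega>. u * complex_of_real (b \<omega>))" and c': "integrable M (\<lambda>\<omega>. v * complex_of_real (c \<omega>))"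
    using b c by (auto simp: complex_of_real_integrable_eq)
  have a1: "integrable M (\<lambda>\<omega>. a \<omega> - 1)" using a by simp
  show "integrable M (\<lambda>\<omega>. a \<omega> - 1 - u * complex_of_real (b \<omega>) + v * complex_of_real (c \<omega>))"
    by (intro Bochner_Integration.integrable_add Bochner_Integration.integrable_diff a1 b' c')
  have "expectation (\<lambda>\<omega>. a \<omega> - 1 - u * complex_of_real (b \<omega>) + v * complex_of_real (c \<omega>)) =
      expectation (\<lambda>\<omega>. a \<omega> - 1) - expectation (\<lambda>\<omega>. u * complex_of_real (b \<omega>)) + expectation (\<lambda>\<omega>. v * complex_of_real (c \<omega>))"
    using a1 b' c' by (simp only: Bochner_Integration.integral_add Bochner_Integration.integral_diff
        Bochner_Integration.integrable_diff)
  then show "expectation (\<lambda>\<omega>. a \<omega> - 1 - u * complex_of_real (b \<omega>) + v * complex_of_real (c \<omega>)) =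
      expectation a - 1 - u * complex_of_real (expectation b) + v * complex_of_real (expectation c)"
    using a by (simp add: integral_complex_of_real prob_space)
qed

text \<open>Integrates \<open>iexp_remainder\<close>. The error is expressed through quantities
  whose rates as s tends to 0 are known from \<open>limit_lin\<close>, \<open>limit_quad\<close> and
  \<open>tail_linear\<close>, and none of them involves \<open>y\<close>; the coefficients depending
  on \<open>y\<close> have been replaced by their bounds.\<close>

lemma clt_step_bound:
  obtains C where "C \<ge> 0" and "\<And>\<kappa> \<delta>. \<kappa> \<ge> 1 \<Longrightarrow> 0 < \<delta> \<Longrightarrow> \<delta> \<le> 1 \<Longrightarrow> \<forall>\<^sub>F s in at_right 0. \<forall>y.
      cmod (expectation (\<lambda>\<omega>. iexp (\<kappa> * (\<xi> j (y \<otimes> X s \<omega>) - \<xi> j y))) - 1 + complex_of_real (\<kappa>\<^sup>2 * s * quad_form j y / 2))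
      \<le> C * (\<kappa>\<^sup>2 * ((1 / \<kappa> + \<delta>) * (\<Sum>i\<in>UNIV. damped_cov \<kappa> s i i) + 1 / \<delta> * damped_defect \<kappa> s) + s
           + \<kappa> * (\<Sum>i\<in>UNIV. \<bar>damped_mean \<kappa> s i\<bar>) + \<kappa>\<^sup>2 * (\<Sum>i\<in>UNIV. \<Sum>l\<in>UNIV. \<bar>damped_cov \<kappa> s i l - s * A $ i $ l\<bar>))"
proof -
  obtain C \<rho> where C: "C \<ge> 0" and \<rho>: "\<rho> > 0"
    and rem: "\<And>\<kappa> \<delta> x y. \<kappa> \<ge> 1 \<Longrightarrow> 0 < \<delta> \<Longrightarrow> \<delta> \<le> 1 \<Longrightarrow>
      cmod (iexp (\<kappa> * (\<xi> j (y \<otimes> x) - \<xi> j y)) - 1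
        - \<i> * complex_of_real (\<kappa> * (\<Sum>i\<in>UNIV. \<xi> i x * xi_lie j i y) * iso_damp \<kappa> x)
        + complex_of_real ((\<kappa> * (\<Sum>i\<in>UNIV. \<xi> i x * xi_lie j i y))\<^sup>2 * iso_damp \<kappa> x / 2))
      \<le> C * ((1 / \<kappa> + \<delta>) * (\<kappa>\<^sup>2 * (xi_sq x * iso_damp \<kappa> x))
          + 1 / \<delta> * (\<kappa>\<^sup>2 * (xi_sq x * (iso_damp \<kappa> x - (iso_damp \<kappa> x)\<^sup>2))) + (1 - bump \<rho> x))"
    using iexp_remainder[of j] by blast
  obtain W where W: "W \<ge> 0" "\<And>i y. \<bar>xi_lie j i y\<bar> \<le> W" using xi_lie_bounded by blast
  obtain Cb where Cb: "Cb > 0" "\<forall>\<^sub>F t in at_right 0. expectation (\<lambda>\<omega>. 1 - bump \<rho> (X t \<omega>)) \<le> Cb * t"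
    using tail_linear[OF \<rho>] by blast
  obtain Dx where Dx: "Dx > 0" "\<And>i x. \<bar>\<xi> i x\<bar> \<le> Dx" using xi_bounded by blast
  have [measurable]: "bump \<rho> \<in> borel_measurable (borel :: (real, 'm) vec measure)"
    by (intro borel_measurable_continuous_onI Ck_imp_continuous[OF Ck_bump])
  define C' where "C' = C * (1 + Cb) + W + W\<^sup>2"
  show thesis
  proof (rule that[of C'])
    show "C' \<ge> 0" using C Cb W by (simp add: C'_def)
    fix \<kappa> \<delta> :: real assume \<kappa>: "\<kappa> \<ge> 1" and \<delta>: "0 < \<delta>" "\<delta> \<le> 1"
    from Cb(2) eventually_at_right_less[of 0]
    show "\<forall>\<^sub>F s in at_right 0. \<forall>y.
      cmod (expectation (\<lambda>\<omega>. iexp (\<kappa> * (\<xi> j (y \<otimes> X s \<omega>) - \<xi> j y))) - 1 + complex_of_real (\<kappa>\<^sup>2 * s * quad_form j y / 2))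
      \<le> C' * (\<kappa>\<^sup>2 * ((1 / \<kappa> + \<delta>) * (\<Sum>i\<in>UNIV. damped_cov \<kappa> s i i) + 1 / \<delta> * damped_defect \<kappa> s) + s
           + \<kappa> * (\<Sum>i\<in>UNIV. \<bar>damped_mean \<kappa> s i\<bar>) + \<kappa>\<^sup>2 * (\<Sum>i\<in>UNIV. \<Sum>l\<in>UNIV. \<bar>damped_cov \<kappa> s i l - s * A $ i $ l\<bar>))"
    proof eventually_elim
      case (elim s)
      then have s: "s \<ge> 0" by simp
      note Xs [measurable] = X_measurable[OF s]
      have hb: "\<bar>iso_damp \<kappa> x\<bar> \<le> 1" for x using iso_damp_bounds[of \<kappa> x] by simp
      have hd: "\<bar>iso_damp \<kappa> x - (iso_damp \<kappa> x)\<^sup>2\<bar> \<le> 1" for x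
        using iso_damp_sq_diff[of \<kappa> x] iso_damp_bounds[of \<kappa> x] by linarith
      have i1: "integrable M (\<lambda>\<omega>. \<xi> i (X s \<omega>) * iso_damp \<kappa> (X s \<omega>))" for i
      proof (rule integrable_bounded[of _ "Dx * 1"])
        show "norm (\<xi> i (X s \<omega>) * iso_damp \<kappa> (X s \<omega>)) \<le> Dx * 1" for \<omega>
          using Dx hb unfolding real_norm_def abs_mult by (intro mult_mono) auto
      qed measurable
      have i2: "integrable M (\<lambda>\<omega>. \<xi> i (X s \<omega>) * \<xi> l (X s \<omega>) * iso_damp \<kappa> (X s \<omega>))" for i l
      proof (rule integrable_bounded[of _ "Dx * Dx * 1"])
        show "norm (\<xi> i (X s \<omega>) * \<xi> l (X s \<omega>) * iso_damp \<kappa> (X s \<omega>)) \<le> Dx * Dx * 1" for \<omega>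
          using Dx hb unfolding real_norm_def abs_mult by (intro mult_mono) auto
      qed measurable
      have i4: "integrable M (\<lambda>\<omega>. \<xi> i (X s \<omega>) * \<xi> i (X s \<omega>) * (iso_damp \<kappa> (X s \<omega>) - (iso_damp \<kappa> (X s \<omega>))\<^sup>2))" for i
      proof (rule integrable_bounded[of _ "Dx * Dx * 1"])
        show "norm (\<xi> i (X s \<omega>) * \<xi> i (X s \<omega>) * (iso_damp \<kappa> (X s \<omega>) - (iso_damp \<kappa> (X s \<omega>))\<^sup>2)) \<le> Dx * Dx * 1" for \<omega>
          using Dx hd unfolding real_norm_def abs_mult by (intro mult_mono) auto
      qed measurable
      have ib: "integrable M (\<lambda>\<omega>. 1 - bump \<rho> (X s \<omega>))"
        by (rule integrable_bounded[of _ 1]) (auto simp: abs_le_iff bump_bounds intro: order_trans[OF bump_bounds(2)])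
      show ?case
      proof
        fix y
        define P where "P x = (\<Sum>i\<in>UNIV. \<xi> i x * xi_lie j i y)" for x
        have Pm [measurable]: "P \<in> borel_measurable borel" unfolding P_def[abs_def] by measurable
        have ie: "integrable M (\<lambda>\<omega>. iexp (\<kappa> * (\<xi> j (y \<otimes> X s \<omega>) - \<xi> j y)))"
          by (rule integrable_bounded[of _ 1]) auto
        have EP: "expectation (\<lambda>\<omega>. P (X s \<omega>) * iso_damp \<kappa> (X s \<omega>)) = (\<Sum>i\<in>UNIV. xi_lie j i y * damped_mean \<kappa> s i)"
          and iP: "integrable M (\<lambda>\<omega>. P (X s \<omega>) * iso_damp \<kappa> (X s \<omega>))"
        proof -
          have eq: "P x * iso_damp \<kappa> x = (\<Sum>i\<in>UNIV. xi_lie j i y * (\<xi> i x * iso_damp \<kappa> x))" for x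
            unfolding P_def sum_distrib_right by (intro sum.cong refl) (simp only: mult_ac)
          show "expectation (\<lambda>\<omega>. P (X s \<omega>) * iso_damp \<kappa> (X s \<omega>)) = (\<Sum>i\<in>UNIV. xi_lie j i y * damped_mean \<kappa> s i)"
            unfolding eq damped_mean_def using i1 by simp
          show "integrable M (\<lambda>\<omega>. P (X s \<omega>) * iso_damp \<kappa> (X s \<omega>))"
            unfolding eq using i1 by auto
        qed
        have EQ: "expectation (\<lambda>\<omega>. (P (X s \<omega>))\<^sup>2 * iso_damp \<kappa> (X s \<omega>)) =
            (\<Sum>i\<in>UNIV. \<Sum>l\<in>UNIV. xi_lie j i y * xi_lie j l y * damped_cov \<kappa> s i l)"
          and iQ: "integrable M (\<lambda>\<omega>. (P (X s \<omega>))\<^sup>2 * iso_damp \<kappa> (X s \<omega>))"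
        proof -
          have eq: "(P x)\<^sup>2 * iso_damp \<kappa> x = (\<Sum>i\<in>UNIV. \<Sum>l\<in>UNIV. xi_lie j i y * xi_lie j l y * (\<xi> i x * \<xi> l x * iso_damp \<kappa> x))" for x
            unfolding P_def power2_eq_square unfolding sum_product unfolding sum_distrib_right
            by (intro sum.cong refl) (simp only: mult_ac)
          show "expectation (\<lambda>\<omega>. (P (X s \<omega>))\<^sup>2 * iso_damp \<kappa> (X s \<omega>)) =
            (\<Sum>i\<in>UNIV. \<Sum>l\<in>UNIV. xi_lie j i y * xi_lie j l y * damped_cov \<kappa> s i l)"
            unfolding eq damped_cov_def using i2 by simp
          show "integrable M (\<lambda>\<omega>. (P (X s \<omega>))\<^sup>2 * iso_damp \<kappa> (X s \<omega>))"
            unfolding eq using i2 by auto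
        qed
        define R where "R \<omega> = iexp (\<kappa> * (\<xi> j (y \<otimes> X s \<omega>) - \<xi> j y)) - 1
          - \<i> * complex_of_real (\<kappa> * P (X s \<omega>) * iso_damp \<kappa> (X s \<omega>))
          + complex_of_real ((\<kappa> * P (X s \<omega>))\<^sup>2 * iso_damp \<kappa> (X s \<omega>) / 2)" for \<omega>
        have Req: "R = (\<lambda>\<omega>. iexp (\<kappa> * (\<xi> j (y \<otimes> X s \<omega>) - \<xi> j y)) - 1
          - \<i> * complex_of_real \<kappa> * complex_of_real (P (X s \<omega>) * iso_damp \<kappa> (X s \<omega>))
          + complex_of_real (\<kappa>\<^sup>2 / 2) * complex_of_real ((P (X s \<omega>))\<^sup>2 * iso_damp \<kappa> (X s \<omega>)))"
          by (rule ext) (simp add: R_def power_mult_distrib mult_ac)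
        have ER: "expectation R = expectation (\<lambda>\<omega>. iexp (\<kappa> * (\<xi> j (y \<otimes> X s \<omega>) - \<xi> j y))) - 1
          - \<i> * complex_of_real \<kappa> * complex_of_real (\<Sum>i\<in>UNIV. xi_lie j i y * damped_mean \<kappa> s i)
          + complex_of_real (\<kappa>\<^sup>2 / 2) * complex_of_real (\<Sum>i\<in>UNIV. \<Sum>l\<in>UNIV. xi_lie j i y * xi_lie j l y * damped_cov \<kappa> s i l)"
          unfolding Req EP[symmetric] EQ[symmetric] by (rule expectation_affine[OF ie iP iQ])
        have Ri: "integrable M R"
          unfolding Req by (rule expectation_affine[OF ie iP iQ])
        have Rb: "cmod (expectation R) \<le> C * ((1 / \<kappa> + \<delta>) * (\<kappa>\<^sup>2 * (\<Sum>i\<in>UNIV. damped_cov \<kappa> s i i))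
          + 1 / \<delta> * (\<kappa>\<^sup>2 * damped_defect \<kappa> s) + Cb * s)"
        proof -
          have "cmod (expectation R) \<le> expectation (\<lambda>\<omega>. cmod (R \<omega>))" by (rule integral_norm_bound)
          also have "\<dots> \<le> expectation (\<lambda>\<omega>. C * ((1 / \<kappa> + \<delta>) * (\<kappa>\<^sup>2 * (\<Sum>i\<in>UNIV. \<xi> i (X s \<omega>) * \<xi> i (X s \<omega>) * iso_damp \<kappa> (X s \<omega>)))
             + 1 / \<delta> * (\<kappa>\<^sup>2 * (\<Sum>i\<in>UNIV. \<xi> i (X s \<omega>) * \<xi> i (X s \<omega>) * (iso_damp \<kappa> (X s \<omega>) - (iso_damp \<kappa> (X s \<omega>))\<^sup>2)))
             + (1 - bump \<rho> (X s \<omega>))))"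
          proof (rule integral_mono)
            show "integrable M (\<lambda>\<omega>. cmod (R \<omega>))"
              by (rule integrable_norm[OF Ri])
            show "integrable M (\<lambda>\<omega>. C * ((1 / \<kappa> + \<delta>) * (\<kappa>\<^sup>2 * (\<Sum>i\<in>UNIV. \<xi> i (X s \<omega>) * \<xi> i (X s \<omega>) * iso_damp \<kappa> (X s \<omega>)))
             + 1 / \<delta> * (\<kappa>\<^sup>2 * (\<Sum>i\<in>UNIV. \<xi> i (X s \<omega>) * \<xi> i (X s \<omega>) * (iso_damp \<kappa> (X s \<omega>) - (iso_damp \<kappa> (X s \<omega>))\<^sup>2)))
             + (1 - bump \<rho> (X s \<omega>))))"
              by (intro integrable_mult_right Bochner_Integration.integrable_add ib Bochner_Integration.integrable_sum i2 i4)
            fix \<omega>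
            have eq1: "(\<Sum>i\<in>UNIV. \<xi> i x * \<xi> i x * c) = xi_sq x * c" for x c
              by (simp add: xi_sq_def power2_eq_square sum_distrib_right)
            show "cmod (R \<omega>) \<le> C * ((1 / \<kappa> + \<delta>) * (\<kappa>\<^sup>2 * (\<Sum>i\<in>UNIV. \<xi> i (X s \<omega>) * \<xi> i (X s \<omega>) * iso_damp \<kappa> (X s \<omega>)))
             + 1 / \<delta> * (\<kappa>\<^sup>2 * (\<Sum>i\<in>UNIV. \<xi> i (X s \<omega>) * \<xi> i (X s \<omega>) * (iso_damp \<kappa> (X s \<omega>) - (iso_damp \<kappa> (X s \<omega>))\<^sup>2)))
             + (1 - bump \<rho> (X s \<omega>)))"
              unfolding eq1 R_def P_def by (rule rem[OF \<kappa> \<delta>])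
          qed
          also have "\<dots> = C * ((1 / \<kappa> + \<delta>) * (\<kappa>\<^sup>2 * (\<Sum>i\<in>UNIV. damped_cov \<kappa> s i i))
             + 1 / \<delta> * (\<kappa>\<^sup>2 * damped_defect \<kappa> s) + expectation (\<lambda>\<omega>. 1 - bump \<rho> (X s \<omega>)))"
          proof -
            have a: "integrable M (\<lambda>\<omega>. (1 / \<kappa> + \<delta>) * (\<kappa>\<^sup>2 * (\<Sum>i\<in>UNIV. \<xi> i (X s \<omega>) * \<xi> i (X s \<omega>) * iso_damp \<kappa> (X s \<omega>))))"
              by (intro integrable_mult_right Bochner_Integration.integrable_sum i2)
            have b: "integrable M (\<lambda>\<omega>. 1 / \<delta> * (\<kappa>\<^sup>2 * (\<Sum>i\<in>UNIV. \<xi> i (X s \<omega>) * \<xi> i (X s \<omega>) * (iso_damp \<kappa> (X s \<omega>) - (iso_damp \<kappa> (X s \<omega>))\<^sup>2))))"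
              by (intro integrable_mult_right Bochner_Integration.integrable_sum i4)
            show ?thesis
              unfolding damped_cov_def damped_defect_def
              by (simp only: integral_mult_right_zero Bochner_Integration.integral_add[OF Bochner_Integration.integrable_add[OF a b] ib]
                  Bochner_Integration.integral_add[OF a b] Bochner_Integration.integral_sum[OF i2] Bochner_Integration.integral_sum[OF i4])
          qed
          also have "\<dots> \<le> C * ((1 / \<kappa> + \<delta>) * (\<kappa>\<^sup>2 * (\<Sum>i\<in>UNIV. damped_cov \<kappa> s i i))
             + 1 / \<delta> * (\<kappa>\<^sup>2 * damped_defect \<kappa> s) + Cb * s)"
            using C elim(1) by (intro mult_left_mono add_mono order_refl) auto
          finally show ?thesis .
        qed
        define E0 where "E0 = expectation (\<lambda>\<omega>. iexp (\<kappa> * (\<xi> j (y \<otimes> X s \<omega>) - \<xi> j y))) - 1 + complex_of_real (\<kappa>\<^sup>2 * s * quad_form j y / 2)"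
        have E0: "E0 = expectation R + \<i> * complex_of_real (\<kappa> * (\<Sum>i\<in>UNIV. xi_lie j i y * damped_mean \<kappa> s i))
          - complex_of_real (\<kappa>\<^sup>2 / 2 * (\<Sum>i\<in>UNIV. \<Sum>l\<in>UNIV. xi_lie j i y * xi_lie j l y * (damped_cov \<kappa> s i l - s * A $ i $ l)))"
        proof -
          have "(\<Sum>i\<in>UNIV. \<Sum>l\<in>UNIV. xi_lie j i y * xi_lie j l y * (damped_cov \<kappa> s i l - s * A $ i $ l)) =
            (\<Sum>i\<in>UNIV. \<Sum>l\<in>UNIV. xi_lie j i y * xi_lie j l y * damped_cov \<kappa> s i l) - s * quad_form j y"
            unfolding quad_form_def sum_distrib_left sum_subtractf[symmetric]
            by (intro sum.cong refl) (simp add: algebra_simps)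
          note eq = this
          show ?thesis unfolding eq ER E0_def by (simp add: algebra_simps del: of_real_sum)
        qed
        have b1: "\<bar>\<kappa> * (\<Sum>i\<in>UNIV. xi_lie j i y * damped_mean \<kappa> s i)\<bar> \<le> W * (\<kappa> * (\<Sum>i\<in>UNIV. \<bar>damped_mean \<kappa> s i\<bar>))"
        proof -
          have "\<bar>\<Sum>i\<in>UNIV. xi_lie j i y * damped_mean \<kappa> s i\<bar> \<le> (\<Sum>i\<in>UNIV. W * \<bar>damped_mean \<kappa> s i\<bar>)"
            using W by (intro order_trans[OF sum_abs] sum_mono) (simp add: abs_mult mult_right_mono)
          then have "\<bar>\<Sum>i\<in>UNIV. xi_lie j i y * damped_mean \<kappa> s i\<bar> \<le> W * (\<Sum>i\<in>UNIV. \<bar>damped_mean \<kappa> s i\<bar>)"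
            by (simp only: sum_distrib_left)
          from mult_left_mono[OF this, of \<kappa>] \<kappa> show ?thesis by (simp add: abs_mult mult.left_commute)
        qed
        have b2: "\<bar>\<kappa>\<^sup>2 / 2 * (\<Sum>i\<in>UNIV. \<Sum>l\<in>UNIV. xi_lie j i y * xi_lie j l y * (damped_cov \<kappa> s i l - s * A $ i $ l))\<bar>
            \<le> W\<^sup>2 * (\<kappa>\<^sup>2 * (\<Sum>i\<in>UNIV. \<Sum>l\<in>UNIV. \<bar>damped_cov \<kappa> s i l - s * A $ i $ l\<bar>))"
        proof -
          let ?S = "\<Sum>i\<in>UNIV. \<Sum>l\<in>UNIV. \<bar>damped_cov \<kappa> s i l - s * A $ i $ l\<bar>"
          have "\<bar>\<Sum>i\<in>UNIV. \<Sum>l\<in>UNIV. xi_lie j i y * xi_lie j l y * (damped_cov \<kappa> s i l - s * A $ i $ l)\<bar>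
             \<le> (\<Sum>i\<in>UNIV. \<Sum>l\<in>UNIV. W\<^sup>2 * \<bar>damped_cov \<kappa> s i l - s * A $ i $ l\<bar>)"
          proof (rule order_trans[OF sum_abs], rule sum_mono)
            fix i
            show "\<bar>\<Sum>l\<in>UNIV. xi_lie j i y * xi_lie j l y * (damped_cov \<kappa> s i l - s * A $ i $ l)\<bar> \<le> (\<Sum>l\<in>UNIV. W\<^sup>2 * \<bar>damped_cov \<kappa> s i l - s * A $ i $ l\<bar>)"
            proof (rule order_trans[OF sum_abs], rule sum_mono)
              fix l
              have "\<bar>xi_lie j i y * xi_lie j l y\<bar> \<le> W\<^sup>2"
                unfolding abs_mult power2_eq_square using W by (intro mult_mono) auto
              then show "\<bar>xi_lie j i y * xi_lie j l y * (damped_cov \<kappa> s i l - s * A $ i $ l)\<bar> \<le> W\<^sup>2 * \<bar>damped_cov \<kappa> s i l - s * A $ i $ l\<bar>"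
                unfolding abs_mult[of "xi_lie j i y * xi_lie j l y"] by (rule mult_right_mono) simp
            qed
          qed
          also have "\<dots> = W\<^sup>2 * ?S" by (simp add: sum_distrib_left)
          finally have le: "\<bar>\<Sum>i\<in>UNIV. \<Sum>l\<in>UNIV. xi_lie j i y * xi_lie j l y * (damped_cov \<kappa> s i l - s * A $ i $ l)\<bar> \<le> W\<^sup>2 * ?S" .
          have "\<bar>\<kappa>\<^sup>2 / 2 * (\<Sum>i\<in>UNIV. \<Sum>l\<in>UNIV. xi_lie j i y * xi_lie j l y * (damped_cov \<kappa> s i l - s * A $ i $ l))\<bar> \<le> \<kappa>\<^sup>2 / 2 * (W\<^sup>2 * ?S)"
            unfolding abs_mult[of "\<kappa>\<^sup>2 / 2"] by (intro mult_mono le) auto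
          also have "\<dots> \<le> \<kappa>\<^sup>2 * (W\<^sup>2 * ?S)" by (intro mult_right_mono mult_nonneg_nonneg sum_nonneg) auto
          finally show ?thesis by (simp only: mult_ac)
        qed
        have "cmod E0 \<le> cmod (expectation R) + \<bar>\<kappa> * (\<Sum>i\<in>UNIV. xi_lie j i y * damped_mean \<kappa> s i)\<bar>
          + \<bar>\<kappa>\<^sup>2 / 2 * (\<Sum>i\<in>UNIV. \<Sum>l\<in>UNIV. xi_lie j i y * xi_lie j l y * (damped_cov \<kappa> s i l - s * A $ i $ l))\<bar>"
          unfolding E0
          by (rule order_trans[OF norm_triangle_ineq4], rule add_mono, rule order_trans[OF norm_triangle_ineq])
             (simp_all only: norm_mult norm_ii norm_of_real mult_1 order_refl)
        also have "\<dots> \<le> C * ((1 / \<kappa> + \<delta>) * (\<kappa>\<^sup>2 * (\<Sum>i\<in>UNIV. damped_cov \<kappa> s i i)) + 1 / \<delta> * (\<kappa>\<^sup>2 * damped_defect \<kappa> s) + Cb * s)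
          + W * (\<kappa> * (\<Sum>i\<in>UNIV. \<bar>damped_mean \<kappa> s i\<bar>)) + W\<^sup>2 * (\<kappa>\<^sup>2 * (\<Sum>i\<in>UNIV. \<Sum>l\<in>UNIV. \<bar>damped_cov \<kappa> s i l - s * A $ i $ l\<bar>))"
          by (intro add_mono Rb b1 b2)
        also have "\<dots> \<le> C' * (\<kappa>\<^sup>2 * ((1 / \<kappa> + \<delta>) * (\<Sum>i\<in>UNIV. damped_cov \<kappa> s i i) + 1 / \<delta> * damped_defect \<kappa> s)) + C' * s
           + C' * (\<kappa> * (\<Sum>i\<in>UNIV. \<bar>damped_mean \<kappa> s i\<bar>)) + C' * (\<kappa>\<^sup>2 * (\<Sum>i\<in>UNIV. \<Sum>l\<in>UNIV. \<bar>damped_cov \<kappa> s i l - s * A $ i $ l\<bar>))"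
        proof -
          define T where "T = \<kappa>\<^sup>2 * ((1 / \<kappa> + \<delta>) * (\<Sum>i\<in>UNIV. damped_cov \<kappa> s i i) + 1 / \<delta> * damped_defect \<kappa> s)"
          have "damped_cov \<kappa> s i i \<ge> 0" for i
            unfolding damped_cov_def using iso_damp_bounds(1) by (intro integral_nonneg_AE AE_I2) (simp add: less_imp_le)
          moreover have "damped_defect \<kappa> s \<ge> 0"
            unfolding damped_defect_def using iso_damp_sq_diff(1) by (intro sum_nonneg integral_nonneg_AE AE_I2) simp
          ultimately have T: "T \<ge> 0"
            unfolding T_def using \<kappa> \<delta> by (intro mult_nonneg_nonneg add_nonneg_nonneg sum_nonneg) auto
          have "C * ((1 / \<kappa> + \<delta>) * (\<kappa>\<^sup>2 * (\<Sum>i\<in>UNIV. damped_cov \<kappa> s i i)) + 1 / \<delta> * (\<kappa>\<^sup>2 * damped_defect \<kappa> s) + Cb * s) = C * T + C * Cb * s"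
            by (simp add: T_def algebra_simps)
          moreover have "C * T \<le> C' * T" using T C Cb W by (intro mult_right_mono) (auto simp: C'_def algebra_simps)
          moreover have "C * Cb * s \<le> C' * s" using s C W by (intro mult_right_mono) (auto simp: C'_def algebra_simps)
          moreover have "W * (\<kappa> * (\<Sum>i\<in>UNIV. \<bar>damped_mean \<kappa> s i\<bar>)) \<le> C' * (\<kappa> * (\<Sum>i\<in>UNIV. \<bar>damped_mean \<kappa> s i\<bar>))"
            using \<kappa> C Cb W by (intro mult_right_mono mult_nonneg_nonneg sum_nonneg) (auto simp: C'_def)
          moreover have "W\<^sup>2 * (\<kappa>\<^sup>2 * (\<Sum>i\<in>UNIV. \<Sum>l\<in>UNIV. \<bar>damped_cov \<kappa> s i l - s * A $ i $ l\<bar>)) \<le> C' * (\<kappa>\<^sup>2 * (\<Sum>i\<in>UNIV. \<Sum>l\<in>UNIV. \<bar>damped_cov \<kappa> s i l - s * A $ i $ l\<bar>))"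
            using \<kappa> C Cb W by (intro mult_right_mono mult_nonneg_nonneg sum_nonneg) (auto simp: C'_def)
          ultimately show ?thesis unfolding T_def[symmetric] by linarith
        qed
        finally show "cmod (expectation (\<lambda>\<omega>. iexp (\<kappa> * (\<xi> j (y \<otimes> X s \<omega>) - \<xi> j y))) - 1 + complex_of_real (\<kappa>\<^sup>2 * s * quad_form j y / 2))
          \<le> C' * (\<kappa>\<^sup>2 * ((1 / \<kappa> + \<delta>) * (\<Sum>i\<in>UNIV. damped_cov \<kappa> s i i) + 1 / \<delta> * damped_defect \<kappa> s) + s
           + \<kappa> * (\<Sum>i\<in>UNIV. \<bar>damped_mean \<kappa> s i\<bar>) + \<kappa>\<^sup>2 * (\<Sum>i\<in>UNIV. \<Sum>l\<in>UNIV. \<bar>damped_cov \<kappa> s i l - s * A $ i $ l\<bar>))"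
          unfolding E0_def distrib_left[of C'] .
      qed
    qed
  qed
qed

text \<open>At a fixed frequency the error divided by s tends to C \<Lambda>(\<kappa>), and
  \<Lambda>(\<kappa>) / \<kappa>^2 tends to \<delta> times the trace of \<open>A\<close>: the jump
  moments vanish by dominated convergence, and drift terms, which carry only one factor \<kappa>,
  are of lower order than \<kappa>^2.\<close>

lemma clt_step:
  assumes \<epsilon>: "\<epsilon> > 0"
  obtains \<kappa>0 where "\<kappa>0 \<ge> 1" and "\<And>\<kappa>. \<kappa> \<ge> \<kappa>0 \<Longrightarrow> \<forall>\<^sub>F s in at_right 0. \<forall>y.
      cmod (expectation (\<lambda>\<omega>. iexp (\<kappa> * (\<xi> j (y \<otimes> X s \<omega>) - \<xi> j y))) - 1 + complex_of_real (\<kappa>\<^sup>2 * s * quad_form j y / 2))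
      \<le> \<epsilon> * \<kappa>\<^sup>2 * s"
proof -
  obtain C where C: "C \<ge> 0" and bnd: "\<And>\<kappa> \<delta>. \<kappa> \<ge> 1 \<Longrightarrow> 0 < \<delta> \<Longrightarrow> \<delta> \<le> 1 \<Longrightarrow> \<forall>\<^sub>F s in at_right 0. \<forall>y.
      cmod (expectation (\<lambda>\<omega>. iexp (\<kappa> * (\<xi> j (y \<otimes> X s \<omega>) - \<xi> j y))) - 1 + complex_of_real (\<kappa>\<^sup>2 * s * quad_form j y / 2))
      \<le> C * (\<kappa>\<^sup>2 * ((1 / \<kappa> + \<delta>) * (\<Sum>i\<in>UNIV. damped_cov \<kappa> s i i) + 1 / \<delta> * damped_defect \<kappa> s) + s
           + \<kappa> * (\<Sum>i\<in>UNIV. \<bar>damped_mean \<kappa> s i\<bar>) + \<kappa>\<^sup>2 * (\<Sum>i\<in>UNIV. \<Sum>l\<in>UNIV. \<bar>damped_cov \<kappa> s i l - s * A $ i $ l\<bar>))"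
    using clt_step_bound[of j] by blast
  define tr where "tr = (\<Sum>i\<in>UNIV. A $ i $ i)"
  have tr: "tr \<ge> 0" unfolding tr_def by (intro sum_nonneg A_diag_nonneg)
  \<comment> \<open>The parameter of Young's inequality, so small that the surviving Gaussian error
    C \<delta> tr is below \<epsilon>. The summand 1 keeps the denominator positive when C tr is
    0.\<close>
  define \<delta> where "\<delta> = min 1 (\<epsilon> / (2 * (C * tr + 1)))"
  have Ct: "C * tr \<ge> 0" using C tr by simp
  have \<delta>: "0 < \<delta>" "\<delta> \<le> 1" using \<epsilon> Ct by (auto simp: \<delta>_def)
  have \<delta>2: "C * (\<delta> * tr) < \<epsilon>"
  proof -
    have "\<delta> * (C * tr) \<le> \<epsilon> / (2 * (C * tr + 1)) * (C * tr)" using Ct by (intro mult_right_mono) (auto simp: \<delta>_def)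
    also have "\<dots> < \<epsilon>"
    proof -
      have "0 \<le> C * (\<epsilon> * tr)" using mult_nonneg_nonneg[OF less_imp_le[OF \<epsilon>] Ct] by (simp only: mult_ac)
      then have "0 < C * (\<epsilon> * tr) + \<epsilon> * 2" using \<epsilon> by linarith
      then show ?thesis using Ct \<epsilon> by (simp add: divide_less_eq algebra_simps)
    qed
    finally show ?thesis by (simp add: mult_ac)
  qed
  define V where "V \<kappa> i l = (\<integral>y. \<xi> i y * \<xi> l y * iso_damp \<kappa> y \<partial>\<nu>)" for \<kappa> i l
  define V4 where "V4 \<kappa> = (\<Sum>i\<in>UNIV. \<integral>y. \<xi> i y * \<xi> i y * (iso_damp \<kappa> y - (iso_damp \<kappa> y)\<^sup>2) \<partial>\<nu>)" for \<kappa>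
  define L where "L \<kappa> i = (\<integral>y. \<xi> i y * iso_damp \<kappa> y - \<xi> i y \<partial>\<nu>)" for \<kappa> i
  \<comment> \<open>The limit of the bracket in \<open>clt_step_bound\<close> divided by s, with
    every moment replaced by its generator limit.\<close>
  define \<Lambda> where "\<Lambda> \<kappa> = \<kappa>\<^sup>2 * ((1 / \<kappa> + \<delta>) * (\<Sum>i\<in>UNIV. A $ i $ i + V \<kappa> i i) + 1 / \<delta> * V4 \<kappa>) + 1
      + \<kappa> * (\<Sum>i\<in>UNIV. \<bar>B $ i + L \<kappa> i\<bar>) + \<kappa>\<^sup>2 * (\<Sum>i\<in>UNIV. \<Sum>l\<in>UNIV. \<bar>V \<kappa> i l\<bar>)" for \<kappa>
  have V_lim: "((\<lambda>\<kappa>. V \<kappa> i l) \<longlongrightarrow> 0) at_top" for i l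
    unfolding V_def
  proof (rule nu_dominated_vanishing)
    fix \<kappa> y
    show "\<bar>\<xi> i y * \<xi> l y * iso_damp \<kappa> y\<bar> \<le> xi_sq y"
      using xi_mult_le_xi_sq[of i y l] iso_damp_bounds[of \<kappa> y] mult_mono[of "\<bar>\<xi> i y * \<xi> l y\<bar>" "xi_sq y" "iso_damp \<kappa> y" 1]
      by (simp add: abs_mult[of "_ * _"] xi_sq_nonneg)
  next
    fix y assume "xi_sq y > 0"
    from tendsto_mult_right_zero[OF iso_damp_vanishes[OF this]]
    show "((\<lambda>\<kappa>. \<xi> i y * \<xi> l y * iso_damp \<kappa> y) \<longlongrightarrow> 0) at_top" .
  qed measurable
  have V4_lim: "(V4 \<longlongrightarrow> 0) at_top"
  proof -
    have "((\<lambda>\<kappa>. \<integral>y. \<xi> i y * \<xi> i y * (iso_damp \<kappa> y - (iso_damp \<kappa> y)\<^sup>2) \<partial>\<nu>) \<longlongrightarrow> 0) at_top" for i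
    proof (rule nu_dominated_vanishing)
      fix \<kappa> y
      have "\<bar>iso_damp \<kappa> y - (iso_damp \<kappa> y)\<^sup>2\<bar> \<le> 1"
        using iso_damp_sq_diff[of \<kappa> y] iso_damp_bounds[of \<kappa> y] by linarith
      then show "\<bar>\<xi> i y * \<xi> i y * (iso_damp \<kappa> y - (iso_damp \<kappa> y)\<^sup>2)\<bar> \<le> xi_sq y"
        using xi_mult_le_xi_sq[of i y i] mult_mono[of "\<bar>\<xi> i y * \<xi> i y\<bar>" "xi_sq y" "\<bar>iso_damp \<kappa> y - (iso_damp \<kappa> y)\<^sup>2\<bar>" 1]
        by (simp add: abs_mult[of "_ * _"] xi_sq_nonneg)
    next
      fix y assume "xi_sq y > 0"
      note h = iso_damp_vanishes[OF this]
      have "((\<lambda>\<kappa>. \<xi> i y * \<xi> i y * (iso_damp \<kappa> y - (iso_damp \<kappa> y)\<^sup>2)) \<longlongrightarrow> \<xi> i y * \<xi> i y * (0 - 0\<^sup>2)) at_top"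
        by (intro tendsto_intros h)
      then show "((\<lambda>\<kappa>. \<xi> i y * \<xi> i y * (iso_damp \<kappa> y - (iso_damp \<kappa> y)\<^sup>2)) \<longlongrightarrow> 0) at_top" by simp
    qed measurable
    then have "(V4 \<longlongrightarrow> (\<Sum>i\<in>(UNIV::'m set). 0)) at_top"
      unfolding V4_def[abs_def] by (intro tendsto_sum)
    then show ?thesis by simp
  qed
  \<comment> \<open>Without integrability of \<open>\<xi> i\<close> the compensated integral may
    diverge as \<kappa> grows, but it only has to be of smaller order than \<kappa>. After division
    by \<kappa> the integrand is dominated by \<open>xi_sq\<close>.\<close>
  have L_lim: "((\<lambda>\<kappa>. L \<kappa> i / \<kappa>) \<longlongrightarrow> 0) at_top" for i
  proof -
    have "((\<lambda>\<kappa>. \<integral>y. (\<xi> i y * iso_damp \<kappa> y - \<xi> i y) / \<kappa> \<partial>\<nu>) \<longlongrightarrow> 0) at_top"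
    proof (rule nu_dominated_vanishing)
      fix \<kappa> :: real and y assume \<kappa>: "\<kappa> \<ge> 1"
      define u where "u = \<kappa> * sqrt (xi_sq y)"
      have u: "u \<ge> 0" using \<kappa> xi_sq_nonneg[of y] by (simp add: u_def)
      have "0 \<le> (u - 1)\<^sup>2" by simp
      then have "u \<le> 1 + u\<^sup>2" using u by (simp add: power2_diff)
      moreover have "1 + u\<^sup>2 > 0" by (simp add: add_pos_nonneg)
      moreover have u2: "u\<^sup>2 = \<kappa>\<^sup>2 * xi_sq y" using xi_sq_nonneg[of y] by (simp add: u_def power_mult_distrib)
      ultimately have uh: "u * iso_damp \<kappa> y \<le> 1" by (simp add: iso_damp_eq)
      have "\<bar>\<xi> i y * iso_damp \<kappa> y - \<xi> i y\<bar> = \<bar>\<xi> i y\<bar> * (1 - iso_damp \<kappa> y)"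
      proof -
        have "\<xi> i y * iso_damp \<kappa> y - \<xi> i y = \<xi> i y * (iso_damp \<kappa> y - 1)" by (simp add: algebra_simps)
        then show ?thesis using iso_damp_bounds[of \<kappa> y] by (simp add: abs_mult)
      qed
      also have "\<dots> \<le> sqrt (xi_sq y) * (\<kappa>\<^sup>2 * xi_sq y * iso_damp \<kappa> y)"
        unfolding iso_damp_complement using iso_damp_bounds[of \<kappa> y] xi_sq_nonneg[of y]
        by (intro mult_right_mono xi_le_sqrt) auto
      also have "\<dots> = \<kappa> * xi_sq y * (u * iso_damp \<kappa> y)" by (simp add: u_def power2_eq_square mult_ac)
      also have "\<dots> \<le> \<kappa> * xi_sq y * 1" using uh \<kappa> xi_sq_nonneg[of y] by (intro mult_left_mono) auto
      finally show "\<bar>(\<xi> i y * iso_damp \<kappa> y - \<xi> i y) / \<kappa>\<bar> \<le> xi_sq y" using \<kappa> by (simp add: divide_le_eq mult.commute)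
    next
      fix y assume "xi_sq y > 0"
      have "((\<lambda>\<kappa>. (\<xi> i y * iso_damp \<kappa> y - \<xi> i y) * (1 / \<kappa>)) \<longlongrightarrow> (\<xi> i y * 0 - \<xi> i y) * 0) at_top"
        using tendsto_divide_0[OF tendsto_const filterlim_at_top_imp_at_infinity[OF filterlim_ident]]
        by (intro tendsto_intros iso_damp_vanishes \<open>xi_sq y > 0\<close>) auto
      then show "((\<lambda>\<kappa>. (\<xi> i y * iso_damp \<kappa> y - \<xi> i y) / \<kappa>) \<longlongrightarrow> 0) at_top" by simp
    qed measurable
    then show ?thesis by (simp add: L_def)
  qed
  have inv_lim: "((\<lambda>\<kappa>::real. c / \<kappa>) \<longlongrightarrow> 0) at_top" for c
    by (rule tendsto_divide_0[OF tendsto_const filterlim_at_top_imp_at_infinity[OF filterlim_ident]])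
  have "((\<lambda>\<kappa>. (1 / \<kappa> + \<delta>) * (\<Sum>i\<in>UNIV. A $ i $ i + V \<kappa> i i) + 1 / \<delta> * V4 \<kappa> + 1 / \<kappa> * (1 / \<kappa>)
      + (\<Sum>i\<in>UNIV. \<bar>B $ i / \<kappa> + L \<kappa> i / \<kappa>\<bar>) + (\<Sum>i\<in>UNIV. \<Sum>l\<in>UNIV. \<bar>V \<kappa> i l\<bar>))
    \<longlongrightarrow> (0 + \<delta>) * (\<Sum>i\<in>UNIV. A $ i $ i + 0) + 1 / \<delta> * 0 + 0 * 0 + (\<Sum>i\<in>(UNIV::'m set). \<bar>0 + 0\<bar>) +
      (\<Sum>i\<in>(UNIV::'m set). \<Sum>l\<in>(UNIV::'m set). \<bar>0\<bar>)) at_top"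
    by (intro tendsto_add tendsto_mult tendsto_const tendsto_sum tendsto_rabs V_lim V4_lim L_lim inv_lim)
  then have lim: "((\<lambda>\<kappa>. (1 / \<kappa> + \<delta>) * (\<Sum>i\<in>UNIV. A $ i $ i + V \<kappa> i i) + 1 / \<delta> * V4 \<kappa> + 1 / \<kappa> * (1 / \<kappa>)
      + (\<Sum>i\<in>UNIV. \<bar>B $ i / \<kappa> + L \<kappa> i / \<kappa>\<bar>) + (\<Sum>i\<in>UNIV. \<Sum>l\<in>UNIV. \<bar>V \<kappa> i l\<bar>))
    \<longlongrightarrow> \<delta> * tr) at_top"
    by (simp add: tr_def)
  have \<Lambda>_eq: "(1 / \<kappa> + \<delta>) * (\<Sum>i\<in>UNIV. A $ i $ i + V \<kappa> i i) + 1 / \<delta> * V4 \<kappa> + 1 / \<kappa> * (1 / \<kappa>)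
      + (\<Sum>i\<in>UNIV. \<bar>B $ i / \<kappa> + L \<kappa> i / \<kappa>\<bar>) + (\<Sum>i\<in>UNIV. \<Sum>l\<in>UNIV. \<bar>V \<kappa> i l\<bar>) = \<Lambda> \<kappa> / \<kappa>\<^sup>2" if "\<kappa> > 0" for \<kappa>
  proof -
    have "(\<Sum>i\<in>UNIV. \<bar>B $ i / \<kappa> + L \<kappa> i / \<kappa>\<bar>) = (\<Sum>i\<in>UNIV. \<bar>B $ i + L \<kappa> i\<bar>) / \<kappa>"
      unfolding sum_divide_distrib add_divide_distrib[symmetric] using that by simp
    then show ?thesis using that by (simp add: \<Lambda>_def add_divide_distrib power2_eq_square)
  qed
  have "((\<lambda>\<kappa>. \<Lambda> \<kappa> / \<kappa>\<^sup>2) \<longlongrightarrow> \<delta> * tr) at_top"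
    by (rule Lim_transform_eventually[OF lim]) (use \<Lambda>_eq in \<open>auto intro: eventually_mono[OF eventually_gt_at_top[of 0]]\<close>)
  then have "((\<lambda>\<kappa>. C * (\<Lambda> \<kappa> / \<kappa>\<^sup>2)) \<longlongrightarrow> C * (\<delta> * tr)) at_top" by (rule tendsto_mult_left)
  then have "\<forall>\<^sub>F \<kappa> in at_top. C * (\<Lambda> \<kappa> / \<kappa>\<^sup>2) < \<epsilon>" using \<delta>2 by (rule order_tendstoD)
  then obtain \<kappa>1 where \<kappa>1: "\<And>\<kappa>. \<kappa> \<ge> \<kappa>1 \<Longrightarrow> C * (\<Lambda> \<kappa> / \<kappa>\<^sup>2) < \<epsilon>" by (auto simp: eventually_at_top_linorder)
  show thesis
  proof (rule that[of "max 1 \<kappa>1"])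
    fix \<kappa> assume "max 1 \<kappa>1 \<le> \<kappa>"
    then have \<kappa>: "\<kappa> \<ge> 1" and "C * (\<Lambda> \<kappa> / \<kappa>\<^sup>2) < \<epsilon>" using \<kappa>1 by auto
    then have \<Lambda>: "C * \<Lambda> \<kappa> < \<epsilon> * \<kappa>\<^sup>2" by (simp add: divide_less_eq)
    have xx_lim: "((\<lambda>s. damped_cov \<kappa> s i l / s) \<longlongrightarrow> A $ i $ l + V \<kappa> i l) (at_right 0)" for i l
      using limit_quad[OF Ck_iso_damp, of i l \<kappa>] by (simp add: damped_cov_def V_def)
    have x1_lim: "((\<lambda>s. damped_mean \<kappa> s i / s) \<longlongrightarrow> B $ i + L \<kappa> i) (at_right 0)" for i
      using limit_lin[OF Ck_iso_damp, of \<kappa> i] damp_limit[of "\<lambda>_. \<kappa>\<^sup>2"] by (simp add: damped_mean_def L_def iso_damp_def)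
    have x4_lim: "((\<lambda>s. damped_defect \<kappa> s / s) \<longlongrightarrow> V4 \<kappa>) (at_right 0)"
    proof -
      have "((\<lambda>s. \<Sum>i\<in>UNIV. expectation (\<lambda>\<omega>. \<xi> i (X s \<omega>) * \<xi> i (X s \<omega>) *
          (iso_damp \<kappa> (X s \<omega>) - (iso_damp \<kappa> (X s \<omega>))\<^sup>2)) / s) \<longlongrightarrow>
        (\<Sum>i\<in>UNIV. 0 + (\<integral>y. \<xi> i y * \<xi> i y * (iso_damp \<kappa> y - (iso_damp \<kappa> y)\<^sup>2) \<partial>\<nu>))) (at_right 0)"
        by (intro tendsto_sum) (use limit_quad[OF Ck_iso_damp_diff[of \<kappa>]] in simp)
      then show ?thesis by (simp add: damped_defect_def V4_def sum_divide_distrib)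
    qed
    define F where "F s = \<kappa>\<^sup>2 * ((1 / \<kappa> + \<delta>) * (\<Sum>i\<in>UNIV. damped_cov \<kappa> s i i) + 1 / \<delta> * damped_defect \<kappa> s) + s
           + \<kappa> * (\<Sum>i\<in>UNIV. \<bar>damped_mean \<kappa> s i\<bar>) + \<kappa>\<^sup>2 * (\<Sum>i\<in>UNIV. \<Sum>l\<in>UNIV. \<bar>damped_cov \<kappa> s i l - s * A $ i $ l\<bar>)" for s
    have "((\<lambda>s. \<kappa>\<^sup>2 * ((1 / \<kappa> + \<delta>) * (\<Sum>i\<in>UNIV. damped_cov \<kappa> s i i / s) + 1 / \<delta> * (damped_defect \<kappa> s / s)) + 1
           + \<kappa> * (\<Sum>i\<in>UNIV. \<bar>damped_mean \<kappa> s i / s\<bar>) + \<kappa>\<^sup>2 * (\<Sum>i\<in>UNIV. \<Sum>l\<in>UNIV. \<bar>damped_cov \<kappa> s i l / s - A $ i $ l\<bar>))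
        \<longlongrightarrow> \<kappa>\<^sup>2 * ((1 / \<kappa> + \<delta>) * (\<Sum>i\<in>UNIV. A $ i $ i + V \<kappa> i i) + 1 / \<delta> * V4 \<kappa>) + 1
           + \<kappa> * (\<Sum>i\<in>UNIV. \<bar>B $ i + L \<kappa> i\<bar>) + \<kappa>\<^sup>2 * (\<Sum>i\<in>UNIV. \<Sum>l\<in>UNIV. \<bar>(A $ i $ l + V \<kappa> i l) - A $ i $ l\<bar>)) (at_right 0)"
      by (intro tendsto_add tendsto_mult tendsto_const tendsto_sum tendsto_rabs tendsto_diff xx_lim x1_lim x4_lim)
    then have lim: "((\<lambda>s. \<kappa>\<^sup>2 * ((1 / \<kappa> + \<delta>) * (\<Sum>i\<in>UNIV. damped_cov \<kappa> s i i / s) + 1 / \<delta> * (damped_defect \<kappa> s / s)) + 1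
           + \<kappa> * (\<Sum>i\<in>UNIV. \<bar>damped_mean \<kappa> s i / s\<bar>) + \<kappa>\<^sup>2 * (\<Sum>i\<in>UNIV. \<Sum>l\<in>UNIV. \<bar>damped_cov \<kappa> s i l / s - A $ i $ l\<bar>))
        \<longlongrightarrow> \<Lambda> \<kappa>) (at_right 0)" by (simp add: \<Lambda>_def)
    have F_eq: "\<kappa>\<^sup>2 * ((1 / \<kappa> + \<delta>) * (\<Sum>i\<in>UNIV. damped_cov \<kappa> s i i / s) + 1 / \<delta> * (damped_defect \<kappa> s / s)) + 1
           + \<kappa> * (\<Sum>i\<in>UNIV. \<bar>damped_mean \<kappa> s i / s\<bar>) + \<kappa>\<^sup>2 * (\<Sum>i\<in>UNIV. \<Sum>l\<in>UNIV. \<bar>damped_cov \<kappa> s i l / s - A $ i $ l\<bar>) = F s / s" if "s > 0" for s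
    proof -
      have 1: "damped_cov \<kappa> s i l / s - A $ i $ l = (damped_cov \<kappa> s i l - s * A $ i $ l) / s" for i l
        using that by (simp add: diff_divide_distrib)
      have 2: "(\<Sum>i\<in>UNIV. \<Sum>l\<in>UNIV. \<bar>damped_cov \<kappa> s i l / s - A $ i $ l\<bar>) = (\<Sum>i\<in>UNIV. \<Sum>l\<in>UNIV. \<bar>damped_cov \<kappa> s i l - s * A $ i $ l\<bar>) / s"
        unfolding sum_divide_distrib 1 using that by simp
      have 3: "(\<Sum>i\<in>UNIV. \<bar>damped_mean \<kappa> s i / s\<bar>) = (\<Sum>i\<in>UNIV. \<bar>damped_mean \<kappa> s i\<bar>) / s"
        unfolding sum_divide_distrib using that by simp
      have "a * (b * (X / s) + c * (Y / s)) + 1 + e * (Z / s) + a * (T / s) = (a * (b * X + c * Y) + s + e * Z + a * T) / s"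
        for a b c e X Y Z T :: real using that by (simp add: field_simps)
      then show ?thesis unfolding 2 3 sum_divide_distrib[symmetric] F_def .
    qed
    have "((\<lambda>s. F s / s) \<longlongrightarrow> \<Lambda> \<kappa>) (at_right 0)"
      by (rule Lim_transform_eventually[OF lim]) (use F_eq in \<open>auto intro: eventually_mono[OF eventually_at_right_less[of 0]]\<close>)
    then have "((\<lambda>s. C * (F s / s)) \<longlongrightarrow> C * \<Lambda> \<kappa>) (at_right 0)" by (rule tendsto_mult_left)
    then have "\<forall>\<^sub>F s in at_right 0. C * (F s / s) < \<epsilon> * \<kappa>\<^sup>2" using \<Lambda> by (rule order_tendstoD)
    then show "\<forall>\<^sub>F s in at_right 0. \<forall>y.
      cmod (expectation (\<lambda>\<omega>. iexp (\<kappa> * (\<xi> j (y \<otimes> X s \<omega>) - \<xi> j y))) - 1 + complex_of_real (\<kappa>\<^sup>2 * s * quad_form j y / 2))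
      \<le> \<epsilon> * \<kappa>\<^sup>2 * s"
      using bnd[OF \<kappa> \<delta>] eventually_at_right_less[of 0]
    proof eventually_elim
      case (elim s)
      have "C * F s \<le> \<epsilon> * \<kappa>\<^sup>2 * s" using elim(1,3) by (simp add: divide_less_eq)
      then show ?case using elim(2) unfolding F_def by (meson order_trans)
    qed
  qed simp
qed

lemma quad_form_zero: "quad_form j 0 = A $ j $ j"
  by (simp add: quad_form_def xi_lie_zero if_distrib[of "\<lambda>c. _ * c"] if_distrib[of "\<lambda>c. c * _"] cong: if_cong)

lemma quad_form_continuous: "continuous_on UNIV (quad_form j)"
  unfolding quad_form_def[abs_def]
  by (intro continuous_on_sum continuous_on_mult continuous_on_const xi_lie_continuous)

lemma quad_form_bounded: obtains D where "D \<ge> 0" and "\<And>y. \<bar>quad_form j y\<bar> \<le> D"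
proof -
  obtain W where W: "W \<ge> 0" "\<And>i y. \<bar>xi_lie j i y\<bar> \<le> W" using xi_lie_bounded by blast
  show thesis
  proof (rule that[of "\<Sum>i\<in>UNIV. \<Sum>l\<in>UNIV. \<bar>A $ i $ l\<bar> * (W * W)"])
    fix y
    show "\<bar>quad_form j y\<bar> \<le> (\<Sum>i\<in>UNIV. \<Sum>l\<in>UNIV. \<bar>A $ i $ l\<bar> * (W * W))"
      unfolding quad_form_def
    proof (rule order_trans[OF sum_abs], rule sum_mono, rule order_trans[OF sum_abs], rule sum_mono)
      fix i l
      show "\<bar>A $ i $ l * (xi_lie j i y * xi_lie j l y)\<bar> \<le> \<bar>A $ i $ l\<bar> * (W * W)"
        unfolding abs_mult using W by (intro mult_left_mono mult_mono) auto
    qed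
  qed (use W in \<open>auto intro!: sum_nonneg\<close>)
qed

text \<open>For the iteration the factor of each step must not depend on the current position. By
  continuity \<open>quad_form j y\<close> is close to its value \<open>A $ j $ j\<close> at the
  identity as long as \<open>y\<close> stays in a small ball; the bounded error elsewhere is charged
  to the event of having left that ball.\<close>

lemma clt_step_diag:
  assumes \<epsilon>: "\<epsilon> > 0"
  obtains r \<kappa>0 D where "r > 0" "\<kappa>0 \<ge> 1" "D \<ge> 0" and "\<And>\<kappa>. \<kappa> \<ge> \<kappa>0 \<Longrightarrow> \<forall>\<^sub>F s in at_right 0. \<forall>y.
      cmod (expectation (\<lambda>\<omega>. iexp (\<kappa> * (\<xi> j (y \<otimes> X s \<omega>) - \<xi> j y))) - complex_of_real (1 - \<kappa>\<^sup>2 * s * A $ j $ j / 2))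
      \<le> \<kappa>\<^sup>2 * s * (\<epsilon> + D * indicator {y. norm y \<ge> r} y)"
proof -
  obtain \<kappa>0 where \<kappa>0: "\<kappa>0 \<ge> 1" "\<And>\<kappa>. \<kappa> \<ge> \<kappa>0 \<Longrightarrow> \<forall>\<^sub>F s in at_right 0. \<forall>y.
      cmod (expectation (\<lambda>\<omega>. iexp (\<kappa> * (\<xi> j (y \<otimes> X s \<omega>) - \<xi> j y))) - 1 + complex_of_real (\<kappa>\<^sup>2 * s * quad_form j y / 2))
      \<le> \<epsilon> / 2 * \<kappa>\<^sup>2 * s"
    using clt_step[of "\<epsilon> / 2" j] \<epsilon> by auto
  obtain D where D: "D \<ge> 0" "\<And>y. \<bar>quad_form j y\<bar> \<le> D" using quad_form_bounded by blast
  have "isCont (quad_form j) 0" using quad_form_continuous by (simp add: continuous_on_eq_continuous_at)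
  then obtain r where r: "r > 0" "\<And>y. norm y < r \<Longrightarrow> \<bar>quad_form j y - A $ j $ j\<bar> < \<epsilon>"
    unfolding continuous_at_eps_delta quad_form_zero using \<epsilon> by (auto simp: dist_norm)
  have near: "\<bar>quad_form j y - A $ j $ j\<bar> / 2 \<le> \<epsilon> / 2 + D * indicator {y. norm y \<ge> r} y" for y
    using r(2)[of y] D(2)[of y] D(2)[of 0] \<epsilon> by (cases "norm y < r") (auto simp: quad_form_zero)
  show thesis
  proof (rule that[OF r(1) \<kappa>0(1) D(1)])
    fix \<kappa> assume \<kappa>: "\<kappa> \<ge> \<kappa>0"
    from \<kappa>0(2)[OF \<kappa>] eventually_at_right_less[of 0]
    show "\<forall>\<^sub>F s in at_right 0. \<forall>y.
      cmod (expectation (\<lambda>\<omega>. iexp (\<kappa> * (\<xi> j (y \<otimes> X s \<omega>) - \<xi> j y))) - complex_of_real (1 - \<kappa>\<^sup>2 * s * A $ j $ j / 2))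
      \<le> \<kappa>\<^sup>2 * s * (\<epsilon> + D * indicator {y. norm y \<ge> r} y)"
    proof eventually_elim
      case (elim s)
      show ?case
      proof
        fix y
        let ?E = "expectation (\<lambda>\<omega>. iexp (\<kappa> * (\<xi> j (y \<otimes> X s \<omega>) - \<xi> j y)))"
        have eq: "?E - complex_of_real (1 - \<kappa>\<^sup>2 * s * A $ j $ j / 2) =
          (?E - 1 + complex_of_real (\<kappa>\<^sup>2 * s * quad_form j y / 2)) - complex_of_real (\<kappa>\<^sup>2 * s * ((quad_form j y - A $ j $ j) / 2))"
          by (simp add: algebra_simps diff_divide_distrib)
        have "cmod (?E - complex_of_real (1 - \<kappa>\<^sup>2 * s * A $ j $ j / 2)) \<le> \<epsilon> / 2 * \<kappa>\<^sup>2 * s + \<bar>\<kappa>\<^sup>2 * s * ((quad_form j y - A $ j $ j) / 2)\<bar>"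
          unfolding eq using elim(1)
          by (intro order_trans[OF norm_triangle_ineq4] add_mono) (auto simp only: norm_of_real order_refl)
        also have "\<bar>\<kappa>\<^sup>2 * s * ((quad_form j y - A $ j $ j) / 2)\<bar> = \<kappa>\<^sup>2 * s * (\<bar>quad_form j y - A $ j $ j\<bar> / 2)"
          using elim(2) by (simp add: abs_mult)
        also have "\<dots> \<le> \<kappa>\<^sup>2 * s * (\<epsilon> / 2 + D * indicator {y. norm y \<ge> r} y)"
          using elim(2) by (intro mult_left_mono near) auto
        finally show "cmod (?E - complex_of_real (1 - \<kappa>\<^sup>2 * s * A $ j $ j / 2)) \<le> \<kappa>\<^sup>2 * s * (\<epsilon> + D * indicator {y. norm y \<ge> r} y)"
          by (simp add: algebra_simps)
      qed
    qed
  qed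
qed

section \<open>Iteration over many small steps\<close>

lemma increments_indep:
  assumes "0 \<le> a" "a \<le> b" "b \<le> c"
  shows "indep_var borel (\<lambda>\<omega>. increment G (\<lambda>r. X r \<omega>) a b) borel (\<lambda>\<omega>. increment G (\<lambda>r. X r \<omega>) b c)"
proof -
  define t where "t i = (if i = 0 then a else if i = 1 then b else c)" for i :: nat
  define I where "I i \<omega> = increment G (\<lambda>r. X r \<omega>) (t i) (t (Suc i))" for i \<omega>
  have "t 0 \<ge> 0 \<and> (\<forall>i<2. t i \<le> t (Suc i))"
    using assms by (auto simp: t_def less_2_cases_iff)
  moreover have "\<forall>(n::nat) (t::nat \<Rightarrow> real). t 0 \<ge> 0 \<and> (\<forall>i<n. t i \<le> t (Suc i)) \<longrightarrow>
      indep_vars (\<lambda>_. borel) (\<lambda>i \<omega>. increment G (\<lambda>r. X r \<omega>) (t i) (t (Suc i))) {..<n}"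
    using levy unfolding levy_process_def by blast
  ultimately have ind: "indep_vars (\<lambda>_. borel) I {..<2::nat}"
    unfolding I_def by blast
  have "indep_var borel ((\<lambda>f. f 0) \<circ> (\<lambda>\<omega>. restrict (\<lambda>i. I i \<omega>) {0::nat}))
      borel ((\<lambda>f. f 1) \<circ> (\<lambda>\<omega>. restrict (\<lambda>i. I i \<omega>) {1}))"
    by (intro indep_var_compose[OF indep_var_restrict[OF ind]]) auto
  then show ?thesis by (simp add: comp_def I_def t_def)
qed

lemma increment_prob:
  assumes "0 \<le> s" "0 \<le> h" and [measurable]: "S \<in> sets borel"
  shows "prob {\<omega> \<in> space M. increment G (\<lambda>r. X r \<omega>) s (s + h) \<in> S} = prob {\<omega> \<in> space M. X h \<omega> \<in> S}"
proof -
  have "measure (distr M borel (\<lambda>\<omega>. increment G (\<lambda>r. X r \<omega>) s (s + h))) S = measure (distr M borel (X h)) S"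
    by (simp add: increment_distr assms)
  then show ?thesis
    using assms by (simp add: measure_distr vimage_def Int_def conj_commute)
qed

text \<open>Freezing the position after k steps shows that the characteristic function is multiplied
  by \<beta> in the next step, up to an error. As 0 \<le> \<beta> \<le> 1, earlier errors are not
  amplified, and the n errors merely add up.\<close>

lemma char_iterate:
  fixes \<kappa> s \<beta> \<eta> \<epsilon> D r \<tau> :: real
  assumes s: "s > 0" and \<beta>: "0 \<le> \<beta>" "\<beta> \<le> 1" and \<eta>: "\<eta> \<ge> 0" and D: "D \<ge> 0" and r: "r > 0"
    and q: "\<And>y. cmod (expectation (\<lambda>\<omega>. iexp (\<kappa> * (\<xi> j (y \<otimes> X s \<omega>) - \<xi> j y))) - complex_of_real \<beta>)
       \<le> \<eta> * (\<epsilon> + D * indicator {y. norm y \<ge> r} y)"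
    and tail: "\<And>u. 0 \<le> u \<Longrightarrow> u \<le> real n * s \<Longrightarrow> prob {\<omega> \<in> space M. norm (X u \<omega>) \<ge> r} \<le> \<tau>"
  shows "cmod (expectation (\<lambda>\<omega>. iexp (\<kappa> * \<xi> j (X (real n * s) \<omega>))) - complex_of_real (\<beta> ^ n))
     \<le> real n * (\<eta> * (\<epsilon> + D * \<tau>))"
proof -
  define Y where "Y k \<omega> = increment G (\<lambda>r. X r \<omega>) 0 (real k * s)" for k \<omega>
  define h where "h k = expectation (\<lambda>\<omega>. iexp (\<kappa> * \<xi> j (Y k \<omega>)))" for k
  have Ym [measurable]: "Y k \<in> borel_measurable M" for k
    unfolding Y_def[abs_def] by (rule increment_measurable) (use s in auto)
  have Xs [measurable]: "X s \<in> borel_measurable M"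
    using s by (intro X_measurable) simp
  have hX: "h k = expectation (\<lambda>\<omega>. iexp (\<kappa> * \<xi> j (X (real k * s) \<omega>)))" for k
    using increment_expectation[of 0 "real k * s" "\<lambda>x. iexp (\<kappa> * \<xi> j x)"] s by (simp add: h_def Y_def)
  have "cmod (h k - complex_of_real (\<beta> ^ k)) \<le> real k * (\<eta> * (\<epsilon> + D * \<tau>))" if "k \<le> n" for k
    using that
  proof (induction k)
    case 0
    show ?case by (simp add: h_def Y_def prob_space)
  next
    case (Suc k)
    define Z where "Z \<omega> = increment G (\<lambda>r. X r \<omega>) (real k * s) (real k * s + s)" for \<omega>
    have Zm [measurable]: "Z \<in> borel_measurable M"
      unfolding Z_def[abs_def] by (rule increment_measurable) (use s in auto)
    define q0 where "q0 y = expectation (\<lambda>\<omega>. iexp (\<kappa> * (\<xi> j (y \<otimes> X s \<omega>) - \<xi> j y)))" for y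
    have qZ: "expectation (\<lambda>\<omega>. iexp (\<kappa> * \<xi> j (y \<otimes> Z \<omega>))) = iexp (\<kappa> * \<xi> j y) * q0 y" for y
    proof -
      have "expectation (\<lambda>\<omega>. iexp (\<kappa> * \<xi> j (y \<otimes> Z \<omega>))) = expectation (\<lambda>\<omega>. iexp (\<kappa> * \<xi> j (y \<otimes> X s \<omega>)))"
        unfolding Z_def using s by (intro increment_expectation) auto
      also have "\<dots> = expectation (\<lambda>\<omega>. iexp (\<kappa> * \<xi> j y) * iexp (\<kappa> * (\<xi> j (y \<otimes> X s \<omega>) - \<xi> j y)))"
        by (intro Bochner_Integration.integral_cong refl) (simp add: exp_add[symmetric] algebra_simps)
      finally show ?thesis by (simp add: q0_def)
    qed
    have qm [measurable]: "q0 \<in> borel_measurable borel"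
      unfolding q0_def[abs_def] by measurable
    have YZ: "Y (Suc k) \<omega> = Y k \<omega> \<otimes> Z \<omega>" for \<omega>
      by (simp add: Y_def Z_def increment_mult algebra_simps)
    have iv: "indep_var borel (Y k) borel Z"
      unfolding Y_def[abs_def] Z_def[abs_def] using s by (intro increments_indep) auto
    have "h (Suc k) = expectation (\<lambda>\<omega>. (\<lambda>p. iexp (\<kappa> * \<xi> j (fst p \<otimes> snd p))) (Y k \<omega>, Z \<omega>))"
      by (simp add: h_def YZ)
    also have "\<dots> = expectation (\<lambda>\<omega>. expectation (\<lambda>\<omega>'. (\<lambda>p. iexp (\<kappa> * \<xi> j (fst p \<otimes> snd p))) (Y k \<omega>, Z \<omega>')))"
    proof (rule indep_var_expectation_iterated[OF iv, where C = 1])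
      show "(\<lambda>p. iexp (\<kappa> * \<xi> j (fst p \<otimes> snd p))) \<in> borel_measurable (borel \<Otimes>\<^sub>M borel)"
        by measurable
    qed simp
    also have "\<dots> = expectation (\<lambda>\<omega>. iexp (\<kappa> * \<xi> j (Y k \<omega>)) * q0 (Y k \<omega>))"
      by (simp only: fst_conv snd_conv qZ)
    finally have hS: "h (Suc k) = expectation (\<lambda>\<omega>. iexp (\<kappa> * \<xi> j (Y k \<omega>)) * q0 (Y k \<omega>))" .
    have q0b: "cmod (q0 y) \<le> 1" for y
    proof -
      have "cmod (q0 y) \<le> expectation (\<lambda>\<omega>. cmod (iexp (\<kappa> * (\<xi> j (y \<otimes> X s \<omega>) - \<xi> j y))))"
        unfolding q0_def by (rule integral_norm_bound)
      then show ?thesis by (simp add: prob_space)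
    qed
    have i1: "integrable M (\<lambda>\<omega>. iexp (\<kappa> * \<xi> j (Y k \<omega>)) * q0 (Y k \<omega>))"
      by (rule integrable_bounded[of _ 1]) (auto simp: norm_mult q0b)
    have i2: "integrable M (\<lambda>\<omega>. iexp (\<kappa> * \<xi> j (Y k \<omega>)))"
      by (rule integrable_bounded[of _ 1]) auto
    have ind: "expectation (\<lambda>\<omega>. indicator {y. norm y \<ge> r} (Y k \<omega>)) \<le> \<tau>"
    proof -
      have "expectation (\<lambda>\<omega>. indicator {y. norm y \<ge> r} (Y k \<omega>)) = expectation (indicator {\<omega> \<in> space M. norm (Y k \<omega>) \<ge> r})"
        by (intro Bochner_Integration.integral_cong) (auto simp: indicator_def)
      also have "\<dots> = prob {\<omega> \<in> space M. norm (Y k \<omega>) \<ge> r}" by simp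
      also have "\<dots> = prob {\<omega> \<in> space M. norm (X (real k * s) \<omega>) \<ge> r}"
        using increment_prob[of 0 "real k * s" "{y. norm y \<ge> r}"] s by (simp add: Y_def)
      also have "\<dots> \<le> \<tau>" using Suc.prems s by (intro tail) (auto intro: mult_right_mono)
      finally show ?thesis .
    qed
    have "h (Suc k) - complex_of_real \<beta> * h k =
        expectation (\<lambda>\<omega>. iexp (\<kappa> * \<xi> j (Y k \<omega>)) * q0 (Y k \<omega>) - complex_of_real \<beta> * iexp (\<kappa> * \<xi> j (Y k \<omega>)))"
      unfolding hS unfolding h_def using i1 i2 by simp
    also have "cmod \<dots> \<le> expectation (\<lambda>\<omega>. cmod (iexp (\<kappa> * \<xi> j (Y k \<omega>)) * q0 (Y k \<omega>) - complex_of_real \<beta> * iexp (\<kappa> * \<xi> j (Y k \<omega>))))"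
      by (rule integral_norm_bound)
    also have "\<dots> \<le> expectation (\<lambda>\<omega>. \<eta> * (\<epsilon> + D * indicator {y. norm y \<ge> r} (Y k \<omega>)))"
    proof (rule integral_mono)
      show "integrable M (\<lambda>\<omega>. cmod (iexp (\<kappa> * \<xi> j (Y k \<omega>)) * q0 (Y k \<omega>) - complex_of_real \<beta> * iexp (\<kappa> * \<xi> j (Y k \<omega>))))"
        using i1 i2 by (intro integrable_norm) auto
      show "integrable M (\<lambda>\<omega>. \<eta> * (\<epsilon> + D * indicator {y. norm y \<ge> r} (Y k \<omega>)))"
        by (intro integrable_mult_right Bochner_Integration.integrable_add integrable_bounded[of "\<lambda>\<omega>. indicator _ (Y k \<omega>)" 1])
           (auto simp: indicator_def)
      fix \<omega>
      have "cmod (iexp (\<kappa> * \<xi> j (Y k \<omega>)) * q0 (Y k \<omega>) - complex_of_real \<beta> * iexp (\<kappa> * \<xi> j (Y k \<omega>))) =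
         cmod (iexp (\<kappa> * \<xi> j (Y k \<omega>)) * (q0 (Y k \<omega>) - complex_of_real \<beta>))"
        by (simp add: algebra_simps)
      also have "\<dots> = cmod (q0 (Y k \<omega>) - complex_of_real \<beta>)" unfolding norm_mult by simp
      also have "\<dots> \<le> \<eta> * (\<epsilon> + D * indicator {y. norm y \<ge> r} (Y k \<omega>))" unfolding q0_def by (rule q)
      finally show "cmod (iexp (\<kappa> * \<xi> j (Y k \<omega>)) * q0 (Y k \<omega>) - complex_of_real \<beta> * iexp (\<kappa> * \<xi> j (Y k \<omega>)))
         \<le> \<eta> * (\<epsilon> + D * indicator {y. norm y \<ge> r} (Y k \<omega>))" .
    qed
    also have "\<dots> = \<eta> * (\<epsilon> + D * expectation (\<lambda>\<omega>. indicator {y. norm y \<ge> r} (Y k \<omega>)))"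
    proof -
      have "integrable M (\<lambda>\<omega>. indicator {y. norm y \<ge> r} (Y k \<omega>) :: real)"
        by (rule integrable_bounded[of _ 1]) (auto simp: indicator_def)
      then show ?thesis by (simp add: prob_space)
    qed
    also have "\<dots> \<le> \<eta> * (\<epsilon> + D * \<tau>)"
      using ind \<eta> D by (intro mult_left_mono add_left_mono) auto
    finally have step: "cmod (h (Suc k) - complex_of_real \<beta> * h k) \<le> \<eta> * (\<epsilon> + D * \<tau>)" .
    have "h (Suc k) - complex_of_real (\<beta> ^ Suc k) =
       (h (Suc k) - complex_of_real \<beta> * h k) + complex_of_real \<beta> * (h k - complex_of_real (\<beta> ^ k))"
      by (simp add: algebra_simps)
    also have "cmod \<dots> \<le> \<eta> * (\<epsilon> + D * \<tau>) + cmod (complex_of_real \<beta> * (h k - complex_of_real (\<beta> ^ k)))"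
      by (intro norm_triangle_le add_mono step order_refl)
    also have "cmod (complex_of_real \<beta> * (h k - complex_of_real (\<beta> ^ k))) = \<beta> * cmod (h k - complex_of_real (\<beta> ^ k))"
      using \<beta> by (simp add: norm_mult)
    also have "\<dots> \<le> 1 * cmod (h k - complex_of_real (\<beta> ^ k))" using \<beta> by (intro mult_right_mono) auto
    also have "\<dots> \<le> real k * (\<eta> * (\<epsilon> + D * \<tau>))" using Suc by simp
    finally show ?case by (simp add: algebra_simps)
  qed
  from this[of n] show ?thesis by (simp add: hX)
qed

text \<open>With \<open>t\<close> fixed, \<open>n\<close> tends to infinity first: the power in
  \<open>char_iterate\<close> becomes the exponential, and the accumulated error \<theta>^2
  (\<epsilon> + D Cr t) does not depend on n. Only then is \<open>t\<close> made small. The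
  probability of leaving the small ball is of order \<open>t\<close>, so this part of the error
  disappears as well.\<close>

lemma clt_char:
  assumes \<theta>: "\<theta> > 0"
  shows "((\<lambda>t. expectation (\<lambda>\<omega>. iexp (\<theta> / sqrt t * \<xi> j (X t \<omega>)))) \<longlongrightarrow>
     complex_of_real (exp (- (\<theta>\<^sup>2 * A $ j $ j / 2)))) (at_right 0)"
proof (rule tendstoI)
  fix e :: real assume e: "e > 0"
  \<comment> \<open>The final error is at most 2 \<theta>^2 \<epsilon>, that is e / 2.\<close>
  define \<epsilon> where "\<epsilon> = e / (4 * \<theta>\<^sup>2)"
  have \<epsilon>: "\<epsilon> > 0" using e \<theta> by (simp add: \<epsilon>_def)
  obtain r \<kappa>0 D where r: "r > 0" and \<kappa>0: "\<kappa>0 \<ge> 1" and D: "D \<ge> 0"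
    and step: "\<And>\<kappa>. \<kappa> \<ge> \<kappa>0 \<Longrightarrow> \<forall>\<^sub>F s in at_right 0. \<forall>y.
      cmod (expectation (\<lambda>\<omega>. iexp (\<kappa> * (\<xi> j (y \<otimes> X s \<omega>) - \<xi> j y))) - complex_of_real (1 - \<kappa>\<^sup>2 * s * A $ j $ j / 2))
      \<le> \<kappa>\<^sup>2 * s * (\<epsilon> + D * indicator {y. norm y \<ge> r} y)"
    using clt_step_diag[OF \<epsilon>, of j] by blast
  obtain Cr where Cr: "Cr > 0" "\<forall>\<^sub>F t in at_right 0. prob {\<omega> \<in> space M. norm (X t \<omega>) \<ge> r} \<le> Cr * t"
    using tail_linear[OF r] by blast
  then obtain t1 where t1: "t1 > 0" "\<And>t. 0 < t \<Longrightarrow> t < t1 \<Longrightarrow> prob {\<omega> \<in> space M. norm (X t \<omega>) \<ge> r} \<le> Cr * t"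
    by (auto simp: eventually_at_right_field)
  \<comment> \<open>The three bounds ensure, in this order, that the tail estimate is valid, that
    the frequency \<theta> / sqrt t is at least \<kappa>0, and that D Cr t is at most
    \<epsilon>.\<close>
  define t2 where "t2 = Min {t1, \<theta>\<^sup>2 / \<kappa>0\<^sup>2, \<epsilon> / (D * Cr + 1)}"
  have DC: "D * Cr + 1 > 0" using D Cr by (simp add: add_nonneg_pos)
  have t2: "t2 > 0" using t1 \<theta> \<kappa>0 \<epsilon> DC by (simp add: t2_def)
  have main: "dist (expectation (\<lambda>\<omega>. iexp (\<theta> / sqrt t * \<xi> j (X t \<omega>)))) (complex_of_real (exp (- (\<theta>\<^sup>2 * A $ j $ j / 2)))) < e"
    if t: "0 < t" "t < t2" for t
  proof -
    have tt: "t < t1" "t \<le> \<theta>\<^sup>2 / \<kappa>0\<^sup>2" "t \<le> \<epsilon> / (D * Cr + 1)" using t by (auto simp: t2_def)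
    define \<kappa> where "\<kappa> = \<theta> / sqrt t"
    have \<kappa>2: "\<kappa>\<^sup>2 = \<theta>\<^sup>2 / t" using t by (simp add: \<kappa>_def power_divide)
    have "\<kappa>0\<^sup>2 \<le> \<theta>\<^sup>2 / t" using tt(2) t \<kappa>0 by (simp add: field_simps)
    then have "\<kappa>0\<^sup>2 \<le> \<kappa>\<^sup>2" by (simp add: \<kappa>2)
    moreover have "\<kappa> \<ge> 0" using \<theta> t by (simp add: \<kappa>_def)
    ultimately have \<kappa>: "\<kappa> \<ge> \<kappa>0" by (rule power2_le_imp_le)
    obtain s0 where s0: "s0 > 0" "\<And>s y. 0 < s \<Longrightarrow> s < s0 \<Longrightarrow>
      cmod (expectation (\<lambda>\<omega>. iexp (\<kappa> * (\<xi> j (y \<otimes> X s \<omega>) - \<xi> j y))) - complex_of_real (1 - \<kappa>\<^sup>2 * s * A $ j $ j / 2))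
      \<le> \<kappa>\<^sup>2 * s * (\<epsilon> + D * indicator {y. norm y \<ge> r} y)"
      using step[OF \<kappa>] unfolding eventually_at_right_field by blast
    let ?h = "expectation (\<lambda>\<omega>. iexp (\<kappa> * \<xi> j (X t \<omega>)))"
    define x where "x = - (\<theta>\<^sup>2 * A $ j $ j / 2)"
    have tail: "prob {\<omega> \<in> space M. norm (X u \<omega>) \<ge> r} \<le> Cr * t" if u: "0 \<le> u" "u \<le> t" for u
    proof (cases "u = 0")
      case True
      have "prob {\<omega> \<in> space M. norm (X 0 \<omega>) \<ge> r} = 0"
      proof -
        have "AE \<omega> in M. \<not> norm (X 0 \<omega>) \<ge> r" using X_zero by eventually_elim (use r in auto)
        then show ?thesis by (subst prob_eq_0) auto
      qed
      then show ?thesis using True Cr t by simp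
    next
      case False
      then have "prob {\<omega> \<in> space M. norm (X u \<omega>) \<ge> r} \<le> Cr * u" using u tt by (intro t1) auto
      also have "\<dots> \<le> Cr * t" using u Cr by (intro mult_left_mono) auto
      finally show ?thesis .
    qed
    have ev: "\<forall>\<^sub>F n in sequentially. cmod (?h - complex_of_real ((1 + x / real n) ^ n)) \<le> \<theta>\<^sup>2 * (\<epsilon> + D * (Cr * t))"
    proof -
      have "(\<lambda>n. t / real n) \<longlonglongrightarrow> 0" by (rule lim_const_over_n)
      then have "\<forall>\<^sub>F n in sequentially. t / real n < s0" using s0(1) by (rule order_tendstoD)
      moreover have "(\<lambda>n. (\<theta>\<^sup>2 * A $ j $ j / 2) / real n) \<longlonglongrightarrow> 0" by (rule lim_const_over_n)
      then have "\<forall>\<^sub>F n in sequentially. (\<theta>\<^sup>2 * A $ j $ j / 2) / real n < 1" by (rule order_tendstoD) simp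
      moreover have "\<forall>\<^sub>F n::nat in sequentially. n > 0" by (rule eventually_gt_at_top)
      ultimately show ?thesis
      proof eventually_elim
        case (elim n)
        have n: "real n > 0" using elim by simp
        have eqt: "real n * (t / real n) = t" using n by simp
        have \<beta>: "1 - \<kappa>\<^sup>2 * (t / real n) * A $ j $ j / 2 = 1 + x / real n"
          using t n by (simp add: \<kappa>2 x_def)
        have ks: "\<kappa>\<^sup>2 * (t / real n) = \<theta>\<^sup>2 / real n" using t n by (simp add: \<kappa>2)
        have "cmod (expectation (\<lambda>\<omega>. iexp (\<kappa> * \<xi> j (X (real n * (t / real n)) \<omega>))) - complex_of_real ((1 + x / real n) ^ n))
            \<le> real n * (\<kappa>\<^sup>2 * (t / real n) * (\<epsilon> + D * (Cr * t)))"
        proof (rule char_iterate[where r = r])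
          show "t / real n > 0" using t n by simp
          show "0 \<le> 1 + x / real n" using elim by (simp add: x_def)
          show "1 + x / real n \<le> 1" using A_diag_nonneg[of j] n by (simp add: x_def divide_le_0_iff)
          show "cmod (expectation (\<lambda>\<omega>. iexp (\<kappa> * (\<xi> j (y \<otimes> X (t / real n) \<omega>) - \<xi> j y))) - complex_of_real (1 + x / real n))
            \<le> \<kappa>\<^sup>2 * (t / real n) * (\<epsilon> + D * indicator {y. r \<le> norm y} y)" for y
            using s0(2)[of "t / real n" y] t n elim unfolding \<beta> by simp
          show "prob {\<omega> \<in> space M. r \<le> norm (X u \<omega>)} \<le> Cr * t" if "0 \<le> u" "u \<le> real n * (t / real n)" for u
            using that tail[of u] unfolding eqt by simp
        qed (use D r t in auto)
        also have "real n * (\<kappa>\<^sup>2 * (t / real n) * (\<epsilon> + D * (Cr * t))) = \<theta>\<^sup>2 * (\<epsilon> + D * (Cr * t))"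
          unfolding ks using n by simp
        finally show ?case unfolding eqt .
      qed
    qed
    have "(\<lambda>n. complex_of_real ((1 + x / real n) ^ n)) \<longlonglongrightarrow> complex_of_real (exp x)"
      by (intro tendsto_of_real tendsto_exp_limit_sequentially)
    then have "(\<lambda>n. cmod (?h - complex_of_real ((1 + x / real n) ^ n))) \<longlonglongrightarrow> cmod (?h - complex_of_real (exp x))"
      by (intro tendsto_norm tendsto_diff tendsto_const)
    then have "cmod (?h - complex_of_real (exp x)) \<le> \<theta>\<^sup>2 * (\<epsilon> + D * (Cr * t))"
      using ev by (rule tendsto_upperbound) simp
    also have "D * (Cr * t) \<le> \<epsilon>"
    proof -
      have "D * Cr * t \<le> (D * Cr + 1) * t" using t by (intro mult_right_mono) auto
      also have "\<dots> \<le> \<epsilon>" using tt(3) DC by (simp add: field_simps)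
      finally show ?thesis by (simp add: mult.assoc)
    qed
    then have "\<theta>\<^sup>2 * (\<epsilon> + D * (Cr * t)) \<le> \<theta>\<^sup>2 * (\<epsilon> + \<epsilon>)" by (intro mult_left_mono) auto
    also have "\<dots> < e" using e \<theta> by (simp add: \<epsilon>_def)
    finally show ?thesis unfolding dist_norm x_def \<kappa>_def .
  qed
  show "\<forall>\<^sub>F t in at_right 0. dist (expectation (\<lambda>\<omega>. iexp (\<theta> / sqrt t * \<xi> j (X t \<omega>)))) (complex_of_real (exp (- (\<theta>\<^sup>2 * A $ j $ j / 2)))) < e"
    unfolding eventually_at_right_field using t2 main by blast
qed

end

section \<open>Large displacements of a nondegenerate coordinate\<close>

lemma std_normal_cdf:
  shows "isCont (cdf std_normal_distribution) x" "cdf std_normal_distribution x > 0"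
proof -
  interpret real_distribution std_normal_distribution by (rule real_dist_normal_dist)
  have "emeasure std_normal_distribution {x} = 0"
  proof -
    have "AE y in lborel. ennreal (std_normal_density y) * indicator {x} y = 0"
      using AE_lborel_singleton[of x] by eventually_elim (simp add: indicator_def)
    then show ?thesis by (subst emeasure_density) (auto simp: nn_integral_0_iff_AE)
  qed
  then show "isCont (cdf std_normal_distribution) x"
    by (simp add: isCont_cdf measure_def)
  have "emeasure std_normal_distribution {..x} \<noteq> 0"
  proof
    assume "emeasure std_normal_distribution {..x} = 0"
    then have "AE y in lborel. ennreal (std_normal_density y) * indicator {..x} y = 0"
      by (subst (asm) emeasure_density) (auto simp: nn_integral_0_iff_AE)
    then have "AE y in lborel. \<not> y \<in> {x - 1..x}"
    proof eventually_elim
      case (elim y)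
      then show ?case using normal_density_pos[of 1 0 y] by (auto simp: indicator_def split: if_splits)
    qed
    then have "emeasure lborel {y \<in> space lborel. y \<in> {x - 1..x}} = 0" by (rule emeasure_eq_0_AE)
    moreover have "{y \<in> space lborel. y \<in> {x - 1..x}} = {x - 1..x}" by auto
    ultimately show False by simp
  qed
  then show "cdf std_normal_distribution x > 0"
    by (simp add: cdf_def emeasure_eq_measure zero_less_measure_iff)
qed

context homogeneous_levy
begin

text \<open>A normal variable exceeds any given level with positive probability, so \<open>c\<close>
  exists for every \<open>L\<close>, although it depends on \<open>L\<close>. The argument is by
  contradiction because Levy's continuity theorem concerns sequences: times \<tau> n tending to 0
  whose probabilities tend to 0 would give the normal law no mass below a finite level.\<close>

lemma gaussian_lower_bound:
  assumes A: "A $ j $ j > 0" and L: "L > 0"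
  obtains c t0 where "c > 0" "t0 > 0"
    and "\<And>t. 0 < t \<Longrightarrow> t < t0 \<Longrightarrow> prob {\<omega> \<in> space M. (\<xi> j (X t \<omega>))\<^sup>2 \<ge> L * t} \<ge> c"
proof (rule ccontr)
  assume "\<not> thesis"
  then have neg: "\<And>c t0. c > 0 \<Longrightarrow> t0 > 0 \<Longrightarrow> \<exists>t. 0 < t \<and> t < t0 \<and> prob {\<omega> \<in> space M. (\<xi> j (X t \<omega>))\<^sup>2 \<ge> L * t} < c"
    using that by (meson not_le)
  define ok where "ok n t \<longleftrightarrow> 0 < t \<and> t < 1 / real (Suc n) \<and>
      prob {\<omega> \<in> space M. (\<xi> j (X t \<omega>))\<^sup>2 \<ge> L * t} < 1 / real (Suc n)" for n t
  define \<tau> where "\<tau> n = (SOME t. ok n t)" for n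
  have ok: "ok n (\<tau> n)" for n
    unfolding \<tau>_def by (rule someI_ex) (use neg[of "1 / real (Suc n)" "1 / real (Suc n)"] in \<open>simp add: ok_def\<close>)
  have \<tau>: "0 < \<tau> n" "\<tau> n < 1 / real (Suc n)"
    "prob {\<omega> \<in> space M. (\<xi> j (X (\<tau> n) \<omega>))\<^sup>2 \<ge> L * \<tau> n} < 1 / real (Suc n)" for n
    using ok[of n] unfolding ok_def by blast+
  have inv: "(\<lambda>n. 1 / real (Suc n)) \<longlonglongrightarrow> 0" by (rule LIMSEQ_Suc[OF lim_1_over_n])
  have "\<tau> \<longlonglongrightarrow> 0"
  proof (rule tendsto_sandwich[OF _ _ tendsto_const inv])
    show "\<forall>\<^sub>F n in sequentially. 0 \<le> \<tau> n" by (intro always_eventually allI less_imp_le \<tau>(1))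
    show "\<forall>\<^sub>F n in sequentially. \<tau> n \<le> 1 / real (Suc n)" by (intro always_eventually allI less_imp_le \<tau>(2))
  qed
  then have fl: "filterlim \<tau> (at_right 0) sequentially"
    by (rule tendsto_imp_filterlim_at_right) (simp add: \<tau>(1))
  have [measurable]: "X (\<tau> n) \<in> borel_measurable M" for n
    by (rule X_measurable) (use \<tau>(1)[of n] in simp)
  define Z where "Z n \<omega> = \<xi> j (X (\<tau> n) \<omega>) / (sqrt (A $ j $ j) * sqrt (\<tau> n))" for n \<omega>
  have Zm [measurable]: "Z n \<in> borel_measurable M" for n unfolding Z_def[abs_def] by measurable
  define \<mu> where "\<mu> n = distr M borel (Z n)" for n
  have rd: "real_distribution (\<mu> n)" for n
    unfolding \<mu>_def real_distribution_def real_distribution_axioms_def by (auto intro: prob_space_distr)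
  have char_eq: "char (\<mu> n) u = expectation (\<lambda>\<omega>. iexp (u * Z n \<omega>))" for n u
    unfolding char_def \<mu>_def by (subst integral_distr) auto
  have pos: "(\<lambda>n. char (\<mu> n) u) \<longlonglongrightarrow> complex_of_real (exp (- (u\<^sup>2) / 2))" if u: "u > 0" for u
  proof -
    define \<theta> where "\<theta> = u / sqrt (A $ j $ j)"
    have \<theta>: "\<theta> > 0" using u A by (simp add: \<theta>_def)
    have "\<theta>\<^sup>2 * A $ j $ j = u\<^sup>2" using A by (simp add: \<theta>_def power_divide)
    moreover have "char (\<mu> n) u = expectation (\<lambda>\<omega>. iexp (\<theta> / sqrt (\<tau> n) * \<xi> j (X (\<tau> n) \<omega>)))" for n
      unfolding char_eq by (simp add: Z_def \<theta>_def)
    ultimately show ?thesis using filterlim_compose[OF clt_char[OF \<theta>, of j] fl] by simp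
  qed
  have "weak_conv_m \<mu> std_normal_distribution"
  proof (rule levy_continuity[OF rd real_dist_normal_dist])
    fix u :: real
    consider "u > 0" | "u = 0" | "u < 0" by linarith
    then show "(\<lambda>n. char (\<mu> n) u) \<longlonglongrightarrow> char std_normal_distribution u"
    proof cases
      case 1
      then show ?thesis using pos by (simp add: char_std_normal_distribution)
    next
      case 2
      then show ?thesis
        using real_distribution.char_zero[OF rd] real_distribution.char_zero[OF real_dist_normal_dist] by simp
    next
      case 3
      have "char (\<mu> n) u = cnj (char (\<mu> n) (- u))" for n
      proof -
        have "cnj (char (\<mu> n) (- u)) = expectation (\<lambda>\<omega>. cnj (iexp (- u * Z n \<omega>)))"
          unfolding char_eq by (rule Bochner_Integration.integral_cnj[symmetric])
        then show ?thesis unfolding char_eq by (simp add: exp_cnj)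
      qed
      moreover have "(\<lambda>n. cnj (char (\<mu> n) (- u))) \<longlonglongrightarrow> cnj (complex_of_real (exp (- ((- u)\<^sup>2) / 2)))"
        using 3 by (intro tendsto_cnj pos) simp
      ultimately show ?thesis by (simp add: char_std_normal_distribution)
    qed
  qed
  \<comment> \<open>One tail suffices for a lower bound, and the left one is directly a value of the
    distribution function.\<close>
  define x where "x = - sqrt (L / A $ j $ j)"
  have "(\<lambda>n. cdf (\<mu> n) x) \<longlonglongrightarrow> cdf std_normal_distribution x"
    using \<open>weak_conv_m \<mu> std_normal_distribution\<close> std_normal_cdf(1)[of x]
    unfolding weak_conv_m_def weak_conv_def by blast
  moreover have "cdf (\<mu> n) x \<le> 1 / real (Suc n)" for n
  proof -
    have "cdf (\<mu> n) x = prob {\<omega> \<in> space M. Z n \<omega> \<le> x}"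
      unfolding cdf_def \<mu>_def by (subst measure_distr) (auto intro!: arg_cong[where f = prob])
    also have "\<dots> \<le> prob {\<omega> \<in> space M. (\<xi> j (X (\<tau> n) \<omega>))\<^sup>2 \<ge> L * \<tau> n}"
    proof (rule finite_measure_mono)
      show "{\<omega> \<in> space M. Z n \<omega> \<le> x} \<subseteq> {\<omega> \<in> space M. (\<xi> j (X (\<tau> n) \<omega>))\<^sup>2 \<ge> L * \<tau> n}"
      proof safe
        fix \<omega> assume "Z n \<omega> \<le> x"
        then have "sqrt (L / A $ j $ j) \<le> - Z n \<omega>" by (simp add: x_def)
        then have "(sqrt (L / A $ j $ j))\<^sup>2 \<le> (- Z n \<omega>)\<^sup>2" using L A by (intro power_mono) auto
        then have "L / A $ j $ j \<le> (\<xi> j (X (\<tau> n) \<omega>))\<^sup>2 / (A $ j $ j * \<tau> n)"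
          using L A \<tau>(1)[of n] by (simp add: Z_def power_divide power_mult_distrib)
        then show "L * \<tau> n \<le> (\<xi> j (X (\<tau> n) \<omega>))\<^sup>2" using A \<tau>(1)[of n] by (simp add: field_simps)
      qed
    qed measurable
    also have "\<dots> \<le> 1 / real (Suc n)" using \<tau>(3)[of n] by simp
    finally show ?thesis .
  qed
  ultimately have "cdf std_normal_distribution x \<le> 0"
    using inv by (intro LIMSEQ_le[of "\<lambda>n. cdf (\<mu> n) x" _ "\<lambda>n. 1 / real (Suc n)"]) auto
  then show False using std_normal_cdf(2)[of x] by linarith
qed

end

subsection \<open>Adaptive partitions\<close>

fun path_sum :: "(real \<Rightarrow> real \<Rightarrow> real) \<Rightarrow> real list \<Rightarrow> real" where
  "path_sum f (s # t # ts) = f s t + path_sum f (t # ts)"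
| "path_sum f _ = 0"

lemma path_sum_eq: "path_sum f ts = (\<Sum>j<length ts - 1. f (ts ! j) (ts ! Suc j))"
proof (induction f ts rule: path_sum.induct)
  case (1 f s t ts)
  show ?case using 1 by (simp add: sum.lessThan_Suc_shift del: sum.lessThan_Suc)
qed auto

lemma path_sum_append:
  "ts1 \<noteq> [] \<Longrightarrow> ts2 \<noteq> [] \<Longrightarrow> last ts1 = hd ts2 \<Longrightarrow> path_sum f (ts1 @ tl ts2) = path_sum f ts1 + path_sum f ts2"
proof (induction f ts1 rule: path_sum.induct)
  case ("2_2" f v)
  then show ?case by (cases ts2) auto
qed auto

lemma path_sum_mono:
  assumes "\<And>s t. f s t \<le> c * g s t"
  shows "path_sum f ts \<le> c * path_sum g ts"
  unfolding path_sum_eq sum_distrib_left by (intro sum_mono assms)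

lemma sorted_wrt_le_last:
  fixes ts :: "real list"
  assumes "sorted_wrt (<) ts" "x \<in> set ts"
  shows "x \<le> last ts"
  using assms by (induction ts) (auto intro: less_imp_le)

lemma partitions_append:
  assumes "ts1 \<in> partitions a b" "ts2 \<in> partitions b c"
  shows "ts1 @ tl ts2 \<in> partitions a c"
proof -
  have 1: "ts1 \<noteq> []" "sorted_wrt (<) ts1" "hd ts1 = a" "last ts1 = b"
    and 2: "ts2 \<noteq> []" "sorted_wrt (<) ts2" "hd ts2 = b" "last ts2 = c"
    using assms by (auto simp: partitions_def)
  obtain u where ts2: "ts2 = b # u" using 2 by (cases ts2) auto
  have "sorted_wrt (<) (ts1 @ u)"
    using 1 2 sorted_wrt_le_last[of ts1] by (force simp: ts2 sorted_wrt_append)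
  moreover have "last (ts1 @ u) = c" using 1 2 by (auto simp: ts2 last_append split: if_splits)
  ultimately show ?thesis using 1 by (simp add: ts2 partitions_def)
qed

text \<open>Hides the partition behind its value: lower bounds on adjacent intervals add up by
  \<open>reaches_trans\<close>, without carrying the concatenated lists along.\<close>

definition reaches :: "(real \<Rightarrow> real \<Rightarrow> real) \<Rightarrow> real \<Rightarrow> real \<Rightarrow> real \<Rightarrow> bool" where
  "reaches f a b v \<longleftrightarrow> (\<exists>ts\<in>partitions a b. path_sum f ts \<ge> v)"

lemma reaches_trans: "reaches f a b v \<Longrightarrow> reaches f b c w \<Longrightarrow> reaches f a c (v + w)"
proof -
  assume "reaches f a b v" "reaches f b c w"
  then obtain ts1 ts2 where t: "ts1 \<in> partitions a b" "path_sum f ts1 \<ge> v"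
    "ts2 \<in> partitions b c" "path_sum f ts2 \<ge> w" by (auto simp: reaches_def)
  then have "path_sum f (ts1 @ tl ts2) = path_sum f ts1 + path_sum f ts2"
    by (intro path_sum_append) (auto simp: partitions_def)
  then show ?thesis using t partitions_append[of ts1 a b ts2 c] unfolding reaches_def
    by (intro bexI[of _ "ts1 @ tl ts2"]) auto
qed

lemma reaches_interval: "a < b \<Longrightarrow> v \<le> f a b \<Longrightarrow> reaches f a b v"
  unfolding reaches_def by (intro bexI[of _ "[a, b]"]) (auto simp: partitions_def)

lemma reaches_sum:
  assumes "\<And>k. k < n \<Longrightarrow> reaches f (t k) (t (Suc k)) (v k)"
  shows "reaches f (t 0) (t n) (\<Sum>k<n. v k)"
  using assms
proof (induction n)
  case 0
  show ?case unfolding reaches_def by (intro bexI[of _ "[t 0]"]) (auto simp: partitions_def)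
next
  case (Suc n)
  then have "reaches f (t 0) (t n) (\<Sum>k<n. v k)" by simp
  from reaches_trans[OF this Suc.prems[of n]] show ?case by simp
qed

section \<open>Recursive splitting of blocks\<close>

context homogeneous_levy
begin

text \<open>Works on an abstract sequence of increments and not on a path. Functionals of a block
  are then measurable functions on a product space over its indices, which is the form in which
  independence of disjoint blocks applies.\<close>

primrec gprod :: "(nat \<Rightarrow> (real, 'm) vec) \<Rightarrow> nat \<Rightarrow> nat \<Rightarrow> (real, 'm) vec" where
  "gprod x b 0 = 0"
| "gprod x b (Suc l) = gprod x b l \<otimes> x (b + l)"

lemma gprod_measurable:
  "{b..<b + l} \<subseteq> I \<Longrightarrow> (\<lambda>x. gprod x b l) \<in> borel_measurable (PiM I (\<lambda>_. borel))"
proof (induction l)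
  case (Suc l)
  have "(\<lambda>x. x (b + l) :: (real, 'm) vec) \<in> measurable (PiM I (\<lambda>_. borel)) borel"
    using Suc.prems by (intro measurable_component_singleton) auto
  moreover have "(\<lambda>x. gprod x b l) \<in> borel_measurable (PiM I (\<lambda>_. borel))"
    using Suc.prems by (intro Suc.IH) auto
  ultimately show ?case by (simp add: measurable_mult_group)
qed simp

lemma gprod_restrict: "{b..<b + l} \<subseteq> I \<Longrightarrow> gprod (restrict x I) b l = gprod x b l"
proof (induction l)
  case (Suc l)
  have "{b..<b + l} \<subseteq> I" "b + l \<in> I" using Suc.prems by auto
  then show ?case using Suc.IH by simp
qed simp

lemma gprod_increments:
  "gprod (\<lambda>i. increment G x (real i * \<eta>) (real (Suc i) * \<eta>)) b l = increment G x (real b * \<eta>) (real (b + l) * \<eta>)"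
proof (induction l)
  case (Suc l)
  then show ?case using increment_mult[of x "real b * \<eta>" "real (b + l) * \<eta>" "real (b + Suc l) * \<eta>"] by simp
qed simp

text \<open>The amount by which a recursively chosen partition of the block starting at \<open>b\<close>, with
  \<open>m ^ n\<close> grid cells, falls short of the quadratic variation \<open>L\<close> times its length: the block is kept as
  one interval if the displacement is large enough, and is split into \<open>m\<close> blocks otherwise.\<close>

primrec deficit :: "real \<Rightarrow> real \<Rightarrow> nat \<Rightarrow> 'm \<Rightarrow> nat \<Rightarrow> nat \<Rightarrow> (nat \<Rightarrow> (real, 'm) vec) \<Rightarrow> real" where
  "deficit L \<eta> m j 0 b x = L * \<eta>"
| "deficit L \<eta> m j (Suc n) b x = (if (\<xi> j (gprod x b (m ^ Suc n)))\<^sup>2 \<ge> L * (\<eta> * real (m ^ Suc n)) then 0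
     else (\<Sum>k<m. deficit L \<eta> m j n (b + k * m ^ n) x))"

lemma deficit_bounds:
  assumes "L \<ge> 0" "\<eta> \<ge> 0"
  shows "0 \<le> deficit L \<eta> m j n b x \<and> deficit L \<eta> m j n b x \<le> L * (\<eta> * real (m ^ n))"
proof (induction n arbitrary: b)
  case (Suc n)
  have "(\<Sum>k<m. deficit L \<eta> m j n (b + k * m ^ n) x) \<le> (\<Sum>k<m. L * (\<eta> * real (m ^ n)))"
    using Suc by (intro sum_mono) auto
  then show ?case using Suc assms by (auto intro!: sum_nonneg simp: mult_ac)
qed (use assms in auto)

lemma block_subset:
  fixes b :: nat
  assumes "k < m"
  shows "{b + k * m ^ n..<b + k * m ^ n + m ^ n} \<subseteq> {b..<b + m ^ Suc n}"
proof -
  have "Suc k * m ^ n \<le> m * m ^ n" using assms by (intro mult_right_mono) auto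
  then show ?thesis by auto
qed

lemma deficit_measurable:
  "{b..<b + m ^ n} \<subseteq> I \<Longrightarrow> deficit L \<eta> m j n b \<in> borel_measurable (PiM I (\<lambda>_. borel))"
proof (induction n arbitrary: b)
  case 0
  show ?case by (simp cong: measurable_cong)
next
  case (Suc n)
  have [measurable]: "(\<lambda>x. gprod x b (m ^ Suc n)) \<in> borel_measurable (PiM I (\<lambda>_. borel))"
    by (rule gprod_measurable[OF Suc.prems])
  have "deficit L \<eta> m j n (b + k * m ^ n) \<in> borel_measurable (PiM I (\<lambda>_. borel))" if "k < m" for k
    using block_subset[OF that, of b n] Suc.prems by (intro Suc.IH) blast
  then have [measurable]: "(\<lambda>x. \<Sum>k<m. deficit L \<eta> m j n (b + k * m ^ n) x) \<in> borel_measurable (PiM I (\<lambda>_. borel))"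
    by (intro borel_measurable_sum) auto
  have "deficit L \<eta> m j (Suc n) b = (\<lambda>x. if (\<xi> j (gprod x b (m ^ Suc n)))\<^sup>2 \<ge> L * (\<eta> * real (m ^ Suc n)) then 0
     else (\<Sum>k<m. deficit L \<eta> m j n (b + k * m ^ n) x))" by (rule ext) (rule deficit.simps)
  also have "\<dots> \<in> borel_measurable (PiM I (\<lambda>_. borel))" by measurable
  finally show ?case .
qed

lemma deficit_restrict:
  "{b..<b + m ^ n} \<subseteq> I \<Longrightarrow> deficit L \<eta> m j n b (restrict x I) = deficit L \<eta> m j n b x"
proof (induction n arbitrary: b)
  case (Suc n)
  have "deficit L \<eta> m j n (b + k * m ^ n) (restrict x I) = deficit L \<eta> m j n (b + k * m ^ n) x" if "k < m" for k
    using block_subset[OF that, of b n] Suc.prems by (intro Suc.IH) blast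
  then show ?case unfolding deficit.simps gprod_restrict[OF Suc.prems] by simp
qed simp

text \<open>The quantity L times length minus deficit is additive over the sub-blocks of a split
  block. On a kept block the displacement itself supplies it, and on a single grid cell it is 0,
  which any interval reaches.\<close>

lemma deficit_reaches:
  assumes \<eta>: "\<eta> > 0" and m: "m > 0"
  shows "reaches (\<lambda>s t. (\<xi> j (increment G x s t))\<^sup>2) (real b * \<eta>) (real (b + m ^ n) * \<eta>)
     (L * (\<eta> * real (m ^ n)) - deficit L \<eta> m j n b (\<lambda>i. increment G x (real i * \<eta>) (real (Suc i) * \<eta>)))"
proof (induction n arbitrary: b)
  case 0
  show ?case using \<eta> by (intro reaches_interval) auto
next
  case (Suc n)
  let ?x = "\<lambda>i. increment G x (real i * \<eta>) (real (Suc i) * \<eta>)"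
  show ?case
  proof (cases "(\<xi> j (gprod ?x b (m ^ Suc n)))\<^sup>2 \<ge> L * (\<eta> * real (m ^ Suc n))")
    case True
    have d0: "deficit L \<eta> m j (Suc n) b ?x = 0" unfolding deficit.simps by (rule if_P[OF True])
    have "m ^ Suc n > 0" using m by simp
    then have "real b * \<eta> < real (b + m ^ Suc n) * \<eta>" using \<eta> by (intro mult_strict_right_mono) auto
    then show ?thesis unfolding d0 using True unfolding gprod_increments by (intro reaches_interval) auto
  next
    case False
    have d: "deficit L \<eta> m j (Suc n) b ?x = (\<Sum>k<m. deficit L \<eta> m j n (b + k * m ^ n) ?x)"
      unfolding deficit.simps by (rule if_not_P[OF False])
    define t where "t k = real (b + k * m ^ n) * \<eta>" for k
    have "reaches (\<lambda>s t. (\<xi> j (increment G x s t))\<^sup>2) (t 0) (t m)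
       (\<Sum>k<m. L * (\<eta> * real (m ^ n)) - deficit L \<eta> m j n (b + k * m ^ n) ?x)"
    proof (rule reaches_sum)
      fix k
      have "t (Suc k) = real (b + k * m ^ n + m ^ n) * \<eta>" by (simp add: t_def algebra_simps)
      then show "reaches (\<lambda>s t. (\<xi> j (increment G x s t))\<^sup>2) (t k) (t (Suc k))
         (L * (\<eta> * real (m ^ n)) - deficit L \<eta> m j n (b + k * m ^ n) ?x)"
        using Suc[of "b + k * m ^ n"] by (simp only: t_def)
    qed
    then show ?thesis unfolding d by (simp add: t_def sum_subtractf mult_ac)
  qed
qed

text \<open>The deficit of a block depends on the increments inside it only, and blocks with
  different \<open>k\<close> use disjoint sets of indices.\<close>

lemma deficit_indep:
  assumes "\<eta> \<ge> 0"
  shows "indep_vars (\<lambda>_. borel) (\<lambda>k \<omega>. deficit L \<eta> m j n (b + k * m ^ n)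
     (\<lambda>i. increment G (\<lambda>r. X r \<omega>) (real i * \<eta>) (real (Suc i) * \<eta>))) {..<K}"
proof -
  define W where "W i \<omega> = increment G (\<lambda>r. X r \<omega>) (real i * \<eta>) (real (Suc i) * \<eta>)" for i \<omega>
  define J where "J k = {b + k * m ^ n..<b + k * m ^ n + m ^ n}" for k
  have ind: "indep_vars (\<lambda>_. borel) W {..<b + K * m ^ n}"
    using indep_grid_increments[of 0 \<eta> "b + K * m ^ n"] assms unfolding W_def[abs_def] by simp
  have "J k \<subseteq> {..<b + K * m ^ n}" if "k \<in> {..<K}" for k
  proof -
    have "Suc k * m ^ n \<le> K * m ^ n" using that by (intro mult_right_mono) auto
    then show ?thesis by (auto simp: J_def)
  qed
  moreover have "disjoint_family_on J {..<K}"
  proof -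
    have "J k \<inter> J l = {}" if "k < l" for k l
    proof -
      have "Suc k * m ^ n \<le> l * m ^ n" using that by (intro mult_right_mono) auto
      then show ?thesis by (auto simp: J_def)
    qed
    then show ?thesis unfolding disjoint_family_on_def by (metis Int_commute linorder_neqE_nat)
  qed
  ultimately have "indep_vars (\<lambda>k. PiM (J k) (\<lambda>_. borel)) (\<lambda>k \<omega>. restrict (\<lambda>i. W i \<omega>) (J k)) {..<K}"
    by (intro indep_vars_restrict[OF ind])
  then have "indep_vars (\<lambda>_. borel) (\<lambda>k \<omega>. deficit L \<eta> m j n (b + k * m ^ n) (restrict (\<lambda>i. W i \<omega>) (J k))) {..<K}"
    by (rule indep_vars_compose2) (auto intro!: deficit_measurable simp: J_def)
  moreover have "deficit L \<eta> m j n (b + k * m ^ n) (restrict (\<lambda>i. W i \<omega>) (J k)) = deficit L \<eta> m j n (b + k * m ^ n) (\<lambda>i. W i \<omega>)" for k \<omega>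
    by (rule deficit_restrict) (simp add: J_def)
  ultimately show ?thesis by (simp add: W_def)
qed

lemma abs_expectation_le_sqrt:
  fixes W :: "'w \<Rightarrow> real"
  assumes [measurable]: "W \<in> borel_measurable M" and C: "\<And>\<omega>. \<bar>W \<omega>\<bar> \<le> C" and V: "expectation (\<lambda>\<omega>. (W \<omega>)\<^sup>2) \<le> V"
  shows "expectation (\<lambda>\<omega>. \<bar>W \<omega>\<bar>) \<le> sqrt V"
proof -
  have 1: "integrable M (\<lambda>\<omega>. \<bar>W \<omega>\<bar>)" by (rule integrable_bounded[of _ C]) (use C in auto)
  have 2: "integrable M (\<lambda>\<omega>. \<bar>W \<omega>\<bar>\<^sup>2)"
    by (rule integrable_bounded[of _ "C\<^sup>2"]) (use C in \<open>auto intro: abs_le_imp_power2_le\<close>)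
  have "0 \<le> variance (\<lambda>\<omega>. \<bar>W \<omega>\<bar>)" by (rule variance_positive)
  also have "\<dots> = expectation (\<lambda>\<omega>. \<bar>W \<omega>\<bar>\<^sup>2) - (expectation (\<lambda>\<omega>. \<bar>W \<omega>\<bar>))\<^sup>2" by (rule variance_eq[OF 1 2])
  finally have "(expectation (\<lambda>\<omega>. \<bar>W \<omega>\<bar>))\<^sup>2 \<le> V" using V by simp
  then show ?thesis by (rule real_le_rsqrt)
qed

text \<open>A block is split with probability at most 1 - c, and then inherits the sum of the m
  deficits of its parts. Splitting is not independent of that sum, but for m independent parts the
  sum fluctuates by a fraction 1 / sqrt m only, so it may be replaced by its mean. Relative to the
  block length the bounds obey z' = (1 - c) z + L / sqrt m, whose fixed point is L / (c sqrt
  m).\<close>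

lemma deficit_expectation:
  assumes \<eta>: "\<eta> > 0" and m: "m > 0" and L: "L > 0" and c: "0 < c" "c \<le> 1"
    and low: "\<And>t. 0 < t \<Longrightarrow> t < t0 \<Longrightarrow> prob {\<omega> \<in> space M. (\<xi> j (X t \<omega>))\<^sup>2 \<ge> L * t} \<ge> c"
  shows "\<eta> * real (m ^ n) < t0 \<Longrightarrow> expectation (\<lambda>\<omega>. deficit L \<eta> m j n b (\<lambda>i. increment G (\<lambda>r. X r \<omega>) (real i * \<eta>) (real (Suc i) * \<eta>)))
     \<le> ((1 - c) ^ n * L + L / (c * sqrt (real m))) * (\<eta> * real (m ^ n))"
proof (induction n arbitrary: b)
  case 0
  show ?case using \<eta> L c m by (simp add: prob_space mult_right_mono)
next
  case (Suc n)
  define h where "h = \<eta> * real (m ^ Suc n)"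
  have h: "h > 0" using \<eta> m by (simp add: h_def)
  define W where "W \<omega> = (\<lambda>i. increment G (\<lambda>r. X r \<omega>) (real i * \<eta>) (real (Suc i) * \<eta>))" for \<omega>
  define D where "D k \<omega> = deficit L \<eta> m j n (b + k * m ^ n) (W \<omega>)" for k \<omega>
  define S where "S \<omega> = (\<Sum>k<m. D k \<omega>)" for \<omega>
  define z where "z = (1 - c) ^ n * L + L / (c * sqrt (real m))"
  define \<beta> where "\<beta> = L * (\<eta> * real (m ^ n))"
  have \<beta>: "\<beta> \<ge> 0" using L \<eta> by (simp add: \<beta>_def)
  have z0: "z \<ge> 0" using L c m by (simp add: z_def)
  have ind: "indep_vars (\<lambda>_. borel) D {..<m}"
    unfolding D_def[abs_def] W_def by (rule deficit_indep) (use \<eta> in simp)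
  have Db: "0 \<le> D k \<omega>" "D k \<omega> \<le> \<beta>" for k \<omega>
    using deficit_bounds[of L \<eta> m j n "b + k * m ^ n" "W \<omega>"] L \<eta> by (auto simp: D_def \<beta>_def)
  have Dm [measurable]: "D k \<in> borel_measurable M" if "k < m" for k
    using ind that unfolding indep_vars_def by blast
  have Sm [measurable]: "S \<in> borel_measurable M"
    unfolding S_def[abs_def] by (intro borel_measurable_sum Dm) simp
  define \<mu> where "\<mu> = (\<Sum>k<m. expectation (D k))"
  have "m ^ n \<le> m ^ Suc n" using m by simp
  then have "real (m ^ n) \<le> real (m ^ Suc n)" by (simp only: of_nat_le_iff)
  then have "\<eta> * real (m ^ n) \<le> \<eta> * real (m ^ Suc n)" by (rule mult_left_mono) (use \<eta> in simp)
  then have small: "\<eta> * real (m ^ n) < t0" using Suc.prems by linarith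
  have "\<mu> \<le> (\<Sum>k<m. z * (\<eta> * real (m ^ n)))"
    unfolding \<mu>_def z_def D_def[abs_def] W_def by (intro sum_mono Suc.IH small)
  then have \<mu>: "\<mu> \<le> z * h" by (simp add: h_def mult_ac)
  have \<mu>0: "\<mu> \<ge> 0" unfolding \<mu>_def using Db(1) by (intro sum_nonneg integral_nonneg_AE AE_I2)
  have Sb: "0 \<le> S \<omega>" "S \<omega> \<le> real m * \<beta>" for \<omega>
    unfolding S_def using Db sum_bounded_above[of "{..<m}" "\<lambda>k. D k \<omega>" \<beta>] by (auto intro!: sum_nonneg)
  have "\<mu> \<le> (\<Sum>k<m. \<beta>)"
    unfolding \<mu>_def
  proof (rule sum_mono)
    fix k assume k: "k \<in> {..<m}"
    have "expectation (D k) \<le> expectation (\<lambda>_. \<beta>)"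
    proof (rule integral_mono)
      show "integrable M (D k)" by (rule integrable_bounded[of _ \<beta>]) (use Db Dm k in auto)
    qed (use Db in auto)
    then show "expectation (D k) \<le> \<beta>" by (simp add: prob_space)
  qed
  then have \<mu>b: "\<mu> \<le> real m * \<beta>" by simp
  have Sb2: "\<bar>S \<omega> - \<mu>\<bar> \<le> real m * \<beta>" for \<omega> using Sb[of \<omega>] \<mu>0 \<mu>b by linarith
  have i1: "integrable M (\<lambda>\<omega>. \<bar>S \<omega> - \<mu>\<bar>)"
    by (rule integrable_bounded[of _ "real m * \<beta>"]) (use Sb2 in auto)
  have dev: "expectation (\<lambda>\<omega>. \<bar>S \<omega> - \<mu>\<bar>) \<le> sqrt (real m) * \<beta>"
  proof -
    have "expectation (\<lambda>\<omega>. (S \<omega> - \<mu>)\<^sup>2) \<le> (\<Sum>k<m. expectation (\<lambda>\<omega>. (D k \<omega>)\<^sup>2))"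
      unfolding S_def \<mu>_def by (rule indep_sum_deviation[OF finite_lessThan ind, of \<beta>]) (use Db in \<open>auto simp: abs_le_iff intro: order_trans\<close>)
    also have "\<dots> \<le> (\<Sum>k<m. \<beta>\<^sup>2)"
    proof (rule sum_mono)
      fix k assume k: "k \<in> {..<m}"
      have D2: "(D k \<omega>)\<^sup>2 \<le> \<beta>\<^sup>2" for \<omega> using Db by (intro power_mono) auto
      have "expectation (\<lambda>\<omega>. (D k \<omega>)\<^sup>2) \<le> expectation (\<lambda>_. \<beta>\<^sup>2)"
      proof (rule integral_mono)
        show "integrable M (\<lambda>\<omega>. (D k \<omega>)\<^sup>2)" by (rule integrable_bounded[of _ "\<beta>\<^sup>2"]) (use D2 Dm k in auto)
      qed (use D2 in auto)
      then show "expectation (\<lambda>\<omega>. (D k \<omega>)\<^sup>2) \<le> \<beta>\<^sup>2" by (simp add: prob_space)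
    qed
    finally have V: "expectation (\<lambda>\<omega>. (S \<omega> - \<mu>)\<^sup>2) \<le> real m * \<beta>\<^sup>2" by simp
    have "expectation (\<lambda>\<omega>. \<bar>S \<omega> - \<mu>\<bar>) \<le> sqrt (real m * \<beta>\<^sup>2)"
      by (rule abs_expectation_le_sqrt[OF _ Sb2 V]) measurable
    then show ?thesis using \<beta> by (simp add: real_sqrt_mult)
  qed
  define F where "F = {\<omega> \<in> space M. (\<xi> j (increment G (\<lambda>r. X r \<omega>) (real b * \<eta>) (real b * \<eta> + h)))\<^sup>2 \<ge> L * h}"
  have bh: "real (b + m ^ Suc n) * \<eta> = real b * \<eta> + h" by (simp add: h_def algebra_simps)
  have incm [measurable]: "(\<lambda>\<omega>. increment G (\<lambda>r. X r \<omega>) (real b * \<eta>) (real b * \<eta> + h)) \<in> borel_measurable M"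
    using \<eta> h by (intro increment_measurable) auto
  have Fm [measurable]: "F \<in> events" unfolding F_def by measurable
  have PF: "prob F \<ge> c"
  proof -
    have "prob F = prob {\<omega> \<in> space M. X h \<omega> \<in> {x. (\<xi> j x)\<^sup>2 \<ge> L * h}}"
      unfolding F_def using increment_prob[of "real b * \<eta>" h "{x. (\<xi> j x)\<^sup>2 \<ge> L * h}"] \<eta> h by simp
    then show ?thesis using low[OF h] Suc.prems by (simp add: h_def)
  qed
  have eq: "deficit L \<eta> m j (Suc n) b (W \<omega>) = S \<omega> * indicator (space M - F) \<omega>" if "\<omega> \<in> space M" for \<omega>
    unfolding deficit.simps W_def gprod_increments bh
    using that by (simp add: F_def S_def D_def W_def indicator_def h_def)
  have "expectation (\<lambda>\<omega>. deficit L \<eta> m j (Suc n) b (W \<omega>)) = expectation (\<lambda>\<omega>. S \<omega> * indicator (space M - F) \<omega>)"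
    by (intro Bochner_Integration.integral_cong refl eq)
  \<comment> \<open>The splitting event and \<open>S\<close> are built from the same increments.
    Replacing \<open>S\<close> by the constant \<mu> on that event decouples them, at the price of
    the mean absolute deviation.\<close>
  also have "\<dots> \<le> expectation (\<lambda>\<omega>. \<bar>S \<omega> - \<mu>\<bar> + \<mu> * indicator (space M - F) \<omega>)"
  proof (rule integral_mono)
    show "integrable M (\<lambda>\<omega>. \<bar>S \<omega> - \<mu>\<bar> + \<mu> * indicator (space M - F) \<omega>)"
      by (intro Bochner_Integration.integrable_add i1 integrable_mult_right integrable_bounded[of "indicator _" 1])
         (auto simp: indicator_def)
    show "integrable M (\<lambda>\<omega>. S \<omega> * indicator (space M - F) \<omega>)"
      by (rule integrable_bounded[of _ "real m * \<beta>"]) (use Sb \<beta> in \<open>auto simp: indicator_def\<close>)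
  qed (use Sb in \<open>auto simp: indicator_def\<close>)
  also have "\<dots> = expectation (\<lambda>\<omega>. \<bar>S \<omega> - \<mu>\<bar>) + \<mu> * prob (space M - F)"
  proof -
    have i2: "integrable M (\<lambda>\<omega>. indicator (space M - F) \<omega> :: real)"
      by (rule integrable_bounded[of _ 1]) (auto simp: indicator_def)
    show ?thesis using i1 i2 by simp
  qed
  also have "\<dots> \<le> sqrt (real m) * \<beta> + (z * h) * (1 - c)"
    using dev \<mu> \<mu>0 PF z0 h c by (intro add_mono mult_mono) (auto simp: prob_compl)
  also have "sqrt (real m) * \<beta> = L / sqrt (real m) * h"
  proof -
    have hX: "h = (\<eta> * real (m ^ n)) * (sqrt (real m) * sqrt (real m))" by (simp add: h_def)
    have "s * (L * x) = L / s * (x * (s * s))" if "s \<noteq> 0" for s x :: real using that by simp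
    moreover have "sqrt (real m) \<noteq> 0" using m by simp
    ultimately show ?thesis unfolding hX \<beta>_def by blast
  qed
  \<comment> \<open>The distance to the fixed point L / (c sqrt m) is multiplied by 1 - c at each
    level.\<close>
  also have "L / sqrt (real m) * h + (z * h) * (1 - c) = ((1 - c) ^ Suc n * L + L / (c * sqrt (real m))) * h"
  proof -
    have "L / sqrt (real m) + z * (1 - c) = (1 - c) ^ Suc n * L + L / (c * sqrt (real m))"
      using c m by (simp add: z_def field_simps)
    then show ?thesis by (metis distrib_right mult.assoc mult.commute)
  qed
  finally show ?case by (simp add: W_def h_def)
qed

text \<open>The critical exponent is reached because \<open>L\<close> is arbitrary: the adaptive
  partition has sum of squares at least \<open>L\<close> minus the total deficit, and with wide and
  deep enough splitting the deficit is below L / 2 with high probability.\<close>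

theorem infinite_variation_gaussian:
  assumes A: "A $ j $ j > 0" and p: "0 < p" "p \<le> 2 * d j"
  shows "AE \<omega> in M. p_variation G N p 0 1 (\<lambda>t. X t \<omega>) = \<infinity>"
proof (rule infinite_variationI[OF p(1)])
  fix K :: nat and \<epsilon> :: real assume \<epsilon>: "\<epsilon> > 0"
  define q where "q = p / d j"
  have q: "0 < q" "q \<le> 2" using p weight_pos[of j] by (auto simp: q_def divide_le_eq)
  obtain C where C: "C > 0" "\<And>x. \<bar>\<xi> j x\<bar> powr q \<le> C * N x powr p"
    using xi_powr_norm_bound[OF p(1), of j] unfolding q_def by blast
  obtain Dx where Dx: "Dx > 0" "\<And>i x. \<bar>\<xi> i x\<bar> \<le> Dx" using xi_bounded by blast
  \<comment> \<open>The exponent q is at most 2, and since \<open>\<xi> j\<close> is bounded the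
    square is at most \<open>Dx powr (2 - q)\<close> times the power q.\<close>
  define C1 where "C1 = Dx powr (2 - q) * C"
  have C1: "C1 > 0" using C Dx by (simp add: C1_def)
  have sq_le: "(\<xi> j x)\<^sup>2 \<le> C1 * N x powr p" for x
  proof (cases "\<xi> j x = 0")
    case True
    then show ?thesis using C1 by simp
  next
    case False
    have "(\<xi> j x)\<^sup>2 = \<bar>\<xi> j x\<bar> powr (2 - q) * \<bar>\<xi> j x\<bar> powr q"
      using False by (simp add: powr_add[symmetric])
    also have "\<dots> \<le> Dx powr (2 - q) * (C * N x powr p)"
      using q Dx C by (intro mult_mono powr_mono2) auto
    finally show ?thesis by (simp add: C1_def mult_ac)
  qed
  \<comment> \<open>The total deficit will have mean at most L / 4 and deviate from it by less than
    L / 4; the remaining L / 2 is C1 K + 1.\<close>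
  define L where "L = 2 * (C1 * real K + 1)"
  have L: "L > 0" using C1 by (simp add: L_def add_nonneg_pos)
  obtain c t0 where c: "c > 0" and t0: "t0 > 0"
    and low: "\<And>t. 0 < t \<Longrightarrow> t < t0 \<Longrightarrow> prob {\<omega> \<in> space M. (\<xi> j (X t \<omega>))\<^sup>2 \<ge> L * t} \<ge> c"
    using gaussian_lower_bound[OF A L] by blast
  have c1: "c \<le> 1" using order_trans[OF low[of "t0 / 2"] prob_le_1] t0 by simp
  obtain m0 where m0: "(8 / c)\<^sup>2 \<le> real m0" using real_arch_simple by blast
  \<comment> \<open>The width \<open>m\<close> makes the fixed point L / (c sqrt m) at most L / 8,
    and the depth \<open>n\<close> below makes the transient part (1 - c)^n L at most L / 8.\<close>
  define m where "m = Suc m0"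
  have m: "m > 0" "(8 / c)\<^sup>2 \<le> real m" using m0 by (auto simp: m_def)
  have sm: "8 / c \<le> sqrt (real m)" using real_le_rsqrt[OF m(2)] by simp
  have "\<exists>n. (1 - c) ^ n < 1 / 8" using c c1 by (intro real_arch_pow_inv) auto
  then obtain n where n: "(1 - c) ^ n < 1 / 8" by blast
  \<comment> \<open>The unit interval is first cut into \<open>B\<close> equal blocks:
    \<open>1 / B\<close> must lie in the range of the lower bound \<open>low\<close>, and
    Chebyshev's inequality for the \<open>B\<close> independent deficits gives 16 / B.\<close>
  obtain M0 where M0: "max (1 / t0) (16 / \<epsilon>) < real M0" using reals_Archimedean2 by blast
  define B where "B = Suc M0"
  have B: "B > 0" "1 / t0 < real B" "16 / \<epsilon> < real B" using M0 by (auto simp: B_def)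
  define \<eta> where "\<eta> = 1 / (real B * real (m ^ n))"
  have \<eta>: "\<eta> > 0" using B m by (simp add: \<eta>_def)
  have H: "\<eta> * real (m ^ n) = 1 / real B" using m by (simp add: \<eta>_def)
  have Ht: "\<eta> * real (m ^ n) < t0" unfolding H using B t0 by (simp add: field_simps)
  define D where "D k \<omega> = deficit L \<eta> m j n (0 + k * m ^ n) (\<lambda>i. increment G (\<lambda>r. X r \<omega>) (real i * \<eta>) (real (Suc i) * \<eta>))" for k \<omega>
  have ind: "indep_vars (\<lambda>_. borel) D {..<B}" unfolding D_def[abs_def] by (rule deficit_indep) (use \<eta> in simp)
  have Db: "0 \<le> D k \<omega>" "D k \<omega> \<le> L / real B" for k \<omega>
    using deficit_bounds[of L \<eta> m j n "0 + k * m ^ n"] L \<eta> unfolding D_def H by (auto simp: less_imp_le)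
  have Dm: "D k \<in> borel_measurable M" if "k < B" for k
    using ind that unfolding indep_vars_def by blast
  have ED: "expectation (D k) \<le> L / 4 / real B" for k
  proof -
    have "expectation (D k) \<le> ((1 - c) ^ n * L + L / (c * sqrt (real m))) * (1 / real B)"
      unfolding D_def[abs_def] H[symmetric]
      by (rule deficit_expectation[OF \<eta> m(1) L c c1 low Ht]) auto
    also have "\<dots> \<le> (L / 8 + L / 8) * (1 / real B)"
    proof (intro mult_right_mono add_mono)
      show "(1 - c) ^ n * L \<le> L / 8" using n L by simp
      have "8 \<le> c * sqrt (real m)" using sm c by (simp add: field_simps)
      then show "L / (c * sqrt (real m)) \<le> L / 8" using L by (intro divide_left_mono) auto
    qed simp
    finally show ?thesis by simp
  qed
  let ?bad = "{\<omega> \<in> space M. \<bar>(\<Sum>k<B. D k \<omega>) - (\<Sum>k<B. expectation (D k))\<bar> \<ge> L / 4}"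
  have Sm: "(\<lambda>\<omega>. \<Sum>k<B. D k \<omega>) \<in> borel_measurable M" by (intro borel_measurable_sum Dm) simp
  have bad: "?bad \<in> events" using Sm by measurable
  have "prob ?bad \<le> (\<Sum>k<B. expectation (\<lambda>\<omega>. (D k \<omega>)\<^sup>2)) / (L / 4)\<^sup>2"
    by (rule indep_sum_concentration[OF finite_lessThan ind, of "L / real B"]) (use Db L in auto)
  also have "\<dots> \<le> (\<Sum>k<B. (L / real B)\<^sup>2) / (L / 4)\<^sup>2"
  proof (intro divide_right_mono sum_mono)
    fix k assume k: "k \<in> {..<B}"
    have D2: "(D k \<omega>)\<^sup>2 \<le> (L / real B)\<^sup>2" for \<omega> using Db by (intro power_mono) auto
    have "expectation (\<lambda>\<omega>. (D k \<omega>)\<^sup>2) \<le> expectation (\<lambda>_. (L / real B)\<^sup>2)"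
    proof (rule integral_mono)
      show "integrable M (\<lambda>\<omega>. (D k \<omega>)\<^sup>2)" by (rule integrable_bounded[of _ "(L / real B)\<^sup>2"]) (use D2 Dm k in auto)
    qed (use D2 in auto)
    then show "expectation (\<lambda>\<omega>. (D k \<omega>)\<^sup>2) \<le> (L / real B)\<^sup>2" by (simp add: prob_space)
  qed simp
  also have "\<dots> = 16 / real B" using L B by (simp add: power2_eq_square field_simps)
  also have "\<dots> \<le> \<epsilon>" using B \<epsilon> by (simp add: field_simps)
  finally have pbad: "prob ?bad \<le> \<epsilon>" .
  show "\<exists>E\<in>events. prob E \<ge> 1 - \<epsilon> \<and>
      (\<forall>\<omega>\<in>E. \<exists>ts\<in>partitions 0 1. var_sum p (\<lambda>r. X r \<omega>) ts > real K)"
  proof (intro bexI[of _ "space M - ?bad"] conjI ballI)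
    show "prob (space M - ?bad) \<ge> 1 - \<epsilon>" using pbad unfolding prob_compl[OF bad] by linarith
    fix \<omega> assume "\<omega> \<in> space M - ?bad"
    then have "\<bar>(\<Sum>k<B. D k \<omega>) - (\<Sum>k<B. expectation (D k))\<bar> < L / 4" by auto
    moreover have "(\<Sum>k<B. expectation (D k)) \<le> (\<Sum>k<B. L / 4 / real B)" by (intro sum_mono ED)
    then have "(\<Sum>k<B. expectation (D k)) \<le> L / 4" using B by simp
    ultimately have small: "(\<Sum>k<B. D k \<omega>) < L / 2" by linarith
    let ?f = "\<lambda>s t. (\<xi> j (increment G (\<lambda>r. X r \<omega>) s t))\<^sup>2"
    define t where "t k = real (k * m ^ n) * \<eta>" for k
    have "reaches ?f (t 0) (t B) (\<Sum>k<B. L / real B - D k \<omega>)"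
    proof (rule reaches_sum)
      fix k
      have "t (Suc k) = real (0 + k * m ^ n + m ^ n) * \<eta>" "t k = real (0 + k * m ^ n) * \<eta>" by (simp_all add: t_def algebra_simps)
      then show "reaches ?f (t k) (t (Suc k)) (L / real B - D k \<omega>)"
        using deficit_reaches[OF \<eta> m(1), of j "\<lambda>r. X r \<omega>" "0 + k * m ^ n" n L] unfolding D_def H by simp
    qed
    moreover have "t 0 = 0" "t B = 1" using B m by (simp_all add: t_def \<eta>_def)
    moreover have "(\<Sum>k<B. L / real B - D k \<omega>) = L - (\<Sum>k<B. D k \<omega>)" using B by (simp add: sum_subtractf)
    ultimately obtain ts where ts: "ts \<in> partitions 0 1" "path_sum ?f ts \<ge> L - (\<Sum>k<B. D k \<omega>)"
      unfolding reaches_def by auto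
    have "C1 * real K < path_sum ?f ts" using ts(2) small by (simp add: L_def)
    also have "\<dots> \<le> C1 * path_sum (\<lambda>s t. N (increment G (\<lambda>r. X r \<omega>) s t) powr p) ts"
      by (rule path_sum_mono) (rule sq_le)
    also have "path_sum (\<lambda>s t. N (increment G (\<lambda>r. X r \<omega>) s t) powr p) ts = var_sum p (\<lambda>r. X r \<omega>) ts"
      by (simp add: path_sum_eq var_sum_def)
    finally have "real K < var_sum p (\<lambda>r. X r \<omega>) ts" using C1 by simp
    then show "\<exists>ts\<in>partitions 0 1. var_sum p (\<lambda>r. X r \<omega>) ts > real K" using ts(1) by blast
  qed (use bad in auto)
qed

end

subsection \<open>Exit counts at a fixed scale\<close>

text \<open>The left side is comparable with the minimum of z^2 and 1, which lies below every power
  between 0 and 2. This and the next two inequalities turn saturated coordinates into the moments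
  that the sets \<open>Gamma_set\<close> control.\<close>

lemma saturated_square_le_powr:
  fixes z \<beta> :: real
  assumes "0 < \<beta>" "\<beta> \<le> 2"
  shows "z\<^sup>2 / (1 + z\<^sup>2) \<le> \<bar>z\<bar> powr \<beta>"
proof -
  have d: "1 + z\<^sup>2 > 0" by (simp add: add_pos_nonneg)
  show ?thesis
  proof (cases "\<bar>z\<bar> \<le> 1")
    case True
    have "z\<^sup>2 / (1 + z\<^sup>2) \<le> z\<^sup>2 / 1" using d by (intro divide_left_mono) auto
    then have "z\<^sup>2 / (1 + z\<^sup>2) \<le> z\<^sup>2" by simp
    also have "z\<^sup>2 \<le> \<bar>z\<bar> powr \<beta>"
    proof (cases "z = 0")
      case False
      have "\<bar>z\<bar> powr 2 \<le> \<bar>z\<bar> powr \<beta>" using True False assms by (intro powr_mono') auto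
      then show ?thesis using False by simp
    qed simp
    finally show ?thesis .
  next
    case False
    have "z\<^sup>2 / (1 + z\<^sup>2) \<le> 1" using d by simp
    also have "1 \<le> \<bar>z\<bar> powr \<beta>" using False assms by (intro ge_one_powr_ge_zero) auto
    finally show ?thesis .
  qed
qed

text \<open>The left side is the error in replacing z by z / (1 + z^2). It behaves like a cube near
  0 and like \<bar>z\<bar> at infinity, hence the restriction \<beta> \<ge> 1.\<close>

lemma saturated_cube_le_powr:
  fixes z \<beta> :: real
  assumes "1 \<le> \<beta>" "\<beta> \<le> 2"
  shows "\<bar>z\<bar> * (z\<^sup>2 / (1 + z\<^sup>2)) \<le> \<bar>z\<bar> powr \<beta>"
proof -
  have d: "1 + z\<^sup>2 > 0" by (simp add: add_pos_nonneg)
  show ?thesis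
  proof (cases "\<bar>z\<bar> \<le> 1")
    case True
    have "\<bar>z\<bar> * (z\<^sup>2 / (1 + z\<^sup>2)) \<le> 1 * (z\<^sup>2 / (1 + z\<^sup>2))" using True by (intro mult_right_mono) auto
    then show ?thesis using saturated_square_le_powr[of \<beta> z] assms by simp
  next
    case False
    have "\<bar>z\<bar> * (z\<^sup>2 / (1 + z\<^sup>2)) \<le> \<bar>z\<bar> * 1" using d by (intro mult_left_mono) auto
    also have "\<dots> = \<bar>z\<bar> powr 1" using False by simp
    also have "\<dots> \<le> \<bar>z\<bar> powr \<beta>" using False assms by (intro powr_mono) auto
    finally show ?thesis .
  qed
qed

text \<open>Linear near 0 and bounded at infinity, hence the restriction \<beta> \<le> 1.\<close>

lemma saturated_linear_le_powr:
  fixes z \<beta> :: real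
  assumes "0 < \<beta>" "\<beta> \<le> 1"
  shows "\<bar>z\<bar> / (1 + z\<^sup>2) \<le> \<bar>z\<bar> powr \<beta>"
proof -
  have d: "1 + z\<^sup>2 > 0" by (simp add: add_pos_nonneg)
  show ?thesis
  proof (cases "\<bar>z\<bar> \<le> 1")
    case True
    have "\<bar>z\<bar> / (1 + z\<^sup>2) \<le> \<bar>z\<bar> / 1" using d by (intro divide_left_mono) auto
    then have "\<bar>z\<bar> / (1 + z\<^sup>2) \<le> \<bar>z\<bar>" by simp
    also have "\<bar>z\<bar> \<le> \<bar>z\<bar> powr \<beta>"
    proof (cases "z = 0")
      case False
      have "\<bar>z\<bar> powr 1 \<le> \<bar>z\<bar> powr \<beta>" using True False assms by (intro powr_mono') auto
      then show ?thesis using False by simp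
    qed simp
    finally show ?thesis .
  next
    case False
    have "0 \<le> (\<bar>z\<bar> - 1)\<^sup>2" by simp
    then have "\<bar>z\<bar> \<le> 1 + z\<^sup>2" by (simp add: power2_diff)
    then have "\<bar>z\<bar> / (1 + z\<^sup>2) \<le> 1" using d by simp
    also have "1 \<le> \<bar>z\<bar> powr \<beta>" using False assms by (intro ge_one_powr_ge_zero) auto
    finally show ?thesis .
  qed
qed

section \<open>Rates of the rescaled coordinates\<close>

context homogeneous_levy
begin

text \<open>With z the coordinate rescaled as by the dilation \<open>1 / r\<close>, this is z / (1 +
  z^2), and the next definition is z^2 / (1 + z^2). The form through \<open>axis_damp\<close> is the
  one to which the generator limits apply.\<close>

definition saturated_lin :: "real \<Rightarrow> 'm \<Rightarrow> (real, 'm) vec \<Rightarrow> real" where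
  "saturated_lin r i x = r powr (- d i) * (\<xi> i x * axis_damp i (r powr (- 2 * d i)) x)"

definition saturated_sq :: "real \<Rightarrow> 'm \<Rightarrow> (real, 'm) vec \<Rightarrow> real" where
  "saturated_sq r i x = r powr (- 2 * d i) * ((\<xi> i x)\<^sup>2 * axis_damp i (r powr (- 2 * d i)) x)"

lemma saturated_lin_eq: "saturated_lin r i x = (r powr (- d i) * \<xi> i x) / (1 + (r powr (- d i) * \<xi> i x)\<^sup>2)"
  and saturated_sq_eq: "saturated_sq r i x = (r powr (- d i) * \<xi> i x)\<^sup>2 / (1 + (r powr (- d i) * \<xi> i x)\<^sup>2)"
proof -
  have "r powr (- 2 * d i) = (r powr (- d i))\<^sup>2" by (simp add: power2_eq_square powr_add[symmetric])
  then show "saturated_lin r i x = (r powr (- d i) * \<xi> i x) / (1 + (r powr (- d i) * \<xi> i x)\<^sup>2)"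
    "saturated_sq r i x = (r powr (- d i) * \<xi> i x)\<^sup>2 / (1 + (r powr (- d i) * \<xi> i x)\<^sup>2)"
    by (simp_all add: saturated_lin_def saturated_sq_def axis_damp_eq power_mult_distrib)
qed

lemma saturated_lin_measurable [measurable]: "saturated_lin r i \<in> borel_measurable borel"
  unfolding saturated_lin_def[abs_def] by measurable

lemma saturated_sq_measurable [measurable]: "saturated_sq r i \<in> borel_measurable borel"
  unfolding saturated_sq_def[abs_def] by measurable

lemma saturated_sq_bounds: "0 \<le> saturated_sq r i x" "saturated_sq r i x \<le> 1"
proof -
  have "1 + (r powr (- d i) * \<xi> i x)\<^sup>2 > 0" by (simp add: add_pos_nonneg)
  then show "0 \<le> saturated_sq r i x" "saturated_sq r i x \<le> 1" unfolding saturated_sq_eq by auto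
qed

lemma saturated_lin_bound: "\<bar>saturated_lin r i x\<bar> \<le> 1"
proof -
  let ?z = "r powr (- d i) * \<xi> i x"
  have "0 \<le> (\<bar>?z\<bar> - 1)\<^sup>2" by simp
  then have "\<bar>?z\<bar> \<le> 1 + ?z\<^sup>2" by (simp add: power2_diff)
  moreover have "1 + ?z\<^sup>2 > 0" by (simp add: add_pos_nonneg)
  ultimately show ?thesis unfolding saturated_lin_eq by (simp add: abs_divide)
qed

lemma scaled_powr_le:
  assumes r: "0 < r" "r \<le> 1" and \<beta>: "0 < \<beta>" "d i * \<beta> \<le> \<gamma>"
  shows "\<bar>r powr (- d i) * \<xi> i x\<bar> powr \<beta> \<le> r powr (- \<gamma>) * \<bar>\<xi> i x\<bar> powr \<beta>"
proof -
  have "\<bar>r powr (- d i) * \<xi> i x\<bar> powr \<beta> = r powr (- d i * \<beta>) * \<bar>\<xi> i x\<bar> powr \<beta>"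
    by (simp add: abs_mult powr_mult powr_powr)
  also have "\<dots> \<le> r powr (- \<gamma>) * \<bar>\<xi> i x\<bar> powr \<beta>"
    using r \<beta> by (intro mult_right_mono powr_mono') auto
  finally show ?thesis .
qed

text \<open>The conditions under which every part of the triplet acts at scale \<open>r\<close> with
  rate O(r^(-\<gamma>)): a Gaussian coordinate has rate r^(-2 d j), a drift has rate r^(-d i), and
  jumps are measured by a moment of order \<gamma> / d i. The minimum with 2 is harmless because
  second moments are always finite.\<close>

definition admissible :: "real \<Rightarrow> bool" where
  "admissible \<gamma> \<longleftrightarrow> \<gamma> > 0 \<and> (\<forall>j. A $ j $ j > 0 \<longrightarrow> 2 * d j \<le> \<gamma>) \<and>
     (\<forall>i. integrable \<nu> (\<lambda>x. \<bar>\<xi> i x\<bar> powr min (\<gamma> / d i) 2)) \<and>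
     (\<forall>i. \<gamma> \<le> d i \<longrightarrow> integrable \<nu> (\<xi> i) \<and> B $ i = (\<integral>x. \<xi> i x \<partial>\<nu>))"

text \<open>The generator limit has a Gaussian term with factor r^(-2 d i), present only when 2 d i
  \<le> \<gamma>, and a jump term bounded by the moment of order \<beta>; both are O(r^(-\<gamma>))
  as r \<le> 1.\<close>

lemma saturated_sq_limit:
  assumes adm: "admissible \<gamma>"
  obtains C where "C \<ge> 0" and "\<And>r. 0 < r \<Longrightarrow> r \<le> 1 \<Longrightarrow>
     \<forall>\<^sub>F s in at_right 0. expectation (\<lambda>\<omega>. saturated_sq r i (X s \<omega>)) \<le> C * r powr (- \<gamma>) * s"
proof -
  define \<beta> where "\<beta> = min (\<gamma> / d i) 2"
  have \<gamma>: "\<gamma> > 0" using adm by (simp add: admissible_def)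
  have \<beta>: "0 < \<beta>" "\<beta> \<le> 2" "d i * \<beta> \<le> \<gamma>"
    using \<gamma> weight_pos[of i] by (auto simp: \<beta>_def min_def field_simps)
  have int: "integrable \<nu> (\<lambda>x. \<bar>\<xi> i x\<bar> powr \<beta>)" using adm by (simp add: admissible_def \<beta>_def)
  define I where "I = (\<integral>x. \<bar>\<xi> i x\<bar> powr \<beta> \<partial>\<nu>)"
  have I: "I \<ge> 0" unfolding I_def by simp
  show thesis
  proof (rule that[of "A $ i $ i + I + 1"])
    show "A $ i $ i + I + 1 \<ge> 0" using I A_diag_nonneg[of i] by simp
    fix r :: real assume r: "0 < r" "r \<le> 1"
    define L where "L = r powr (- 2 * d i)"
    have L: "L > 0" using r by (simp add: L_def)
    have "((\<lambda>s. L * (expectation (\<lambda>\<omega>. (\<xi> i (X s \<omega>))\<^sup>2 * axis_damp i L (X s \<omega>)) / s)) \<longlongrightarrow>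
       L * (A $ i $ i + (\<integral>y. (\<xi> i y)\<^sup>2 * axis_damp i L y \<partial>\<nu>))) (at_right 0)"
      by (intro tendsto_mult_left limit_axis_quad) (use L in simp)
    then have lim: "((\<lambda>s. expectation (\<lambda>\<omega>. saturated_sq r i (X s \<omega>)) / s) \<longlongrightarrow> L * A $ i $ i + (\<integral>y. saturated_sq r i y \<partial>\<nu>)) (at_right 0)"
      by (simp add: saturated_sq_def L_def distrib_left)
    have "L * A $ i $ i \<le> r powr (- \<gamma>) * A $ i $ i"
    proof (cases "A $ i $ i > 0")
      case True
      then have "2 * d i \<le> \<gamma>" using adm by (simp add: admissible_def)
      then show ?thesis unfolding L_def using r True by (intro mult_right_mono powr_mono') auto
    next
      case False
      then show ?thesis using A_diag_nonneg[of i] by simp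
    qed
    moreover have "(\<integral>y. saturated_sq r i y \<partial>\<nu>) \<le> (\<integral>y. r powr (- \<gamma>) * \<bar>\<xi> i y\<bar> powr \<beta> \<partial>\<nu>)"
    proof (rule integral_mono)
      have pt: "saturated_sq r i y \<le> r powr (- \<gamma>) * \<bar>\<xi> i y\<bar> powr \<beta>" for y
        unfolding saturated_sq_eq using saturated_square_le_powr[OF \<beta>(1,2)] scaled_powr_le[OF r \<beta>(1,3)] by (rule order_trans)
      then show "saturated_sq r i y \<le> r powr (- \<gamma>) * \<bar>\<xi> i y\<bar> powr \<beta>" for y .
      show "integrable \<nu> (\<lambda>y. r powr (- \<gamma>) * \<bar>\<xi> i y\<bar> powr \<beta>)" using int by simp
      then show "integrable \<nu> (saturated_sq r i)"
        by (rule Bochner_Integration.integrable_bound) (use pt saturated_sq_bounds in \<open>auto intro!: AE_I2 simp: abs_mult\<close>)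
    qed
    moreover have "(\<integral>y. r powr (- \<gamma>) * \<bar>\<xi> i y\<bar> powr \<beta> \<partial>\<nu>) = r powr (- \<gamma>) * I" by (simp add: I_def)
    ultimately have "L * A $ i $ i + (\<integral>y. saturated_sq r i y \<partial>\<nu>) \<le> r powr (- \<gamma>) * (A $ i $ i + I)"
      unfolding distrib_left by linarith
    also have "\<dots> < (A $ i $ i + I + 1) * r powr (- \<gamma>)" using r by (simp add: algebra_simps)
    finally have "\<forall>\<^sub>F s in at_right 0. expectation (\<lambda>\<omega>. saturated_sq r i (X s \<omega>)) / s < (A $ i $ i + I + 1) * r powr (- \<gamma>)"
      using lim by (intro order_tendstoD)
    then show "\<forall>\<^sub>F s in at_right 0. expectation (\<lambda>\<omega>. saturated_sq r i (X s \<omega>)) \<le> (A $ i $ i + I + 1) * r powr (- \<gamma>) * s"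
      using eventually_at_right_less[of 0] by eventually_elim (simp add: divide_less_eq)
  qed
qed

text \<open>Two regimes. If \<gamma> \<le> d i, the factor r^(-d i) would be too large for a drift,
  but then the drift cancels the compensator and only the integral of the saturated coordinate
  remains. If \<gamma> > d i, the drift is affordable, and the integral is the cubic error of
  saturation.\<close>

lemma saturated_lin_limit:
  assumes adm: "admissible \<gamma>"
  obtains C where "C \<ge> 0" and "\<And>r. 0 < r \<Longrightarrow> r \<le> 1 \<Longrightarrow>
     \<forall>\<^sub>F s in at_right 0. \<bar>expectation (\<lambda>\<omega>. saturated_lin r i (X s \<omega>))\<bar> \<le> C * r powr (- \<gamma>) * s"
proof -
  define \<beta> where "\<beta> = min (\<gamma> / d i) 2"
  have \<gamma>: "\<gamma> > 0" using adm by (simp add: admissible_def)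
  have \<beta>: "0 < \<beta>" "\<beta> \<le> 2" "d i * \<beta> \<le> \<gamma>"
    using \<gamma> weight_pos[of i] by (auto simp: \<beta>_def min_def field_simps)
  have int: "integrable \<nu> (\<lambda>x. \<bar>\<xi> i x\<bar> powr \<beta>)" using adm by (simp add: admissible_def \<beta>_def)
  define I where "I = (\<integral>x. \<bar>\<xi> i x\<bar> powr \<beta> \<partial>\<nu>)"
  have I: "I \<ge> 0" unfolding I_def by simp
  show thesis
  proof (rule that[of "\<bar>B $ i\<bar> + I + 1"])
    show "\<bar>B $ i\<bar> + I + 1 \<ge> 0" using I by simp
    fix r :: real assume r: "0 < r" "r \<le> 1"
    define L where "L = r powr (- 2 * d i)"
    define l where "l = r powr (- d i)"
    have L: "L > 0" and l: "l > 0" using r by (auto simp: L_def l_def)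
    have rg: "r powr (- \<gamma>) > 0" using r by simp
    define V where "V = l * (B $ i + (\<integral>y. \<xi> i y * axis_damp i L y - \<xi> i y \<partial>\<nu>))"
    have "((\<lambda>s. l * (expectation (\<lambda>\<omega>. \<xi> i (X s \<omega>) * axis_damp i L (X s \<omega>)) / s)) \<longlongrightarrow> V) (at_right 0)"
      unfolding V_def by (intro tendsto_mult_left limit_axis_lin) (use L in simp)
    then have lim: "((\<lambda>s. expectation (\<lambda>\<omega>. saturated_lin r i (X s \<omega>)) / s) \<longlongrightarrow> V) (at_right 0)"
      by (simp add: saturated_lin_def L_def l_def)
    have intg: "integrable \<nu> (\<lambda>y. r powr (- \<gamma>) * \<bar>\<xi> i y\<bar> powr \<beta>)" using int by simp
    have intI: "(\<integral>y. r powr (- \<gamma>) * \<bar>\<xi> i y\<bar> powr \<beta> \<partial>\<nu>) = r powr (- \<gamma>) * I" by (simp add: I_def)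
    have "\<bar>V\<bar> \<le> r powr (- \<gamma>) * (\<bar>B $ i\<bar> + I)"
    proof (cases "\<gamma> \<le> d i")
      case True
      then have int1: "integrable \<nu> (\<xi> i)" and B: "B $ i = (\<integral>x. \<xi> i x \<partial>\<nu>)" using adm by (auto simp: admissible_def)
      have \<beta>1: "\<beta> \<le> 1" using True weight_pos[of i] by (simp add: \<beta>_def min_le_iff_disj)
      have int2: "integrable \<nu> (\<lambda>y. \<xi> i y * axis_damp i L y)"
        by (rule Bochner_Integration.integrable_bound[OF int1])
           (use axis_damp_bounds[of L i] L in \<open>auto intro!: AE_I2 simp: abs_mult abs_of_pos mult_left_le\<close>)
      have "V = (\<integral>y. saturated_lin r i y \<partial>\<nu>)"
        unfolding V_def B using int1 int2 by (simp add: saturated_lin_def L_def l_def)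
      also have "\<bar>\<dots>\<bar> \<le> (\<integral>y. \<bar>saturated_lin r i y\<bar> \<partial>\<nu>)" by (rule integral_abs_bound)
      also have "\<dots> \<le> (\<integral>y. r powr (- \<gamma>) * \<bar>\<xi> i y\<bar> powr \<beta> \<partial>\<nu>)"
      proof (rule integral_mono[OF _ intg])
        show pt: "\<bar>saturated_lin r i y\<bar> \<le> r powr (- \<gamma>) * \<bar>\<xi> i y\<bar> powr \<beta>" for y
        proof -
          have "\<bar>saturated_lin r i y\<bar> = \<bar>r powr (- d i) * \<xi> i y\<bar> / (1 + (r powr (- d i) * \<xi> i y)\<^sup>2)"
            unfolding saturated_lin_eq abs_divide by (simp add: add_pos_nonneg)
          then show ?thesis
            using saturated_linear_le_powr[OF \<beta>(1) \<beta>1, of "r powr (- d i) * \<xi> i y"] scaled_powr_le[OF r \<beta>(1,3), of y]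
            by linarith
        qed
        show "integrable \<nu> (\<lambda>y. \<bar>saturated_lin r i y\<bar>)"
          by (rule Bochner_Integration.integrable_bound[OF intg]) (use pt in \<open>auto intro!: AE_I2 simp: abs_mult\<close>)
      qed
      also have "\<dots> = r powr (- \<gamma>) * I" by (rule intI)
      also have "\<dots> \<le> r powr (- \<gamma>) * (\<bar>B $ i\<bar> + I)" using rg by (intro mult_left_mono) auto
      finally show ?thesis .
    next
      case False
      then have \<beta>1: "1 \<le> \<beta>" using weight_pos[of i] by (simp add: \<beta>_def field_simps)
      have g: "\<bar>l * (\<xi> i y * axis_damp i L y - \<xi> i y)\<bar> \<le> r powr (- \<gamma>) * \<bar>\<xi> i y\<bar> powr \<beta>" for y
      proof -
        define z where "z = r powr (- d i) * \<xi> i y"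
        have d: "1 + z\<^sup>2 > 0" by (simp add: add_pos_nonneg)
        have Lz: "L * (\<xi> i y)\<^sup>2 = z\<^sup>2"
          by (simp add: L_def z_def power_mult_distrib power2_eq_square powr_add[symmetric])
        have "l * (\<xi> i y * axis_damp i L y - \<xi> i y) = z * (1 / (1 + z\<^sup>2)) - z"
          unfolding axis_damp_eq Lz by (simp add: l_def z_def algebra_simps)
        also have "\<dots> = - (z * (z\<^sup>2 / (1 + z\<^sup>2)))" using d by (simp add: field_simps)
        finally have "\<bar>l * (\<xi> i y * axis_damp i L y - \<xi> i y)\<bar> = \<bar>z\<bar> * (z\<^sup>2 / (1 + z\<^sup>2))"
          using d by (simp add: abs_mult)
        also have "\<dots> \<le> \<bar>z\<bar> powr \<beta>" by (rule saturated_cube_le_powr[OF \<beta>1 \<beta>(2)])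
        also have "\<dots> \<le> r powr (- \<gamma>) * \<bar>\<xi> i y\<bar> powr \<beta>" unfolding z_def by (rule scaled_powr_le[OF r \<beta>(1,3)])
        finally show ?thesis .
      qed
      have "\<bar>\<integral>y. l * (\<xi> i y * axis_damp i L y - \<xi> i y) \<partial>\<nu>\<bar> \<le> (\<integral>y. \<bar>l * (\<xi> i y * axis_damp i L y - \<xi> i y)\<bar> \<partial>\<nu>)"
        by (rule integral_abs_bound)
      also have "\<dots> \<le> (\<integral>y. r powr (- \<gamma>) * \<bar>\<xi> i y\<bar> powr \<beta> \<partial>\<nu>)"
      proof (rule integral_mono[OF _ intg g])
        show "integrable \<nu> (\<lambda>y. \<bar>l * (\<xi> i y * axis_damp i L y - \<xi> i y)\<bar>)"
          by (rule Bochner_Integration.integrable_bound[OF intg]) (use g in \<open>auto intro!: AE_I2 simp: abs_mult\<close>)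
      qed
      also have "\<dots> = r powr (- \<gamma>) * I" by (rule intI)
      finally have "\<bar>\<integral>y. l * (\<xi> i y * axis_damp i L y - \<xi> i y) \<partial>\<nu>\<bar> \<le> r powr (- \<gamma>) * I" .
      moreover have "\<bar>l * B $ i\<bar> \<le> r powr (- \<gamma>) * \<bar>B $ i\<bar>"
        unfolding abs_mult l_def using r False by (intro mult_mono) (auto intro: powr_mono')
      moreover have "V = l * B $ i + (\<integral>y. l * (\<xi> i y * axis_damp i L y - \<xi> i y) \<partial>\<nu>)" by (simp add: V_def distrib_left)
      ultimately show ?thesis by (simp add: distrib_left)
    qed
    also have "\<dots> < (\<bar>B $ i\<bar> + I + 1) * r powr (- \<gamma>)" using r by (simp add: algebra_simps)
    finally have "\<forall>\<^sub>F s in at_right 0. \<bar>expectation (\<lambda>\<omega>. saturated_lin r i (X s \<omega>)) / s\<bar> < (\<bar>B $ i\<bar> + I + 1) * r powr (- \<gamma>)"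
      using tendsto_rabs[OF lim] by (intro order_tendstoD)
    then show "\<forall>\<^sub>F s in at_right 0. \<bar>expectation (\<lambda>\<omega>. saturated_lin r i (X s \<omega>))\<bar> \<le> (\<bar>B $ i\<bar> + I + 1) * r powr (- \<gamma>) * s"
      using eventually_at_right_less[of 0] by eventually_elim (simp add: divide_less_eq)
  qed
qed

text \<open>A smoothed indicator of having left a dilated ball of scale \<open>r\<close>, zero at
  the identity. One fixed bump function is composed with the dilation, so that its derivatives need
  to be bounded only once.\<close>

definition cutoff :: "real \<Rightarrow> real \<Rightarrow> (real, 'm) vec \<Rightarrow> real" where
  "cutoff \<sigma> r x = 1 - bump \<sigma> (dilation d (1 / r) x)"

lemma dilation_component: "dilation d r x $ i = r powr d i * x $ i"
  by (simp add: dilation_def)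

lemma dilation_zero [simp]: "dilation d r 0 = 0"
  by (simp add: vec_eq_iff dilation_component)

lemma bump_measurable [measurable]: "bump \<rho> \<in> borel_measurable (borel :: (real, 'm) vec measure)"
  by (intro borel_measurable_continuous_onI Ck_imp_continuous[OF Ck_bump])

lemma dilation_measurable [measurable]: "dilation d r \<in> borel_measurable borel"
proof -
  have "continuous_on UNIV (dilation d r)"
    unfolding dilation_def[abs_def] by (intro continuous_on_vec_lambda continuous_intros)
  then show ?thesis by (rule borel_measurable_continuous_onI)
qed

lemma cutoff_measurable [measurable]: "cutoff \<sigma> r \<in> borel_measurable borel"
  unfolding cutoff_def[abs_def] by measurable

lemma cutoff_bounds: "0 \<le> cutoff \<sigma> r x" "cutoff \<sigma> r x \<le> 1"
  using bump_bounds[of \<sigma> "dilation d (1 / r) x"] by (auto simp: cutoff_def)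

lemma cutoff_zero [simp]: "cutoff \<sigma> r 0 = 0"
  by (simp add: cutoff_def)

text \<open>The constant below does not depend on the scale \<open>r\<close>, because dilations are automorphisms and the
  increments are measured in the coordinates of the rescaled group element.\<close>

lemma cutoff_expansion:
  assumes \<sigma>: "\<sigma> > 0"
  obtains C \<rho> W where "C \<ge> 0" "\<rho> > 0" "W \<ge> 0" and "\<And>r x y. 0 < r \<Longrightarrow> r \<le> 1 \<Longrightarrow>
     \<exists>w. (\<forall>i. \<bar>w i\<bar> \<le> W) \<and> (\<forall>x. cutoff \<sigma> r (y \<otimes> x) - cutoff \<sigma> r y - (\<Sum>i\<in>UNIV. saturated_lin r i x * w i) \<le>
       C * ((\<Sum>i\<in>UNIV. saturated_sq r i x) + (1 - bump \<rho> x)))"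
proof -
  have van: "bump \<sigma> x = 0" if "norm x > \<sigma>" for x :: "(real, 'm) vec" using that \<sigma> by (simp add: bump_outside)
  obtain C0 where C0: "C0 \<ge> 0" "\<And>y z. norm z \<le> 1 \<Longrightarrow>
      \<bar>bump \<sigma> (y \<otimes> z) - bump \<sigma> y - (\<Sum>i\<in>UNIV. z $ i * lie (axis i 1) (bump \<sigma>) y)\<bar> \<le> C0 * (norm z)\<^sup>2"
    using mult_taylor[OF Ck_bump van] by blast
  have "\<exists>W. W \<ge> 0 \<and> (\<forall>y. \<bar>lie (axis i 1) (bump \<sigma>) y\<bar> \<le> W)" for i
    using lie_bounded[OF Ck_bump van, where w = "axis i 1"] by metis
  then obtain W1 where W1: "\<And>i. W1 i \<ge> 0" "\<And>i y. \<bar>lie (axis i 1) (bump \<sigma>) y\<bar> \<le> W1 i" by metis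
  define W where "W = (\<Sum>i\<in>UNIV. W1 i)"
  have W: "W \<ge> 0" "\<bar>lie (axis i 1) (bump \<sigma>) y\<bar> \<le> W" for i y
    using W1 member_le_sum[of i UNIV W1] by (auto simp: W_def sum_nonneg intro: order_trans)
  obtain \<rho> where \<rho>: "\<rho> > 0" "\<And>i x. norm x \<le> \<rho> \<Longrightarrow> \<xi> i x = x $ i" using xi_linear_near by blast
  define m where "m = real CARD('m)"
  \<comment> \<open>Here 2 C0 + W is the cost of the Taylor error and of saturating its linear term
    at small rescaled increments; the rest pays for the crude bound where the saturated squares sum
    only to 1/2.\<close>
  define C where "C = 2 * C0 + W + 2 * (1 + m * W)"
  have mW: "m * W \<ge> 0" using W by (simp add: m_def)
  have C: "C \<ge> 0" "2 * C0 + W \<le> C" "2 * (1 + m * W) \<le> C" using C0 W mW by (auto simp: C_def)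
  show thesis
  proof (rule that[OF C(1) \<rho>(1) W(1)])
    fix r :: real and y assume r: "0 < r" "r \<le> 1"
    define y' where "y' = dilation d (1 / r) y"
    define w where "w i = - lie (axis i 1) (bump \<sigma>) y'" for i
    have w: "\<bar>w i\<bar> \<le> W" for i using W by (simp add: w_def)
    have "cutoff \<sigma> r (y \<otimes> x) - cutoff \<sigma> r y - (\<Sum>i\<in>UNIV. saturated_lin r i x * w i) \<le>
       C * ((\<Sum>i\<in>UNIV. saturated_sq r i x) + (1 - bump \<rho> x))" for x
    proof -
      define z where "z = dilation d (1 / r) x"
      have split: "dilation d (1 / r) (y \<otimes> x) = y' \<otimes> z"
        using r by (simp add: dilation_mult y'_def z_def)
      have D: "cutoff \<sigma> r (y \<otimes> x) - cutoff \<sigma> r y = bump \<sigma> y' - bump \<sigma> (y' \<otimes> z)"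
        unfolding cutoff_def split y'_def[symmetric] by simp
      have b1: "1 - bump \<rho> x \<ge> 0" using bump_bounds[of \<rho> x] by simp
      have s0: "(\<Sum>i\<in>UNIV. saturated_sq r i x) \<ge> 0" by (intro sum_nonneg saturated_sq_bounds)
      have lin: "\<bar>\<Sum>i\<in>UNIV. saturated_lin r i x * w i\<bar> \<le> m * W"
      proof -
        have "\<bar>\<Sum>i\<in>UNIV. saturated_lin r i x * w i\<bar> \<le> (\<Sum>i\<in>(UNIV::'m set). 1 * W)"
        proof (rule order_trans[OF sum_abs], rule sum_mono)
          show "\<bar>saturated_lin r i x * w i\<bar> \<le> 1 * W" for i
            unfolding abs_mult by (rule mult_mono[OF saturated_lin_bound w]) auto
        qed
        then show ?thesis by (simp add: m_def)
      qed
      have crude: "cutoff \<sigma> r (y \<otimes> x) - cutoff \<sigma> r y - (\<Sum>i\<in>UNIV. saturated_lin r i x * w i) \<le> 1 + m * W"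
        using cutoff_bounds(2)[of \<sigma> r "y \<otimes> x"] cutoff_bounds(1)[of \<sigma> r y] lin by linarith
      \<comment> \<open>Three regimes: outside the linear region of \<open>\<xi>\<close> the term
        \<open>1 - bump \<rho> x\<close> equals 1; for a rescaled increment \<open>z\<close> in the
        unit ball Taylor's formula applies; for larger \<open>z\<close> the saturated squares sum to
        at least 1/2.\<close>
      show ?thesis
      proof (cases "norm x \<le> \<rho>")
        case False
        then have "bump \<rho> x = 0" using \<rho> by (simp add: bump_outside)
        then have "1 \<le> (\<Sum>i\<in>UNIV. saturated_sq r i x) + (1 - bump \<rho> x)" using s0 by simp
        then have "C * 1 \<le> C * ((\<Sum>i\<in>UNIV. saturated_sq r i x) + (1 - bump \<rho> x))" using C by (intro mult_left_mono) auto
        moreover have "1 + m * W \<le> C * 1"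
          proof -
            have "1 * (1 + m * W) \<le> 2 * (1 + m * W)" using mW by (intro mult_right_mono) auto
            from order_trans[OF this C(3)] show ?thesis by simp
          qed
          ultimately show ?thesis using crude by (blast intro: order_trans)
      next
        case True
        have zi: "r powr (- d i) * \<xi> i x = z $ i" for i
          using \<rho>(2)[OF True] r by (simp add: z_def dilation_component powr_minus_divide powr_divide)
        have n2: "(norm z)\<^sup>2 = (\<Sum>i\<in>UNIV. (z $ i)\<^sup>2)" by (simp add: norm_vec_def L2_set_def sum_nonneg)
        have dz: "1 + (z $ i)\<^sup>2 > 0" for i by (simp add: add_pos_nonneg)
        show ?thesis
        proof (cases "norm z \<le> 1")
          case nz: True
          have comp: "(z $ i)\<^sup>2 \<le> 1" for i
          proof -
            have "\<bar>z $ i\<bar> \<le> 1" using component_le_norm_cart[of z i] nz by linarith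
            from abs_le_imp_power2_le[OF this] show ?thesis by simp
          qed
          have "(norm z)\<^sup>2 \<le> (\<Sum>i\<in>UNIV. 2 * saturated_sq r i x)"
            unfolding n2
          proof (rule sum_mono)
            fix i
            have "(z $ i)\<^sup>2 * (1 + (z $ i)\<^sup>2) \<le> (z $ i)\<^sup>2 * 2" using comp[of i] by (intro mult_left_mono) auto
            then show "(z $ i)\<^sup>2 \<le> 2 * saturated_sq r i x" unfolding saturated_sq_eq zi using dz[of i] by (simp add: pos_le_divide_eq)
          qed
          then have quad: "(norm z)\<^sup>2 \<le> 2 * (\<Sum>i\<in>UNIV. saturated_sq r i x)" by (simp only: sum_distrib_left)
          have "\<bar>\<Sum>i\<in>UNIV. (z $ i - saturated_lin r i x) * w i\<bar> \<le> (\<Sum>i\<in>UNIV. saturated_sq r i x * W)"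
          proof (rule order_trans[OF sum_abs], rule sum_mono)
            fix i
            have "z $ i - saturated_lin r i x = z $ i * saturated_sq r i x"
              unfolding saturated_lin_eq saturated_sq_eq zi using dz[of i] by (simp add: field_simps power2_eq_square)
            moreover have "\<bar>z $ i\<bar> \<le> 1" using component_le_norm_cart[of z i] nz by linarith
            ultimately have "\<bar>z $ i - saturated_lin r i x\<bar> \<le> saturated_sq r i x"
              using saturated_sq_bounds(1)[of r i x] by (simp add: abs_mult mult_left_le_one_le)
            then show "\<bar>(z $ i - saturated_lin r i x) * w i\<bar> \<le> saturated_sq r i x * W"
              unfolding abs_mult using w saturated_sq_bounds(1) by (intro mult_mono) auto
          qed
          then have linerr: "\<bar>\<Sum>i\<in>UNIV. (z $ i - saturated_lin r i x) * w i\<bar> \<le> W * (\<Sum>i\<in>UNIV. saturated_sq r i x)"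
            by (simp only: sum_distrib_left mult.commute)
          have "bump \<sigma> y' - bump \<sigma> (y' \<otimes> z) - (\<Sum>i\<in>UNIV. z $ i * w i) \<le> C0 * (norm z)\<^sup>2"
            using C0(2)[OF nz, of y'] by (simp add: w_def sum_negf)
          also have "\<dots> \<le> C0 * (2 * (\<Sum>i\<in>UNIV. saturated_sq r i x))" using C0(1) quad by (intro mult_left_mono) auto
          finally have "bump \<sigma> y' - bump \<sigma> (y' \<otimes> z) - (\<Sum>i\<in>UNIV. z $ i * w i) \<le> 2 * C0 * (\<Sum>i\<in>UNIV. saturated_sq r i x)" by simp
          moreover have "(\<Sum>i\<in>UNIV. (z $ i - saturated_lin r i x) * w i) = (\<Sum>i\<in>UNIV. z $ i * w i) - (\<Sum>i\<in>UNIV. saturated_lin r i x * w i)"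
            by (simp add: left_diff_distrib sum_subtractf)
          ultimately have "cutoff \<sigma> r (y \<otimes> x) - cutoff \<sigma> r y - (\<Sum>i\<in>UNIV. saturated_lin r i x * w i) \<le> 2 * C0 * (\<Sum>i\<in>UNIV. saturated_sq r i x) + W * (\<Sum>i\<in>UNIV. saturated_sq r i x)"
            using linerr unfolding D by linarith
          also have "\<dots> = (2 * C0 + W) * (\<Sum>i\<in>UNIV. saturated_sq r i x)" by (simp add: distrib_right)
          also have "\<dots> \<le> C * ((\<Sum>i\<in>UNIV. saturated_sq r i x) + (1 - bump \<rho> x))"
            using C s0 b1 C0 W by (intro mult_mono) auto
          finally show ?thesis .
        next
          case nz: False
          then have n1: "(norm z)\<^sup>2 \<ge> 1" by simp
          have "(norm z)\<^sup>2 / (1 + (norm z)\<^sup>2) = (\<Sum>i\<in>UNIV. (z $ i)\<^sup>2 / (1 + (norm z)\<^sup>2))"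
            by (simp add: n2 sum_divide_distrib)
          also have "\<dots> \<le> (\<Sum>i\<in>UNIV. saturated_sq r i x)"
          proof (rule sum_mono)
            fix i
            have "(z $ i)\<^sup>2 \<le> (norm z)\<^sup>2" by (rule abs_le_imp_power2_le[OF component_le_norm_cart])
            then show "(z $ i)\<^sup>2 / (1 + (norm z)\<^sup>2) \<le> saturated_sq r i x"
              unfolding saturated_sq_eq zi using dz[of i] by (intro divide_left_mono mult_pos_pos) (auto intro: less_le_trans)
          qed
          finally have "(norm z)\<^sup>2 / (1 + (norm z)\<^sup>2) \<le> (\<Sum>i\<in>UNIV. saturated_sq r i x)" .
          moreover have "1 / 2 \<le> (norm z)\<^sup>2 / (1 + (norm z)\<^sup>2)" using n1 by (simp add: pos_le_divide_eq add_pos_nonneg)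
          ultimately have "1 / 2 \<le> (\<Sum>i\<in>UNIV. saturated_sq r i x) + (1 - bump \<rho> x)" using b1 by linarith
          then have "2 * (1 + m * W) * (1 / 2) \<le> C * ((\<Sum>i\<in>UNIV. saturated_sq r i x) + (1 - bump \<rho> x))"
            using C mW by (intro mult_mono) auto
          then show ?thesis using crude by simp
        qed
      qed
    qed
    then show "\<exists>w. (\<forall>i. \<bar>w i\<bar> \<le> W) \<and> (\<forall>x. cutoff \<sigma> r (y \<otimes> x) - cutoff \<sigma> r y - (\<Sum>i\<in>UNIV. saturated_lin r i x * w i) \<le>
       C * ((\<Sum>i\<in>UNIV. saturated_sq r i x) + (1 - bump \<rho> x)))"
      using w by blast
  qed
qed

text \<open>The weights \<open>w\<close> of \<open>cutoff_expansion\<close> depend on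
  \<open>y\<close>, but their bound \<open>W\<close> does not, so after taking expectations only the
  rates of the saturated coordinates and of the tail remain. The tail rate is constant in
  \<open>r\<close> and is absorbed because r^(-\<gamma>) \<ge> 1.\<close>

lemma cutoff_drift:
  assumes adm: "admissible \<gamma>" and \<sigma>: "\<sigma> > 0"
  obtains C where "C \<ge> 0" and "\<And>r. 0 < r \<Longrightarrow> r \<le> 1 \<Longrightarrow>
     \<forall>\<^sub>F s in at_right 0. \<forall>y. expectation (\<lambda>\<omega>. cutoff \<sigma> r (y \<otimes> X s \<omega>)) - cutoff \<sigma> r y \<le> C * r powr (- \<gamma>) * s"
proof -
  have \<gamma>: "\<gamma> > 0" using adm by (simp add: admissible_def)
  obtain C \<rho> W where C: "C \<ge> 0" and \<rho>: "\<rho> > 0" and W: "W \<ge> 0" and ex: "\<And>r x y. 0 < r \<Longrightarrow> r \<le> 1 \<Longrightarrow>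
     \<exists>w. (\<forall>i. \<bar>w i\<bar> \<le> W) \<and> (\<forall>x. cutoff \<sigma> r (y \<otimes> x) - cutoff \<sigma> r y - (\<Sum>i\<in>UNIV. saturated_lin r i x * w i) \<le>
       C * ((\<Sum>i\<in>UNIV. saturated_sq r i x) + (1 - bump \<rho> x)))"
    using cutoff_expansion[OF \<sigma>] by blast
  have "\<exists>c\<ge>0. \<forall>r. 0 < r \<and> r \<le> 1 \<longrightarrow> (\<forall>\<^sub>F s in at_right 0. expectation (\<lambda>\<omega>. saturated_sq r i (X s \<omega>)) \<le> c * r powr (- \<gamma>) * s)" for i
    using saturated_sq_limit[OF adm, of i] by metis
  then obtain c2 where c2: "\<And>i. c2 i \<ge> 0" "\<And>i r. 0 < r \<Longrightarrow> r \<le> 1 \<Longrightarrow>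
     \<forall>\<^sub>F s in at_right 0. expectation (\<lambda>\<omega>. saturated_sq r i (X s \<omega>)) \<le> c2 i * r powr (- \<gamma>) * s" by metis
  have "\<exists>c\<ge>0. \<forall>r. 0 < r \<and> r \<le> 1 \<longrightarrow> (\<forall>\<^sub>F s in at_right 0. \<bar>expectation (\<lambda>\<omega>. saturated_lin r i (X s \<omega>))\<bar> \<le> c * r powr (- \<gamma>) * s)" for i
    using saturated_lin_limit[OF adm, of i] by metis
  then obtain c1 where c1: "\<And>i. c1 i \<ge> 0" "\<And>i r. 0 < r \<Longrightarrow> r \<le> 1 \<Longrightarrow>
     \<forall>\<^sub>F s in at_right 0. \<bar>expectation (\<lambda>\<omega>. saturated_lin r i (X s \<omega>))\<bar> \<le> c1 i * r powr (- \<gamma>) * s" by metis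
  obtain Cb where Cb: "Cb > 0" "\<forall>\<^sub>F t in at_right 0. expectation (\<lambda>\<omega>. 1 - bump \<rho> (X t \<omega>)) \<le> Cb * t"
    using tail_linear[OF \<rho>] by blast
  define C' where "C' = (\<Sum>i\<in>UNIV. c1 i * W) + C * ((\<Sum>i\<in>UNIV. c2 i) + Cb)"
  show thesis
  proof (rule that[of C'])
    show "C' \<ge> 0" unfolding C'_def using c1 c2 C Cb W by (intro add_nonneg_nonneg mult_nonneg_nonneg sum_nonneg) auto
    fix r :: real assume r: "0 < r" "r \<le> 1"
    have rg: "1 \<le> r powr (- \<gamma>)" using r \<gamma> powr_mono'[of "- \<gamma>" 0 r] by simp
    have "\<forall>\<^sub>F s in at_right 0. \<forall>i\<in>UNIV. expectation (\<lambda>\<omega>. saturated_sq r i (X s \<omega>)) \<le> c2 i * r powr (- \<gamma>) * s"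
      by (intro eventually_ball_finite ballI c2 r) simp
    moreover have "\<forall>\<^sub>F s in at_right 0. \<forall>i\<in>UNIV. \<bar>expectation (\<lambda>\<omega>. saturated_lin r i (X s \<omega>))\<bar> \<le> c1 i * r powr (- \<gamma>) * s"
      by (intro eventually_ball_finite ballI c1 r) simp
    moreover note Cb(2) eventually_at_right_less[of 0]
    ultimately show "\<forall>\<^sub>F s in at_right 0. \<forall>y. expectation (\<lambda>\<omega>. cutoff \<sigma> r (y \<otimes> X s \<omega>)) - cutoff \<sigma> r y \<le> C' * r powr (- \<gamma>) * s"
    proof eventually_elim
      case (elim s)
      then have s: "s > 0" by simp
      have Xs [measurable]: "X s \<in> borel_measurable M" using s by (intro X_measurable) simp
      show ?case
      proof
        fix y
        obtain w where w: "\<And>i. \<bar>w i\<bar> \<le> W" and le: "\<And>x. cutoff \<sigma> r (y \<otimes> x) - cutoff \<sigma> r y - (\<Sum>i\<in>UNIV. saturated_lin r i x * w i) \<le>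
           C * ((\<Sum>i\<in>UNIV. saturated_sq r i x) + (1 - bump \<rho> x))"
          using ex[OF r, of y] by blast
        have i0: "integrable M (\<lambda>\<omega>. cutoff \<sigma> r (y \<otimes> X s \<omega>))"
          by (rule integrable_bounded[of _ 1]) (use cutoff_bounds in auto)
        have i1: "integrable M (\<lambda>\<omega>. saturated_lin r i (X s \<omega>))" for i
          by (rule integrable_bounded[of _ 1]) (use saturated_lin_bound in auto)
        have i2: "integrable M (\<lambda>\<omega>. saturated_sq r i (X s \<omega>))" for i
          by (rule integrable_bounded[of _ 1]) (use saturated_sq_bounds in auto)
        have i3: "integrable M (\<lambda>\<omega>. 1 - bump \<rho> (X s \<omega>))"
          by (rule integrable_bounded[of _ 1]) (auto simp: abs_le_iff bump_bounds intro: order_trans[OF bump_bounds(2)])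
        have "expectation (\<lambda>\<omega>. cutoff \<sigma> r (y \<otimes> X s \<omega>)) \<le> expectation (\<lambda>\<omega>. cutoff \<sigma> r y + (\<Sum>i\<in>UNIV. saturated_lin r i (X s \<omega>) * w i)
            + C * ((\<Sum>i\<in>UNIV. saturated_sq r i (X s \<omega>)) + (1 - bump \<rho> (X s \<omega>))))"
        proof (rule integral_mono[OF i0])
          show "integrable M (\<lambda>\<omega>. cutoff \<sigma> r y + (\<Sum>i\<in>UNIV. saturated_lin r i (X s \<omega>) * w i)
            + C * ((\<Sum>i\<in>UNIV. saturated_sq r i (X s \<omega>)) + (1 - bump \<rho> (X s \<omega>))))"
            by (intro Bochner_Integration.integrable_add integrable_mult_right integrable_mult_left
                Bochner_Integration.integrable_sum i1 i2 i3 integrable_const)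
          show "cutoff \<sigma> r (y \<otimes> X s \<omega>) \<le> cutoff \<sigma> r y + (\<Sum>i\<in>UNIV. saturated_lin r i (X s \<omega>) * w i)
            + C * ((\<Sum>i\<in>UNIV. saturated_sq r i (X s \<omega>)) + (1 - bump \<rho> (X s \<omega>)))" for \<omega>
            using le[of "X s \<omega>"] by linarith
        qed
        also have "\<dots> = cutoff \<sigma> r y + (\<Sum>i\<in>UNIV. expectation (\<lambda>\<omega>. saturated_lin r i (X s \<omega>)) * w i)
            + C * ((\<Sum>i\<in>UNIV. expectation (\<lambda>\<omega>. saturated_sq r i (X s \<omega>))) + expectation (\<lambda>\<omega>. 1 - bump \<rho> (X s \<omega>)))"
        proof -
          have a: "integrable M (\<lambda>\<omega>. \<Sum>i\<in>UNIV. saturated_lin r i (X s \<omega>) * w i)" using i1 by auto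
          have b: "integrable M (\<lambda>\<omega>. \<Sum>i\<in>UNIV. saturated_sq r i (X s \<omega>))" using i2 by auto
          have a': "expectation (\<lambda>\<omega>. \<Sum>i\<in>UNIV. saturated_lin r i (X s \<omega>) * w i) = (\<Sum>i\<in>UNIV. expectation (\<lambda>\<omega>. saturated_lin r i (X s \<omega>)) * w i)"
            using i1 by simp
          have b': "expectation (\<lambda>\<omega>. \<Sum>i\<in>UNIV. saturated_sq r i (X s \<omega>)) = (\<Sum>i\<in>UNIV. expectation (\<lambda>\<omega>. saturated_sq r i (X s \<omega>)))"
            using i2 by simp
          define f where "f \<omega> = 1 - bump \<rho> (X s \<omega>)" for \<omega>
          have i3': "integrable M f" using i3 by (simp add: f_def[abs_def])
          have "expectation (\<lambda>\<omega>. cutoff \<sigma> r y + (\<Sum>i\<in>UNIV. saturated_lin r i (X s \<omega>) * w i) + C * ((\<Sum>i\<in>UNIV. saturated_sq r i (X s \<omega>)) + f \<omega>)) =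
            cutoff \<sigma> r y + expectation (\<lambda>\<omega>. \<Sum>i\<in>UNIV. saturated_lin r i (X s \<omega>) * w i) + C * (expectation (\<lambda>\<omega>. \<Sum>i\<in>UNIV. saturated_sq r i (X s \<omega>)) + expectation f)"
            using a b i3' by (simp add: prob_space del: Bochner_Integration.integral_sum)
          then show ?thesis unfolding a' b' f_def[abs_def] .
        qed
        also have "\<dots> \<le> cutoff \<sigma> r y + (\<Sum>i\<in>UNIV. c1 i * r powr (- \<gamma>) * s * W) + C * ((\<Sum>i\<in>UNIV. c2 i * r powr (- \<gamma>) * s) + Cb * r powr (- \<gamma>) * s)"
        proof (intro add_mono mult_left_mono sum_mono order_refl C)
          fix i
          have "expectation (\<lambda>\<omega>. saturated_lin r i (X s \<omega>)) * w i \<le> \<bar>expectation (\<lambda>\<omega>. saturated_lin r i (X s \<omega>))\<bar> * \<bar>w i\<bar>"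
            by (metis abs_ge_self abs_mult)
          also have "\<dots> \<le> c1 i * r powr (- \<gamma>) * s * W"
            using elim(2) w c1(1)[of i] s by (intro mult_mono) auto
          finally show "expectation (\<lambda>\<omega>. saturated_lin r i (X s \<omega>)) * w i \<le> c1 i * r powr (- \<gamma>) * s * W" .
        next
          show "expectation (\<lambda>\<omega>. saturated_sq r i (X s \<omega>)) \<le> c2 i * r powr (- \<gamma>) * s" for i using elim(1) by blast
        next
          have "Cb * s * 1 \<le> Cb * s * r powr (- \<gamma>)" using Cb s rg by (intro mult_left_mono) auto
          then show "expectation (\<lambda>\<omega>. 1 - bump \<rho> (X s \<omega>)) \<le> Cb * r powr (- \<gamma>) * s" using elim(3) by (simp add: mult_ac)
        qed
        also have "\<dots> = cutoff \<sigma> r y + C' * r powr (- \<gamma>) * s"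
          by (simp add: C'_def sum_distrib_left sum_distrib_right algebra_simps)
        finally show "expectation (\<lambda>\<omega>. cutoff \<sigma> r (y \<otimes> X s \<omega>)) - cutoff \<sigma> r y \<le> C' * r powr (- \<gamma>) * s" by simp
      qed
    qed
  qed
qed

text \<open>The number of restarts is adapted to the increments, so its mean can be computed step by step, while it
  dominates the number of increments longer than \<open>2 r\<close> of an arbitrary partition.\<close>

primrec walk :: "real \<Rightarrow> (nat \<Rightarrow> (real, 'm) vec) \<Rightarrow> nat \<Rightarrow> (real, 'm) vec" where
  "walk r x 0 = 0"
| "walk r x (Suc k) = (if N (walk r x k \<otimes> x k) > r then 0 else walk r x k \<otimes> x k)"

definition resets :: "real \<Rightarrow> (nat \<Rightarrow> (real, 'm) vec) \<Rightarrow> nat \<Rightarrow> real" where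
  "resets r x n = (\<Sum>k<n. if N (walk r x k \<otimes> x k) > r then 1 else 0)"

lemma resets_Suc: "resets r x (Suc n) = resets r x n + (if N (walk r x n \<otimes> x n) > r then 1 else 0)"
  by (simp add: resets_def)

lemma resets_nonneg: "0 \<le> resets r x n"
  by (simp add: resets_def sum_nonneg)

lemma resets_le: "resets r x n \<le> real n"
proof -
  have "resets r x n \<le> (\<Sum>k<n. 1)" unfolding resets_def by (intro sum_mono) auto
  then show ?thesis by simp
qed

lemma walk_bound: "r \<ge> 0 \<Longrightarrow> N (walk r x n) \<le> r"
  by (induction n) (auto simp: N_zero)

lemma walk_restrict: "{..<n} \<subseteq> I \<Longrightarrow> walk r (restrict x I) n = walk r x n"
proof (induction n)
  case (Suc n)
  have "{..<n} \<subseteq> I" "n \<in> I" using Suc.prems by auto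
  then show ?case using Suc.IH by simp
qed simp

lemma walk_measurable: "{..<n} \<subseteq> I \<Longrightarrow> (\<lambda>x. walk r x n) \<in> borel_measurable (PiM I (\<lambda>_. borel))"
proof (induction n)
  case (Suc n)
  have [measurable]: "(\<lambda>x. x n :: (real, 'm) vec) \<in> measurable (PiM I (\<lambda>_. borel)) borel"
    using Suc.prems by (intro measurable_component_singleton) auto
  have [measurable]: "(\<lambda>x. walk r x n) \<in> borel_measurable (PiM I (\<lambda>_. borel))"
    using Suc.prems by (intro Suc.IH) auto
  show ?case unfolding walk.simps by measurable
qed simp

lemma walk_gprod:
  "resets r x (i + l) \<ge> resets r x i + 1 \<or>
   resets r x (i + l) = resets r x i \<and> walk r x (i + l) = walk r x i \<otimes> gprod x i l"
proof (induction l)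
  case (Suc l)
  show ?case
  proof (cases "N (walk r x (i + l) \<otimes> x (i + l)) > r")
    case True
    have "resets r x i \<le> resets r x (i + l)" using Suc by auto
    then show ?thesis using True by (simp add: resets_Suc)
  next
    case False
    then show ?thesis using Suc by (auto simp: resets_Suc m_assoc)
  qed
qed simp

text \<open>Without a reset inside the block the walk is merely multiplied by the block's product.
  Both its values have norm at most \<open>r\<close>, so the product has norm at most 2 r.\<close>

lemma resets_jump:
  assumes r: "r \<ge> 0"
  shows "resets r x i + (if N (gprod x i l) > 2 * r then 1 else 0) \<le> resets r x (i + l)"
proof (cases "N (gprod x i l) > 2 * r")
  case True
  have "\<not> (resets r x (i + l) = resets r x i \<and> walk r x (i + l) = walk r x i \<otimes> gprod x i l)"
  proof
    assume "resets r x (i + l) = resets r x i \<and> walk r x (i + l) = walk r x i \<otimes> gprod x i l"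
    then have "walk r x (i + l) = walk r x i \<otimes> gprod x i l" by simp
    then have "(- walk r x i) \<otimes> walk r x (i + l) = gprod x i l"
      by (simp flip: inv_eq_uminus m_assoc add: one_eq_zero)
    then have "N (gprod x i l) \<le> N (- walk r x i) + N (walk r x (i + l))" using N_mult by metis
    then show False using walk_bound[OF r, of x i] walk_bound[OF r, of x "i + l"] True by (simp add: N_uminus)
  qed
  then show ?thesis using walk_gprod[of r x i l] True by auto
next
  case False
  then show ?thesis using walk_gprod[of r x i l] by auto
qed

lemma resets_count:
  assumes r: "r \<ge> 0" and a: "\<And>j. a j \<le> a (Suc j)"
  shows "(\<Sum>j<n. if N (gprod x (a j) (a (Suc j) - a j)) > 2 * r then 1 else 0) \<le> resets r x (a n)"
proof (induction n)
  case (Suc n)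
  show ?case using resets_jump[OF r, of x "a n" "a (Suc n) - a n"] Suc a[of n] by simp
qed (simp add: resets_nonneg)

text \<open>Continuity of \<open>N\<close> at the identity gives \<sigma> at scale 1, and
  homogeneity makes the same \<sigma> work at every scale.\<close>

lemma cutoff_exit:
  obtains \<sigma> where "\<sigma> > 0" "\<And>r y. r > 0 \<Longrightarrow> N y > r \<Longrightarrow> cutoff \<sigma> r y = 1"
proof -
  have "isCont N 0" using N_continuous by (simp add: continuous_on_eq_continuous_at)
  then obtain \<sigma> where \<sigma>: "\<sigma> > 0" "\<And>x. dist x 0 < \<sigma> \<Longrightarrow> dist (N x) (N 0) < 1"
    unfolding continuous_at_eps_delta using zero_less_one by metis
  show thesis
  proof (rule that[OF \<sigma>(1)])
    fix r y assume r: "r > 0" "N y > r"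
    then have "N (dilation d (1 / r) y) > 1" by (simp add: N_dilation)
    then have "\<not> norm (dilation d (1 / r) y) < \<sigma>" using \<sigma>(2)[of "dilation d (1 / r) y"] by (auto simp: N_zero)
    then show "cutoff \<sigma> r y = 1" using \<sigma>(1) by (simp add: cutoff_def bump_outside)
  qed
qed

lemma resets_measurable:
  assumes s: "s \<ge> 0"
  defines "W \<equiv> \<lambda>i \<omega>. increment G (\<lambda>t. X t \<omega>) (real i * s) (real (Suc i) * s)"
  shows "(\<lambda>\<omega>. walk r (\<lambda>i. W i \<omega>) n) \<in> borel_measurable M" "(\<lambda>\<omega>. resets r (\<lambda>i. W i \<omega>) n) \<in> borel_measurable M"
proof -
  have Wm [measurable]: "W i \<in> borel_measurable M" for i
    unfolding W_def[abs_def] by (intro increment_measurable mult_nonneg_nonneg s of_nat_0_le_iff)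
  have walkm [measurable]: "(\<lambda>\<omega>. walk r (\<lambda>i. W i \<omega>) n) \<in> borel_measurable M" for n
  proof (induction n)
    case (Suc n)
    note [measurable] = Suc
    show ?case unfolding walk.simps by measurable
  qed simp
  have Rm [measurable]: "(\<lambda>\<omega>. resets r (\<lambda>i. W i \<omega>) n) \<in> borel_measurable M" for n
    unfolding resets_def by measurable
  show "(\<lambda>\<omega>. walk r (\<lambda>i. W i \<omega>) n) \<in> borel_measurable M" by measurable
  show "(\<lambda>\<omega>. resets r (\<lambda>i. W i \<omega>) n) \<in> borel_measurable M" by measurable
qed

text \<open>A potential argument: resets plus the cutoff at the current position of the walk grow by
  at most \<open>c\<close> per step in expectation, start at 0, and dominate the number of resets.
  The position depends on past increments only, hence is independent of the next one.\<close>

lemma expected_resets: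
  assumes s: "s \<ge> 0" and ex: "\<And>y. N y > r \<Longrightarrow> cutoff \<sigma> r y = 1"
    and drift: "\<And>y. expectation (\<lambda>\<omega>. cutoff \<sigma> r (y \<otimes> X s \<omega>)) - cutoff \<sigma> r y \<le> c"
  defines "W \<equiv> \<lambda>i \<omega>. increment G (\<lambda>t. X t \<omega>) (real i * s) (real (Suc i) * s)"
  shows "expectation (\<lambda>\<omega>. resets r (\<lambda>i. W i \<omega>) n) \<le> real n * c"
proof -
  have Wm [measurable]: "W i \<in> borel_measurable M" for i
    unfolding W_def[abs_def] by (intro increment_measurable mult_nonneg_nonneg s of_nat_0_le_iff)
  have [measurable]: "(\<lambda>\<omega>. walk r (\<lambda>i. W i \<omega>) n) \<in> borel_measurable M"
    "(\<lambda>\<omega>. resets r (\<lambda>i. W i \<omega>) n) \<in> borel_measurable M" for n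
    unfolding W_def by (rule resets_measurable[OF s])+
  have iR: "integrable M (\<lambda>\<omega>. resets r (\<lambda>i. W i \<omega>) n)" for n
    by (rule integrable_bounded[of _ "real n"]) (use resets_nonneg resets_le in auto)
  have icm: "integrable M (\<lambda>\<omega>. cutoff \<sigma> r (f \<omega>))" if "f \<in> borel_measurable M" for f
    by (rule integrable_bounded[of _ 1]) (use that cutoff_bounds in \<open>auto intro: measurable_compose[OF _ cutoff_measurable]\<close>)
  have "expectation (\<lambda>\<omega>. resets r (\<lambda>i. W i \<omega>) n + cutoff \<sigma> r (walk r (\<lambda>i. W i \<omega>) n)) \<le> real n * c"
  proof (induction n)
    case (Suc k)
    define H where "H = (\<lambda>p. cutoff \<sigma> r (walk r (fst p) k \<otimes> snd p k) - cutoff \<sigma> r (walk r (fst p) k))"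
    have "indep_vars (\<lambda>_. borel) W {..<Suc k}"
      using indep_grid_increments[of 0 s "Suc k"] s unfolding W_def by simp
    then have iv: "indep_var (PiM {..<k} (\<lambda>_. borel)) (\<lambda>\<omega>. restrict (\<lambda>i. W i \<omega>) {..<k})
        (PiM {k} (\<lambda>_. borel)) (\<lambda>\<omega>. restrict (\<lambda>i. W i \<omega>) {k})"
      by (rule indep_var_restrict) auto
    have [measurable]: "(\<lambda>x. walk r x k) \<in> borel_measurable (PiM {..<k} (\<lambda>_. borel))"
      by (rule walk_measurable) simp
    have [measurable]: "(\<lambda>x. x k :: (real, 'm) vec) \<in> measurable (PiM {k} (\<lambda>_. borel)) borel"
      by (intro measurable_component_singleton) auto
    have Hm: "H \<in> borel_measurable (PiM {..<k} (\<lambda>_. borel) \<Otimes>\<^sub>M PiM {k} (\<lambda>_. borel))"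
      unfolding H_def by measurable
    have Hb: "norm (H q) \<le> 1" for q
      unfolding H_def using cutoff_bounds[of \<sigma> r "walk r (fst q) k \<otimes> snd q k"] cutoff_bounds[of \<sigma> r "walk r (fst q) k"] by auto
    have Hr: "H (restrict (\<lambda>i. W i \<omega>) {..<k}, restrict (\<lambda>i. W i \<omega>') {k}) = cutoff \<sigma> r (walk r (\<lambda>i. W i \<omega>) k \<otimes> W k \<omega>') - cutoff \<sigma> r (walk r (\<lambda>i. W i \<omega>) k)" for \<omega> \<omega>'
      by (simp add: H_def walk_restrict)
    have E1: "expectation (\<lambda>\<omega>'. cutoff \<sigma> r (y \<otimes> W k \<omega>')) = expectation (\<lambda>\<omega>'. cutoff \<sigma> r (y \<otimes> X s \<omega>'))" for y
      using grid_increment_expectation[of 0 s "\<lambda>x. cutoff \<sigma> r (y \<otimes> x)" k] s by (simp add: W_def)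
    have "expectation (\<lambda>\<omega>. cutoff \<sigma> r (walk r (\<lambda>i. W i \<omega>) k \<otimes> W k \<omega>) - cutoff \<sigma> r (walk r (\<lambda>i. W i \<omega>) k)) =
        expectation (\<lambda>\<omega>. expectation (\<lambda>\<omega>'. cutoff \<sigma> r (walk r (\<lambda>i. W i \<omega>) k \<otimes> W k \<omega>') - cutoff \<sigma> r (walk r (\<lambda>i. W i \<omega>) k)))"
      using indep_var_expectation_iterated[OF iv Hm Hb] unfolding Hr .
    also have "\<dots> = expectation (\<lambda>\<omega>. expectation (\<lambda>\<omega>'. cutoff \<sigma> r (walk r (\<lambda>i. W i \<omega>) k \<otimes> X s \<omega>')) - cutoff \<sigma> r (walk r (\<lambda>i. W i \<omega>) k))"
    proof (intro Bochner_Integration.integral_cong refl)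
      fix \<omega>
      have "(\<lambda>\<omega>'. walk r (\<lambda>i. W i \<omega>) k \<otimes> W k \<omega>') \<in> borel_measurable M" by measurable
      from icm[OF this]
      show "expectation (\<lambda>\<omega>'. cutoff \<sigma> r (walk r (\<lambda>i. W i \<omega>) k \<otimes> W k \<omega>') - cutoff \<sigma> r (walk r (\<lambda>i. W i \<omega>) k)) =
          expectation (\<lambda>\<omega>'. cutoff \<sigma> r (walk r (\<lambda>i. W i \<omega>) k \<otimes> X s \<omega>')) - cutoff \<sigma> r (walk r (\<lambda>i. W i \<omega>) k)"
        by (simp add: E1 prob_space)
    qed
    also have "\<dots> \<le> c"
    proof (cases "integrable M (\<lambda>\<omega>. expectation (\<lambda>\<omega>'. cutoff \<sigma> r (walk r (\<lambda>i. W i \<omega>) k \<otimes> X s \<omega>')) - cutoff \<sigma> r (walk r (\<lambda>i. W i \<omega>) k))")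
      case True
      from integral_le_const[OF this, of c] show ?thesis using drift by simp
    next
      \<comment> \<open>The integral is 0 by convention here, and the drift bound at the identity,
        where the cutoff vanishes, shows 0 \<le> c.\<close>
      case False
      have "0 \<le> expectation (\<lambda>\<omega>'. cutoff \<sigma> r (0 \<otimes> X s \<omega>'))" by (intro integral_nonneg_AE) (simp add: cutoff_bounds)
      then have "0 \<le> c" using drift[of 0] by simp
      then show ?thesis using False by (simp add: not_integrable_integral_eq)
    qed
    finally have step: "expectation (\<lambda>\<omega>. cutoff \<sigma> r (walk r (\<lambda>i. W i \<omega>) k \<otimes> W k \<omega>) - cutoff \<sigma> r (walk r (\<lambda>i. W i \<omega>) k)) \<le> c" .
    \<comment> \<open>A restart trades the value 1 of the cutoff for one more reset, because the
      cutoff is 1 beyond norm \<open>r\<close> and 0 at the identity; the sum is therefore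
      unaffected by restarts.\<close>
    have "resets r x (Suc k) + cutoff \<sigma> r (walk r x (Suc k)) = (resets r x k + cutoff \<sigma> r (walk r x k)) +
        (cutoff \<sigma> r (walk r x k \<otimes> x k) - cutoff \<sigma> r (walk r x k))" for x
      using ex by (simp add: resets_Suc)
    then have "expectation (\<lambda>\<omega>. resets r (\<lambda>i. W i \<omega>) (Suc k) + cutoff \<sigma> r (walk r (\<lambda>i. W i \<omega>) (Suc k))) =
       expectation (\<lambda>\<omega>. (resets r (\<lambda>i. W i \<omega>) k + cutoff \<sigma> r (walk r (\<lambda>i. W i \<omega>) k)) +
        (cutoff \<sigma> r (walk r (\<lambda>i. W i \<omega>) k \<otimes> W k \<omega>) - cutoff \<sigma> r (walk r (\<lambda>i. W i \<omega>) k)))" by (simp only:)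
    also have "\<dots> = expectation (\<lambda>\<omega>. resets r (\<lambda>i. W i \<omega>) k + cutoff \<sigma> r (walk r (\<lambda>i. W i \<omega>) k)) +
        expectation (\<lambda>\<omega>. cutoff \<sigma> r (walk r (\<lambda>i. W i \<omega>) k \<otimes> W k \<omega>) - cutoff \<sigma> r (walk r (\<lambda>i. W i \<omega>) k))"
      by (intro Bochner_Integration.integral_add Bochner_Integration.integrable_add Bochner_Integration.integrable_diff iR icm) measurable
    also have "\<dots> \<le> real k * c + c" using Suc step by simp
    finally show ?case by (simp add: distrib_right add.commute)
  qed (simp add: resets_def)
  moreover have "expectation (\<lambda>\<omega>. resets r (\<lambda>i. W i \<omega>) n) \<le> expectation (\<lambda>\<omega>. resets r (\<lambda>i. W i \<omega>) n + cutoff \<sigma> r (walk r (\<lambda>i. W i \<omega>) n))"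
    by (intro integral_mono Bochner_Integration.integrable_add iR icm) (auto simp: cutoff_bounds)
  ultimately show "expectation (\<lambda>\<omega>. resets r (\<lambda>i. W i \<omega>) n) \<le> real n * c" by simp
qed

end

subsection \<open>Finite variation\<close>

text \<open>A single term of the series suffices, namely the largest dyadic scale 2^(-k) with v > 2
  * 2^(-k). The preceding scale fails, which gives v \<le> 4 * 2^(-k) and the constant
  \<open>4 powr p\<close>; if k = 0 there is no preceding scale, and the a priori bound
  \<open>R\<close> steps in.\<close>

lemma powr_le_dyadic_sum:
  fixes v R p :: real
  assumes v: "0 \<le> v" "v \<le> R" and p: "p > 0"
  shows "ennreal (v powr p) \<le> ennreal (R powr p + 4 powr p) *
    (\<Sum>k. ennreal (((1 / 2) ^ k) powr p) * ennreal (if v > 2 * (1 / 2) ^ k then 1 else 0))"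
proof (cases "v = 0")
  case False
  have "\<exists>k. v > 2 * (1 / 2) ^ k"
  proof -
    obtain k where "(1 / 2) ^ k < v / 2" using real_arch_pow_inv[of "v / 2" "1 / 2"] v False by auto
    then show ?thesis by (intro exI[of _ k]) simp
  qed
  define k where "k = (LEAST k. v > 2 * (1 / 2) ^ k)"
  have k: "v > 2 * (1 / 2) ^ k" unfolding k_def using \<open>\<exists>k. v > 2 * (1 / 2) ^ k\<close> by (rule LeastI_ex)
  let ?f = "\<lambda>k. ennreal (((1 / 2) ^ k) powr p) * ennreal (if v > 2 * (1 / 2) ^ k then 1 else 0)"
  have "v powr p \<le> (R powr p + 4 powr p) * ((1 / 2) ^ k) powr p"
  proof (cases k)
    case 0
    have "v powr p \<le> R powr p" using v p by (intro powr_mono2) auto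
    then show ?thesis using 0 by (simp add: add_increasing2)
  next
    case (Suc l)
    have "\<not> v > 2 * (1 / 2) ^ l" using not_less_Least[of l "\<lambda>k. v > 2 * (1 / 2) ^ k"] Suc by (simp add: k_def)
    then have "v \<le> 4 * (1 / 2) ^ k" using Suc by simp
    then have "v powr p \<le> (4 * (1 / 2) ^ k) powr p" using v p by (intro powr_mono2) auto
    also have "\<dots> = 4 powr p * ((1 / 2) ^ k) powr p" by (simp add: powr_mult)
    also have "\<dots> \<le> (R powr p + 4 powr p) * ((1 / 2) ^ k) powr p" by (intro mult_right_mono) auto
    finally show ?thesis .
  qed
  then have "ennreal (v powr p) \<le> ennreal (R powr p + 4 powr p) * ?f k"
    using k by (simp add: ennreal_leI flip: ennreal_mult' del: ennreal_plus)
  also have "\<dots> \<le> ennreal (R powr p + 4 powr p) * (\<Sum>k. ?f k)"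
    using sum_le_suminf[of ?f "{k}"] by (intro mult_left_mono) auto
  finally show ?thesis .
qed (use p in auto)

section \<open>From the grid to cadlag paths\<close>

context homogeneous_levy
begin

text \<open>One-sided limits bound the path near every time, and Bolzano's bisection principle glues
  the local bounds together.\<close>

lemma cadlag_bounded:
  fixes x :: "real \<Rightarrow> (real, 'm) vec"
  assumes x: "cadlag x" and T: "T \<ge> 0"
  obtains R where "R \<ge> 0" "\<And>t. 0 \<le> t \<Longrightarrow> t \<le> T \<Longrightarrow> N (x t) \<le> R"
proof -
  have bd: "\<exists>c. \<forall>\<^sub>F t in F. N (x t) \<le> c" if "(x \<longlongrightarrow> l) F" for l F
  proof -
    have "((\<lambda>t. N (x t)) \<longlongrightarrow> N l) F"
      using that N_continuous by (intro continuous_on_tendsto_compose[of UNIV N]) auto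
    then have "\<forall>\<^sub>F t in F. N (x t) < N l + 1" by (rule order_tendstoD) simp
    then have "\<forall>\<^sub>F t in F. N (x t) \<le> N l + 1" by eventually_elim simp
    then show ?thesis ..
  qed
  \<comment> \<open>Nothing is known about negative times, yet the local step of the bisection has
    to treat intervals around 0.\<close>
  define I where "I = {0 :: real..}"
  from T have "\<exists>R. \<forall>t\<in>{0..T} \<inter> I. N (x t) \<le> R"
  proof (induction rule: Bolzano)
    case (trans a b c)
    then obtain R1 R2 where "\<forall>t\<in>{a..b} \<inter> I. N (x t) \<le> R1" "\<forall>t\<in>{b..c} \<inter> I. N (x t) \<le> R2" by blast
    then have "\<forall>t\<in>{a..c} \<inter> I. N (x t) \<le> max R1 R2"
      by (metis IntE IntI atLeastAtMost_iff linear max.coboundedI1 max.coboundedI2)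
    then show ?case ..
  next
    case (local s)
    obtain c1 where "\<forall>\<^sub>F t in at_right s. N (x t) \<le> c1"
      using bd[of "x s" "at_right s"] x local unfolding cadlag_def by blast
    then obtain b1 where b1: "b1 > s" "\<And>t. s < t \<Longrightarrow> t < b1 \<Longrightarrow> N (x t) \<le> c1"
      unfolding eventually_at_right_field by blast
    have "\<exists>b2<s. \<exists>c2. \<forall>t. b2 < t \<and> t < s \<and> 0 \<le> t \<longrightarrow> N (x t) \<le> c2"
    proof (cases "s = 0")
      case False
      then obtain l where "(x \<longlongrightarrow> l) (at_left s)" using x local unfolding cadlag_def by (metis less_eq_real_def)
      then obtain c2 where "\<forall>\<^sub>F t in at_left s. N (x t) \<le> c2" using bd by blast
      then show ?thesis unfolding eventually_at_left_field by blast
    next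
      case True
      then show ?thesis by (intro exI[of _ "s - 1"]) auto
    qed
    then obtain b2 c2 where b2: "b2 < s" "\<And>t. b2 < t \<Longrightarrow> t < s \<Longrightarrow> 0 \<le> t \<Longrightarrow> N (x t) \<le> c2" by blast
    show ?case
    proof (rule exI[of _ "min (b1 - s) (s - b2)"], intro conjI allI impI)
      show "0 < min (b1 - s) (s - b2)" using b1 b2 by simp
      fix a b assume ab: "a \<le> s \<and> s \<le> b \<and> b - a < min (b1 - s) (s - b2)"
      have "N (x t) \<le> max (N (x s)) (max c1 c2)" if "t \<in> {a..b}" "0 \<le> t" for t
      proof (rule linorder_cases[of t s])
        assume "t < s"
        then show ?thesis using b2(2)[of t] that ab by auto
      next
        assume "t > s"
        then show ?thesis using b1(2)[of t] that ab by auto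
      qed simp
      then show "\<exists>R. \<forall>t\<in>{a..b} \<inter> I. N (x t) \<le> R" unfolding I_def by blast
    qed
  qed
  then obtain R where "\<forall>t\<in>{0..T} \<inter> I. N (x t) \<le> R" by blast
  then have R: "\<And>t. 0 \<le> t \<Longrightarrow> t \<le> T \<Longrightarrow> N (x t) \<le> R" by (auto simp: I_def)
  have "0 \<le> R" using R[of 0] N_nonneg[of "x 0"] T by simp
  then show thesis using R by (rule that)
qed

text \<open>Rounding up keeps the grid times at or to the right of \<open>t\<close>, the side on
  which the path is continuous.\<close>

lemma dyadic_approximation:
  fixes x :: "real \<Rightarrow> (real, 'm) vec"
  assumes x: "cadlag x" and t: "t \<ge> 0"
  shows "(\<lambda>K. x (real (nat \<lceil>t * 2 ^ K\<rceil>) * (1 / 2 ^ K))) \<longlonglongrightarrow> x t"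
proof -
  define a where "a K = real (nat \<lceil>t * 2 ^ K\<rceil>) * (1 / 2 ^ K)" for K
  have eq: "real (nat \<lceil>t * 2 ^ K\<rceil>) = of_int \<lceil>t * 2 ^ K\<rceil>" for K :: nat
  proof -
    have "0 \<le> t * 2 ^ K" using t by simp
    then have "0 \<le> \<lceil>t * 2 ^ K\<rceil>" by (smt (verit) ceiling_mono ceiling_zero)
    then show ?thesis by simp
  qed
  have lo: "t \<le> a K" and up: "a K \<le> t + (1 / 2) ^ K" for K
  proof -
    show "t \<le> a K" unfolding a_def eq by (simp add: pos_le_divide_eq)
    have "of_int \<lceil>t * 2 ^ K\<rceil> \<le> t * 2 ^ K + (1 :: real)" by linarith
    then have "of_int \<lceil>t * 2 ^ K\<rceil> / 2 ^ K \<le> (t * 2 ^ K + (1 :: real)) / 2 ^ K" by (rule divide_right_mono) simp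
    then show "a K \<le> t + (1 / 2) ^ K" unfolding a_def eq by (simp add: add_divide_distrib power_one_over)
  qed
  have "a \<longlonglongrightarrow> t"
  proof (rule tendsto_sandwich[OF _ _ tendsto_const])
    have "(\<lambda>K. t + (1 / 2) ^ K) \<longlonglongrightarrow> t + (0 :: real)" by (intro tendsto_intros LIMSEQ_power_zero) simp
    then show "(\<lambda>K. t + (1 / 2) ^ K) \<longlonglongrightarrow> t" by simp
  qed (use lo up in \<open>auto intro: always_eventually\<close>)
  have "(x \<longlongrightarrow> x t) (at_right t)" using x t by (simp add: cadlag_def)
  then have "continuous (at t within {t..}) x"
    unfolding continuous_within at_within_Ici_at_right .
  then have "(\<lambda>K. x (a K)) \<longlonglongrightarrow> x t"
    unfolding continuous_within_sequentially using \<open>a \<longlonglongrightarrow> t\<close> lo by (auto simp: comp_def)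
  then show ?thesis by (simp add: a_def)
qed

text \<open>The lower limit of the reset counts over dyadic grids is measurable, does not refer to a
  partition, and has the required mean by Fatou's lemma. For any partition the points are rounded up
  to the grid: increments converge by right-continuity, so those longer than 2 r are eventually
  counted by the resets.\<close>

lemma large_increment_count:
  assumes adm: "admissible \<gamma>"
  obtains C where "C \<ge> 0" and "\<And>r. 0 < r \<Longrightarrow> r \<le> 1 \<Longrightarrow>
    \<exists>D\<in>borel_measurable M. (\<integral>\<^sup>+\<omega>. D \<omega> \<partial>M) \<le> ennreal (C * r powr (- \<gamma>)) \<and>
      (\<forall>\<omega>. cadlag (\<lambda>t. X t \<omega>) \<longrightarrow> (\<forall>ts\<in>partitions 0 1.
        ennreal (\<Sum>j<length ts - 1. if N (increment G (\<lambda>t. X t \<omega>) (ts ! j) (ts ! Suc j)) > 2 * r then 1 else 0) \<le> D \<omega>))"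
proof -
  obtain \<sigma> where \<sigma>: "\<sigma> > 0" and ex: "\<And>r y. r > 0 \<Longrightarrow> N y > r \<Longrightarrow> cutoff \<sigma> r y = 1"
    using cutoff_exit by blast
  obtain C where C: "C \<ge> 0" and drift: "\<And>r. 0 < r \<Longrightarrow> r \<le> 1 \<Longrightarrow>
     \<forall>\<^sub>F s in at_right 0. \<forall>y. expectation (\<lambda>\<omega>. cutoff \<sigma> r (y \<otimes> X s \<omega>)) - cutoff \<sigma> r y \<le> C * r powr (- \<gamma>) * s"
    using cutoff_drift[OF adm \<sigma>] by blast
  show thesis
  proof (rule that[OF C])
    fix r :: real assume r: "0 < r" "r \<le> 1"
    define W where "W K \<omega> = (\<lambda>i. increment G (\<lambda>t. X t \<omega>) (real i * (1 / 2 ^ K)) (real (Suc i) * (1 / 2 ^ K)))" for K :: nat and \<omega>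
    define Z where "Z K \<omega> = resets r (W K \<omega>) (2 ^ K)" for K \<omega>
    have Zm [measurable]: "Z K \<in> borel_measurable M" for K
      unfolding Z_def[abs_def] W_def by (rule resets_measurable) simp
    have Z0: "0 \<le> Z K \<omega>" "Z K \<omega> \<le> 2 ^ K" for K \<omega>
      using resets_nonneg resets_le[of r "W K \<omega>" "2 ^ K"] by (simp_all add: Z_def)
    have "filterlim (\<lambda>K. 1 / 2 ^ K) (at_right (0 :: real)) sequentially"
    proof -
      have "(\<lambda>K. (1 / 2) ^ K) \<longlonglongrightarrow> (0 :: real)" by (intro LIMSEQ_power_zero) simp
      then show ?thesis by (intro tendsto_imp_filterlim_at_right) (auto simp: power_one_over intro: always_eventually)
    qed
    from eventually_compose_filterlim[OF drift[OF r] this]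
    have "\<forall>\<^sub>F K in sequentially. (\<integral>\<^sup>+\<omega>. ennreal (Z K \<omega>) \<partial>M) \<le> ennreal (C * r powr (- \<gamma>))"
    proof eventually_elim
      case (elim K)
      have "expectation (Z K) \<le> real (2 ^ K) * (C * r powr (- \<gamma>) * (1 / 2 ^ K))"
        unfolding Z_def[abs_def] W_def by (rule expected_resets[OF _ ex[OF r(1)]]) (use elim in auto)
      then have "expectation (Z K) \<le> C * r powr (- \<gamma>)" by simp
      moreover have "integrable M (Z K)" by (rule integrable_bounded[of _ "2 ^ K"]) (use Z0 in auto)
      ultimately show ?case using Z0 by (simp add: nn_integral_eq_integral ennreal_leI)
    qed
    then have "liminf (\<lambda>K. \<integral>\<^sup>+\<omega>. ennreal (Z K \<omega>) \<partial>M) \<le> liminf (\<lambda>K. ennreal (C * r powr (- \<gamma>)))"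
      by (rule Liminf_mono)
    then have int: "(\<integral>\<^sup>+\<omega>. liminf (\<lambda>K. ennreal (Z K \<omega>)) \<partial>M) \<le> ennreal (C * r powr (- \<gamma>))"
      by (simp add: Liminf_const order_trans[OF nn_integral_liminf])
    have "ennreal (\<Sum>j<length ts - 1. if N (increment G (\<lambda>t. X t \<omega>) (ts ! j) (ts ! Suc j)) > 2 * r then 1 else 0)
        \<le> liminf (\<lambda>K. ennreal (Z K \<omega>))"
      if cl: "cadlag (\<lambda>t. X t \<omega>)" and ts: "ts \<in> partitions 0 1" for \<omega> ts
    proof -
      define n where "n = length ts - 1"
      define x where "x = (\<lambda>t. X t \<omega>)"
      have cx: "cadlag x" using cl by (simp add: x_def)
      have ts': "ts \<noteq> []" "sorted_wrt (<) ts" "ts ! 0 = 0" "ts ! n = 1"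
        using ts by (auto simp: partitions_def n_def hd_conv_nth last_conv_nth)
      have mono: "ts ! i \<le> ts ! j" if "i \<le> j" "j \<le> n" for i j
        using sorted_wrt_nth_less[OF ts'(2), of i j] that ts'(1)
        by (cases "i = j") (auto simp: n_def le_less less_diff_conv Suc_diff_le)
      \<comment> \<open>\<open>resets_count\<close> wants a monotone sequence indexed by all natural
        numbers; the minimum with \<open>n\<close> keeps it constant beyond the last point.\<close>
      define a where "a K j = nat \<lceil>ts ! min j n * 2 ^ K\<rceil>" for K :: nat and j
      have am: "a K j \<le> a K (Suc j)" for K j
        unfolding a_def by (intro nat_mono ceiling_mono mult_right_mono mono) auto
      have an: "a K n = 2 ^ K" for K
      proof -
        have "real (nat \<lceil>(2 :: real) ^ K\<rceil>) = 2 ^ K"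
          by (metis ceiling_of_nat nat_int of_nat_numeral of_nat_power)
        then have "nat \<lceil>(2 :: real) ^ K\<rceil> = 2 ^ K" by (metis of_nat_eq_iff of_nat_numeral of_nat_power)
        then show ?thesis by (simp add: a_def ts')
      qed
      have gp: "gprod (W K \<omega>) (a K j) (a K (Suc j) - a K j) =
          increment G x (real (a K j) * (1 / 2 ^ K)) (real (a K (Suc j)) * (1 / 2 ^ K))" for K j
        unfolding W_def gprod_increments x_def using am[of K j] by simp
      have lim: "(\<lambda>K. x (real (a K j) * (1 / 2 ^ K))) \<longlonglongrightarrow> x (ts ! min j n)" for j
        unfolding a_def using mono[of 0 "min j n"] ts' by (intro dyadic_approximation cx) auto
      have Nlim: "(\<lambda>K. N (gprod (W K \<omega>) (a K j) (a K (Suc j) - a K j))) \<longlonglongrightarrow> N (increment G x (ts ! j) (ts ! Suc j))"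
        if "j < n" for j
      proof -
        have "(\<lambda>K. increment G x (real (a K j) * (1 / 2 ^ K)) (real (a K (Suc j)) * (1 / 2 ^ K))) \<longlonglongrightarrow>
            increment G x (ts ! min j n) (ts ! min (Suc j) n)"
          unfolding increment_def inv_eq_uminus by (intro tendsto_intros lim)
        then show ?thesis unfolding gp using that N_continuous
          by (intro continuous_on_tendsto_compose[of UNIV N]) auto
      qed
      have "\<forall>\<^sub>F K in sequentially. \<forall>j\<in>{..<n}. (if N (increment G x (ts ! j) (ts ! Suc j)) > 2 * r then 1 else 0 :: real) \<le>
          (if N (gprod (W K \<omega>) (a K j) (a K (Suc j) - a K j)) > 2 * r then 1 else 0)"
      proof (intro eventually_ball_finite ballI finite_lessThan)
        fix j assume "j \<in> {..<n}"
        then have j: "j < n" by simp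
        show "\<forall>\<^sub>F K in sequentially. (if N (increment G x (ts ! j) (ts ! Suc j)) > 2 * r then 1 else 0 :: real) \<le>
          (if N (gprod (W K \<omega>) (a K j) (a K (Suc j) - a K j)) > 2 * r then 1 else 0)"
        proof (cases "N (increment G x (ts ! j) (ts ! Suc j)) > 2 * r")
          case True
          \<comment> \<open>Exceeding 2 r strictly is an open condition and passes to the
            approximating increments.\<close>
          from order_tendstoD(1)[OF Nlim[OF j] True] show ?thesis by eventually_elim simp
        qed simp
      qed
      then have "\<forall>\<^sub>F K in sequentially. (\<Sum>j<n. if N (increment G x (ts ! j) (ts ! Suc j)) > 2 * r then 1 else 0) \<le> Z K \<omega>"
      proof eventually_elim
        case (elim K)
        have "(\<Sum>j<n. if N (increment G x (ts ! j) (ts ! Suc j)) > 2 * r then 1 else 0) \<le>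
            (\<Sum>j<n. if N (gprod (W K \<omega>) (a K j) (a K (Suc j) - a K j)) > 2 * r then 1 else (0 :: real))"
          using elim by (intro sum_mono) blast
        also have "\<dots> \<le> resets r (W K \<omega>) (a K n)" using r by (intro resets_count am) simp
        finally show ?case by (simp add: Z_def an)
      qed
      then have "\<forall>\<^sub>F K in sequentially. ennreal (\<Sum>j<n. if N (increment G x (ts ! j) (ts ! Suc j)) > 2 * r then 1 else 0) \<le> ennreal (Z K \<omega>)"
        by eventually_elim (rule ennreal_leI)
      from Liminf_bounded[OF this] show ?thesis by (simp add: n_def x_def)
    qed
    with int show "\<exists>D\<in>borel_measurable M. (\<integral>\<^sup>+\<omega>. D \<omega> \<partial>M) \<le> ennreal (C * r powr (- \<gamma>)) \<and>
      (\<forall>\<omega>. cadlag (\<lambda>t. X t \<omega>) \<longrightarrow> (\<forall>ts\<in>partitions 0 1.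
        ennreal (\<Sum>j<length ts - 1. if N (increment G (\<lambda>t. X t \<omega>) (ts ! j) (ts ! Suc j)) > 2 * r then 1 else 0) \<le> D \<omega>))"
      by (intro bexI[of _ "\<lambda>\<omega>. liminf (\<lambda>K. ennreal (Z K \<omega>))"] conjI) auto
  qed
qed

text \<open>Increments of size about 2^(-k) contribute 2^(-k p) each, and their expected number is
  O(2^(k \<gamma>)). As \<gamma> < p the series of expectations is geometric, so the random series
  \<open>S\<close> is almost surely finite, and it bounds the sums over all partitions
  simultaneously.\<close>

theorem finite_variation:
  assumes adm: "admissible \<gamma>" and p: "\<gamma> < p"
  shows "AE \<omega> in M. p_variation G N p 0 1 (\<lambda>t. X t \<omega>) < \<infinity>"
proof -
  have p0: "p > 0" using adm p by (simp add: admissible_def)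
  let ?P = "\<lambda>C r D. (\<integral>\<^sup>+\<omega>. D \<omega> \<partial>M) \<le> ennreal (C * r powr (- \<gamma>)) \<and>
      (\<forall>\<omega>. cadlag (\<lambda>t. X t \<omega>) \<longrightarrow> (\<forall>ts\<in>partitions 0 1.
        ennreal (\<Sum>j<length ts - 1. if N (increment G (\<lambda>t. X t \<omega>) (ts ! j) (ts ! Suc j)) > 2 * r then 1 else 0) \<le> D \<omega>))"
  obtain C where C: "C \<ge> 0" and ex: "\<And>r. 0 < r \<Longrightarrow> r \<le> 1 \<Longrightarrow> \<exists>D\<in>borel_measurable M. ?P C r D"
    using large_increment_count[OF adm] by blast
  have "\<forall>k::nat. \<exists>D. D \<in> borel_measurable M \<and> ?P C ((1 / 2) ^ k) D"
    using ex[of "(1 / 2) ^ k" for k] by (simp add: power_le_one Bex_def)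
  from choice[OF this] obtain D where "\<forall>k. D k \<in> borel_measurable M \<and> ?P C ((1 / 2) ^ k) (D k)" ..
  then have Dm [measurable]: "D k \<in> borel_measurable M" and Di: "(\<integral>\<^sup>+\<omega>. D k \<omega> \<partial>M) \<le> ennreal (C * ((1 / 2) ^ k) powr (- \<gamma>))"
    and Dc: "cadlag (\<lambda>t. X t \<omega>) \<Longrightarrow> ts \<in> partitions 0 1 \<Longrightarrow>
        ennreal (\<Sum>j<length ts - 1. if N (increment G (\<lambda>t. X t \<omega>) (ts ! j) (ts ! Suc j)) > 2 * (1 / 2) ^ k then 1 else 0) \<le> D k \<omega>"
    for k \<omega> ts by auto
  define S where "S \<omega> = (\<Sum>k. ennreal (((1 / 2) ^ k) powr p) * D k \<omega>)" for \<omega>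
  have Sm [measurable]: "S \<in> borel_measurable M" unfolding S_def[abs_def] by measurable
  define q where "q = (1 / 2) powr (p - \<gamma>)"
  have q: "0 \<le> q" "q < 1" using p powr_less_mono'[of "1 / 2" 0 "p - \<gamma>"] by (auto simp: q_def)
  have "(\<integral>\<^sup>+\<omega>. S \<omega> \<partial>M) = (\<Sum>k. ennreal (((1 / 2) ^ k) powr p) * (\<integral>\<^sup>+\<omega>. D k \<omega> \<partial>M))"
    unfolding S_def by (subst nn_integral_suminf) (auto simp: nn_integral_cmult)
  also have "\<dots> \<le> (\<Sum>k. ennreal (C * q ^ k))"
  proof (intro suminf_le summableI)
    fix k :: nat
    have "ennreal (((1 / 2) ^ k) powr p) * (\<integral>\<^sup>+\<omega>. D k \<omega> \<partial>M) \<le>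
        ennreal (((1 / 2) ^ k) powr p) * ennreal (C * ((1 / 2) ^ k) powr (- \<gamma>))"
      by (intro mult_left_mono Di) simp
    also have "\<dots> = ennreal (((1 / 2) ^ k) powr p * (C * ((1 / 2) ^ k) powr (- \<gamma>)))"
      using C by (simp add: ennreal_mult)
    also have "((1 / 2) ^ k) powr p * (C * ((1 / 2) ^ k) powr (- \<gamma>)) = C * ((1 / 2) ^ k) powr (p - \<gamma>)"
      by (simp add: powr_add[symmetric])
    also have "((1 / 2) ^ k) powr (p - \<gamma>) = q ^ k"
      unfolding q_def by (simp add: powr_powr mult.commute flip: powr_realpow)
    finally show "ennreal (((1 / 2) ^ k) powr p) * (\<integral>\<^sup>+\<omega>. D k \<omega> \<partial>M) \<le> ennreal (C * q ^ k)" .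
  qed
  also have "\<dots> < \<infinity>"
  proof -
    have "summable (\<lambda>k. C * q ^ k)" using q by (intro summable_mult summable_geometric) simp
    then have "(\<Sum>k. ennreal (C * q ^ k)) = ennreal (\<Sum>k. C * q ^ k)"
      using C q by (intro suminf_ennreal2) auto
    then show ?thesis by simp
  qed
  finally have "(\<integral>\<^sup>+\<omega>. S \<omega> \<partial>M) \<noteq> \<infinity>" by simp
  then have "AE \<omega> in M. S \<omega> \<noteq> \<infinity>" by (intro nn_integral_PInf_AE Sm)
  moreover have "AE \<omega> in M. cadlag (\<lambda>t. X t \<omega>)" using levy by (simp add: levy_process_def)
  ultimately show ?thesis
  proof eventually_elim
    case (elim \<omega>)
    define x where "x = (\<lambda>t. X t \<omega>)"
    have cl: "cadlag x" using elim by (simp add: x_def)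
    obtain R where R: "R \<ge> 0" "\<And>t. 0 \<le> t \<Longrightarrow> t \<le> 1 \<Longrightarrow> N (x t) \<le> R"
      using cadlag_bounded[OF cl, of 1] by auto
    \<comment> \<open>Subadditivity and symmetry of \<open>N\<close> bound every increment of the
      path by 2 R.\<close>
    define c where "c = ennreal ((2 * R) powr p + 4 powr p)"
    have bound: "ennreal (var_sum p x ts) \<le> c * S \<omega>" if ts: "ts \<in> partitions 0 1" for ts
    proof -
      define n where "n = length ts - 1"
      define v where "v j = N (increment G x (ts ! j) (ts ! Suc j))" for j
      let ?g = "\<lambda>j k. ennreal (((1 / 2) ^ k) powr p) * ennreal (if v j > 2 * (1 / 2) ^ k then 1 else 0)"
      have ts': "ts \<noteq> []" "sorted_wrt (<) ts" "ts ! 0 = 0" "ts ! n = 1"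
        using ts by (auto simp: partitions_def n_def hd_conv_nth last_conv_nth)
      have lt: "ts ! i < ts ! j" if "i < j" "j \<le> n" for i j
        using sorted_wrt_nth_less[OF ts'(2), of i j] that ts'(1) by (auto simp: n_def le_less less_diff_conv Suc_diff_le)
      have tr: "0 \<le> ts ! j" "ts ! j \<le> 1" if "j \<le> n" for j
        using lt[of 0 j] lt[of j n] that ts' by (cases "j = 0"; cases "j = n"; force)+
      have v: "0 \<le> v j" "v j \<le> 2 * R" if "j < n" for j
      proof -
        have "v j \<le> N (x (ts ! j)) + N (x (ts ! Suc j))"
          unfolding v_def increment_def inv_eq_uminus using N_mult[of "- x (ts ! j)"] by (simp add: N_uminus)
        moreover have "N (x (ts ! j)) \<le> R" "N (x (ts ! Suc j)) \<le> R" using that by (auto intro!: R tr)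
        ultimately show "v j \<le> 2 * R" by simp
      qed (simp add: v_def N_nonneg)
      have "ennreal (var_sum p x ts) = (\<Sum>j<n. ennreal (v j powr p))"
        by (simp add: var_sum_def v_def n_def)
      also have "\<dots> \<le> (\<Sum>j<n. c * (\<Sum>k. ?g j k))"
        unfolding c_def by (intro sum_mono powr_le_dyadic_sum v p0) simp_all
      also have "\<dots> = c * (\<Sum>k. \<Sum>j<n. ?g j k)"
        by (subst suminf_sum) (auto simp: sum_distrib_left)
      also have "\<dots> = c * (\<Sum>k. ennreal (((1 / 2) ^ k) powr p) * ennreal (\<Sum>j<n. if v j > 2 * (1 / 2) ^ k then 1 else 0))"
      proof -
        have "ennreal (\<Sum>j<n. if v j > 2 * (1 / 2) ^ k then 1 else 0) = (\<Sum>j<n. ennreal (if v j > 2 * (1 / 2) ^ k then 1 else 0))" for k :: nat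
          by (rule sum_ennreal[symmetric]) simp
        then show ?thesis by (simp only: sum_distrib_left)
      qed
      also have "\<dots> \<le> c * S \<omega>"
        unfolding S_def using Dc[OF elim(2) ts] by (intro mult_left_mono suminf_le summableI) (auto simp: v_def n_def x_def)
      finally show ?thesis .
    qed
    obtain b where b: "c * S \<omega> = ennreal b" "b \<ge> 0"
    proof -
      have "c * S \<omega> \<noteq> \<infinity>" using elim(1) by (simp add: c_def ennreal_mult_eq_top_iff)
      then show ?thesis using that by (cases "c * S \<omega>") auto
    qed
    obtain K where "b \<le> real K" using real_arch_simple by blast
    moreover have "var_sum p x ts \<le> b" if "ts \<in> partitions 0 1" for ts
      using bound[OF that] b by simp
    ultimately show ?case unfolding finite_p_variation_iff[OF p0] x_def[symmetric] by (meson order_trans)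
  qed
qed

text \<open>There are finitely many thresholds, all strictly below \<open>p\<close>, so the midpoint
  between their maximum and \<open>p\<close> leaves room on both sides. Including 0 among them makes
  \<gamma> positive.\<close>

lemma admissible_exponent:
  assumes p: "p > 0"
    and J: "\<And>j. j \<in> J_set A \<Longrightarrow> p > 2 * d j"
    and K: "\<And>k. k \<in> K_set \<xi> B \<nu> \<Longrightarrow> p > d k"
    and \<Gamma>: "\<And>i. Gamma_set \<xi> \<nu> i \<noteq> {} \<Longrightarrow> p / d i > Sup (Gamma_set \<xi> \<nu> i)"
  obtains \<gamma> where "admissible \<gamma>" "\<gamma> < p"
proof -
  define S where "S = insert 0 ((\<lambda>j. 2 * d j) ` J_set A \<union> d ` K_set \<xi> B \<nu> \<union>
     (\<lambda>i. d i * Sup (Gamma_set \<xi> \<nu> i)) ` {i. Gamma_set \<xi> \<nu> i \<noteq> {}})"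
  have "finite S" unfolding S_def by (intro finite.insertI finite_UnI finite_imageI finite)
  moreover have "\<forall>s\<in>S. s < p"
  proof -
    have "d i * Sup (Gamma_set \<xi> \<nu> i) < p" if "Gamma_set \<xi> \<nu> i \<noteq> {}" for i
      using \<Gamma>[OF that] weight_pos[of i] by (simp add: less_divide_eq mult.commute)
    then show ?thesis using J K p by (auto simp: S_def)
  qed
  moreover have "S \<noteq> {}" by (simp add: S_def)
  ultimately have b: "Max S < p" "\<And>s. s \<in> S \<Longrightarrow> s \<le> Max S" by auto
  define \<gamma> where "\<gamma> = (Max S + p) / 2"
  have less: "s < \<gamma>" if "s \<in> S" for s using b(1) b(2)[OF that] by (simp add: \<gamma>_def)
  have \<gamma>: "\<gamma> < p" using b(1) by (simp add: \<gamma>_def)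
  have \<gamma>0: "\<gamma> > 0" by (rule less) (simp add: S_def)
  have above: "d i * g < \<gamma>" if "g \<in> Gamma_set \<xi> \<nu> i" for i g
  proof -
    have "bdd_above (Gamma_set \<xi> \<nu> i)" by (rule bdd_aboveI[of _ 2]) (auto simp: Gamma_set_def)
    then have "g \<le> Sup (Gamma_set \<xi> \<nu> i)" using that by (intro cSup_upper)
    then have "d i * g \<le> d i * Sup (Gamma_set \<xi> \<nu> i)" using weight_pos[of i] by simp
    also have "\<dots> < \<gamma>" by (rule less) (use that in \<open>auto simp: S_def\<close>)
    finally show ?thesis .
  qed
  have "integrable \<nu> (\<lambda>x. \<bar>\<xi> i x\<bar> powr min (\<gamma> / d i) 2)" for i
  proof (cases "\<gamma> / d i < 2")
    case True
    have "\<gamma> / d i \<notin> Gamma_set \<xi> \<nu> i" using above[of "\<gamma> / d i" i] weight_pos[of i] by auto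
    then show ?thesis using True \<gamma>0 weight_pos[of i] notin_Gamma_set_iff_integrable[of "\<gamma> / d i" i] by simp
  next
    \<comment> \<open>Exponents of at least 2 are outside the range of \<open>Gamma_set\<close>;
      here the second moment of the Levy measure is used.\<close>
    case False
    have "\<bar>\<bar>\<xi> i x\<bar> powr 2\<bar> \<le> 1 * xi_sq x" for x
      using xi_le_xi_sq[of i x] by simp
    then have "integrable \<nu> (\<lambda>x. \<bar>\<xi> i x\<bar> powr 2)" by (intro integrable_nu_bound[of _ 1]) auto
    then show ?thesis using False by simp
  qed
  moreover have "integrable \<nu> (\<xi> i) \<and> B $ i = (\<integral>x. \<xi> i x \<partial>\<nu>)" if "\<gamma> \<le> d i" for i
  proof
    have 1: "1 \<notin> Gamma_set \<xi> \<nu> i" using above[of 1 i] that by auto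
    then have "integrable \<nu> (\<lambda>x. \<bar>\<xi> i x\<bar> powr 1)" using notin_Gamma_set_iff_integrable[of 1 i] by simp
    then show "integrable \<nu> (\<xi> i)" by (subst integrable_abs_iff[symmetric]) auto
    have "i \<notin> K_set \<xi> B \<nu>" using less[of "d i"] that by (auto simp: S_def)
    then show "B $ i = (\<integral>x. \<xi> i x \<partial>\<nu>)" using 1 by (simp add: K_set_def K_tilde_def B_tilde_def)
  qed
  moreover have "2 * d j \<le> \<gamma>" if "A $ j $ j > 0" for j
    using less[of "2 * d j"] that by (auto simp: S_def J_set_def)
  ultimately have "admissible \<gamma>" unfolding admissible_def using \<gamma>0 by blast
  then show thesis using \<gamma> by (rule that)
qed

end

theorem theorem5p1:
  fixes G :: "((real, 'm::{finite,linorder}) vec) monoid"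
    and d :: "'m \<Rightarrow> real"
    and N :: "(real, 'm) vec \<Rightarrow> real"
    and p :: real
    and U :: "((real, 'm) vec) set"
    and \<xi> :: "'m \<Rightarrow> (real, 'm) vec \<Rightarrow> real"
    and M :: "'w measure"
    and X :: "real \<Rightarrow> 'w \<Rightarrow> (real, 'm) vec"
    and A :: "((real, 'm) vec, 'm) vec"
    and B :: "(real, 'm) vec"
    and \<nu> :: "((real, 'm) vec) measure"
  assumes "homogeneous_group G d"
    and "subadditive_homogeneous_norm G d N"
    and "p > 0"
    and "local_coordinates G U \<xi>"
    and "levy_process G M X"
    and "has_triplet G \<xi> M X A B \<nu>"
  shows
    "((\<forall>j\<in>J_set A. p > 2 * d j) \<and>
      (\<forall>k\<in>K_set \<xi> B \<nu>. p > d k) \<and>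
      (\<forall>i. Gamma_set \<xi> \<nu> i \<noteq> {} \<longrightarrow> p / d i > Sup (Gamma_set \<xi> \<nu> i))
        \<longrightarrow> (AE \<omega> in M. p_variation G N p 0 1 (\<lambda>t. X t \<omega>) < \<infinity>)) \<and>
     ((\<exists>j\<in>J_set A. p \<le> 2 * d j) \<or>
      (\<exists>k\<in>K_set \<xi> B \<nu>. p < d k) \<or>
      (\<exists>i. p / d i \<in> Gamma_set \<xi> \<nu> i)
        \<longrightarrow> (AE \<omega> in M. p_variation G N p 0 1 (\<lambda>t. X t \<omega>) = \<infinity>))"
proof -
  interpret homogeneous_group G d by fact
  interpret prob_space M using assms(5) by (simp add: levy_process_def)
  interpret homogeneous_levy G d M N U \<xi> X A B \<nu> by unfold_locales fact+
  show ?thesis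
  proof (intro conjI impI; (elim conjE)?)
    assume "\<forall>j\<in>J_set A. p > 2 * d j" "\<forall>k\<in>K_set \<xi> B \<nu>. p > d k"
      "\<forall>i. Gamma_set \<xi> \<nu> i \<noteq> {} \<longrightarrow> p / d i > Sup (Gamma_set \<xi> \<nu> i)"
    then obtain \<gamma> where "admissible \<gamma>" "\<gamma> < p" using admissible_exponent[OF \<open>p > 0\<close>] by blast
    then show "AE \<omega> in M. p_variation G N p 0 1 (\<lambda>t. X t \<omega>) < \<infinity>" by (rule finite_variation)
  next
    have gauss: "AE \<omega> in M. p_variation G N p 0 1 (\<lambda>t. X t \<omega>) = \<infinity>" if "A $ j $ j > 0" "p \<le> 2 * d j" for j
      using infinite_variation_gaussian[OF that(1) \<open>p > 0\<close> that(2)] .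
    assume "(\<exists>j\<in>J_set A. p \<le> 2 * d j) \<or> (\<exists>k\<in>K_set \<xi> B \<nu>. p < d k) \<or> (\<exists>i. p / d i \<in> Gamma_set \<xi> \<nu> i)"
    then consider j where "A $ j $ j > 0" "p \<le> 2 * d j"
      | k where "k \<in> K_set \<xi> B \<nu>" "p < d k" | i where "p / d i \<in> Gamma_set \<xi> \<nu> i"
      by (auto simp: J_set_def)
    then show "AE \<omega> in M. p_variation G N p 0 1 (\<lambda>t. X t \<omega>) = \<infinity>"
    proof cases
      case 1
      then show ?thesis by (rule gauss)
    next
      case (2 k)
      show ?thesis
      \<comment> \<open>If \<open>A $ k $ k\<close> is positive, then p < d k \<le> 2 d k puts the
        coordinate under the Gaussian criterion.\<close>
      proof (cases "A $ k $ k = 0")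
        case True
        then show ?thesis using infinite_variation_drift[OF 2(1) _ \<open>p > 0\<close> 2(2)] by simp
      next
        case False
        then show ?thesis using A_diag_nonneg[of k] 2(2) weight_pos[of k] by (intro gauss[of k]) auto
      qed
    next
      case 3
      then show ?thesis by (rule infinite_variation_jumps[OF \<open>p > 0\<close>])
    qed
  qed
qed

end
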